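(* Let $M$ be a flat Coxeter matrix, $W=W(M)$, $W_+=W_+(M)$, and let $x\mapsto w(x)$ be any function attaching to every $x\in W$ a reduced word $w(x)$ in the letters $s_i$ representing $x$. Then: (i) the elements $T_{w(x)}$, $x\in W$, form a basis of $A(M)$ as a left $R$-module; (ii) the elements $T_{w(x)}$, $x\in W_+$, form a basis of $A_+(M)$ as a left $R$-module.
   Context: A Coxeter matrix over a finite set $I$ is a collection $M$ of elements $m_{ij}\in\mathbb{Z}_{\ge 2}\cup\{\infty\}$, $i,j\in I$, $i\neq j$, with $m_{ij}=m_{ji}$. The Coxeter group $W(M)$ is generated by $s_i$, $i\in I$, with relations $s_i^2=1$ and $(s_is_j)^{m_{ij}}=1$ whenever $m_{ij}<\infty$. $W_+(M)\subset W(M)$ is the kernel of the sign character $s_i\mapsto -1$. Let $t_{ijk}$ ($i\ne j$ in $I$ with $m_{ij}<\infty$, $k\in\mathbb{Z}_{m_{ij}}=\mathbb{Z}/m_{ij}\mathbb{Z}$) be commuting invertible variables subject only to $t_{ijk}=t_{ji,-k}^{-1}$, and let $R=\mathbb{C}[t_{ijk}]$ be the commutative ring they generate (a Laurent polynomial ring). $A(M)$ is the $\mathbb{C}$-algebra with invertible generators $s_i$ ($i\in I$) and $t_{ijk}$, and relations $t_{ijk}=t_{ji,-k}^{-1}$, $s_i^2=1$, $\prod_{k=1}^{m_{ij}}(s_is_j-t_{ijk})=0$ if $m_{ij}<\infty$, $[t_{ijk},t_{i'j'k'}]=0$, $s_pt_{ijk}=t_{jik}s_p$. It is a left $R$-module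 via the $t_{ijk}$. $A_+(M)$ is the $R$-algebra generated by $a_{ij}$, $i\neq j$, with $a_{ij}=a_{ji}^{-1}$, and relations $\prod_{k=1}^{m_{ij}}(a_{ij}-t_{ijk})=0$ if $m_{ij}<\infty$, and $a_{ij}a_{jp}a_{pi}=1$ for distinct $i,j,p$. It is identified with the subalgebra of $A(M)$ generated by the $t_{ijk}$ and the $s_is_j$ via $a_{ij}\mapsto s_is_j$. For a word $w$ in the letters $s_i$, $T_w\in A(M)$ denotes the corresponding product of generators; if $w$ has even length, then $T_w\in A_+(M)$. Flatness: set $t_{ijk}=e^{2\pi \mathrm{i}k/m_{ij}}e^{\tau_{ijk}}$ with formal parameters $\tau_{ijk}$ (so $\tau_{ijk}=-\tau_{ji,-k}$), and $\hat R=\mathbb{C}[[\tau_{ijk}]]$. $\hat A_+(M)$ is the ($\tau$-adically complete) $\hat R$-algebra topologically generated by the same generators with the same relations as $A_+(M)$. $M$ is called flat if $\hat A_+(M)$ is a flat deformation of $\mathbb{C}[W_+(M)]$, i.e. if $\hat A_+(M)$ is a topologically free left $\hat R$-module (isomorphic to $V[[\tau]]$ for a complex vector space $V$). *)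

theory Defs
  imports
    "HOL-Algebra.Algebraic_Closure_Type"
    "HOL-Library.Multiset"
    "HOL-Library.Extended_Nat"
begin

section \<open>Coxeter groups\<close>

text \<open>Only the entries \<open>m i j\<close> with \<open>i \<noteq> j\<close> in \<open>I\<close> are meaningful.\<close>

definition coxeter_matrix :: "'i set \<Rightarrow> ('i \<Rightarrow> 'i \<Rightarrow> enat) \<Rightarrow> bool" where
  "coxeter_matrix I m \<longleftrightarrow> finite I \<and>
     (\<forall>i\<in>I. \<forall>j\<in>I. i \<noteq> j \<longrightarrow> 2 \<le> m i j \<and> m i j = m j i)"

text \<open>
  Since every generator is an involution, the group with the Coxeter presentation is the monoid
  with the same presentation: its elements are the classes of words in \<open>I\<close> modulo the
  congruence on the free monoid generated by the defining relations.
\<close>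

inductive_set coxeter_cong :: "'i set \<Rightarrow> ('i \<Rightarrow> 'i \<Rightarrow> enat) \<Rightarrow> 'i list rel"
  for I :: "'i set" and m :: "'i \<Rightarrow> 'i \<Rightarrow> enat" where
  refl: "u \<in> lists I \<Longrightarrow> (u, u) \<in> coxeter_cong I m"
| sym: "(u, v) \<in> coxeter_cong I m \<Longrightarrow> (v, u) \<in> coxeter_cong I m"
| trans: "(u, v) \<in> coxeter_cong I m \<Longrightarrow> (v, z) \<in> coxeter_cong I m \<Longrightarrow>
    (u, z) \<in> coxeter_cong I m"
| square: "u \<in> lists I \<Longrightarrow> v \<in> lists I \<Longrightarrow> i \<in> I \<Longrightarrow>
    (u @ [i, i] @ v, u @ v) \<in> coxeter_cong I m"
| power: "u \<in> lists I \<Longrightarrow> v \<in> lists I \<Longrightarrow> i \<in> I \<Longrightarrow> j \<in> I \<Longrightarrow> i \<noteq> j \<Longrightarrow> m i j = enat n \<Longrightarrow>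
    (u @ concat (replicate n [i, j]) @ v, u @ v) \<in> coxeter_cong I m"

definition coxeter_group :: "'i set \<Rightarrow> ('i \<Rightarrow> 'i \<Rightarrow> enat) \<Rightarrow> 'i list set monoid" where
  "coxeter_group I m =
     \<lparr>carrier = lists I // coxeter_cong I m,
      monoid.mult = (\<lambda>x y. \<Union>u\<in>x. \<Union>v\<in>y. coxeter_cong I m `` {u @ v}),
      one = coxeter_cong I m `` {[]}\<rparr>"

text \<open>The sign character; all words representing \<open>x\<close> have lengths of the same parity.\<close>

definition coxeter_sign :: "'i list set \<Rightarrow> int" where
  "coxeter_sign x = (-1) ^ length (SOME u. u \<in> x)"

definition coxeter_plus :: "'i set \<Rightarrow> ('i \<Rightarrow> 'i \<Rightarrow> enat) \<Rightarrow> 'i list set set" where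
  "coxeter_plus I m = {x \<in> carrier (coxeter_group I m). coxeter_sign x = 1}"

text \<open>An element of the group is the set of all words representing it.\<close>

definition reduced_word_for :: "'i list set \<Rightarrow> 'i list \<Rightarrow> bool" where
  "reduced_word_for x u \<longleftrightarrow> u \<in> x \<and> (\<forall>v\<in>x. length u \<le> length v)"


section \<open>Algebras given by generators and relations\<close>

abbreviation complex_ring :: "complex ring" where
  "complex_ring \<equiv> ring_of_type_algebra"

text \<open>The free associative unital algebra over \<open>K\<close> on the letters \<open>G\<close>.\<close>

definition free_alg :: "'k ring \<Rightarrow> 'g set \<Rightarrow> ('k, 'g list \<Rightarrow> 'k) module" where
  "free_alg K G =
     \<lparr>carrier = {f. (\<forall>w. f w \<in> carrier K) \<and> finite {w. f w \<noteq> \<zero>\<^bsub>K\<^esub>} \<and>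
                    {w. f w \<noteq> \<zero>\<^bsub>K\<^esub>} \<subseteq> lists G},
      monoid.mult = (\<lambda>f g w. \<Oplus>\<^bsub>K\<^esub>n\<in>{..length w}. f (take n w) \<otimes>\<^bsub>K\<^esub> g (drop n w)),
      one = (\<lambda>w. if w = [] then \<one>\<^bsub>K\<^esub> else \<zero>\<^bsub>K\<^esub>),
      zero = (\<lambda>w. \<zero>\<^bsub>K\<^esub>),
      add = (\<lambda>f g w. f w \<oplus>\<^bsub>K\<^esub> g w),
      module.smult = (\<lambda>c f w. c \<otimes>\<^bsub>K\<^esub> f w)\<rparr>"

definition gen :: "'k ring \<Rightarrow> 'g \<Rightarrow> 'g list \<Rightarrow> 'k" where
  "gen K g = (\<lambda>w. if w = [g] then \<one>\<^bsub>K\<^esub> else \<zero>\<^bsub>K\<^esub>)"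

text \<open>\<open>F Quot J\<close> with the induced scalar multiplication, in the style of \<^const>\<open>rcoset_mult\<close>.\<close>

definition quot_alg :: "('k, 'a) module \<Rightarrow> 'a set \<Rightarrow> ('k, 'a set) module" where
  "quot_alg F J = ring.extend (F Quot J)
     (module.fields (\<lambda>c Y. \<Union>x\<in>Y. J +>\<^bsub>F\<^esub> (c \<odot>\<^bsub>F\<^esub> x)))"

text \<open>In HOL-Algebra, \<^const>\<open>genideal\<close> is the generated two-sided ideal.\<close>

definition pres_alg :: "'k ring \<Rightarrow> 'g set \<Rightarrow> ('g list \<Rightarrow> 'k) set \<Rightarrow> ('k, ('g list \<Rightarrow> 'k) set) module"
  where "pres_alg K G Rel = quot_alg (free_alg K G) (genideal (free_alg K G) Rel)"

definition pres_class ::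
  "'k ring \<Rightarrow> 'g set \<Rightarrow> ('g list \<Rightarrow> 'k) set \<Rightarrow> ('g list \<Rightarrow> 'k) \<Rightarrow> ('g list \<Rightarrow> 'k) set"
  where "pres_class K G Rel p = genideal (free_alg K G) Rel +>\<^bsub>free_alg K G\<^esub> p"

text \<open>Product in list order; the rings here need not be commutative.\<close>

definition lprod :: "('a, 'b) ring_scheme \<Rightarrow> 'a list \<Rightarrow> 'a" where
  "lprod F xs = foldr (\<lambda>x y. x \<otimes>\<^bsub>F\<^esub> y) xs \<one>\<^bsub>F\<^esub>"

text \<open>\<open>(e x)\<close>, \<open>x \<in> Y\<close>, is a basis of the left \<open>K\<close>-module \<open>M\<close> (as a family indexed by \<open>Y\<close>).\<close>

definition module_basis :: "'k ring \<Rightarrow> ('k, 'a) module \<Rightarrow> 'x set \<Rightarrow> ('x \<Rightarrow> 'a) \<Rightarrow> bool" where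
  "module_basis K M Y e \<longleftrightarrow> module K M \<and> e \<in> Y \<rightarrow> carrier M \<and>
     (\<forall>a\<in>carrier M. \<exists>F c. finite F \<and> F \<subseteq> Y \<and> c \<in> F \<rightarrow> carrier K \<and>
        a = (\<Oplus>\<^bsub>M\<^esub>x\<in>F. c x \<odot>\<^bsub>M\<^esub> e x)) \<and>
     (\<forall>F c. finite F \<and> F \<subseteq> Y \<and> c \<in> F \<rightarrow> carrier K \<and>
        (\<Oplus>\<^bsub>M\<^esub>x\<in>F. c x \<odot>\<^bsub>M\<^esub> e x) = \<zero>\<^bsub>M\<^esub> \<longrightarrow> (\<forall>x\<in>F. c x = \<zero>\<^bsub>K\<^esub>))"


section \<open>The ring \<open>R\<close> and the algebra \<open>A(M)\<close>\<close>

text \<open>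
  The residue \<open>k \<in> \<int>/m\<^sub>i\<^sub>j\<close> is represented by \<open>0 \<le> k < m\<^sub>i\<^sub>j\<close>.
\<close>

datatype 'i letter = S 'i | T 'i 'i nat

definition t_index :: "'i set \<Rightarrow> ('i \<Rightarrow> 'i \<Rightarrow> enat) \<Rightarrow> ('i \<times> 'i \<times> nat) set" where
  "t_index I m = {(i, j, k). i \<in> I \<and> j \<in> I \<and> i \<noteq> j \<and> m i j \<noteq> \<infinity> \<and> enat k < m i j}"

definition neg_index :: "('i \<Rightarrow> 'i \<Rightarrow> enat) \<Rightarrow> 'i \<Rightarrow> 'i \<Rightarrow> nat \<Rightarrow> nat" where
  "neg_index m i j k = (the_enat (m i j) - k) mod the_enat (m i j)"

definition t_letters :: "'i set \<Rightarrow> ('i \<Rightarrow> 'i \<Rightarrow> enat) \<Rightarrow> 'i letter set" where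
  "t_letters I m = {T i j k | i j k. (i, j, k) \<in> t_index I m}"

definition A_letters :: "'i set \<Rightarrow> ('i \<Rightarrow> 'i \<Rightarrow> enat) \<Rightarrow> 'i letter set" where
  "A_letters I m = S ` I \<union> t_letters I m"

text \<open>
  The relations between the \<open>t i j k\<close>: \<open>t i j k * t j i (-k) = 1\<close> (which also makes them
  invertible) and commutativity.
\<close>

definition t_relations ::
  "('i letter list \<Rightarrow> complex, 'b) ring_scheme \<Rightarrow> 'i set \<Rightarrow> ('i \<Rightarrow> 'i \<Rightarrow> enat) \<Rightarrow>
     ('i letter list \<Rightarrow> complex) set" where
  "t_relations F I m =
     (let g = gen complex_ring in
       {g (T i j k) \<otimes>\<^bsub>F\<^esub> g (T j i (neg_index m i j k)) \<ominus>\<^bsub>F\<^esub> \<one>\<^bsub>F\<^esub> | i j k.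
          (i, j, k) \<in> t_index I m} \<union>
       {g x \<otimes>\<^bsub>F\<^esub> g y \<ominus>\<^bsub>F\<^esub> g y \<otimes>\<^bsub>F\<^esub> g x | x y. x \<in> t_letters I m \<and> y \<in> t_letters I m})"

definition R_relations ::
  "'i set \<Rightarrow> ('i \<Rightarrow> 'i \<Rightarrow> enat) \<Rightarrow> ('i letter list \<Rightarrow> complex) set" where
  "R_relations I m = t_relations (free_alg complex_ring (t_letters I m)) I m"

definition R_ring ::
  "'i set \<Rightarrow> ('i \<Rightarrow> 'i \<Rightarrow> enat) \<Rightarrow> ('i letter list \<Rightarrow> complex) set ring" where
  "R_ring I m = ring.truncate (pres_alg complex_ring (t_letters I m) (R_relations I m))"

definition R_t ::
  "'i set \<Rightarrow> ('i \<Rightarrow> 'i \<Rightarrow> enat) \<Rightarrow> 'i \<Rightarrow> 'i \<Rightarrow> nat \<Rightarrow> ('i letter list \<Rightarrow> complex) set" where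
  "R_t I m i j k =
     pres_class complex_ring (t_letters I m) (R_relations I m) (gen complex_ring (T i j k))"

text \<open>
  The factors of the product over \<open>k = 1, \<dots>, m\<^sub>i\<^sub>j\<close> commute modulo the other relations;
  the index \<open>k = m\<^sub>i\<^sub>j\<close> is the residue \<open>0\<close>.
\<close>

definition A_relations ::
  "'i set \<Rightarrow> ('i \<Rightarrow> 'i \<Rightarrow> enat) \<Rightarrow> ('i letter list \<Rightarrow> complex) set" where
  "A_relations I m =
     (let F = free_alg complex_ring (A_letters I m); g = gen complex_ring in
       t_relations F I m \<union>
       {g (S i) \<otimes>\<^bsub>F\<^esub> g (S i) \<ominus>\<^bsub>F\<^esub> \<one>\<^bsub>F\<^esub> | i. i \<in> I} \<union>
       {lprod F (map (\<lambda>k. g (S i) \<otimes>\<^bsub>F\<^esub> g (S j) \<ominus>\<^bsub>F\<^esub> g (T i j (k mod n))) [1..<Suc n]) | i j n.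
          i \<in> I \<and> j \<in> I \<and> i \<noteq> j \<and> m i j = enat n} \<union>
       {g (S p) \<otimes>\<^bsub>F\<^esub> g (T i j k) \<ominus>\<^bsub>F\<^esub> g (T j i k) \<otimes>\<^bsub>F\<^esub> g (S p) | p i j k.
          p \<in> I \<and> (i, j, k) \<in> t_index I m})"

definition A_ideal ::
  "'i set \<Rightarrow> ('i \<Rightarrow> 'i \<Rightarrow> enat) \<Rightarrow> ('i letter list \<Rightarrow> complex) set" where
  "A_ideal I m = genideal (free_alg complex_ring (A_letters I m)) (A_relations I m)"

text \<open>
  \<open>A(M)\<close> as a left module over \<open>R\<close>, not only over the complex numbers. The free algebra on
  \<open>t_letters\<close> is literally a subalgebra of the one on \<open>A_letters\<close>, so a representative \<open>p\<close> of an
  element of \<open>R\<close> is at the same time a representative of its image in \<open>A(M)\<close>.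
\<close>

definition A_alg :: "'i set \<Rightarrow> ('i \<Rightarrow> 'i \<Rightarrow> enat) \<Rightarrow>
    (('i letter list \<Rightarrow> complex) set, ('i letter list \<Rightarrow> complex) set) module" where
  "A_alg I m =
     (let F = free_alg complex_ring (A_letters I m) in
      ring.extend (F Quot A_ideal I m)
        (module.fields (\<lambda>r Y. \<Union>p\<in>r. \<Union>x\<in>Y. A_ideal I m +>\<^bsub>F\<^esub> (p \<otimes>\<^bsub>F\<^esub> x))))"

definition A_s :: "'i set \<Rightarrow> ('i \<Rightarrow> 'i \<Rightarrow> enat) \<Rightarrow> 'i \<Rightarrow> ('i letter list \<Rightarrow> complex) set" where
  "A_s I m i =
     pres_class complex_ring (A_letters I m) (A_relations I m) (gen complex_ring (S i))"

definition T_word ::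
  "'i set \<Rightarrow> ('i \<Rightarrow> 'i \<Rightarrow> enat) \<Rightarrow> 'i list \<Rightarrow> ('i letter list \<Rightarrow> complex) set" where
  "T_word I m w = lprod (A_alg I m) (map (A_s I m) w)"


section \<open>The algebra \<open>A\<^sub>+(M)\<close>\<close>

text \<open>
  The presentation of \<open>A\<^sub>+(M)\<close>, over an arbitrary coefficient ring \<open>K\<close> with prescribed values
  \<open>t i j k\<close> in \<open>K\<close>: it is used both over \<open>R\<close> and over the power series ring. The letter \<open>(i, j)\<close>
  stands for \<open>a\<^sub>i\<^sub>j\<close>.
\<close>

definition Ap_letters :: "'i set \<Rightarrow> ('i \<times> 'i) set" where
  "Ap_letters I = {(i, j). i \<in> I \<and> j \<in> I \<and> i \<noteq> j}"

definition Ap_relations ::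
  "'k ring \<Rightarrow> ('i \<Rightarrow> 'i \<Rightarrow> nat \<Rightarrow> 'k) \<Rightarrow> 'i set \<Rightarrow> ('i \<Rightarrow> 'i \<Rightarrow> enat) \<Rightarrow> (('i \<times> 'i) list \<Rightarrow> 'k) set"
  where
  "Ap_relations K t I m =
     (let F = free_alg K (Ap_letters I); a = (\<lambda>i j. gen K (i, j)) in
       {a i j \<otimes>\<^bsub>F\<^esub> a j i \<ominus>\<^bsub>F\<^esub> \<one>\<^bsub>F\<^esub> | i j. i \<in> I \<and> j \<in> I \<and> i \<noteq> j} \<union>
       {lprod F (map (\<lambda>k. a i j \<ominus>\<^bsub>F\<^esub> t i j (k mod n) \<odot>\<^bsub>F\<^esub> \<one>\<^bsub>F\<^esub>) [1..<Suc n]) | i j n.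
          i \<in> I \<and> j \<in> I \<and> i \<noteq> j \<and> m i j = enat n} \<union>
       {a i j \<otimes>\<^bsub>F\<^esub> a j p \<otimes>\<^bsub>F\<^esub> a p i \<ominus>\<^bsub>F\<^esub> \<one>\<^bsub>F\<^esub> | i j p.
          i \<in> I \<and> j \<in> I \<and> p \<in> I \<and> i \<noteq> j \<and> j \<noteq> p \<and> i \<noteq> p})"

definition Ap_over ::
  "'k ring \<Rightarrow> ('i \<Rightarrow> 'i \<Rightarrow> nat \<Rightarrow> 'k) \<Rightarrow> 'i set \<Rightarrow> ('i \<Rightarrow> 'i \<Rightarrow> enat) \<Rightarrow>
     ('k, (('i \<times> 'i) list \<Rightarrow> 'k) set) module" where
  "Ap_over K t I m = pres_alg K (Ap_letters I) (Ap_relations K t I m)"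

definition Ap_alg :: "'i set \<Rightarrow> ('i \<Rightarrow> 'i \<Rightarrow> enat) \<Rightarrow>
    (('i letter list \<Rightarrow> complex) set, (('i \<times> 'i) list \<Rightarrow> ('i letter list \<Rightarrow> complex) set) set) module"
  where "Ap_alg I m = Ap_over (R_ring I m) (R_t I m) I m"

text \<open>The image of \<open>s\<^sub>i s\<^sub>j\<close>; here \<open>s\<^sub>i s\<^sub>i = 1\<close>.\<close>

definition Ap_a :: "'i set \<Rightarrow> ('i \<Rightarrow> 'i \<Rightarrow> enat) \<Rightarrow> 'i \<Rightarrow> 'i \<Rightarrow>
    (('i \<times> 'i) list \<Rightarrow> ('i letter list \<Rightarrow> complex) set) set" where
  "Ap_a I m i j =
     (if i = j then \<one>\<^bsub>Ap_alg I m\<^esub>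
      else pres_class (R_ring I m) (Ap_letters I) (Ap_relations (R_ring I m) (R_t I m) I m)
             (gen (R_ring I m) (i, j)))"

text \<open>
  \<open>T\<^sub>w\<close> as an element of \<open>A\<^sub>+(M)\<close>, for \<open>w\<close> of even length: under the identification
  \<open>a\<^sub>i\<^sub>j \<mapsto> s\<^sub>i s\<^sub>j\<close>, the product of the generators is grouped into consecutive pairs.
\<close>

fun Tp_word :: "'i set \<Rightarrow> ('i \<Rightarrow> 'i \<Rightarrow> enat) \<Rightarrow> 'i list \<Rightarrow>
    (('i \<times> 'i) list \<Rightarrow> ('i letter list \<Rightarrow> complex) set) set" where
  "Tp_word I m [] = \<one>\<^bsub>Ap_alg I m\<^esub>"
| "Tp_word I m [i] = undefined"
| "Tp_word I m (i # j # w) = Ap_a I m i j \<otimes>\<^bsub>Ap_alg I m\<^esub> Tp_word I m w"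


section \<open>Formal power series and flatness\<close>

text \<open>
  Power series in the commuting variables \<open>Y\<close>; monomials are finite multisets of variables.
\<close>

type_synonym 'x series = "'x multiset \<Rightarrow> complex"

definition series_ring :: "'x set \<Rightarrow> 'x series ring" where
  "series_ring Y =
     \<lparr>carrier = {f. \<forall>A. \<not> set_mset A \<subseteq> Y \<longrightarrow> f A = 0},
      monoid.mult = (\<lambda>f g A. \<Sum>B\<in>{B. B \<subseteq># A}. f B * g (A - B)),
      one = (\<lambda>A. if A = {#} then 1 else 0),
      zero = (\<lambda>A. 0),
      add = (\<lambda>f g A. f A + g A)\<rparr>"

text \<open>
  The \<open>n\<close>-th power of the maximal ideal (for finite \<open>Y\<close>): series without terms of degree
  less than \<open>n\<close>.
\<close>

definition series_filtration :: "'x set \<Rightarrow> nat \<Rightarrow> 'x series set" where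
  "series_filtration Y n = {f \<in> carrier (series_ring Y). \<forall>A. size A < n \<longrightarrow> f A = 0}"

text \<open>
  The exponential of a series \<open>f\<close> without constant term; then \<open>f\<^sup>n\<close> does not contribute to the
  coefficient of a monomial of degree less than \<open>n\<close>.
\<close>

definition series_exp :: "'x set \<Rightarrow> 'x series \<Rightarrow> 'x series" where
  "series_exp Y f = (\<lambda>A. \<Sum>n\<le>size A. (f [^]\<^bsub>series_ring Y\<^esub> n) A / fact n)"

text \<open>
  For a complex vector space \<open>V\<close>, the module \<open>V[[Y]]\<close> over the power series ring.
  A module record has multiplicative fields, which play no role for modules.
\<close>

definition series_module :: "'x set \<Rightarrow> (complex, 'v) module \<Rightarrow> ('x series, 'x multiset \<Rightarrow> 'v) module"
  where
  "series_module Y V =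
     \<lparr>carrier = {v. (\<forall>A. v A \<in> carrier V) \<and> (\<forall>A. \<not> set_mset A \<subseteq> Y \<longrightarrow> v A = \<zero>\<^bsub>V\<^esub>)},
      monoid.mult = undefined,
      one = undefined,
      zero = (\<lambda>A. \<zero>\<^bsub>V\<^esub>),
      add = (\<lambda>v v' A. v A \<oplus>\<^bsub>V\<^esub> v' A),
      module.smult = (\<lambda>f v A. \<Oplus>\<^bsub>V\<^esub>B\<in>{B. B \<subseteq># A}. f B \<odot>\<^bsub>V\<^esub> v (A - B))\<rparr>"

definition module_iso :: "'k ring \<Rightarrow> ('k, 'a) module \<Rightarrow> ('k, 'b) module \<Rightarrow> ('a \<Rightarrow> 'b) set" where
  "module_iso K M N =
     {h. bij_betw h (carrier M) (carrier N) \<and>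
         (\<forall>x\<in>carrier M. \<forall>y\<in>carrier M. h (x \<oplus>\<^bsub>M\<^esub> y) = h x \<oplus>\<^bsub>N\<^esub> h y) \<and>
         (\<forall>c\<in>carrier K. \<forall>x\<in>carrier M. h (c \<odot>\<^bsub>M\<^esub> x) = c \<odot>\<^bsub>N\<^esub> h x)}"

text \<open>
  Taking the carrier of \<open>V\<close> inside the type of elements of \<open>M\<close> is no restriction: \<open>V\<close> embeds
  into \<open>V[[Y]]\<close>, hence into \<open>M\<close>, as the constant series. Linear isomorphisms are automatically
  homeomorphisms for the adic topologies.
\<close>

definition topologically_free :: "'x set \<Rightarrow> ('x series, 'a) module \<Rightarrow> bool" where
  "topologically_free Y M \<longleftrightarrow>
     (\<exists>V :: (complex, 'a) module. module complex_ring V \<and>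
        module_iso (series_ring Y) M (series_module Y V) \<noteq> {})"

text \<open>
  The adic completion of an algebra \<open>B\<close> over the power series ring, as the inverse limit of
  its quotients by the ideals \<open>\<mm>\<^sup>n B\<close>. A family of cosets is compatible iff it is decreasing.
\<close>

definition adic_ideal :: "'x set \<Rightarrow> ('x series, 'b) module \<Rightarrow> nat \<Rightarrow> 'b set" where
  "adic_ideal Y B n = genideal B ((\<lambda>f. f \<odot>\<^bsub>B\<^esub> \<one>\<^bsub>B\<^esub>) ` series_filtration Y n)"

definition adic_completion ::
  "'x set \<Rightarrow> ('x series, 'b) module \<Rightarrow> ('x series, nat \<Rightarrow> 'b set) module" where
  "adic_completion Y B =
     (let Q = (\<lambda>n. quot_alg B (adic_ideal Y B n)) in
     \<lparr>carrier = {x. (\<forall>n. x n \<in> carrier (Q n)) \<and> (\<forall>n. x (Suc n) \<subseteq> x n)},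
      monoid.mult = (\<lambda>x y n. x n \<otimes>\<^bsub>Q n\<^esub> y n),
      one = (\<lambda>n. \<one>\<^bsub>Q n\<^esub>),
      zero = (\<lambda>n. \<zero>\<^bsub>Q n\<^esub>),
      add = (\<lambda>x y n. x n \<oplus>\<^bsub>Q n\<^esub> y n),
      module.smult = (\<lambda>f x n. f \<odot>\<^bsub>Q n\<^esub> x n)\<rparr>)"

text \<open>
  Because \<open>\<tau> i j k = - \<tau> j i (-k)\<close>, one of the two is an independent parameter and the other its
  negative. An arbitrary linear order of the labels decides which; another order gives the
  same ring with some variables replaced by their negatives.
\<close>

definition label_order :: "'i rel" where
  "label_order = (SOME r. strict_linear_order_on UNIV r)"

definition tau_vars :: "'i set \<Rightarrow> ('i \<Rightarrow> 'i \<Rightarrow> enat) \<Rightarrow> ('i \<times> 'i \<times> nat) set" where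
  "tau_vars I m = {(i, j, k) \<in> t_index I m. (i, j) \<in> label_order}"

abbreviation R_hat ::
  "'i set \<Rightarrow> ('i \<Rightarrow> 'i \<Rightarrow> enat) \<Rightarrow> ('i \<times> 'i \<times> nat) series ring" where
  "R_hat I m \<equiv> series_ring (tau_vars I m)"

definition series_var :: "'x \<Rightarrow> 'x series" where
  "series_var v = (\<lambda>A. if A = {#v#} then 1 else 0)"

definition tau :: "'i set \<Rightarrow> ('i \<Rightarrow> 'i \<Rightarrow> enat) \<Rightarrow> 'i \<Rightarrow> 'i \<Rightarrow> nat \<Rightarrow> ('i \<times> 'i \<times> nat) series" where
  "tau I m i j k =
     (if (i, j) \<in> label_order then series_var (i, j, k)
      else \<ominus>\<^bsub>R_hat I m\<^esub> series_var (j, i, neg_index m i j k))"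

definition t_hat :: "'i set \<Rightarrow> ('i \<Rightarrow> 'i \<Rightarrow> enat) \<Rightarrow> 'i \<Rightarrow> 'i \<Rightarrow> nat \<Rightarrow> ('i \<times> 'i \<times> nat) series" where
  "t_hat I m i j k =
     (\<lambda>A. exp (2 * of_real pi * \<i> * of_nat k / of_nat (the_enat (m i j)))
            * series_exp (tau_vars I m) (tau I m i j k) A)"

definition Ap_hat :: "'i set \<Rightarrow> ('i \<Rightarrow> 'i \<Rightarrow> enat) \<Rightarrow>
    (('i \<times> 'i \<times> nat) series,
     nat \<Rightarrow> (('i \<times> 'i) list \<Rightarrow> ('i \<times> 'i \<times> nat) series) set set) module" where
  "Ap_hat I m = adic_completion (tau_vars I m) (Ap_over (R_hat I m) (t_hat I m) I m)"

definition flat_coxeter_matrix :: "'i set \<Rightarrow> ('i \<Rightarrow> 'i \<Rightarrow> enat) \<Rightarrow> bool" where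
  "flat_coxeter_matrix I m \<longleftrightarrow>
     coxeter_matrix I m \<and> topologically_free (tau_vars I m) (Ap_hat I m)"

end

theory Submission
  imports Defs
begin

text \<open>
  Spanning: in \<open>A(M)\<close> a braid move changes \<open>T\<^sub>w\<close> only by a combination of words that are shorter, because
  the monic relation \<open>\<Prod>(s\<^sub>is\<^sub>j - t\<^sub>i\<^sub>j\<^sub>k) = 0\<close> expresses \<open>(s\<^sub>is\<^sub>j)\<^sup>m\<close> by smaller powers. Hence the theorem of Matsumoto
  and Tits reduces every word to the chosen reduced words. Tits' theorem rests on the exchange condition,
  which is read off the contragredient geometric representation.

  Independence: the substitution \<open>t\<^sub>i\<^sub>j\<^sub>k = e\<^bsup>2\<pi>ik/m\<^esup> e\<^bsup>\<tau>\<^esup>\<close> embeds \<open>R\<close> into the power series ring, because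
  exponentials of distinct linear forms are linearly independent. A linear relation between words of even
  length thus gives one in the completed algebra, which is topologically free; a nontrivial relation there
  would induce a nontrivial one modulo the maximal ideal, that is in \<open>\<complex>[W\<^sub>+]\<close>. For words of arbitrary length,
  \<open>A(M)\<close> acts by two by two matrices over \<open>A\<^sub>+(M)\<close>, and the first row of the matrix of \<open>T\<^sub>w\<close> is the class of \<open>w\<close>
  or of \<open>w s\<^sub>o\<close>, according to the parity of \<open>w\<close>.
\<close>

text \<open>The presentation of \<open>A_+(M)\<close> does not exhibit it as a subalgebra of
  \<open>A(M)\<close>, and its image there is not studied. All transfer goes from
  \<open>A(M)\<close> to matrices over \<open>A_+(M)\<close>: the first row turns a linear relation
  in \<open>A(M)\<close> into relations in \<open>A_+(M)\<close>, and it also carries the spanning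
  statement from \<open>A(M)\<close> down to \<open>A_+(M)\<close>, so the braid computation is done
  only once. The restriction to the first row comes from the twist: \<open>s_p\<close> exchanges
  \<open>t_ijk\<close> and \<open>t_jik\<close>, so scalars act differently on the two rows.

  Relations are only pushed forward: from \<open>R\<close> to power series, from the algebra to its
  completion, and from there to the reduction modulo the maximal ideal. The group algebra is
  represented by operators on functions on \<open>W\<close>, where translations by distinct elements
  are told apart by an indicator function.

  The geometric representation supplies a single fact, the nontriviality of
  \<open>(s_i s_j)^p\<close> for \<open>0 < p < m_ij\<close>. The exchange condition then follows
  from Tits' count, modulo 2, of the reflections along a word.\<close>

section \<open>The two alternating words in two letters\<close>

fun alt :: "nat \<Rightarrow> 'i \<Rightarrow> 'i \<Rightarrow> 'i list" where
  "alt 0 i j = []"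
| "alt (Suc n) i j = i # alt n j i"

lemma length_alt [simp]: "length (alt n i j) = n"
  by (induction n arbitrary: i j) auto

lemma alt_in_lists: "i \<in> I \<Longrightarrow> j \<in> I \<Longrightarrow> alt n i j \<in> lists I"
  by (induction n arbitrary: i j) auto

lemma alt_add: "alt (k + l) i j = alt k i j @ (if even k then alt l i j else alt l j i)"
  by (induction k arbitrary: i j) auto

lemma alt_Suc_right: "alt (Suc n) i j = alt n i j @ [if even n then i else j]"
  using alt_add[of n 1 i j] by (auto simp del: alt.simps(2) simp: alt.simps(2)[of 0, simplified])

lemma rev_alt: "rev (alt n i j) = (if even n then alt n j i else alt n i j)"
proof (induction n arbitrary: i j)
  case (Suc n)
  then show ?case using alt_Suc_right[of n i j] alt_Suc_right[of n j i] by auto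
qed auto

lemma concat_replicate_alt: "concat (replicate n [i, j]) = alt (2 * n) i j"
  by (induction n) auto

lemma take_alt: "k \<le> n \<Longrightarrow> take k (alt n i j) = alt k i j"
  using alt_add[of k "n - k" i j] by simp


section \<open>The geometric representation\<close>

text \<open>Twice the canonical bilinear form of the Coxeter matrix on the simple roots of
  \<open>i\<close> and \<open>k\<close>, the form being \<open>- cos (pi / m)\<close> for distinct
  roots; the value \<open>- 2\<close> for an infinite entry is the limit as \<open>m\<close>
  grows.\<close>

definition cox_coeff :: "('i \<Rightarrow> 'i \<Rightarrow> enat) \<Rightarrow> 'i \<Rightarrow> 'i \<Rightarrow> real" where
  "cox_coeff m i k =
     (if k = i then 2 else case m i k of enat n \<Rightarrow> - 2 * cos (pi / n) | \<infinity> \<Rightarrow> - 2)"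

text \<open>The contragredient of the geometric representation; no sums over \<open>I\<close> occur in it.\<close>

definition cox_act :: "('i \<Rightarrow> 'i \<Rightarrow> enat) \<Rightarrow> 'i \<Rightarrow> ('i \<Rightarrow> real) \<Rightarrow> 'i \<Rightarrow> real" where
  "cox_act m i f = (\<lambda>k. f k - f i * cox_coeff m i k)"

text \<open>Reflecting alternately at \<open>i\<close> and \<open>j\<close> involves only the
  coordinates at \<open>i\<close> and \<open>j\<close>. The pair consists of the coordinate at the
  letter due next and the one at the other letter; a reflection negates the former, adds
  \<open>q\<close> times it to the latter and exchanges the roles. This is the recursion of the
  Chebyshev polynomials of the second kind.\<close>

fun alt_coord :: "real \<Rightarrow> real \<Rightarrow> real \<Rightarrow> nat \<Rightarrow> real" where
  "alt_coord q a b 0 = a"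
| "alt_coord q a b (Suc n) = alt_coord q (b + q * a) (- a) n"

lemma cox_act_involution: "cox_act m i (cox_act m i f) = f"
  by (auto simp: cox_act_def cox_coeff_def algebra_simps)

text \<open>A reflection at \<open>i\<close> subtracts a multiple of the row
  \<open>cox_coeff m i\<close>, the multiple being the current coordinate at \<open>i\<close>.
  Adding up these displacements describes all coordinates after \<open>n\<close> steps, also those
  outside \<open>i\<close> and \<open>j\<close>.\<close>

lemma fold_alt:
  assumes "i \<noteq> j" "cox_coeff m i j = - q" "cox_coeff m j i = - q"
  shows "fold (cox_act m) (alt n i j) f k =
    f k - (\<Sum>l<n. alt_coord q (f i) (f j) l * cox_coeff m (if even l then i else j) k)"
  using assms
proof (induction n arbitrary: i j f)
  case (Suc n)
  have "cox_act m i f j = f j + q * f i" "cox_act m i f i = - f i"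
    using Suc.prems by (auto simp: cox_act_def cox_coeff_def)
  then have "fold (cox_act m) (alt (Suc n) i j) f k = cox_act m i f k -
      (\<Sum>l<n. alt_coord q (f i) (f j) (Suc l) * cox_coeff m (if even l then j else i) k)"
    using Suc.IH[of j i "cox_act m i f"] Suc.prems by simp
  also have "\<dots> = f k - (\<Sum>l<Suc n. alt_coord q (f i) (f j) l * cox_coeff m (if even l then i else j) k)"
    unfolding sum.lessThan_Suc_shift by (auto simp: cox_act_def intro!: sum.cong)
  finally show ?case .
qed simp

lemma fold_alt_coord:
  assumes "i \<noteq> j" "cox_coeff m i j = - q" "cox_coeff m j i = - q"
  shows "fold (cox_act m) (alt n i j) f (if even n then i else j) = alt_coord q (f i) (f j) n"
  using assms
proof (induction n arbitrary: i j f)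
  case (Suc n)
  have "cox_act m i f j = f j + q * f i" "cox_act m i f i = - f i"
    using Suc.prems by (auto simp: cox_act_def cox_coeff_def)
  then show ?case using Suc.IH[of j i "cox_act m i f"] Suc.prems by (auto simp: if_distrib)
qed simp

text \<open>The recursion is the one satisfied by \<open>sin ((n + 1) * x) / sin x\<close>; the
  factor \<open>sin x\<close> stays on the left so that no division occurs.\<close>

lemma alt_coord_trig:
  "alt_coord (2 * cos x) a b n * sin x = a * sin ((n + 1) * x) + b * sin (n * x)"
proof (induction n arbitrary: a b)
  case (Suc n)
  have "sin ((real n + 2) * x) = 2 * cos x * sin ((real n + 1) * x) - sin (real n * x)"
  proof -
    have "sin ((real n + 1) * x + x) + sin ((real n + 1) * x - x) = 2 * cos x * sin ((real n + 1) * x)"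
      by (simp add: sin_add sin_diff)
    moreover have "(real n + 1) * x + x = (real n + 2) * x" "(real n + 1) * x - x = real n * x"
      by (simp_all add: algebra_simps)
    ultimately show ?thesis by simp
  qed
  moreover have "alt_coord (2 * cos x) a b (Suc n) * sin x =
      a * (2 * cos x * sin ((real n + 1) * x) - sin (real n * x)) + b * sin ((real n + 1) * x)"
    using Suc[of "b + 2 * cos x * a" "- a"] by (simp add: ring_distribs)
  ultimately show ?case by (simp add: ac_simps)
qed simp

text \<open>The limit of the trigonometric formula as \<open>x\<close> tends to 0, which is the case
  of an infinite entry.\<close>

lemma alt_coord_2: "alt_coord 2 a b n = a * (n + 1) + b * n"
  by (induction n arbitrary: a b) (auto simp: algebra_simps)

text \<open>The angles run through a full period in equal steps. Multiplication by
  \<open>2 * sin (pi / n)\<close> makes the sum telescope to a difference of two cosines whose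
  arguments differ by \<open>2 * pi\<close>; \<open>n = 1\<close> is excluded because
  \<open>sin (pi / n)\<close> vanishes there.\<close>

lemma sum_sin_period:
  assumes "2 \<le> n"
  shows "(\<Sum>l<n. sin (2 * real l * (pi / n) + y)) = 0"
proof -
  define x where "x = pi / n"
  have x: "0 < x" "x < pi"
    using assms by (auto simp: x_def field_simps)
  have "2 * sin x * sin (2 * real l * x + y)
      = - cos ((2 * real (Suc l) - 1) * x + y) - - cos ((2 * real l - 1) * x + y)" for l
  proof -
    have "cos ((2 * real l * x + y) - x) - cos ((2 * real l * x + y) + x) = 2 * sin x * sin (2 * real l * x + y)"
      by (simp add: cos_add cos_diff)
    moreover have "(2 * real l * x + y) - x = (2 * real l - 1) * x + y"
      "(2 * real l * x + y) + x = (2 * real (Suc l) - 1) * x + y"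
      by (simp_all add: algebra_simps)
    ultimately show ?thesis by simp
  qed
  then have "2 * sin x * (\<Sum>l<n. sin (2 * real l * x + y)) =
      (\<Sum>l<n. - cos ((2 * real (Suc l) - 1) * x + y) - - cos ((2 * real l - 1) * x + y))"
    by (simp only: sum_distrib_left)
  also have "\<dots> = - cos ((2 * real n - 1) * x + y) - - cos ((2 * real 0 - 1) * x + y)"
    by (rule sum_lessThan_telescope)
  also have "(2 * real n - 1) * x + y = (y - x) + 2 * pi"
    using assms by (simp add: x_def algebra_simps)
  finally have "2 * sin x * (\<Sum>l<n. sin (2 * real l * x + y)) = 0"
    by (simp only: cos_periodic) simp
  moreover have "sin x > 0" using x by (rule sin_gt_zero)
  ultimately show ?thesis by (simp add: x_def)
qed

lemma sum_even_odd_split: "(\<Sum>l<2 * n. f l) = (\<Sum>l<n. f (2 * l)) + (\<Sum>l<n. f (2 * l + 1 :: nat) :: real)"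
  by (induction n) auto

section \<open>Words modulo the Coxeter relations\<close>

locale coxeter_words =
  fixes I :: "'i set" and m :: "'i \<Rightarrow> 'i \<Rightarrow> enat"
  assumes cox: "coxeter_matrix I m"
begin

definition eqv :: "'i list \<Rightarrow> 'i list \<Rightarrow> bool" (infix "\<approx>" 50) where
  "u \<approx> v \<longleftrightarrow> (u, v) \<in> coxeter_cong I m"

lemma rev_in_lists [simp]: "rev u \<in> lists I \<longleftrightarrow> u \<in> lists I"
  by (simp add: in_lists_conv_set)

lemma eqv_refl: "u \<in> lists I \<Longrightarrow> u \<approx> u"
  unfolding eqv_def by (rule coxeter_cong.refl)

lemma eqv_sym: "u \<approx> v \<Longrightarrow> v \<approx> u"
  unfolding eqv_def by (rule coxeter_cong.sym)

lemma eqv_trans [trans]: "u \<approx> v \<Longrightarrow> v \<approx> z \<Longrightarrow> u \<approx> z"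
  unfolding eqv_def by (rule coxeter_cong.trans)

lemmas eqv_squareI = coxeter_cong.square[of _ I _ _ m, folded eqv_def]
lemmas eqv_powerI = coxeter_cong.power[of _ I _ _ _ m, folded eqv_def]

lemmas eqv_induct [consumes 1, case_names refl sym trans square power] =
  coxeter_cong.induct[of _ _ I m, folded eqv_def]

lemma m_sym: "i \<in> I \<Longrightarrow> j \<in> I \<Longrightarrow> m i j = m j i"
  using cox by (cases "i = j") (auto simp: coxeter_matrix_def)

lemma m_ge_2: "i \<in> I \<Longrightarrow> j \<in> I \<Longrightarrow> i \<noteq> j \<Longrightarrow> m i j = enat n \<Longrightarrow> 2 \<le> n"
  using cox unfolding coxeter_matrix_def by (metis enat_ord_simps(1) numeral_eq_enat)

lemma eqv_lists: "u \<approx> v \<Longrightarrow> u \<in> lists I \<and> v \<in> lists I"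
proof (induction rule: eqv_induct)
  case (power u v i j n)
  then have "concat (replicate n [i, j]) \<in> lists I"
    by (simp add: concat_replicate_alt alt_in_lists)
  then show ?case using power by auto
qed auto


lemma equiv_cong: "equiv (lists I) (coxeter_cong I m)"
proof (rule equivI)
  show "coxeter_cong I m \<subseteq> lists I \<times> lists I" by (intro subrelI SigmaI) (metis eqv_def eqv_lists)+
  show "refl_on (lists I) (coxeter_cong I m)" by (rule refl_onI) (rule coxeter_cong.refl)
  show "sym (coxeter_cong I m)" by (rule symI) (rule coxeter_cong.sym)
  show "trans (coxeter_cong I m)" by (rule transI) (rule coxeter_cong.trans)
qed

lemma eqv_context:
  assumes "u \<approx> v" "x \<in> lists I" "y \<in> lists I"
  shows "x @ u @ y \<approx> x @ v @ y"
  using assms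
proof (induction rule: eqv_induct)
  case (square u v i)
  then show ?case using eqv_squareI[of "x @ u" "v @ y" i] by simp
next
  case (power u v i j n)
  then show ?case using eqv_powerI[of "x @ u" "v @ y" i j n] by simp
next
  case (refl u)
  then show ?case by (intro eqv_refl) simp
qed (blast intro: eqv_sym eqv_trans)+

lemma eqv_append:
  assumes "u \<approx> u'" "v \<approx> v'"
  shows "u @ v \<approx> u' @ v'"
proof -
  have "u @ v \<approx> u' @ v" using eqv_context[OF assms(1), of "[]" v] eqv_lists[OF assms(2)] by simp
  also have "\<dots> \<approx> u' @ v'" using eqv_context[OF assms(2), of u' "[]"] eqv_lists[OF assms(1)] by simp
  finally show ?thesis .
qed

lemma eqv_square: "i \<in> I \<Longrightarrow> [i, i] \<approx> []"
  using eqv_squareI[of "[]" "[]" i] by simp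

lemma append_rev_eqv: "u \<in> lists I \<Longrightarrow> u @ rev u \<approx> []"
proof (induction u)
  case (Cons i u)
  then have "[i] @ (u @ rev u) @ [i] \<approx> [i] @ [] @ [i]"
    by (intro eqv_context) auto
  also have "\<dots> \<approx> []" using eqv_square Cons.prems by simp
  finally show ?case by simp
qed (auto intro: eqv_refl)

lemma rev_append_eqv: "u \<in> lists I \<Longrightarrow> rev u @ u \<approx> []"
  using append_rev_eqv[of "rev u"] by simp

lemma eqv_insert: "w \<approx> [] \<Longrightarrow> u \<in> lists I \<Longrightarrow> v \<in> lists I \<Longrightarrow> u @ w @ v \<approx> u @ v"
  using eqv_context[of w "[]" u v] by simp

lemma eqv_cancel_left:
  assumes "x @ u \<approx> x @ v" shows "u \<approx> v"
proof -
  have x: "x \<in> lists I" "u \<in> lists I" "v \<in> lists I" using eqv_lists[OF assms] by auto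
  have "u \<approx> (rev x @ x) @ u"
    using eqv_insert[OF rev_append_eqv, of x "[]" u] x by (simp add: eqv_sym)
  also have "\<dots> \<approx> (rev x @ x) @ v"
    using eqv_append[OF eqv_refl assms, of "rev x"] x by simp
  also have "\<dots> \<approx> v"
    using eqv_insert[OF rev_append_eqv, of x "[]" v] x by simp
  finally show ?thesis .
qed

lemma eqv_cancel_right:
  assumes "u @ x \<approx> v @ x" shows "u \<approx> v"
proof -
  have x: "x \<in> lists I" "u \<in> lists I" "v \<in> lists I" using eqv_lists[OF assms] by auto
  have "u \<approx> u @ (x @ rev x)"
    using eqv_insert[OF append_rev_eqv, of x u "[]"] x by (simp add: eqv_sym)
  also have "\<dots> \<approx> v @ (x @ rev x)"
    using eqv_append[OF assms eqv_refl, of "rev x"] x by simp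
  also have "\<dots> \<approx> v"
    using eqv_insert[OF append_rev_eqv, of x v "[]"] x by simp
  finally show ?thesis .
qed

lemma eqv_parity: "u \<approx> v \<Longrightarrow> even (length u) = even (length v)"
  by (induction rule: eqv_induct) (auto simp: concat_replicate_alt)

lemma eqv_Cons_flip: "i \<in> I \<Longrightarrow> i # u \<approx> v \<Longrightarrow> u \<approx> i # v"
proof -
  assume i: "i \<in> I" and e: "i # u \<approx> v"
  have "[i] @ i # u \<approx> [i] @ v" using e i by (intro eqv_append eqv_refl) auto
  moreover have "[] @ [i, i] @ u \<approx> [] @ u"
    using eqv_lists[OF e] i by (intro eqv_insert eqv_square) auto
  ultimately show ?thesis by (auto intro: eqv_sym eqv_trans)
qed

text \<open>The displacement over \<open>2 * n\<close> steps is a combination of just two rows, that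
  of \<open>i\<close> from the even steps and that of \<open>j\<close> from the odd ones. Each of
  the two total coefficients is made of sums of sines over equally spaced angles and vanishes, which
  settles all coordinates at once.\<close>

lemma fold_act_alt_trivial:
  assumes "i \<in> I" "j \<in> I" "i \<noteq> j" "m i j = enat n"
  shows "fold (cox_act m) (alt (2 * n) i j) = id"
proof (rule ext, rule ext)
  fix f k
  define x where "x = pi / real n"
  have n: "2 \<le> n" using m_ge_2 assms by blast
  have x: "0 < x" "x < pi" "sin x > 0"
    using n sin_gt_zero[of x] by (auto simp: x_def field_simps)
  have "m j i = enat n" using m_sym assms by metis
  then have q: "cox_coeff m i j = - (2 * cos x)" "cox_coeff m j i = - (2 * cos x)"
    using assms(3,4) by (simp_all add: cox_coeff_def x_def)
  let ?X = "alt_coord (2 * cos x) (f i) (f j)"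
  \<comment> \<open>Here \<open>d\<close> selects the parity of the step: 0 for the reflections at
    \<open>i\<close>, 1 for those at \<open>j\<close>.\<close>
  have zero: "(\<Sum>l<n. ?X (2 * l + d)) = 0" for d
  proof -
    have "?X (2 * l + d) * sin x =
        f i * sin (2 * real l * x + (d + 1) * x) + f j * sin (2 * real l * x + d * x)" for l
      using alt_coord_trig[of x "f i" "f j" "2 * l + d"] by (simp add: algebra_simps)
    then have "(\<Sum>l<n. ?X (2 * l + d)) * sin x =
        f i * (\<Sum>l<n. sin (2 * real l * x + (d + 1) * x)) + f j * (\<Sum>l<n. sin (2 * real l * x + d * x))"
      by (simp only: sum_distrib_left sum_distrib_right sum.distrib)
   also have "\<dots> = 0" unfolding x_def using sum_sin_period[OF n] by simp
    finally show ?thesis using x by simp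
  qed
  have "fold (cox_act m) (alt (2 * n) i j) f k =
      f k - (\<Sum>l<2 * n. ?X l * cox_coeff m (if even l then i else j) k)"
    using fold_alt[OF assms(3) q] .
  also have "(\<Sum>l<2 * n. ?X l * cox_coeff m (if even l then i else j) k) = 0"
    using zero[of 0] zero[of 1] by (simp add: sum_even_odd_split sum_distrib_right[symmetric])
  finally show "fold (cox_act m) (alt (2 * n) i j) f k = id f k" by simp
qed

lemma eqv_fold_act: "u \<approx> v \<Longrightarrow> fold (cox_act m) u = fold (cox_act m) v"
proof (induction rule: eqv_induct)
  case (square u v i)
  show ?case by (auto simp: fun_eq_iff cox_act_involution)
next
  case (power u v i j n)
  show ?case using fold_act_alt_trivial[OF power(3-6)] by (simp add: concat_replicate_alt)
qed auto

text \<open>If the word were trivial, the coordinate at \<open>i\<close> would return to its initial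
  value for every \<open>f\<close>. For the indicator function of \<open>j\<close> this makes
  \<open>2 * p * pi / n\<close> a zero of the sine strictly between 0 and \<open>2 * pi\<close>,
  hence equal to \<open>pi\<close>; the indicator function of \<open>i\<close> then gives
  \<open>- sin x = sin x\<close>. With an infinite entry the coordinate grows linearly
  instead.\<close>

lemma alt_not_trivial:
  assumes "i \<in> I" "j \<in> I" "i \<noteq> j" "0 < p" "enat p < m i j"
  shows "\<not> alt (2 * p) i j \<approx> []"
proof
  assume "alt (2 * p) i j \<approx> []"
  then have fold: "fold (cox_act m) (alt (2 * p) i j) f = f" for f
    using eqv_fold_act by fastforce
  have coord: "alt_coord q (f i) (f j) (2 * p) = f i"
    if "cox_coeff m i j = - q" "cox_coeff m j i = - q" for q f
    using fold_alt_coord[OF assms(3) that, of "2 * p" f] fold[of f] by simp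
  show False
  proof (cases "m i j")
    case (enat n)
    define x where "x = pi / real n"
    have n: "2 \<le> n" "p < n" using m_ge_2 assms enat by auto
    have x: "0 < x" "x < pi" "sin x > 0"
      using n sin_gt_zero[of x] by (auto simp: x_def field_simps)
    have "m j i = enat n" using enat m_sym assms by metis
    then have q: "cox_coeff m i j = - (2 * cos x)" "cox_coeff m j i = - (2 * cos x)"
      using assms(3) enat by (simp_all add: cox_coeff_def x_def)
    have 1: "sin (real (2 * p) * x) = 0"
      using coord[OF q, of "\<lambda>k. if k = j then 1 else 0"] alt_coord_trig[of x 0 1 "2 * p"] assms by simp
    have 2: "sin (real (2 * p) * x + x) = sin x"
      using coord[OF q, of "\<lambda>k. if k = i then 1 else 0"] alt_coord_trig[of x 1 0 "2 * p"] assms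
      by (simp add: algebra_simps)
    have *: "0 < real (2 * p) * x" "real (2 * p) * x < 2 * pi"
      using n x assms by (auto simp: x_def field_simps)
    have "real (2 * p) * x = pi"
    proof (rule ccontr)
      assume ne: "real (2 * p) * x \<noteq> pi"
      show False
      proof (cases "real (2 * p) * x < pi")
        case True
        then show False using sin_gt_zero[OF *(1)] 1 by simp
      next
        case False
        then show False using sin_lt_zero[of "real (2 * p) * x"] ne * 1 by simp
      qed
    qed
    then have "- sin x = sin x" using 2 by (simp add: sin_add)
    then show False using x by simp
  next
    case infinity
    have "m j i = \<infinity>" using infinity m_sym assms by metis
    then have q: "cox_coeff m i j = - 2" "cox_coeff m j i = - 2"
      using assms(3) infinity by (simp_all add: cox_coeff_def)
    show False
      using coord[OF q, of "\<lambda>k. if k = i then 1 else 0"] assms by (simp add: alt_coord_2)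
  qed
qed


section \<open>Reflections and the exchange condition\<close>

text \<open>The word \<open>s_1 ... s_r s_(r+1) s_r ... s_1\<close>, which represents a conjugate of
  a generator. Multiplying \<open>u\<close> by it on the left deletes the letter at position
  \<open>r\<close>, counted from 0.\<close>

definition reflection :: "'i list \<Rightarrow> nat \<Rightarrow> 'i list" where
  "reflection u r = take (Suc r) u @ rev (take r u)"

text \<open>Tits' cocycle: the parity with which \<open>t\<close> occurs in the list of reflections
  of \<open>u\<close>. The count itself depends on the word, its parity only on the group element,
  by \<open>eqv_refl_parity\<close>.\<close>

definition refl_parity :: "'i list \<Rightarrow> 'i list \<Rightarrow> bool" where
  "refl_parity u t \<longleftrightarrow> odd (card {r. r < length u \<and> t \<approx> reflection u r})"

lemma take_in_lists: "u \<in> lists I \<Longrightarrow> take r u \<in> lists I"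
  using set_take_subset by fastforce

lemma reflection_in_lists: "u \<in> lists I \<Longrightarrow> reflection u r \<in> lists I"
  using take_in_lists[of u r] take_in_lists[of u "Suc r"] by (simp add: reflection_def)

lemma eqv_conj_iff:
  assumes "u \<in> lists I" "t \<in> lists I" "x \<in> lists I"
  shows "t \<approx> u @ x @ rev u \<longleftrightarrow> rev u @ t @ u \<approx> x"
proof
  assume "t \<approx> u @ x @ rev u"
  then have "rev u @ t @ u \<approx> rev u @ (u @ x @ rev u) @ u"
    using assms by (intro eqv_context) auto
  also have "\<dots> = (rev u @ u) @ x @ (rev u @ u)" by simp
  also have "\<dots> \<approx> [] @ x @ []"
    using assms by (intro eqv_append rev_append_eqv eqv_refl) auto
  finally show "rev u @ t @ u \<approx> x" by simp
next
  assume "rev u @ t @ u \<approx> x"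
  then have "u @ (rev u @ t @ u) @ rev u \<approx> u @ x @ rev u"
    using assms by (intro eqv_context) auto
  moreover have "(u @ rev u) @ t @ (u @ rev u) \<approx> [] @ t @ []"
    using assms by (intro eqv_append append_rev_eqv eqv_refl) auto
  ultimately show "t \<approx> u @ x @ rev u" by (auto intro: eqv_sym eqv_trans)
qed

text \<open>The reflections of \<open>u @ v\<close> are those of \<open>u\<close> followed by those
  of \<open>v\<close> conjugated by \<open>u\<close>. This is the cocycle identity, and it reduces
  the invariance of the parity to single relators.\<close>

lemma refl_parity_append:
  assumes "u \<in> lists I" "v \<in> lists I" "t \<in> lists I"
  shows "refl_parity (u @ v) t \<longleftrightarrow> refl_parity u t \<noteq> refl_parity v (rev u @ t @ u)"
proof -
  let ?A = "{r. r < length u \<and> t \<approx> reflection u r}"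
  let ?B = "{r. r < length v \<and> rev u @ t @ u \<approx> reflection v r}"
  have 1: "reflection (u @ v) r = reflection u r" if "r < length u" for r
    using that by (simp add: reflection_def)
  have 2: "t \<approx> reflection (u @ v) (length u + r) \<longleftrightarrow> rev u @ t @ u \<approx> reflection v r" for r
    using eqv_conj_iff[of u t "reflection v r"] assms reflection_in_lists
    by (simp add: reflection_def)
  have "{r. r < length (u @ v) \<and> t \<approx> reflection (u @ v) r} = ?A \<union> (+) (length u) ` ?B" (is "?L = ?R")
  proof (intro subset_antisym subsetI)
    fix r assume r: "r \<in> ?L"
    show "r \<in> ?R"
    proof (cases "r < length u")
      case True then show ?thesis using r 1 by auto
    next
      case False
      then obtain s where "r = length u + s" by (metis le_Suc_ex not_less)
      then show ?thesis using r 2[of s] by auto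
    qed
  next
    fix r assume "r \<in> ?R" then show "r \<in> ?L" using 1 2 by auto
  qed
  moreover have "card (?A \<union> (+) (length u) ` ?B) = card ?A + card ?B"
    by (subst card_Un_disjoint) (auto simp: card_image)
  ultimately show ?thesis by (simp add: refl_parity_def)
qed

lemma refl_parity_cong: "t \<approx> t' \<Longrightarrow> refl_parity u t = refl_parity u t'"
proof -
  assume "t \<approx> t'"
  then have "t \<approx> z \<longleftrightarrow> t' \<approx> z" for z by (metis eqv_sym eqv_trans)
  then show ?thesis by (simp add: refl_parity_def)
qed

text \<open>The list of reflections repeats after \<open>n\<close> entries, so every element occurs
  in it an even number of times. Relators have this property.\<close>

lemma refl_parity_double:
  assumes "length w = 2 * n" "\<And>r. r < n \<Longrightarrow> reflection w (n + r) \<approx> reflection w r"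
  shows "\<not> refl_parity w t"
proof -
  let ?B = "{r. r < n \<and> t \<approx> reflection w r}"
  have *: "t \<approx> reflection w (n + r) \<longleftrightarrow> t \<approx> reflection w r" if "r < n" for r
    using assms(2)[OF that] by (blast intro: eqv_sym eqv_trans)
  have "{r. r < length w \<and> t \<approx> reflection w r} = ?B \<union> (+) n ` ?B" (is "?L = ?R")
  proof (intro subset_antisym subsetI)
    fix r assume r: "r \<in> ?L"
    show "r \<in> ?R"
    proof (cases "r < n")
      case True then show ?thesis using r by auto
    next
      case False
      then obtain s where "r = n + s" by (metis le_Suc_ex not_less)
      then show ?thesis using r *[of s] assms(1) by auto
    qed
  next
    fix r assume "r \<in> ?R" then show "r \<in> ?L" using * assms(1) by auto
  qed
  moreover have "card (?B \<union> (+) n ` ?B) = card ?B + card ?B"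
    by (subst card_Un_disjoint) (auto simp: card_image)
  ultimately show ?thesis by (simp add: refl_parity_def)
qed

lemma reflection_alt: "r < n \<Longrightarrow> reflection (alt n i j) r = alt (2 * r + 1) i j"
  using alt_add[of "Suc r" r i j] rev_alt[of r i j]
  by (simp add: reflection_def take_alt mult_2 del: alt.simps)

text \<open>A relator contributes nothing to the parity by \<open>refl_parity_double\<close>, and
  since it represents 1, conjugation by it does not change the element that is compared with the
  rest of the word.\<close>

lemma eqv_refl_parity:
  "u \<approx> v \<Longrightarrow> t \<in> lists I \<Longrightarrow> refl_parity u t = refl_parity v t"
proof (induction rule: eqv_induct)
  case (square u v i)
  have "\<not> refl_parity [i, i] t'" for t'
  proof (rule refl_parity_double[where n = 1])
    fix r :: nat assume "r < 1"
    then show "reflection [i, i] (1 + r) \<approx> reflection [i, i] r"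
      using eqv_insert[OF eqv_square, of i "[i]" "[]"] square by (simp add: reflection_def)
  qed simp
  moreover have "[i, i] \<approx> []" using eqv_square square by blast
  ultimately have *: "\<not> refl_parity [i, i] t'" "[i, i] \<approx> []" for t' by auto
  have "rev [i,i] @ (rev u @ t @ u) @ [i, i] \<approx> [] @ (rev u @ t @ u) @ []"
    using square *(2) by (intro eqv_append eqv_refl) auto
  then have "refl_parity v (rev [i,i] @ (rev u @ t @ u) @ [i, i]) = refl_parity v (rev u @ t @ u)"
    using refl_parity_cong by simp
  then show ?case
    using square *(1) refl_parity_append[of u "[i, i] @ v" t] refl_parity_append[of "[i, i]" v "rev u @ t @ u"]
      refl_parity_append[of u v t]
    by simp
next
  case (power u v i j n)
  define w where "w = concat (replicate n [i, j])"
  have w: "w = alt (2 * n) i j" by (simp add: w_def concat_replicate_alt)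
  have wI: "w \<in> lists I" using power by (simp add: w alt_in_lists)
  have w0: "w \<approx> []" using eqv_powerI[of "[]" "[]" i j n] power by (simp add: w_def)
  have *: "\<not> refl_parity w t'" for t'
  proof (rule refl_parity_double[where n = n])
    fix r assume r: "r < n"
    have "alt (2 * (n + r) + 1) i j = w @ alt (2 * r + 1) i j"
      using alt_add[of "2 * n" "2 * r + 1" i j] by (simp add: w)
   also have "\<dots> \<approx> alt (2 * r + 1) i j"
      using eqv_insert[OF w0, of "[]" "alt (2 * r + 1) i j"] power
      by (simp add: alt_in_lists)
    finally show "reflection w (n + r) \<approx> reflection w r"
      using r by (simp add: w reflection_alt del: alt.simps)
  qed (simp add: w)
  have "rev w \<approx> []"
    using eqv_append[OF eqv_refl[of "rev w"] eqv_sym[OF w0]] rev_append_eqv[OF wI] wI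
    by (auto intro: eqv_trans)
  then have "rev w @ (rev u @ t @ u) @ w \<approx> [] @ (rev u @ t @ u) @ []"
    using power w0 by (intro eqv_append eqv_refl) auto
  then have "refl_parity v (rev w @ (rev u @ t @ u) @ w) = refl_parity v (rev u @ t @ u)"
    using refl_parity_cong by simp
  then show ?case
    using power * wI refl_parity_append[of u "w @ v" t] refl_parity_append[of w v "rev u @ t @ u"]
      refl_parity_append[of u v t]
    unfolding w_def[symmetric] by simp
qed auto

definition reduced :: "'i list \<Rightarrow> bool" where
  "reduced u \<longleftrightarrow> u \<in> lists I \<and> (\<forall>v. u \<approx> v \<longrightarrow> length u \<le> length v)"

text \<open>When the reflections of \<open>u\<close> are pairwise inequivalent, each of them has odd
  parity in \<open>u\<close>, hence in every equivalent \<open>v\<close>, and so occurs among the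
  reflections of \<open>v\<close>. This injects the positions of \<open>u\<close> into those of
  \<open>v\<close>.\<close>

lemma reducedI_reflections:
  assumes u: "u \<in> lists I"
    and distinct: "\<And>r s. r < s \<Longrightarrow> s < length u \<Longrightarrow> \<not> reflection u r \<approx> reflection u s"
  shows "reduced u"
  unfolding reduced_def
proof (intro conjI allI impI)
  fix v assume uv: "u \<approx> v"
  have inj: "r = s" if "reflection u r \<approx> reflection u s" "r < length u" "s < length u" for r s
    using distinct[of r s] distinct[of s r] that eqv_sym by (meson linorder_neqE_nat)
  have "\<exists>s<length v. reflection u r \<approx> reflection v s" if r: "r < length u" for r
  proof -
    have "{s. s < length u \<and> reflection u r \<approx> reflection u s} = {r}"
      using inj r eqv_refl reflection_in_lists[OF u] by auto
    then have "refl_parity u (reflection u r)" by (simp add: refl_parity_def)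
    then have "refl_parity v (reflection u r)"
      using eqv_refl_parity[OF uv] reflection_in_lists[OF u] by blast
    then have "{s. s < length v \<and> reflection u r \<approx> reflection v s} \<noteq> {}"
      unfolding refl_parity_def by (metis card.empty even_zero)
    then show ?thesis by auto
  qed
  then obtain g where g: "\<And>r. r < length u \<Longrightarrow> g r < length v \<and> reflection u r \<approx> reflection v (g r)"
    by metis
  have "inj_on g {..<length u}"
  proof (rule inj_onI)
    fix r s assume "r \<in> {..<length u}" "s \<in> {..<length u}" "g r = g s"
    then show "r = s" using inj[of r s] g[of r] g[of s] by (auto intro: eqv_trans eqv_sym)
  qed
  then have "card {..<length u} \<le> card {..<length v}"
    using g by (intro card_inj_on_le[of g]) auto
  then show "length u \<le> length v" by simp
qed (rule u)

text \<open>The reflections of an alternating word are the alternating words of odd length. Two of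
  them coincide only if some \<open>(s_i s_j)^p\<close> with \<open>0 < p < m i j\<close> is
  trivial, which the geometric representation excludes.\<close>

lemma reduced_alt:
  assumes "i \<in> I" "j \<in> I" "i \<noteq> j" "enat k \<le> m i j"
  shows "reduced (alt k i j)"
proof (rule reducedI_reflections)
  fix r s assume rs: "r < s" "s < length (alt k i j)"
  show "\<not> reflection (alt k i j) r \<approx> reflection (alt k i j) s"
  proof
    assume "reflection (alt k i j) r \<approx> reflection (alt k i j) s"
    moreover have "alt (2 * s + 1) i j = alt (2 * (s - r)) i j @ alt (2 * r + 1) i j"
    proof -
      have "2 * s + 1 = 2 * (s - r) + (2 * r + 1)" using rs by simp
      then show ?thesis using alt_add[of "2 * (s - r)" "2 * r + 1" i j] by (simp del: alt.simps)
    qed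
    ultimately have "[] @ alt (2 * r + 1) i j \<approx> alt (2 * (s - r)) i j @ alt (2 * r + 1) i j"
      using rs by (simp add: reflection_alt del: alt.simps)
    then have "alt (2 * (s - r)) i j \<approx> []"
      using eqv_cancel_right eqv_sym by blast
    moreover have "enat (s - r) < m i j"
      using rs assms(4) by (auto intro: less_le_trans[of _ "enat k"])
    ultimately show False using alt_not_trivial[of i j "s - r"] assms rs by auto
  qed
qed (use assms in \<open>simp add: alt_in_lists\<close>)

text \<open>The word \<open>[j]\<close> is the reflection of \<open>j # v\<close> at position 0 and,
  by reducedness, at no other position. Its parity is therefore odd, also in \<open>u\<close>, so it
  is a reflection of \<open>u\<close> as well, and multiplying by \<open>j\<close> deletes the
  corresponding letter.\<close>

lemma exchange:
  assumes red: "reduced (j # v)" and uv: "u \<approx> j # v"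
  obtains u1 a u2 where "u = u1 @ a # u2" "j # u \<approx> u1 @ u2"
proof -
  have jv: "j # v \<in> lists I" using red by (simp add: reduced_def)
  have u: "u \<in> lists I" using eqv_lists[OF uv] by simp
  \<comment> \<open>The deletion identity \<open>x a y = (x a x^-1) x y\<close>.\<close>
  have delete: "x @ a # y \<approx> t @ x @ y"
    if "x @ a # rev x \<approx> t" "x @ a # y \<in> lists I" for x a y t
  proof -
    have "x @ [a] @ y \<approx> (x @ [a] @ rev x) @ x @ y"
      using eqv_insert[OF rev_append_eqv, of x "x @ [a]" y] that(2) by (simp add: eqv_sym)
   also have "\<dots> \<approx> t @ x @ y" using that by (intro eqv_append eqv_refl) auto
    finally show ?thesis by simp
  qed
  \<comment> \<open>At a second occurrence \<open>x a x^-1\<close> would equal \<open>s_j\<close>,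
    because conjugation by \<open>s_j\<close> fixes \<open>s_j\<close>; then \<open>j # v\<close>
    would be equivalent to the shorter word \<open>x @ y\<close>.\<close>
  have "\<not> [j] \<approx> reflection (j # v) r" if r: "0 < r" "r < length (j # v)" for r
  proof
    assume e: "[j] \<approx> reflection (j # v) r"
    obtain s where s: "r = Suc s" using r by (cases r) auto
    define x a y where "x = take s v" and "a = v ! s" and "y = drop (Suc s) v"
    have v: "v = x @ a # y" and "take (Suc s) v = x @ [a]"
      using r s by (auto simp: x_def a_def y_def id_take_nth_drop take_Suc_conv_app_nth)
    then have "[j] \<approx> [j] @ (x @ a # rev x) @ rev [j]"
      using e s by (simp add: reflection_def x_def)
    moreover have "[j] @ [j] @ [j] \<approx> [j]"
      using eqv_insert[OF eqv_square, of j "[j]" "[]"] jv by simp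
    moreover have "[j] @ [j] @ [j] \<approx> x @ a # rev x"
      if "[j] \<approx> [j] @ (x @ a # rev x) @ rev [j]"
      using that eqv_conj_iff[of "[j]" "[j]" "x @ a # rev x"] jv v by simp
    ultimately have "x @ a # rev x \<approx> [j]" by (metis eqv_sym eqv_trans)
    then have "j # v \<approx> [j] @ [j] @ x @ y"
      using eqv_append[OF eqv_refl[of "[j]"] delete[of x a "[j]" y]] v jv by simp
   also have "\<dots> \<approx> x @ y" using eqv_insert[OF eqv_square, of j "[]" "x @ y"] jv v by simp
    finally have "length (j # v) \<le> length (x @ y)" using red by (auto simp: reduced_def)
    then show False by (simp add: v)
  qed
  moreover have "[j] \<approx> reflection (j # v) 0" using jv by (simp add: reflection_def eqv_refl)
  ultimately have "{r. r < length (j # v) \<and> [j] \<approx> reflection (j # v) r} = {0}"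
    by auto
  then have "refl_parity (j # v) [j]" by (simp add: refl_parity_def)
  then have "refl_parity u [j]" using eqv_refl_parity[OF uv, of "[j]"] jv by simp
  then have "{r. r < length u \<and> [j] \<approx> reflection u r} \<noteq> {}"
    unfolding refl_parity_def by (metis card.empty even_zero)
  then obtain r where r: "r < length u" "[j] \<approx> reflection u r" by auto
  define x a y where "x = take r u" and "a = u ! r" and "y = drop (Suc r) u"
  have ux: "u = x @ a # y" and "take (Suc r) u = x @ [a]"
    using r by (auto simp: x_def a_def y_def id_take_nth_drop take_Suc_conv_app_nth)
  then have "u \<approx> [j] @ x @ y"
    using delete[of x a "[j]" y] r u by (auto simp: reflection_def x_def intro: eqv_sym)
  then have "j # u \<approx> x @ y"
    using jv eqv_Cons_flip[of j "x @ y" u] by (auto intro: eqv_sym)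
  then show ?thesis using that ux by blast
qed

lemma reduced_length: "reduced u \<Longrightarrow> u \<approx> v \<Longrightarrow> length u \<le> length v"
  by (simp add: reduced_def)

lemma reduced_append: "reduced (u @ v) \<Longrightarrow> reduced v"
  unfolding reduced_def
proof (intro conjI allI impI)
  fix v' assume red: "u @ v \<in> lists I \<and> (\<forall>v'. u @ v \<approx> v' \<longrightarrow> length (u @ v) \<le> length v')" and "v \<approx> v'"
  then have "u @ v \<approx> u @ v'" by (intro eqv_append eqv_refl) auto
  then show "length v \<le> length v'" using red by fastforce
qed auto

text \<open>Exchange lets an alternating prefix grow: if the element starts with
  \<open>alt k b a\<close> and also has \<open>a\<close> as a left descent, then it starts with
  \<open>alt (Suc k) a b\<close>, as long as the latter is reduced. This goes on up to length
  \<open>m i j\<close>; an infinite entry would produce prefixes longer than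
  \<open>x\<close>.\<close>

lemma two_descents:
  assumes x: "reduced x" and xi: "x \<approx> i # u" "length x = length (i # u)"
    and xj: "x \<approx> j # v" "length x = length (j # v)" and "i \<noteq> j"
  obtains n z z' where "m i j = enat n" "x \<approx> alt n i j @ z" "x \<approx> alt n j i @ z'"
    "length x = n + length z" "length x = n + length z'"
proof -
  have ij: "i \<in> I" "j \<in> I" using eqv_lists[OF xi(1)] eqv_lists[OF xj(1)] by auto
  have red: "reduced y" if "x \<approx> y" "length x = length y" for y
    using x that eqv_lists[OF that(1)] unfolding reduced_def by (metis eqv_trans)
  have step: "\<exists>z. x \<approx> alt k a b @ z \<and> length x = k + length z"
    if "a = i \<and> b = j \<or> a = j \<and> b = i" "1 \<le> k" "enat k \<le> m i j" for k a b
    using that(2,1,3)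
  proof (induction k arbitrary: a b rule: dec_induct)
    case base
    then show ?case using xi xj by auto
  next
    case (step k)
    have "enat k \<le> m i j" using step.prems(2) by (metis Suc_ile_eq order_less_imp_le)
    then obtain z where z: "x \<approx> alt k b a @ z" "length x = k + length z"
      using step.IH[of b a] step.prems by auto
    obtain y where y: "x \<approx> a # y" "length x = length (a # y)" using step.prems xi xj by auto
    have "alt k b a @ z \<approx> a # y" using y z by (blast intro: eqv_sym eqv_trans)
    then obtain u1 c u2 where u: "alt k b a @ z = u1 @ c # u2" "a # alt k b a @ z \<approx> u1 @ u2"
      using exchange[OF red[OF y]] by blast
    \<comment> \<open>The deleted letter lies in the alternating prefix or in the rest
      \<open>z\<close>. In the former case cancelling \<open>z\<close> would shorten
      \<open>alt (Suc k) a b\<close>, which is reduced; so it lies in \<open>z\<close>, and the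
      prefix survives.\<close>
    show ?case
    proof (cases "length u1 < k")
      case True
      obtain u2' where u2': "alt k b a = u1 @ c # u2'" "u2 = u2' @ z"
      proof -
        have "alt k b a = take k (u1 @ c # u2)" "z = drop k (u1 @ c # u2)"
          using u(1) by (metis append_eq_conv_conj length_alt)+
        then show ?thesis
          using True that[of "take (k - Suc (length u1)) u2"]
          by (simp add: take_Cons' drop_Cons' Suc_diff_le)
      qed
      have "(a # alt k b a) @ z \<approx> (u1 @ u2') @ z" using u u2' by simp
      then have "alt (Suc k) a b \<approx> u1 @ u2'" using eqv_cancel_right by fastforce
      moreover have "reduced (alt (Suc k) a b)"
        using step.prems ij \<open>i \<noteq> j\<close> m_sym[of i j] by (intro reduced_alt) auto
      ultimately have "length (alt (Suc k) a b) \<le> length (u1 @ u2')" using reduced_length by blast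
      moreover have "length (alt k b a) = length (u1 @ c # u2')" using u2' by simp
      ultimately show ?thesis by (simp del: alt.simps)
    next
      case False
      then obtain u1' where u1': "u1 = alt k b a @ u1'" "z = u1' @ c # u2"
        using u(1) that[of "drop k u1"] by (auto simp: append_eq_append_conv_if)
      have a: "a \<in> I" using step.prems ij by auto
      have "alt k b a @ z \<approx> a # u1 @ u2" using eqv_Cons_flip[OF a u(2)] .
      then have "x \<approx> a # u1 @ u2" using z(1) eqv_trans by blast
      then have "x \<approx> alt (Suc k) a b @ (u1' @ u2)" by (simp add: u1')
      then show ?thesis using z(2) u1' by (intro exI[of _ "u1' @ u2"]) auto
    qed
  qed
  obtain n where n: "m i j = enat n"
  proof (cases "m i j")
    case infinity
    then obtain z where "length x = Suc (length x) + length z"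
      using step[of i j "Suc (length x)"] by auto
    then show ?thesis by simp
  qed
  have "1 \<le> n" using m_ge_2[OF ij \<open>i \<noteq> j\<close> n] by simp
  then show ?thesis using step[of i j n] step[of j i n] that n by auto
qed

text \<open>
  The theorem of Matsumoto and Tits in the form in which it is needed: the operator \<open>cl\<close>
  abstracts the passage from a set of words to all words whose products lie in its linear span.
\<close>

theorem span_reduced_words:
  assumes cl_lists: "\<And>S. S \<subseteq> lists I \<Longrightarrow> cl S \<subseteq> lists I"
    and cl_base: "\<And>S. S \<subseteq> lists I \<Longrightarrow> S \<subseteq> cl S"
    and cl_trans: "\<And>S S'. S \<subseteq> lists I \<Longrightarrow> S' \<subseteq> lists I \<Longrightarrow> S \<subseteq> cl S' \<Longrightarrow> cl S \<subseteq> cl S'"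
    and cl_Cons: "\<And>i u S. i \<in> I \<Longrightarrow> S \<subseteq> lists I \<Longrightarrow> u \<in> cl S \<Longrightarrow> i # u \<in> cl ((#) i ` S)"
    and cl_square: "\<And>i v. i \<in> I \<Longrightarrow> v \<in> lists I \<Longrightarrow> i # i # v \<in> cl {v}"
    and cl_braid: "\<And>i j n v. i \<in> I \<Longrightarrow> j \<in> I \<Longrightarrow> i \<noteq> j \<Longrightarrow> m i j = enat n \<Longrightarrow> v \<in> lists I \<Longrightarrow>
      alt n i j @ v \<in> cl (insert (alt n j i @ v) {y \<in> lists I. length y < n + length v})"
    and W: "W \<subseteq> lists I" "\<And>u. u \<in> lists I \<Longrightarrow> \<exists>y\<in>W. u \<approx> y \<and> reduced y"
  shows "lists I \<subseteq> cl W"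
proof -
  define short where "short n = {y \<in> lists I. length y < n}" for n
  have short: "short n \<subseteq> lists I" for n by (auto simp: short_def)
  have cl_mono: "cl S \<subseteq> cl S'" if "S \<subseteq> S'" "S' \<subseteq> lists I" for S S'
    using cl_trans[of S S'] cl_base[of S'] that by blast
  have cl_tr: "u \<in> cl (insert y (short n))"
    if "u \<in> cl (insert v (short n))" "v \<in> cl (insert y (short n))" "v \<in> lists I" "y \<in> lists I" for u v y n
    using cl_trans[of "insert v (short n)" "insert y (short n)"] cl_base[of "insert y (short n)"]
      that short by blast
  \<comment> \<open>Two reduced words of one element agree modulo strictly shorter words. With equal
    initial letters the induction hypothesis applies to the tails; otherwise both letters are left
    descents, and the way leads through the two alternating words of length
    \<open>m i j\<close>.\<close>
  have same: "u \<in> cl (insert v (short n))"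
    if "reduced u" "u \<approx> v" "length u = n" "length v = n" for u v n
    using that
  proof (induction n arbitrary: u v)
    case 0
    then show ?case using cl_base[of "insert v (short 0)"] short by auto
  next
    case (Suc n)
    have head: "i # a \<in> cl (insert (i # b) (short (Suc n)))"
      if r: "reduced (i # a)" and "i # a \<approx> i # b" "length a = n" "length b = n" for i a b
    proof -
      have ab: "a \<in> lists I" "b \<in> lists I" "i \<in> I" using eqv_lists[OF that(2)] by auto
      have "a \<in> cl (insert b (short n))"
        using Suc.IH[of a b] that reduced_append[of "[i]" a] eqv_cancel_left[of "[i]" a b] by simp
      then have "i # a \<in> cl ((#) i ` insert b (short n))"
        using cl_Cons ab short[of n] by blast
      moreover have "(#) i ` insert b (short n) \<subseteq> insert (i # b) (short (Suc n))"
        using ab by (auto simp: short_def)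
      ultimately show ?thesis
        using cl_mono[of "(#) i ` insert b (short n)" "insert (i # b) (short (Suc n))"] ab short[of "Suc n"]
        by auto
    qed
    obtain i u' j v' where uv: "u = i # u'" "v = j # v'"
      using Suc.prems by (cases u; cases v) auto
    have lists: "u \<in> lists I" "v \<in> lists I" using eqv_lists[OF Suc.prems(2)] by auto
    have red: "reduced y" if "u \<approx> y" "length y = Suc n" for y
      using Suc.prems that eqv_lists[OF that(1)] unfolding reduced_def by (metis eqv_trans)
    show ?case
    proof (cases "i = j")
      case True
      then show ?thesis using head[of i u' v'] uv Suc.prems by simp
    next
      case False
      obtain k z z' where k: "m i j = enat k" and z: "u \<approx> alt k i j @ z" "u \<approx> alt k j i @ z'"
        "length u = k + length z" "length u = k + length z'"
      proof (rule two_descents[OF Suc.prems(1), of i u' j v'])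
        show "u \<approx> i # u'" using lists eqv_refl uv by blast
      qed (use False Suc.prems uv in auto)
      have ij: "i \<in> I" "j \<in> I" using lists uv by auto
      have k2: "2 \<le> k" using m_ge_2[OF ij False k] .
      then obtain l where l: "k = Suc l" by (cases k) auto
      have zl: "alt k i j @ z \<in> lists I" "alt k j i @ z' \<in> lists I"
        using eqv_lists[OF z(1)] eqv_lists[OF z(2)] by auto
      let ?z = "alt k j i @ z"
      have ez: "?z \<approx> alt k i j @ z"
      proof -
        have "alt k i j @ alt k i j = alt (2 * k) i j" if "even k"
          using that alt_add[of k k i j] by (simp add: mult_2)
        moreover have "alt k i j @ alt k j i = alt (2 * k) i j" if "odd k"
          using that alt_add[of k k i j] by (simp add: mult_2)
        ultimately have "alt k i j @ rev (alt k j i) = alt (2 * k) i j" by (auto simp: rev_alt)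
        then have "alt k i j @ rev (alt k j i) \<approx> []"
          using eqv_powerI[of "[]" "[]" i j k] ij False k by (simp add: concat_replicate_alt)
        moreover have "alt k j i @ rev (alt k j i) \<approx> []"
          using ij by (intro append_rev_eqv alt_in_lists)
        ultimately have "alt k j i \<approx> alt k i j"
          using eqv_cancel_right eqv_sym eqv_trans by blast
        then show ?thesis using zl by (intro eqv_append eqv_refl) auto
      qed
      have zl': "?z \<in> lists I" using eqv_lists[OF ez] by simp
      have uz: "u \<approx> ?z" using ez z(1) by (blast intro: eqv_sym eqv_trans)
      \<comment> \<open>Three links: \<open>u\<close> shares its initial letter \<open>i\<close>
        with \<open>alt k i j @ z\<close>, a braid move leads from there to
        \<open>alt k j i @ z\<close>, and this word shares its initial letter \<open>j\<close> with
        \<open>v\<close>.\<close>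
      have 1: "u \<in> cl (insert (alt k i j @ z) (short (Suc n)))"
        using head[of i u' "alt l j i @ z"] uv l z(1,3) Suc.prems by simp
      have 2: "alt k i j @ z \<in> cl (insert ?z (short (Suc n)))"
        using cl_braid[OF ij False k, of z] zl z(3) Suc.prems(3) by (simp add: short_def)
      have 3: "?z \<in> cl (insert v (short (Suc n)))"
        using head[of j "alt l i j @ z" v'] uv l z(3) Suc.prems red[OF uz] eqv_trans[OF eqv_sym[OF uz] Suc.prems(2)]
        by simp
      show ?thesis using cl_tr[OF cl_tr[OF 1 2 zl(1) zl'] 3 zl' lists(2)] .
    qed
  qed
  have "\<forall>u\<in>lists I. length u = n \<longrightarrow> u \<in> cl W" for n
  proof (induction n rule: less_induct)
    case (less n)
    have sub: "cl (short n) \<subseteq> cl W"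
      using less W short[of n] by (intro cl_trans) (auto simp: short_def)
    show ?case
    proof (intro ballI impI)
      fix u assume u: "u \<in> lists I" "length u = n"
      show "u \<in> cl W"
      proof (cases "reduced u")
        case True
        obtain y where y: "y \<in> W" "u \<approx> y" "reduced y" using W u by blast
        then have "length y = n" using True u reduced_length eqv_sym by (metis le_antisym)
        then have "u \<in> cl (insert y (short n))" using same True u y by blast
        moreover have "insert y (short n) \<subseteq> cl W"
          using y cl_base[OF W(1)] less short by (auto simp: short_def)
        ultimately show ?thesis
          using cl_trans[of "insert y (short n)" W] short[of n] W(1) y(1) by blast
      next
        case False
        \<comment> \<open>Read from the right, some letter \<open>i\<close> is the one that destroys
          reducedness.\<close>
        have "\<exists>u1 i u2. u = u1 @ i # u2 \<and> reduced u2 \<and> \<not> reduced (i # u2)"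
          using False
        proof (induction u)
          case Nil
          then show ?case by (simp add: reduced_def)
        next
          case (Cons i u)
          show ?case
          proof (cases "reduced u")
            case True
            then show ?thesis using Cons by (intro exI[of _ "[]"]) auto
          next
            case False
            then obtain u1 i' u2 where "u = u1 @ i' # u2" "reduced u2" "\<not> reduced (i' # u2)"
              using Cons by blast
            then show ?thesis by (intro exI[of _ "i # u1"]) auto
          qed
        qed
        then obtain u1 i u2 where ue: "u = u1 @ i # u2" and r: "reduced u2" "\<not> reduced (i # u2)" by blast
        have iu: "i \<in> I" "u1 \<in> lists I" "u2 \<in> lists I" using u ue by auto
        obtain y where y: "i # u2 \<approx> y" "length y < length (i # u2)"
          using r(2) iu unfolding reduced_def by (auto simp: not_le)
        have yI: "y \<in> lists I" using eqv_lists[OF y(1)] by simp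
        \<comment> \<open>By parity the shorter word \<open>y\<close> cannot have the length of
          \<open>u2\<close>, so \<open>i # y\<close> has exactly that length and is another reduced
          word of the same element. Replacing \<open>u2\<close> by it produces the square in
          \<open>i # i # y\<close>.\<close>
        have y2: "u2 \<approx> i # y" using eqv_Cons_flip y iu by blast
        then have "length u2 \<le> length (i # y)" using r reduced_length by blast
        moreover have "length y \<noteq> length u2" using eqv_parity[OF y(1)] by auto
        ultimately have ly: "length u2 = length (i # y)" using y(2) by auto
        have "u2 \<in> cl (insert (i # y) (short (length u2)))" using same r y2 ly by simp
        then have 1: "i # u2 \<in> cl ((#) i ` insert (i # y) (short (length u2)))"
          using cl_Cons[of i "insert (i # y) (short (length u2))" u2] iu(1,3) yI short[of "length u2"] by auto
        have "cl ((#) i ` insert (i # y) (short (length u2))) \<subseteq> cl (short (length (i # u2)))"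
        proof (rule cl_trans)
          have "y \<in> short (length (i # u2))" using yI ly by (simp add: short_def)
          then have "i # i # y \<in> cl (short (length (i # u2)))"
            using cl_square[of i y] iu yI cl_mono[of "{y}" "short (length (i # u2))"] short by blast
          moreover have "(#) i ` short (length u2) \<subseteq> short (length (i # u2))"
            using iu by (auto simp: short_def)
          ultimately show "(#) i ` insert (i # y) (short (length u2)) \<subseteq> cl (short (length (i # u2)))"
            using cl_base[OF short] by auto
        qed (use iu yI short in \<open>auto simp: short_def\<close>)
        with 1 have "i # u2 \<in> cl (short (length (i # u2)))" by blast
        then have "u1 @ i # u2 \<in> cl (short (length (u1 @ i # u2)))"
          using iu(2)
        proof (induction u1)
          case (Cons a u1)
          then have "a # u1 @ i # u2 \<in> cl ((#) a ` short (length (u1 @ i # u2)))"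
            using cl_Cons short by auto
          moreover have "cl ((#) a ` short (length (u1 @ i # u2))) \<subseteq> cl (short (length (a # u1 @ i # u2)))"
            using Cons.prems by (intro cl_mono short) (auto simp: short_def)
          ultimately show ?case by (simp add: subset_iff)
        qed simp
        then show ?thesis using sub u ue by auto
      qed
    qed
  qed
  then show ?thesis by blast
qed

end

section \<open>Rings with equal operations, and ordered products\<close>

text \<open>Quotients, truncations and extensions yield records of different types with the same
  operations; the ring axioms pass from one to the other along the equality of the fields.\<close>

lemma ring_cong_fields:
  fixes R :: "('a, 'b) ring_scheme" and S :: "('a, 'c) ring_scheme"
  assumes R: "ring R" and eq: "carrier S = carrier R" "monoid.mult S = monoid.mult R" "one S = one R"
    "zero S = zero R" "add S = add R"
  shows "ring S"
proof -
  interpret R: ring R by fact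
  show ?thesis
  proof (rule ringI)
    show "abelian_group S"
    proof (rule abelian_groupI)
      show "\<exists>y\<in>carrier S. y \<oplus>\<^bsub>S\<^esub> x = \<zero>\<^bsub>S\<^esub>" if "x \<in> carrier S" for x
        using that R.l_neg[of x] by (auto simp: eq intro!: bexI[of _ "\<ominus>\<^bsub>R\<^esub> x"])
    qed (simp_all add: eq R.a_ac)
    show "monoid S" by (rule monoidI) (simp_all add: eq R.m_assoc)
  qed (simp_all add: eq R.l_distr R.r_distr)
qed

lemma lprod_Nil [simp]: "lprod R [] = \<one>\<^bsub>R\<^esub>"
  by (simp add: lprod_def)

lemma lprod_Cons [simp]: "lprod R (x # xs) = x \<otimes>\<^bsub>R\<^esub> lprod R xs"
  by (simp add: lprod_def)

context ring begin

lemma lprod_closed: "set xs \<subseteq> carrier R \<Longrightarrow> lprod R xs \<in> carrier R"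
  by (induction xs) auto

lemma lprod_append:
  "set xs \<subseteq> carrier R \<Longrightarrow> set ys \<subseteq> carrier R \<Longrightarrow> lprod R (xs @ ys) = lprod R xs \<otimes> lprod R ys"
  by (induction xs) (auto simp: lprod_closed m_assoc)

lemma lprod_commute:
  assumes "x \<in> carrier R" "set ys \<subseteq> carrier R" "\<And>y. y \<in> set ys \<Longrightarrow> x \<otimes> y = y \<otimes> x"
  shows "x \<otimes> lprod R ys = lprod R ys \<otimes> x"
  using assms(2,3)
proof (induction ys)
  case (Cons y ys)
  have y: "y \<in> carrier R" "lprod R ys \<in> carrier R" "x \<otimes> y = y \<otimes> x"
    using Cons.prems lprod_closed by auto
  have "x \<otimes> (y \<otimes> lprod R ys) = y \<otimes> (x \<otimes> lprod R ys)"
    using assms(1) y m_assoc[of x y] m_assoc[of y x] by simp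
  also have "x \<otimes> lprod R ys = lprod R ys \<otimes> x" using Cons by simp
  finally show ?case using assms(1) y by (simp add: m_assoc)
qed (use assms in auto)

lemma minus_eq_zero_iff: "x \<in> carrier R \<Longrightarrow> y \<in> carrier R \<Longrightarrow> x \<ominus> y = \<zero> \<longleftrightarrow> x = y"
  by (simp add: a_minus_def) (metis a_inv_closed minus_equality minus_minus r_neg)

end

lemma ring_hom_lprod:
  assumes "h \<in> ring_hom R R'" "ring R" "set xs \<subseteq> carrier R"
  shows "h (lprod R xs) = lprod R' (map h xs)"
  using assms(3)
proof (induction xs)
  case (Cons x xs)
  then show ?case
    using ring_hom_mult[OF assms(1)] ring.lprod_closed[OF assms(2)] by simp
qed (use ring_hom_one[OF assms(1)] in simp)

lemma ring_hom_sub: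
  assumes "h \<in> ring_hom R R'" "ring R" "ring R'" "x \<in> carrier R" "y \<in> carrier R"
  shows "h (x \<ominus>\<^bsub>R\<^esub> y) = h x \<ominus>\<^bsub>R'\<^esub> h y"
proof -
  interpret ring_hom_ring R R' h by (intro ring_hom_ringI2 assms)
  show ?thesis using assms by (simp add: a_minus_def)
qed

lemma ring_hom_finsum:
  assumes "h \<in> ring_hom R R'" "ring R" "ring R'" "f \<in> A \<rightarrow> carrier R"
  shows "h (finsum R f A) = finsum R' (h \<circ> f) A"
proof -
  interpret ring_hom_ring R R' h by (intro ring_hom_ringI2 assms)
  have "h (finsum R f A) = finsum R' (h \<circ> f) A" if "finite A"
    using that assms(4)
  proof (induction A rule: finite_induct)
    case (insert x A)
    then have "(\<lambda>x. h (f x)) \<in> A \<rightarrow> carrier R'" by (auto simp: Pi_iff)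
    then show ?case using insert by (simp add: Pi_iff comp_def)
  qed simp
  then show ?thesis by (cases "finite A") auto
qed


section \<open>The free algebra\<close>

locale free_algebra = K: cring K for K :: "'k ring" and G :: "'g set"
begin

abbreviation F where "F \<equiv> free_alg K G"

definition mono :: "'k \<Rightarrow> 'g list \<Rightarrow> 'g list \<Rightarrow> 'k" where
  "mono c w = (\<lambda>v. if v = w then c else \<zero>\<^bsub>K\<^esub>)"

abbreviation supp :: "('g list \<Rightarrow> 'k) \<Rightarrow> 'g list set" where
  "supp f \<equiv> {w. f w \<noteq> \<zero>\<^bsub>K\<^esub>}"

lemma carrier_iff:
  "f \<in> carrier F \<longleftrightarrow> (\<forall>w. f w \<in> carrier K) \<and> finite (supp f) \<and> supp f \<subseteq> lists G"
  by (auto simp: free_alg_def)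

lemma carrierI:
  "(\<And>w. f w \<in> carrier K) \<Longrightarrow> supp f \<subseteq> A \<Longrightarrow> finite A \<Longrightarrow> A \<subseteq> lists G \<Longrightarrow> f \<in> carrier F"
  unfolding carrier_iff by (meson finite_subset order_trans)

lemma supp_finite: "f \<in> carrier F \<Longrightarrow> finite (supp f)"
  by (simp add: carrier_iff)

lemma supp_lists: "f \<in> carrier F \<Longrightarrow> supp f \<subseteq> lists G"
  by (simp add: carrier_iff)

lemma supp_word: "f \<in> carrier F \<Longrightarrow> f w \<noteq> \<zero>\<^bsub>K\<^esub> \<Longrightarrow> w \<in> lists G"
  using supp_lists by blast

lemma coeff_closed [simp]: "f \<in> carrier F \<Longrightarrow> f w \<in> carrier K"
  by (simp add: carrier_iff)

lemma F_simps:
  "\<one>\<^bsub>F\<^esub> = mono \<one>\<^bsub>K\<^esub> []" "\<zero>\<^bsub>F\<^esub> = (\<lambda>w. \<zero>\<^bsub>K\<^esub>)" "f \<oplus>\<^bsub>F\<^esub> g = (\<lambda>w. f w \<oplus>\<^bsub>K\<^esub> g w)"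
  "c \<odot>\<^bsub>F\<^esub> f = (\<lambda>w. c \<otimes>\<^bsub>K\<^esub> f w)"
  "f \<otimes>\<^bsub>F\<^esub> g = (\<lambda>w. \<Oplus>\<^bsub>K\<^esub>n\<in>{..length w}. f (take n w) \<otimes>\<^bsub>K\<^esub> g (drop n w))"
  by (simp_all only: free_alg_def mono_def monoid.simps ring.simps module.simps)

lemma gen_mono: "gen K g = mono \<one>\<^bsub>K\<^esub> [g]"
  by (simp add: gen_def mono_def)

lemma mono_closed [simp]: "c \<in> carrier K \<Longrightarrow> w \<in> lists G \<Longrightarrow> mono c w \<in> carrier F"
  by (rule carrierI[of _ "{w}"]) (auto simp: mono_def)

lemma gen_closed [simp]: "g \<in> G \<Longrightarrow> gen K g \<in> carrier F"
  by (simp add: gen_mono)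

lemma zero_closed': "\<zero>\<^bsub>F\<^esub> \<in> carrier F"
  by (simp add: carrier_iff F_simps)

lemma add_closed': "f \<in> carrier F \<Longrightarrow> g \<in> carrier F \<Longrightarrow> f \<oplus>\<^bsub>F\<^esub> g \<in> carrier F"
proof -
  assume f: "f \<in> carrier F" and g: "g \<in> carrier F"
  have "supp (f \<oplus>\<^bsub>F\<^esub> g) \<subseteq> supp f \<union> supp g" by (auto simp: F_simps)
  then show ?thesis
    using f g supp_finite supp_lists by (intro carrierI[of _ "supp f \<union> supp g"]) (simp_all add: F_simps)
qed

lemma abelian_group_F: "abelian_group F"
proof (rule abelian_groupI)
  fix f assume f: "f \<in> carrier F"
  have "(\<lambda>w. \<ominus>\<^bsub>K\<^esub> f w) \<in> carrier F"
  proof -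
    have "supp (\<lambda>w. \<ominus>\<^bsub>K\<^esub> f w) \<subseteq> supp f" by auto
    then show ?thesis
      using f supp_finite supp_lists by (intro carrierI[of _ "supp f"]) simp_all
  qed
  then show "\<exists>g\<in>carrier F. g \<oplus>\<^bsub>F\<^esub> f = \<zero>\<^bsub>F\<^esub>"
    using f by (intro bexI[of _ "\<lambda>w. \<ominus>\<^bsub>K\<^esub> f w"]) (auto simp: F_simps K.l_neg)
qed (auto simp: F_simps(2,3) fun_eq_iff K.a_ac intro: add_closed'[simplified F_simps] zero_closed'[simplified F_simps])

interpretation F: abelian_group F by (rule abelian_group_F)

lemma mult_closed':
  assumes f: "f \<in> carrier F" and g: "g \<in> carrier F"
  shows "f \<otimes>\<^bsub>F\<^esub> g \<in> carrier F"
proof -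
  have sub: "supp (f \<otimes>\<^bsub>F\<^esub> g) \<subseteq> (\<lambda>(u, v). u @ v) ` (supp f \<times> supp g)"
  proof
    fix w assume "w \<in> supp (f \<otimes>\<^bsub>F\<^esub> g)"
    then have "(\<Oplus>\<^bsub>K\<^esub>n\<in>{..length w}. f (take n w) \<otimes>\<^bsub>K\<^esub> g (drop n w)) \<noteq> \<zero>\<^bsub>K\<^esub>" by (simp add: F_simps)
    then obtain n where "f (take n w) \<otimes>\<^bsub>K\<^esub> g (drop n w) \<noteq> \<zero>\<^bsub>K\<^esub>"
      by (meson K.add.finprod_one_eqI)
    then have "f (take n w) \<noteq> \<zero>\<^bsub>K\<^esub>" "g (drop n w) \<noteq> \<zero>\<^bsub>K\<^esub>" using f g by auto
    then show "w \<in> (\<lambda>(u, v). u @ v) ` (supp f \<times> supp g)"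
      by (intro image_eqI[of _ _ "(take n w, drop n w)"]) auto
  qed
  show ?thesis
  proof (rule carrierI[OF _ sub])
    show "(\<lambda>(u, v). u @ v) ` (supp f \<times> supp g) \<subseteq> lists G"
      using supp_lists[OF f] supp_lists[OF g] by fastforce
  qed (use f g supp_finite in \<open>auto simp: F_simps Pi_def intro!: K.finsum_closed\<close>)
qed

lemma l_distr':
  "f \<in> carrier F \<Longrightarrow> g \<in> carrier F \<Longrightarrow> h \<in> carrier F \<Longrightarrow>
    (f \<oplus>\<^bsub>F\<^esub> g) \<otimes>\<^bsub>F\<^esub> h = f \<otimes>\<^bsub>F\<^esub> h \<oplus>\<^bsub>F\<^esub> g \<otimes>\<^bsub>F\<^esub> h"
  unfolding F_simps
  by (intro ext, subst K.finsum_addf[symmetric])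
    (auto simp: Pi_def K.l_distr intro!: K.finsum_cong')

lemma r_distr':
  "f \<in> carrier F \<Longrightarrow> g \<in> carrier F \<Longrightarrow> h \<in> carrier F \<Longrightarrow>
    h \<otimes>\<^bsub>F\<^esub> (f \<oplus>\<^bsub>F\<^esub> g) = h \<otimes>\<^bsub>F\<^esub> f \<oplus>\<^bsub>F\<^esub> h \<otimes>\<^bsub>F\<^esub> g"
  unfolding F_simps
  by (intro ext, subst K.finsum_addf[symmetric])
    (auto simp: Pi_def K.r_distr intro!: K.finsum_cong')

lemma zero_mult': "f \<in> carrier F \<Longrightarrow> \<zero>\<^bsub>F\<^esub> \<otimes>\<^bsub>F\<^esub> f = \<zero>\<^bsub>F\<^esub>"
  unfolding F_simps by (intro ext K.add.finprod_one_eqI) simp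

lemma mult_zero': "f \<in> carrier F \<Longrightarrow> f \<otimes>\<^bsub>F\<^esub> \<zero>\<^bsub>F\<^esub> = \<zero>\<^bsub>F\<^esub>"
  unfolding F_simps by (intro ext K.add.finprod_one_eqI) simp

text \<open>Of all the ways to cut \<open>u @ v\<close> in two, only the cut after
  \<open>length u\<close> letters contributes to the convolution.\<close>

lemma mono_mult:
  assumes "c \<in> carrier K" "d \<in> carrier K"
  shows "mono c u \<otimes>\<^bsub>F\<^esub> mono d v = mono (c \<otimes>\<^bsub>K\<^esub> d) (u @ v)"
proof
  fix w
  show "(mono c u \<otimes>\<^bsub>F\<^esub> mono d v) w = mono (c \<otimes>\<^bsub>K\<^esub> d) (u @ v) w"
  proof (cases "w = u @ v")
    case True
    have *: "mono c u (take n w) \<otimes>\<^bsub>K\<^esub> mono d v (drop n w) = (if length u = n then c \<otimes>\<^bsub>K\<^esub> d else \<zero>\<^bsub>K\<^esub>)"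
      if "n \<le> length w" for n
    proof (cases "length u = n")
      case False
      then have "take n w \<noteq> u" using that by (metis length_take min.absorb2)
      then show ?thesis using assms False by (auto simp: mono_def)
    qed (auto simp: mono_def True)
    have "(mono c u \<otimes>\<^bsub>F\<^esub> mono d v) w =
        (\<Oplus>\<^bsub>K\<^esub>n\<in>{..length w}. if length u = n then c \<otimes>\<^bsub>K\<^esub> d else \<zero>\<^bsub>K\<^esub>)"
      unfolding F_simps using assms
      by (intro K.finsum_cong') (auto simp: *)
    also have "\<dots> = c \<otimes>\<^bsub>K\<^esub> d"
      using assms True by (intro K.finsum_singleton) auto
    finally show ?thesis by (simp add: True mono_def)
  next
    case False
    then have "mono c u (take n w) \<otimes>\<^bsub>K\<^esub> mono d v (drop n w) = \<zero>\<^bsub>K\<^esub>" for n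
      using assms by (auto simp: mono_def)
    then show ?thesis using False by (simp add: F_simps) (simp add: mono_def)
  qed
qed

text \<open>Every element is a finite sum of monomials, by induction on a finite set that contains
  the support. Associativity, the unit laws and the multiplicativity of evaluations thereby become
  identities of lists, and no iterated convolution sums have to be rearranged.\<close>

lemma free_alg_induct [consumes 1, case_names zero mono add]:
  assumes f: "f \<in> carrier F" and zero: "P \<zero>\<^bsub>F\<^esub>"
    and mono: "\<And>c w. c \<in> carrier K \<Longrightarrow> w \<in> lists G \<Longrightarrow> P (mono c w)"
    and add: "\<And>f g. f \<in> carrier F \<Longrightarrow> g \<in> carrier F \<Longrightarrow> P f \<Longrightarrow> P g \<Longrightarrow> P (f \<oplus>\<^bsub>F\<^esub> g)"
  shows "P f"
proof -
  have "finite A \<Longrightarrow> f \<in> carrier F \<Longrightarrow> supp f \<subseteq> A \<Longrightarrow> P f" for A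
  proof (induction A arbitrary: f rule: finite_induct)
    case empty
    then have "f = \<zero>\<^bsub>F\<^esub>" by (auto simp: F_simps)
    then show ?case using zero by simp
  next
    case (insert w A)
    let ?g = "f(w := \<zero>\<^bsub>K\<^esub>)"
    have g: "?g \<in> carrier F"
      using insert.prems(1) supp_finite supp_lists by (intro carrierI[of _ "supp f"]) auto
    show ?case
    proof (cases "f w = \<zero>\<^bsub>K\<^esub>")
      case True
      then show ?thesis using insert by auto
    next
      case False
      then have w: "w \<in> lists G" using insert.prems unfolding carrier_iff by blast
      have "f = mono (f w) w \<oplus>\<^bsub>F\<^esub> ?g" using insert.prems by (auto simp: F_simps mono_def)
      moreover have "P ?g" using insert.prems by (intro insert.IH g) auto
      ultimately show ?thesis using add[of "mono (f w) w" ?g] mono[of "f w" w] g w insert.prems by simp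
    qed
  qed
  then show ?thesis using f unfolding carrier_iff by blast
qed

lemma mult_assoc':
  assumes "f \<in> carrier F" "g \<in> carrier F" "h \<in> carrier F"
  shows "(f \<otimes>\<^bsub>F\<^esub> g) \<otimes>\<^bsub>F\<^esub> h = f \<otimes>\<^bsub>F\<^esub> (g \<otimes>\<^bsub>F\<^esub> h)"
  using assms(1)
proof (induction f rule: free_alg_induct)
  case (mono c u)
  show ?case using assms(2)
  proof (induction g rule: free_alg_induct)
    case (mono d v)
    show ?case using assms(3)
    proof (induction h rule: free_alg_induct)
      case (mono e w)
      show ?case using \<open>c \<in> carrier K\<close> \<open>d \<in> carrier K\<close> mono by (simp add: mono_mult K.m_assoc)
    qed (use \<open>c \<in> carrier K\<close> \<open>d \<in> carrier K\<close> \<open>u \<in> lists G\<close> \<open>v \<in> lists G\<close> in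
        \<open>simp_all add: mult_zero' r_distr' mult_closed'\<close>)
  qed (use \<open>c \<in> carrier K\<close> \<open>u \<in> lists G\<close> assms(3) in
      \<open>simp_all add: mult_zero' zero_mult' l_distr' r_distr' mult_closed'\<close>)
qed (use assms(2,3) in \<open>simp_all add: zero_mult' l_distr' mult_closed'\<close>)

lemma one_mult':
  "f \<in> carrier F \<Longrightarrow> \<one>\<^bsub>F\<^esub> \<otimes>\<^bsub>F\<^esub> f = f"
  by (induction f rule: free_alg_induct)
    (simp_all add: mult_zero' r_distr' F_simps(1) mono_mult)

lemma mult_one':
  "f \<in> carrier F \<Longrightarrow> f \<otimes>\<^bsub>F\<^esub> \<one>\<^bsub>F\<^esub> = f"
  by (induction f rule: free_alg_induct)
    (simp_all add: zero_mult' l_distr' F_simps(1) mono_mult)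

lemma ring_F: "ring F"
proof (rule ringI)
  show "monoid F"
    by (rule monoidI) (simp_all add: mult_closed' mult_assoc' one_mult' mult_one', simp add: F_simps)
qed (simp_all add: abelian_group_F l_distr' r_distr')

lemma smult_eq_mult:
  assumes c: "c \<in> carrier K" and f: "f \<in> carrier F"
  shows "c \<odot>\<^bsub>F\<^esub> f = mono c [] \<otimes>\<^bsub>F\<^esub> f"
  using f
proof (induction f rule: free_alg_induct)
  case zero
  have "c \<odot>\<^bsub>F\<^esub> \<zero>\<^bsub>F\<^esub> = \<zero>\<^bsub>F\<^esub>" using c by (simp add: F_simps)
  then show ?case using c by (simp add: mult_zero')
next
  case (mono d w)
  have "c \<odot>\<^bsub>F\<^esub> mono d w = mono (c \<otimes>\<^bsub>K\<^esub> d) w" using c by (auto simp: F_simps mono_def)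
  then show ?case using c mono by (simp add: mono_mult)
next
  case (add f g)
  have "c \<odot>\<^bsub>F\<^esub> (f \<oplus>\<^bsub>F\<^esub> g) = c \<odot>\<^bsub>F\<^esub> f \<oplus>\<^bsub>F\<^esub> c \<odot>\<^bsub>F\<^esub> g"
    using c add(1,2) by (simp add: F_simps(3,4) K.r_distr)
  then show ?case using c add by (simp add: r_distr')
qed

lemma mono_central:
  assumes c: "c \<in> carrier K" and f: "f \<in> carrier F"
  shows "mono c [] \<otimes>\<^bsub>F\<^esub> f = f \<otimes>\<^bsub>F\<^esub> mono c []"
  using f
proof (induction f rule: free_alg_induct)
  case (mono d w)
  then show ?case using c by (simp add: mono_mult K.m_comm)
qed (use c in \<open>simp_all add: mult_zero' zero_mult' r_distr' l_distr'\<close>)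

lemma mono_Nil_hom: "(\<lambda>c. mono c []) \<in> ring_hom K F"
  by (rule ring_hom_memI) (simp_all add: mono_mult, auto simp: F_simps mono_def)

lemma mono_eq_lprod: "w \<in> lists G \<Longrightarrow> mono \<one>\<^bsub>K\<^esub> w = lprod F (map (gen K) w)"
proof (induction w)
  case (Cons g w)
  have "mono \<one>\<^bsub>K\<^esub> (g # w) = gen K g \<otimes>\<^bsub>F\<^esub> mono \<one>\<^bsub>K\<^esub> w" by (simp add: gen_mono mono_mult)
  then show ?case using Cons by simp
qed (simp add: F_simps)

lemma mono_eq_smult_lprod:
  assumes "c \<in> carrier K" "w \<in> lists G"
  shows "mono c w = mono c [] \<otimes>\<^bsub>F\<^esub> lprod F (map (gen K) w)"
  using assms by (simp add: mono_mult flip: mono_eq_lprod)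

end


section \<open>Evaluation\<close>

text \<open>The universal property of the free algebra. Scalars are asked to commute only with the
  images of the generators, not with all of \<open>B\<close>: among the additive operators that
  serve as a target below, scalars are not central.\<close>

locale free_eval = free_algebra K G + B: ring B
  for K :: "'k ring" and G :: "'g set" and B :: "('b, 'x) ring_scheme" +
  fixes \<eta> :: "'k \<Rightarrow> 'b" and \<gamma> :: "'g \<Rightarrow> 'b"
  assumes \<eta>: "\<eta> \<in> ring_hom K B"
    and \<gamma>: "\<And>g. g \<in> G \<Longrightarrow> \<gamma> g \<in> carrier B"
    and \<eta>_\<gamma>: "\<And>c g. c \<in> carrier K \<Longrightarrow> g \<in> G \<Longrightarrow> \<eta> c \<otimes>\<^bsub>B\<^esub> \<gamma> g = \<gamma> g \<otimes>\<^bsub>B\<^esub> \<eta> c"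
begin

definition ev :: "('g list \<Rightarrow> 'k) \<Rightarrow> 'b" where
  "ev f = (\<Oplus>\<^bsub>B\<^esub>w\<in>supp f. \<eta> (f w) \<otimes>\<^bsub>B\<^esub> lprod B (map \<gamma> w))"

lemma eta_closed [simp]: "c \<in> carrier K \<Longrightarrow> \<eta> c \<in> carrier B"
  by (rule ring_hom_closed[OF \<eta>])

lemma eta_zero [simp]: "\<eta> \<zero>\<^bsub>K\<^esub> = \<zero>\<^bsub>B\<^esub>"
  using ring_hom_zero[OF \<eta> K.ring_axioms B.ring_axioms] .

lemma word_closed [simp]: "w \<in> lists G \<Longrightarrow> lprod B (map \<gamma> w) \<in> carrier B"
  using \<gamma> by (intro B.lprod_closed) auto

lemma ev_superset:
  assumes "f \<in> carrier F" "finite A" "supp f \<subseteq> A" "A \<subseteq> lists G"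
  shows "ev f = (\<Oplus>\<^bsub>B\<^esub>w\<in>A. \<eta> (f w) \<otimes>\<^bsub>B\<^esub> lprod B (map \<gamma> w))"
  unfolding ev_def using assms
  by (intro B.add.finprod_mono_neutral_cong_left) (auto simp: subset_iff)

lemma ev_closed [simp]: "f \<in> carrier F \<Longrightarrow> ev f \<in> carrier B"
  unfolding ev_def by (intro B.finsum_closed Pi_I B.m_closed eta_closed word_closed) (auto dest: supp_word)

lemma ev_add:
  assumes f: "f \<in> carrier F" and g: "g \<in> carrier F"
  shows "ev (f \<oplus>\<^bsub>F\<^esub> g) = ev f \<oplus>\<^bsub>B\<^esub> ev g"
proof -
  interpret F: ring F by (rule ring_F)
  let ?A = "supp f \<union> supp g"
  have A: "finite ?A" "?A \<subseteq> lists G" using f g by (auto simp: carrier_iff)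
  have sub: "supp (f \<oplus>\<^bsub>F\<^esub> g) \<subseteq> ?A" by (auto simp: F_simps)
  have "ev (f \<oplus>\<^bsub>F\<^esub> g) = (\<Oplus>\<^bsub>B\<^esub>w\<in>?A. \<eta> ((f \<oplus>\<^bsub>F\<^esub> g) w) \<otimes>\<^bsub>B\<^esub> lprod B (map \<gamma> w))"
    using f g A sub by (intro ev_superset) auto
  also have "\<dots> = (\<Oplus>\<^bsub>B\<^esub>w\<in>?A. \<eta> (f w) \<otimes>\<^bsub>B\<^esub> lprod B (map \<gamma> w) \<oplus>\<^bsub>B\<^esub> \<eta> (g w) \<otimes>\<^bsub>B\<^esub> lprod B (map \<gamma> w))"
    using f g A word_closed
    by (intro B.finsum_cong' Pi_I) (simp_all add: F_simps(3) ring_hom_add[OF \<eta>] B.l_distr subset_iff)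
  also have "\<dots> = ev f \<oplus>\<^bsub>B\<^esub> ev g"
    using f g A ev_superset[OF f A(1) _ A(2)] ev_superset[OF g A(1) _ A(2)]
    by (subst B.finsum_addf) (auto simp: subset_iff)
  finally show ?thesis .
qed

lemma ev_zero [simp]: "ev \<zero>\<^bsub>F\<^esub> = \<zero>\<^bsub>B\<^esub>"
  by (simp add: ev_def F_simps)

lemma ev_mono: "c \<in> carrier K \<Longrightarrow> w \<in> lists G \<Longrightarrow> ev (mono c w) = \<eta> c \<otimes>\<^bsub>B\<^esub> lprod B (map \<gamma> w)"
proof -
  assume c: "c \<in> carrier K" and w: "w \<in> lists G"
  have "ev (mono c w) = (\<Oplus>\<^bsub>B\<^esub>v\<in>{w}. \<eta> (mono c w v) \<otimes>\<^bsub>B\<^esub> lprod B (map \<gamma> v))"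
    using w by (intro ev_superset mono_closed c) (auto simp: mono_def)
  also have "\<dots> = \<eta> (mono c w w) \<otimes>\<^bsub>B\<^esub> lprod B (map \<gamma> w)"
    using c w word_closed[OF w] by (subst B.finsum_insert) (simp_all add: mono_def)
  finally show ?thesis by (simp add: mono_def)
qed

lemma ev_mult:
  assumes f: "f \<in> carrier F" and g: "g \<in> carrier F"
  shows "ev (f \<otimes>\<^bsub>F\<^esub> g) = ev f \<otimes>\<^bsub>B\<^esub> ev g"
  using f
proof (induction f rule: free_alg_induct)
  case (mono c u)
  note c = mono
  show ?case using g
  proof (induction g rule: free_alg_induct)
    case (mono d v)
    let ?u = "lprod B (map \<gamma> u)" and ?v = "lprod B (map \<gamma> v)"
    have uv: "?u \<in> carrier B" "?v \<in> carrier B" using c mono by simp_all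
    \<comment> \<open>The commutation of scalars with the images of generators enters here: the
      coefficient \<open>d\<close> has to move past the word \<open>u\<close>.\<close>
    have "\<eta> d \<otimes>\<^bsub>B\<^esub> ?u = ?u \<otimes>\<^bsub>B\<^esub> \<eta> d"
      using c mono \<gamma> \<eta>_\<gamma> by (intro B.lprod_commute) auto
    then have "(\<eta> c \<otimes>\<^bsub>B\<^esub> ?u) \<otimes>\<^bsub>B\<^esub> (\<eta> d \<otimes>\<^bsub>B\<^esub> ?v) = (\<eta> c \<otimes>\<^bsub>B\<^esub> \<eta> d) \<otimes>\<^bsub>B\<^esub> (?u \<otimes>\<^bsub>B\<^esub> ?v)"
      using c mono uv by (metis B.m_assoc B.m_closed eta_closed)
    moreover have "lprod B (map \<gamma> (u @ v)) = ?u \<otimes>\<^bsub>B\<^esub> ?v"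
      using c mono \<gamma> B.lprod_append[of "map \<gamma> u" "map \<gamma> v"] by auto
    ultimately show ?case
      using c mono by (simp add: mono_mult ev_mono ring_hom_mult[OF \<eta>])
  qed (use c in \<open>simp_all add: mult_zero' r_distr' ev_add mult_closed' B.r_distr\<close>)
qed (use g in \<open>simp_all add: zero_mult' l_distr' ev_add mult_closed' B.l_distr\<close>)

lemma ev_hom: "ev \<in> ring_hom F B"
proof (rule ring_hom_memI)
  show "ev \<one>\<^bsub>F\<^esub> = \<one>\<^bsub>B\<^esub>" using ev_mono[of "\<one>\<^bsub>K\<^esub>" "[]"] ring_hom_one[OF \<eta>] by (simp add: F_simps)
qed (simp_all add: ev_add ev_mult)

lemma ev_gen [simp]: "g \<in> G \<Longrightarrow> ev (gen K g) = \<gamma> g"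
  using ev_mono[of "\<one>\<^bsub>K\<^esub>" "[g]"] ring_hom_one[OF \<eta>] \<gamma> by (simp add: gen_mono)

lemma ev_scalar [simp]: "c \<in> carrier K \<Longrightarrow> ev (mono c []) = \<eta> c"
  using ev_mono[of c "[]"] by simp

end


section \<open>Presented algebras\<close>

text \<open>The map is defined through an arbitrary representative of a coset; the condition on
  \<open>J\<close> makes the choice immaterial.\<close>

lemma ideal_quotient_lift:
  assumes J: "ideal J R" and h: "h \<in> ring_hom R B" and B: "ring B"
    and ker: "\<And>x. x \<in> J \<Longrightarrow> h x = \<zero>\<^bsub>B\<^esub>"
  obtains g where "g \<in> ring_hom (R Quot J) B" "\<And>x. x \<in> carrier R \<Longrightarrow> g (J +>\<^bsub>R\<^esub> x) = h x"
proof -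
  interpret J: ideal J R by fact
  interpret h: ring_hom_ring R B h by (intro ring_hom_ringI2 J.ring_axioms B h)
  define g where "g Z = h (SOME x. x \<in> Z)" for Z
  have g: "g (J +>\<^bsub>R\<^esub> x) = h x" if x: "x \<in> carrier R" for x
  proof -
    have "(SOME y. y \<in> J +>\<^bsub>R\<^esub> x) \<in> J +>\<^bsub>R\<^esub> x" using J.a_rcos_self[OF x] by (rule someI)
    then obtain j where "j \<in> J" "(SOME y. y \<in> J +>\<^bsub>R\<^esub> x) = j \<oplus>\<^bsub>R\<^esub> x"
      by (auto simp: a_r_coset_def')
    then show ?thesis using x ker[of j] J.a_Hcarr[of j] by (simp add: g_def)
  qed
  have "g \<in> ring_hom (R Quot J) B"
  proof (rule ring_hom_memI)
    fix Z Y assume "Z \<in> carrier (R Quot J)" "Y \<in> carrier (R Quot J)"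
    then obtain x y where "x \<in> carrier R" "Z = J +>\<^bsub>R\<^esub> x" "y \<in> carrier R" "Y = J +>\<^bsub>R\<^esub> y"
      by (auto simp: FactRing_simps)
    then show "g Z \<in> carrier B" "g (Z \<otimes>\<^bsub>R Quot J\<^esub> Y) = g Z \<otimes>\<^bsub>B\<^esub> g Y"
      "g (Z \<oplus>\<^bsub>R Quot J\<^esub> Y) = g Z \<oplus>\<^bsub>B\<^esub> g Y"
      by (simp_all add: g FactRing_def J.rcoset_mult_add J.a_rcos_sum)
  qed (simp add: FactRing_def g)
  then show ?thesis using that g by blast
qed

locale presented_algebra = free_algebra K G for K :: "'k ring" and G :: "'g set" +
  fixes Rel :: "('g list \<Rightarrow> 'k) set"
  assumes Rel: "Rel \<subseteq> carrier (free_alg K G)"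
begin

abbreviation J where "J \<equiv> genideal F Rel"
abbreviation P where "P \<equiv> pres_alg K G Rel"
abbreviation cls where "cls \<equiv> pres_class K G Rel"

sublocale F: ring F by (rule ring_F)
sublocale J: ideal J F by (rule F.genideal_ideal[OF Rel])

lemma P_fields:
  "carrier P = carrier (F Quot J)" "monoid.mult P = monoid.mult (F Quot J)" "one P = one (F Quot J)"
  "zero P = zero (F Quot J)" "add P = add (F Quot J)"
  by (simp_all add: pres_alg_def quot_alg_def ring.defs module.defs)

lemma ring_P: "ring P"
  by (rule ring_cong_fields[OF J.quotient_is_ring P_fields])

sublocale P: ring P by (rule ring_P)

lemma cls_hom: "cls \<in> ring_hom F P"
  using J.rcos_ring_hom unfolding ring_hom_def P_fields pres_class_def by simp

lemma cls_closed [simp]: "x \<in> carrier F \<Longrightarrow> cls x \<in> carrier P"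
  by (rule ring_hom_closed[OF cls_hom])

lemma cls_add: "x \<in> carrier F \<Longrightarrow> y \<in> carrier F \<Longrightarrow> cls (x \<oplus>\<^bsub>F\<^esub> y) = cls x \<oplus>\<^bsub>P\<^esub> cls y"
  by (rule ring_hom_add[OF cls_hom])

lemma cls_mult: "x \<in> carrier F \<Longrightarrow> y \<in> carrier F \<Longrightarrow> cls (x \<otimes>\<^bsub>F\<^esub> y) = cls x \<otimes>\<^bsub>P\<^esub> cls y"
  by (rule ring_hom_mult[OF cls_hom])

lemma cls_one: "cls \<one>\<^bsub>F\<^esub> = \<one>\<^bsub>P\<^esub>"
  by (rule ring_hom_one[OF cls_hom])

lemma cls_zero: "cls \<zero>\<^bsub>F\<^esub> = \<zero>\<^bsub>P\<^esub>"
  by (rule ring_hom_zero[OF cls_hom ring_F ring_P])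

lemma cls_minus: "x \<in> carrier F \<Longrightarrow> y \<in> carrier F \<Longrightarrow> cls (x \<ominus>\<^bsub>F\<^esub> y) = cls x \<ominus>\<^bsub>P\<^esub> cls y"
  by (rule ring_hom_sub[OF cls_hom ring_F ring_P])

lemma cls_lprod: "set xs \<subseteq> carrier F \<Longrightarrow> cls (lprod F xs) = lprod P (map cls xs)"
  by (rule ring_hom_lprod[OF cls_hom ring_F])

lemma cls_surj: "Z \<in> carrier P \<Longrightarrow> \<exists>x\<in>carrier F. Z = cls x"
  by (auto simp: P_fields FactRing_simps pres_class_def)

lemma zero_P: "\<zero>\<^bsub>P\<^esub> = J"
  by (simp add: P_fields FactRing_def)

lemma cls_eq_zero_iff: "x \<in> carrier F \<Longrightarrow> cls x = \<zero>\<^bsub>P\<^esub> \<longleftrightarrow> x \<in> J"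
  unfolding zero_P pres_class_def by (metis J.a_rcos_const J.a_rcos_self)

lemma cls_Rel: "r \<in> Rel \<Longrightarrow> cls r = \<zero>\<^bsub>P\<^esub>"
  using F.genideal_self[OF Rel] Rel cls_eq_zero_iff by blast

text \<open>The scalar multiple of a coset is a union over its representatives. All of them give the
  same coset, because a scalar acts as left multiplication by an element of the free algebra and
  \<open>J\<close> is an ideal.\<close>

lemma smult_cls:
  assumes c: "c \<in> carrier K" and x: "x \<in> carrier F"
  shows "c \<odot>\<^bsub>P\<^esub> cls x = cls (c \<odot>\<^bsub>F\<^esub> x)"
proof -
  have "J +>\<^bsub>F\<^esub> (c \<odot>\<^bsub>F\<^esub> y) = J +>\<^bsub>F\<^esub> (c \<odot>\<^bsub>F\<^esub> x)" if y: "y \<in> J +>\<^bsub>F\<^esub> x" for y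
  proof -
    obtain j where j: "j \<in> J" "y = j \<oplus>\<^bsub>F\<^esub> x" using y by (auto simp: a_r_coset_def')
    have jc: "j \<in> carrier F" using j J.a_Hcarr by blast
    have "c \<odot>\<^bsub>F\<^esub> y = mono c [] \<otimes>\<^bsub>F\<^esub> j \<oplus>\<^bsub>F\<^esub> c \<odot>\<^bsub>F\<^esub> x"
      using c x j jc by (simp add: smult_eq_mult F.r_distr)
    moreover have "mono c [] \<otimes>\<^bsub>F\<^esub> j \<in> J" using c j by (intro J.I_l_closed) auto
    moreover have "c \<odot>\<^bsub>F\<^esub> x \<in> carrier F" using c x by (simp add: smult_eq_mult)
    ultimately show ?thesis
      by (metis F.a_coset_add_assoc J.a_Hcarr J.a_rcos_const J.a_subset)
  qed
  moreover have "J +>\<^bsub>F\<^esub> x \<noteq> {}" using J.a_rcos_self[OF x] by blast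
  ultimately show ?thesis
    by (simp add: pres_alg_def quot_alg_def ring.defs module.defs pres_class_def)
qed

lemma smult_P_eq_mult:
  "c \<in> carrier K \<Longrightarrow> Z \<in> carrier P \<Longrightarrow> c \<odot>\<^bsub>P\<^esub> Z = cls (mono c []) \<otimes>\<^bsub>P\<^esub> Z"
  using cls_surj[of Z] by (auto simp: smult_cls smult_eq_mult cls_mult)

lemma scalar_central:
  "c \<in> carrier K \<Longrightarrow> Z \<in> carrier P \<Longrightarrow> cls (mono c []) \<otimes>\<^bsub>P\<^esub> Z = Z \<otimes>\<^bsub>P\<^esub> cls (mono c [])"
  using cls_surj[of Z] by (auto simp: mono_central simp flip: cls_mult)

lemma scalar_hom: "(\<lambda>c. cls (mono c [])) \<in> ring_hom K P"
  using ring_hom_trans[OF mono_Nil_hom cls_hom] by (simp add: comp_def)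

lemma scalar_closed [simp]: "c \<in> carrier K \<Longrightarrow> cls (mono c []) \<in> carrier P"
  by simp

lemma module_P: "module K P"
  using ring_hom_add[OF scalar_hom] ring_hom_mult[OF scalar_hom] ring_hom_one[OF scalar_hom]
  by (intro moduleI K.is_cring P.is_abelian_group)
    (simp_all add: smult_P_eq_mult P.l_distr P.r_distr P.m_assoc)

sublocale module K P by (rule module_P)

lemma smult_mult:
  "c \<in> carrier K \<Longrightarrow> Z \<in> carrier P \<Longrightarrow> Y \<in> carrier P \<Longrightarrow> (c \<odot>\<^bsub>P\<^esub> Z) \<otimes>\<^bsub>P\<^esub> Y = c \<odot>\<^bsub>P\<^esub> (Z \<otimes>\<^bsub>P\<^esub> Y)"
  by (simp add: smult_P_eq_mult P.m_assoc)

lemma mult_smult: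
  "c \<in> carrier K \<Longrightarrow> Z \<in> carrier P \<Longrightarrow> Y \<in> carrier P \<Longrightarrow> Z \<otimes>\<^bsub>P\<^esub> (c \<odot>\<^bsub>P\<^esub> Y) = c \<odot>\<^bsub>P\<^esub> (Z \<otimes>\<^bsub>P\<^esub> Y)"
proof -
  assume a: "c \<in> carrier K" "Z \<in> carrier P" "Y \<in> carrier P"
  have "Z \<otimes>\<^bsub>P\<^esub> (cls (mono c []) \<otimes>\<^bsub>P\<^esub> Y) = (cls (mono c []) \<otimes>\<^bsub>P\<^esub> Z) \<otimes>\<^bsub>P\<^esub> Y"
    using a scalar_central[of c Z] by (simp add: P.m_assoc)
  then show ?thesis using a by (simp add: smult_P_eq_mult P.m_assoc)
qed

lemma cls_mono:
  "c \<in> carrier K \<Longrightarrow> w \<in> lists G \<Longrightarrow> cls (mono c w) = c \<odot>\<^bsub>P\<^esub> lprod P (map (\<lambda>g. cls (gen K g)) w)"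
proof -
  assume a: "c \<in> carrier K" "w \<in> lists G"
  have "set (map (gen K) w) \<subseteq> carrier F" using a by auto
  moreover have "lprod P (map (\<lambda>g. cls (gen K g)) w) \<in> carrier P"
    using a by (intro P.lprod_closed) auto
  ultimately show ?thesis
    using a F.lprod_closed cls_lprod
    by (simp add: mono_eq_smult_lprod[of c w] cls_mult smult_P_eq_mult P.lprod_closed subset_iff comp_def)
qed

lemma cls_scalar: "c \<in> carrier K \<Longrightarrow> cls (mono c []) = c \<odot>\<^bsub>P\<^esub> \<one>\<^bsub>P\<^esub>"
  using cls_mono[of c "[]"] by simp

lemma pres_induct [consumes 1, case_names zero word add]:
  assumes "Z \<in> carrier P" "Q \<zero>\<^bsub>P\<^esub>"
    and "\<And>c w. c \<in> carrier K \<Longrightarrow> w \<in> lists G \<Longrightarrow> Q (c \<odot>\<^bsub>P\<^esub> lprod P (map (\<lambda>g. cls (gen K g)) w))"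
    and "\<And>Z Y. Z \<in> carrier P \<Longrightarrow> Y \<in> carrier P \<Longrightarrow> Q Z \<Longrightarrow> Q Y \<Longrightarrow> Q (Z \<oplus>\<^bsub>P\<^esub> Y)"
  shows "Q Z"
proof -
  have "Q (cls x)" if "x \<in> carrier F" for x
    using that by (induction x rule: free_alg_induct) (use assms in \<open>simp_all add: cls_zero cls_add cls_mono\<close>)
  then show ?thesis using cls_surj[OF assms(1)] by blast
qed

end

text \<open>The kernel of the evaluation is a two-sided ideal, so it contains the ideal generated by
  \<open>Rel\<close> as soon as it contains \<open>Rel\<close>.\<close>

lemma (in free_eval) pres_lift:
  assumes "presented_algebra K G Rel" and ker: "\<And>r. r \<in> Rel \<Longrightarrow> ev r = \<zero>\<^bsub>B\<^esub>"
  obtains h where "h \<in> ring_hom (pres_alg K G Rel) B"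
    "\<And>x. x \<in> carrier F \<Longrightarrow> h (pres_class K G Rel x) = ev x"
    "\<And>g. g \<in> G \<Longrightarrow> h (pres_class K G Rel (gen K g)) = \<gamma> g"
    "\<And>c Z. c \<in> carrier K \<Longrightarrow> Z \<in> carrier (pres_alg K G Rel) \<Longrightarrow>
      h (c \<odot>\<^bsub>pres_alg K G Rel\<^esub> Z) = \<eta> c \<otimes>\<^bsub>B\<^esub> h Z"
proof -
  interpret presented_algebra K G Rel by fact
  have "ring_hom_ring F B ev" by (rule ring_hom_ringI2[OF ring_F B.ring_axioms ev_hom])
  then have ker_ideal: "ideal (a_kernel F B ev) F" by (rule ring_hom_ring.kernel_is_ideal)
  have "Rel \<subseteq> a_kernel F B ev"
    using ker Rel by (auto simp: a_kernel_def')
  then have "J \<subseteq> a_kernel F B ev"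
    by (rule F.genideal_minimal[OF ker_ideal])
  then have zero: "ev x = \<zero>\<^bsub>B\<^esub>" if "x \<in> J" for x
    using that by (auto simp: a_kernel_def')
  then obtain h where h: "h \<in> ring_hom (F Quot J) B" "\<And>x. x \<in> carrier F \<Longrightarrow> h (J +>\<^bsub>F\<^esub> x) = ev x"
    using ideal_quotient_lift[OF J.ideal_axioms ev_hom B.ring_axioms zero] by blast
  have hP: "h \<in> ring_hom P B" using h(1) by (simp add: ring_hom_def P_fields)
  have cls: "h (cls x) = ev x" if "x \<in> carrier F" for x
    using h(2)[OF that] by (simp add: pres_class_def)
  show ?thesis
  proof (rule that[OF hP cls])
    fix c Z assume "c \<in> carrier K" "Z \<in> carrier P"
    then show "h (c \<odot>\<^bsub>P\<^esub> Z) = \<eta> c \<otimes>\<^bsub>B\<^esub> h Z"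
      using ring_hom_mult[OF hP, of "cls (mono c [])" Z] by (simp add: smult_P_eq_mult cls)
  qed (simp_all add: cls)
qed

section \<open>Power series\<close>

lemma finite_sub_mset [simp]: "finite {B. B \<subseteq># A}"
proof (induction A)
  case (add x A)
  have "B \<in> {B. B \<subseteq># A} \<union> add_mset x ` {B. B \<subseteq># A}" if B: "B \<subseteq># add_mset x A" for B
  proof (cases "x \<in># B")
    case True
    then obtain C where "B = add_mset x C" by (meson multi_member_split)
    then show ?thesis using B by auto
  next
    case False
    then have "B \<subseteq># A" using B by (metis diff_single_trivial subset_eq_diff_conv add_mset_add_single)
    then show ?thesis by blast
  qed
  then have "{B. B \<subseteq># add_mset x A} \<subseteq> {B. B \<subseteq># A} \<union> add_mset x ` {B. B \<subseteq># A}" by blast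
  then show ?case using add by (meson finite_UnI finite_imageI finite_subset)
qed simp

lemma diff_diff_submset: "B \<subseteq># A \<Longrightarrow> A - (A - B) = B"
  by (simp add: multiset_eq_iff subseteq_mset_def)

lemma series_simps:
  "f \<in> carrier (series_ring Y) \<longleftrightarrow> (\<forall>A. \<not> set_mset A \<subseteq> Y \<longrightarrow> f A = 0)"
  "f \<otimes>\<^bsub>series_ring Y\<^esub> g = (\<lambda>A. \<Sum>B\<in>{B. B \<subseteq># A}. f B * g (A - B))"
  "\<one>\<^bsub>series_ring Y\<^esub> = (\<lambda>A. if A = {#} then 1 else 0)"
  "\<zero>\<^bsub>series_ring Y\<^esub> = (\<lambda>A. 0)"
  "f \<oplus>\<^bsub>series_ring Y\<^esub> g = (\<lambda>A. f A + g A)"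
  by (simp_all add: series_ring_def)

lemma series_mult_closed:
  assumes "f \<in> carrier (series_ring Y)" "g \<in> carrier (series_ring Y)"
  shows "f \<otimes>\<^bsub>series_ring Y\<^esub> g \<in> carrier (series_ring Y)"
  unfolding series_simps
proof (intro allI impI sum.neutral ballI)
  fix A B assume A: "\<not> set_mset A \<subseteq> Y" and B: "B \<in> {B. B \<subseteq># A}"
  have "set_mset A = set_mset B \<union> set_mset (A - B)"
    using B by (metis mem_Collect_eq set_mset_union subset_mset.add_diff_inverse)
  then have "\<not> set_mset B \<subseteq> Y \<or> \<not> set_mset (A - B) \<subseteq> Y" using A by blast
  then show "f B * g (A - B) = 0" using assms by (auto simp: series_simps)
qed

lemma series_mult_comm: "f \<otimes>\<^bsub>series_ring Y\<^esub> g = g \<otimes>\<^bsub>series_ring Y\<^esub> f"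
proof
  fix A
  have "(\<Sum>B\<in>{B. B \<subseteq># A}. f B * g (A - B)) = (\<Sum>B\<in>{B. B \<subseteq># A}. g B * f (A - B))"
    by (rule sum.reindex_bij_witness[of _ "\<lambda>B. A - B" "\<lambda>B. A - B"])
      (auto simp: mult.commute diff_diff_submset)
  then show "(f \<otimes>\<^bsub>series_ring Y\<^esub> g) A = (g \<otimes>\<^bsub>series_ring Y\<^esub> f) A"
    by (simp add: series_simps)
qed

lemma series_mult_assoc:
  "(f \<otimes>\<^bsub>series_ring Y\<^esub> g) \<otimes>\<^bsub>series_ring Y\<^esub> h = f \<otimes>\<^bsub>series_ring Y\<^esub> (g \<otimes>\<^bsub>series_ring Y\<^esub> h)"
proof
  fix A
  have "(\<Sum>B\<in>{B. B \<subseteq># A}. (\<Sum>C\<in>{C. C \<subseteq># B}. f C * g (B - C)) * h (A - B)) =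
      (\<Sum>(B, C)\<in>(SIGMA B:{B. B \<subseteq># A}. {C. C \<subseteq># B}). f C * g (B - C) * h (A - B))"
    by (simp add: sum_distrib_right sum.Sigma)
  also have "\<dots> = (\<Sum>(C, D)\<in>(SIGMA C:{C. C \<subseteq># A}. {D. D \<subseteq># A - C}). f C * (g D * h (A - C - D)))"
  \<comment> \<open>A chain of multisets \<open>C\<close> inside \<open>B\<close> inside
    \<open>A\<close> is recorded by \<open>C\<close> and the difference
    \<open>D = B - C\<close>.\<close>
  proof (rule sum.reindex_bij_witness[of _ "\<lambda>(C, D). (C + D, C)" "\<lambda>(B, C). (C, B - C)"])
    fix a assume "a \<in> (SIGMA B:{B. B \<subseteq># A}. {C. C \<subseteq># B})"
    then obtain B C where a: "a = (B, C)" "B \<subseteq># A" "C \<subseteq># B" by auto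
    then have "A - C - (B - C) = A - B"
      by (metis diff_diff_add_mset subset_mset.add_diff_inverse)
    then show "(case case a of (B, C) \<Rightarrow> (C, B - C) of (C, D) \<Rightarrow> f C * (g D * h (A - C - D))) =
        (case a of (B, C) \<Rightarrow> f C * g (B - C) * h (A - B))" using a by simp
    show "(case case a of (B, C) \<Rightarrow> (C, B - C) of (C, D) \<Rightarrow> (C + D, C)) = a"
      using a by simp
    show "(case a of (B, C) \<Rightarrow> (C, B - C)) \<in> (SIGMA C:{C. C \<subseteq># A}. {D. D \<subseteq># A - C})"
      using a by (auto intro: order.trans[of _ "count B _"] simp: subseteq_mset_def diff_le_mono)
  next
    fix b assume "b \<in> (SIGMA C:{C. C \<subseteq># A}. {D. D \<subseteq># A - C})"
    then obtain C D where b: "b = (C, D)" "C \<subseteq># A" "D \<subseteq># A - C" by auto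
    then have "C + D \<subseteq># A"
      by (metis mset_subset_eq_mono_add_left_cancel subset_mset.add_diff_inverse)
    then show "(case b of (C, D) \<Rightarrow> (C + D, C)) \<in> (SIGMA B:{B. B \<subseteq># A}. {C. C \<subseteq># B})"
      using b by simp
    show "(case case b of (C, D) \<Rightarrow> (C + D, C) of (B, C) \<Rightarrow> (C, B - C)) = b"
      using b by simp
  qed
  also have "\<dots> = (\<Sum>C\<in>{C. C \<subseteq># A}. f C * (\<Sum>D\<in>{D. D \<subseteq># A - C}. g D * h (A - C - D)))"
    by (simp add: sum_distrib_left sum.Sigma)
  finally show "(f \<otimes>\<^bsub>series_ring Y\<^esub> g \<otimes>\<^bsub>series_ring Y\<^esub> h) A =
      (f \<otimes>\<^bsub>series_ring Y\<^esub> (g \<otimes>\<^bsub>series_ring Y\<^esub> h)) A"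
    by (simp add: series_simps)
qed

definition series_const :: "complex \<Rightarrow> 'x series" where
  "series_const c = (\<lambda>A. if A = {#} then c else 0)"

lemma series_const_mult: "series_const c \<otimes>\<^bsub>series_ring Y\<^esub> f = (\<lambda>A. c * f A)"
proof
  fix A
  have "(\<Sum>B\<in>{B. B \<subseteq># A}. series_const c B * f (A - B)) = (\<Sum>B\<in>{{#}}. series_const c B * f (A - B))"
    by (rule sum.mono_neutral_right) (auto simp: series_const_def)
  then show "(series_const c \<otimes>\<^bsub>series_ring Y\<^esub> f) A = c * f A"
    by (simp add: series_simps series_const_def)
qed

lemma series_const_closed [simp]: "series_const c \<in> carrier (series_ring Y)"
  by (auto simp: series_simps series_const_def)

lemma cring_series: "cring (series_ring Y)"
proof (rule cringI)
  show "abelian_group (series_ring Y)"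
  proof (rule abelian_groupI)
    fix f assume "f \<in> carrier (series_ring Y)"
    then show "\<exists>g\<in>carrier (series_ring Y). g \<oplus>\<^bsub>series_ring Y\<^esub> f = \<zero>\<^bsub>series_ring Y\<^esub>"
      by (intro bexI[of _ "\<lambda>A. - f A"]) (auto simp: series_simps)
  qed (auto simp: series_simps)
  have one: "\<one>\<^bsub>series_ring Y\<^esub> = series_const 1" by (simp add: series_simps series_const_def)
  show "comm_monoid (series_ring Y)"
  proof (rule comm_monoidI)
    fix f assume "f \<in> carrier (series_ring Y)"
    show "\<one>\<^bsub>series_ring Y\<^esub> \<otimes>\<^bsub>series_ring Y\<^esub> f = f"
      unfolding one series_const_mult by simp
  qed (auto simp: one series_mult_closed series_mult_assoc intro: series_mult_comm)
qed (simp add: series_simps sum.distrib distrib_right)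

lemma series_const_hom: "series_const \<in> ring_hom complex_ring (series_ring Y)"
proof (rule ring_hom_memI)
  fix c d :: complex
  show "series_const (c \<otimes>\<^bsub>complex_ring\<^esub> d) = series_const c \<otimes>\<^bsub>series_ring Y\<^esub> (series_const d :: 'a series)"
    unfolding series_const_mult by (auto simp: ring_of_type_algebra_def series_const_def)
qed (auto simp: ring_of_type_algebra_def series_const_def series_simps)

lemma series_a_inv: "f \<in> carrier (series_ring Y) \<Longrightarrow> \<ominus>\<^bsub>series_ring Y\<^esub> f = (\<lambda>A. - f A)"
proof -
  interpret cring "series_ring Y" by (rule cring_series)
  assume "f \<in> carrier (series_ring Y)"
  then show ?thesis by (intro minus_equality) (auto simp: series_simps)
qed

text \<open>The exponential series \<open>e^(c y)\<close> in the single variable \<open>y\<close>;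
  its monomials are the powers of \<open>y\<close>.\<close>

definition var_exp :: "'x \<Rightarrow> complex \<Rightarrow> 'x series" where
  "var_exp y c = (\<lambda>A. if A = replicate_mset (size A) y then c ^ size A / fact (size A) else 0)"

lemma var_exp_closed [simp]: "y \<in> Y \<Longrightarrow> var_exp y c \<in> carrier (series_ring Y)"
proof -
  assume y: "y \<in> Y"
  have "set_mset A \<subseteq> Y" if "A = replicate_mset n y" for A n using that y by (auto simp: set_mset_replicate_mset_subset)
  then show ?thesis unfolding series_simps var_exp_def by metis
qed

text \<open>The \<open>n\<close>-th power of \<open>c y\<close> is concentrated at the monomial
  \<open>y^n\<close>. So at a monomial \<open>A\<close> only \<open>n = size A\<close> can
  contribute, which lies just inside the range of summation of \<open>series_exp\<close>.\<close>

lemma series_exp_scaled_var: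
  assumes y: "y \<in> Y"
  shows "series_exp Y (\<lambda>A. c * series_var y A) = var_exp y c"
proof -
  interpret cring "series_ring Y" by (rule cring_series)
  let ?f = "\<lambda>A. c * series_var y A"
  have f: "?f \<in> carrier (series_ring Y)" using y by (auto simp: series_simps series_var_def)
  have pow: "?f [^]\<^bsub>series_ring Y\<^esub> n = (\<lambda>A. if A = replicate_mset n y then c ^ n else 0)" for n
  proof (induction n)
    case 0
    show ?case by (simp add: series_simps fun_eq_iff)
  next
    case (Suc n)
    show ?case
    proof
      fix A
      have "(?f [^]\<^bsub>series_ring Y\<^esub> Suc n) A =
          (\<Sum>B\<in>{B. B \<subseteq># A}. (if B = replicate_mset n y then c ^ n else 0) * ?f (A - B))"
        using Suc by (simp add: series_simps)
      also have "\<dots> = (\<Sum>B\<in>{B. B \<subseteq># A}. if B = replicate_mset n y then c ^ n * ?f (A - replicate_mset n y) else 0)"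
        by (intro sum.cong) auto
      also have "\<dots> = (if replicate_mset n y \<subseteq># A then c ^ n * ?f (A - replicate_mset n y) else 0)"
        by (simp add: sum.delta')
      also have "\<dots> = (if A = replicate_mset (Suc n) y then c ^ Suc n else 0)"
      proof (cases "A = replicate_mset (Suc n) y")
        case True
        then show ?thesis by (simp add: series_var_def)
      next
        case False
        have "A - replicate_mset n y \<noteq> {#y#}" if "replicate_mset n y \<subseteq># A"
        proof
          assume e: "A - replicate_mset n y = {#y#}"
          have "A = replicate_mset n y + (A - replicate_mset n y)" using that by simp
          then show False using False by (simp add: e)
        qed
        then show ?thesis using False by (simp add: series_var_def)
      qed
      finally show "(?f [^]\<^bsub>series_ring Y\<^esub> Suc n) A = (if A = replicate_mset (Suc n) y then c ^ Suc n else 0)" .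
    qed
  qed
  show ?thesis
  proof
    fix A
    have "series_exp Y ?f A = (\<Sum>n\<le>size A. if n = size A then var_exp y c A else 0)"
      unfolding series_exp_def pow by (intro sum.cong) (auto simp: var_exp_def)
    then show "series_exp Y ?f A = var_exp y c A" by simp
  qed
qed

text \<open>The exponential of the integral linear form with coefficients \<open>\<alpha>\<close>,
  that is, the product of the series \<open>e^(\<alpha>(y) y)\<close>. Up to constants these are the
  images of the Laurent monomials of \<open>R\<close>.\<close>

definition expo :: "'x set \<Rightarrow> ('x \<Rightarrow> int) \<Rightarrow> 'x series" where
  "expo Y \<alpha> = (\<lambda>A. if set_mset A \<subseteq> Y
     then \<Prod>y\<in>set_mset A. of_int (\<alpha> y) ^ count A y / fact (count A y) else 0)"

lemma expo_closed [simp]: "expo Y \<alpha> \<in> carrier (series_ring Y)"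
  by (simp add: series_simps expo_def)

lemma expo_zero: "expo Y (\<lambda>_. 0) = \<one>\<^bsub>series_ring Y\<^esub>"
proof
  fix A :: "'a multiset"
  have "(\<Prod>y\<in>set_mset A. (0::complex) ^ count A y / fact (count A y)) = 0" if "A \<noteq> {#}"
    using that by (auto intro: prod_zero simp: multiset_nonemptyE)
  then show "expo Y (\<lambda>_. 0) A = \<one>\<^bsub>series_ring Y\<^esub> A" by (auto simp: expo_def series_simps)
qed

lemma exp_binomial:
  "(\<Sum>k\<le>n. (a ^ (n - k) / fact (n - k)) * (c ^ k / fact k)) = (a + c) ^ n / (fact n :: complex)"
proof -
  have "(a + c) ^ n = (\<Sum>k\<le>n. of_nat (n choose k) * c ^ k * a ^ (n - k))"
    using binomial_ring[of c a n] by (simp add: add.commute)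
  then have "(a + c) ^ n / fact n = (\<Sum>k\<le>n. of_nat (n choose k) * c ^ k * a ^ (n - k) / fact n)"
    by (simp add: sum_divide_distrib)
  also have "\<dots> = (\<Sum>k\<le>n. (a ^ (n - k) / fact (n - k)) * (c ^ k / fact k))"
    by (intro sum.cong) (auto simp: binomial_fact field_simps)
  finally show ?thesis by simp
qed

text \<open>Only the submultisets obtained from \<open>A\<close> by removing copies of
  \<open>y\<close> contribute. The other variables give the common factor \<open>G\<close>, and what
  remains is the binomial theorem for the exponent of \<open>y\<close>.\<close>

lemma expo_mult_var_exp:
  assumes y: "y \<in> Y"
  shows "expo Y \<alpha> \<otimes>\<^bsub>series_ring Y\<^esub> var_exp y (of_int c) = expo Y (\<alpha>(y := \<alpha> y + c))"
proof
  fix A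
  show "(expo Y \<alpha> \<otimes>\<^bsub>series_ring Y\<^esub> var_exp y (of_int c)) A = expo Y (\<alpha>(y := \<alpha> y + c)) A"
  proof (cases "set_mset A \<subseteq> Y")
    case False
    then show ?thesis
      using series_mult_closed[OF expo_closed var_exp_closed[OF y], of \<alpha> "of_int c"]
      by (simp add: series_simps(1) expo_def)
  next
    case True
    define n where "n = count A y"
    define Z where "Z = insert y (set_mset A)"
    define G :: complex where "G = (\<Prod>z\<in>Z - {y}. of_int (\<alpha> z) ^ count A z / fact (count A z))"
    have Z: "finite Z" "y \<in> Z" by (auto simp: Z_def)
    have expo: "expo Y \<beta> B = of_int (\<beta> y) ^ count B y / fact (count B y) * G"
      if "set_mset B \<subseteq> set_mset A" "\<And>z. z \<noteq> y \<Longrightarrow> count B z = count A z" "\<And>z. z \<noteq> y \<Longrightarrow> \<beta> z = \<alpha> z" for \<beta> B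
    proof -
      have "expo Y \<beta> B = (\<Prod>z\<in>set_mset B. of_int (\<beta> z) ^ count B z / fact (count B z))"
        using that True by (simp add: expo_def subset_trans)
      also have "\<dots> = (\<Prod>z\<in>Z. of_int (\<beta> z) ^ count B z / fact (count B z))"
        using that Z by (intro prod.mono_neutral_left) (auto simp: Z_def not_in_iff)
      also have "\<dots> = of_int (\<beta> y) ^ count B y / fact (count B y) *
          (\<Prod>z\<in>Z - {y}. of_int (\<beta> z) ^ count B z / fact (count B z))"
        using Z by (simp add: prod.remove)
      also have "(\<Prod>z\<in>Z - {y}. of_int (\<beta> z) ^ count B z / fact (count B z)) = G"
        unfolding G_def using that by (intro prod.cong) auto
      finally show ?thesis .
    qed
    let ?B = "\<lambda>k. A - replicate_mset k y"
    let ?f = "\<lambda>B. expo Y \<alpha> B * var_exp y (of_int c) (A - B)"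
    have sub: "replicate_mset k y \<subseteq># A" if "k \<le> n" for k
      using that by (simp add: n_def count_le_replicate_mset_subset_eq)
    have inj: "inj_on ?B {..n}"
    proof (rule inj_onI)
      fix k l assume "k \<in> {..n}" "l \<in> {..n}" "?B k = ?B l"
      then have "count (?B k) y = count (?B l) y" by simp
      then show "k = l" using \<open>k \<in> {..n}\<close> \<open>l \<in> {..n}\<close> by (simp add: n_def)
    qed
    have "(expo Y \<alpha> \<otimes>\<^bsub>series_ring Y\<^esub> var_exp y (of_int c)) A = (\<Sum>B\<in>{B. B \<subseteq># A}. ?f B)"
      by (simp add: series_simps)
    also have "\<dots> = (\<Sum>B\<in>?B ` {..n}. ?f B)"
    proof (rule sum.mono_neutral_right)
      show "\<forall>B\<in>{B. B \<subseteq># A} - ?B ` {..n}. ?f B = 0"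
      proof
        fix B assume B: "B \<in> {B. B \<subseteq># A} - ?B ` {..n}"
        have "A - B \<noteq> replicate_mset (size (A - B)) y"
        proof
          assume e: "A - B = replicate_mset (size (A - B)) y"
          then have "B = ?B (size (A - B))" using B diff_diff_submset[of B A] by simp
          moreover have "size (A - B) \<le> n"
            using e unfolding n_def by (metis count_le_replicate_mset_subset_eq diff_subset_eq_self)
          ultimately show False using B by blast
        qed
        then show "?f B = 0" by (simp add: var_exp_def)
      qed
    qed auto
    also have "\<dots> = (\<Sum>k\<le>n. ?f (?B k))" by (simp add: sum.reindex[OF inj])
    also have "\<dots> = (\<Sum>k\<le>n. (of_int (\<alpha> y) ^ (n - k) / fact (n - k)) * (of_int c ^ k / fact k) * G)"
    proof (rule sum.cong)
      fix k assume "k \<in> {..n}"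
      then have "A - ?B k = replicate_mset k y" using sub by (simp add: diff_diff_submset)
      moreover have "expo Y \<alpha> (?B k) = of_int (\<alpha> y) ^ count (?B k) y / fact (count (?B k) y) * G"
        by (rule expo) (auto dest: in_diffD)
      ultimately show "?f (?B k) = (of_int (\<alpha> y) ^ (n - k) / fact (n - k)) * (of_int c ^ k / fact k) * G"
        by (simp add: var_exp_def n_def)
    qed simp
    also have "\<dots> = (of_int (\<alpha> y) + of_int c) ^ n / fact n * G"
      by (simp only: exp_binomial flip: sum_distrib_right)
    also have "\<dots> = expo Y (\<alpha>(y := \<alpha> y + c)) A"
      by (subst expo) (auto simp: n_def)
    finally show ?thesis .
  qed
qed

text \<open>After clearing factorials the coefficient at \<open>A\<close> becomes the product of the
  values \<open>\<alpha> y\<close> over the elements of \<open>A\<close>, a character of the free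
  commutative monoid on \<open>Y\<close>. Distinct characters are independent by Dedekind's
  argument: if \<open>y\<close> separates \<open>\<alpha>\<close> from \<open>\<beta>\<close>, the
  relation at \<open>add_mset y A\<close> minus \<open>\<beta> y\<close> times the relation at
  \<open>A\<close> no longer involves \<open>\<beta>\<close>, and the coefficient of
  \<open>\<alpha>\<close> has only been multiplied by a nonzero number.\<close>

lemma expo_independent:
  assumes "finite F" and supp: "\<And>\<alpha> y. \<alpha> \<in> F \<Longrightarrow> y \<notin> Y \<Longrightarrow> \<alpha> y = 0"
    and zero: "\<And>A. (\<Sum>\<alpha>\<in>F. c \<alpha> * expo Y \<alpha> A) = 0"
  shows "\<alpha> \<in> F \<Longrightarrow> c \<alpha> = 0"
proof -
  define pw where "pw \<alpha> A = (\<Prod>y\<in>#A. of_int (\<alpha> y) :: complex)" for \<alpha> :: "'a \<Rightarrow> int" and A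
  have "(\<Sum>\<alpha>\<in>F. c \<alpha> * pw \<alpha> A) = 0" if A: "set_mset A \<subseteq> Y" for A
  proof -
    have "pw \<alpha> A = expo Y \<alpha> A * (\<Prod>y\<in>set_mset A. fact (count A y))" for \<alpha>
      using A by (simp add: pw_def expo_def image_prod_mset_multiplicity flip: prod.distrib)
    then have "(\<Sum>\<alpha>\<in>F. c \<alpha> * pw \<alpha> A) = (\<Sum>\<alpha>\<in>F. c \<alpha> * expo Y \<alpha> A) * (\<Prod>y\<in>set_mset A. fact (count A y))"
      by (simp add: sum_distrib_right mult.assoc)
    then show ?thesis using zero by simp
  qed
  with \<open>finite F\<close> supp show "\<alpha> \<in> F \<Longrightarrow> c \<alpha> = 0"
  proof (induction "card F" arbitrary: F c \<alpha>)
    case (Suc n)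
    show ?case
    proof (cases "F = {\<alpha>}")
      case True
      then show ?thesis using Suc.prems(4)[of "{#}"] by (simp add: pw_def)
    next
      case False
      then obtain \<beta> where \<beta>: "\<beta> \<in> F" "\<beta> \<noteq> \<alpha>" using Suc.prems by blast
      then obtain y where y: "\<beta> y \<noteq> \<alpha> y" by blast
      then have "y \<in> Y" using Suc.prems(1,3) \<beta>(1) by metis
      let ?c = "\<lambda>\<gamma>. c \<gamma> * (of_int (\<gamma> y) - of_int (\<beta> y))"
      have "?c \<alpha> = 0"
      proof (rule Suc.hyps(1)[of "F - {\<beta>}" \<alpha> ?c])
        fix A assume A: "set_mset A \<subseteq> Y"
        have "(\<Sum>\<gamma>\<in>F - {\<beta>}. ?c \<gamma> * pw \<gamma> A) = (\<Sum>\<gamma>\<in>F. ?c \<gamma> * pw \<gamma> A)"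
          using Suc.prems(2) \<beta>(1) by (simp add: sum.remove)
        also have "\<dots> = (\<Sum>\<gamma>\<in>F. c \<gamma> * pw \<gamma> (add_mset y A)) - of_int (\<beta> y) * (\<Sum>\<gamma>\<in>F. c \<gamma> * pw \<gamma> A)"
          by (simp add: pw_def algebra_simps sum_subtractf sum_distrib_left)
        also have "\<dots> = 0" using Suc.prems(4) A \<open>y \<in> Y\<close> by simp
        finally show "(\<Sum>\<gamma>\<in>F - {\<beta>}. ?c \<gamma> * pw \<gamma> A) = 0" .
      qed (use Suc.prems \<beta> Suc.hyps(2) in auto)
      then show ?thesis using y by simp
    qed
  qed simp
qed

section \<open>The coefficient ring\<close>

lemma complex_ring_simps [simp]:
  "carrier complex_ring = UNIV" "x \<otimes>\<^bsub>complex_ring\<^esub> y = x * y" "\<one>\<^bsub>complex_ring\<^esub> = 1"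
  "\<zero>\<^bsub>complex_ring\<^esub> = 0" "x \<oplus>\<^bsub>complex_ring\<^esub> y = x + y"
  by (simp_all add: ring_of_type_algebra_def)

lemma cring_complex: "cring complex_ring"
  by (rule cring_from_type_algebra)

lemma finsum_complex: "finsum complex_ring f A = sum f A"
proof -
  interpret cring complex_ring by (rule cring_complex)
  show ?thesis by (induction A rule: infinite_finite_induct) auto
qed

lemma finsum_series:
  assumes "f \<in> A \<rightarrow> carrier (series_ring Y)"
  shows "finsum (series_ring Y) f A = (\<lambda>M. \<Sum>x\<in>A. f x M)"
proof -
  interpret cring "series_ring Y" by (rule cring_series)
  show ?thesis
  proof (cases "finite A")
    case True
    then show ?thesis using assms by induction (auto simp: series_simps fun_eq_iff)
  qed (simp add: series_simps)
qed

lemma (in module) finsum_smult_rdistr: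
  assumes "finite A" "f \<in> A \<rightarrow> carrier R" "x \<in> carrier M"
  shows "(finsum R f A) \<odot>\<^bsub>M\<^esub> x = (\<Oplus>\<^bsub>M\<^esub>a\<in>A. f a \<odot>\<^bsub>M\<^esub> x)"
  using assms by induction (auto simp: smult_l_distr Pi_iff)

text \<open>Terms are collected along the fibres of \<open>g\<close>, where the vector is constant
  and the coefficients add up to zero. It serves to collect the words of \<open>R\<close> that have
  the same exponent.\<close>

lemma module_finsum_regroup:
  assumes "module K M" "finite A" "f \<in> A \<rightarrow> carrier K" "\<And>u. u \<in> A \<Longrightarrow> e (g u) \<in> carrier M"
    and vanish: "\<And>a. a \<in> g ` A \<Longrightarrow> finsum K f {u \<in> A. g u = a} = \<zero>\<^bsub>K\<^esub>"
  shows "(\<Oplus>\<^bsub>M\<^esub>u\<in>A. f u \<odot>\<^bsub>M\<^esub> e (g u)) = \<zero>\<^bsub>M\<^esub>"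
proof -
  interpret module K M by fact
  have A: "A = (\<Union>a\<in>g ` A. {u \<in> A. g u = a})" by auto
  have "(\<Oplus>\<^bsub>M\<^esub>u\<in>A. f u \<odot>\<^bsub>M\<^esub> e (g u)) =
      (\<Oplus>\<^bsub>M\<^esub>a\<in>g ` A. \<Oplus>\<^bsub>M\<^esub>u\<in>{u \<in> A. g u = a}. f u \<odot>\<^bsub>M\<^esub> e (g u))"
    by (subst A, rule M.add.finprod_UN_disjoint) (use assms(2-4) in \<open>auto simp: Pi_iff disjnt_def pairwise_def\<close>)
  also have "\<dots> = \<zero>\<^bsub>M\<^esub>"
  proof (rule M.add.finprod_one_eqI)
    fix a assume a: "a \<in> g ` A"
    have "(\<Oplus>\<^bsub>M\<^esub>u\<in>{u \<in> A. g u = a}. f u \<odot>\<^bsub>M\<^esub> e (g u)) = (\<Oplus>\<^bsub>M\<^esub>u\<in>{u \<in> A. g u = a}. f u \<odot>\<^bsub>M\<^esub> e a)"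
      using assms(3,4) by (intro M.finsum_cong') (auto simp: Pi_iff)
    also have "\<dots> = (finsum K f {u \<in> A. g u = a}) \<odot>\<^bsub>M\<^esub> e a"
      using a assms(2-4) by (subst finsum_smult_rdistr) (auto simp: Pi_iff)
    also have "\<dots> = \<zero>\<^bsub>M\<^esub>" unfolding vanish[OF a] using a assms(4) by (intro smult_l_null) auto
    finally show "(\<Oplus>\<^bsub>M\<^esub>u\<in>{u \<in> A. g u = a}. f u \<odot>\<^bsub>M\<^esub> e (g u)) = \<zero>\<^bsub>M\<^esub>" .
  qed
  finally show ?thesis .
qed

text \<open>The class map is itself an evaluation, with values in the presented algebra, and an
  evaluation is by definition a sum over the support.\<close>

lemma (in presented_algebra) cls_expand:
  assumes "f \<in> carrier F"
  shows "cls f = (\<Oplus>\<^bsub>P\<^esub>w\<in>supp f. f w \<odot>\<^bsub>P\<^esub> lprod P (map (\<lambda>g. cls (gen K g)) w))"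
proof -
  have E: "free_eval K G P (\<lambda>c. cls (mono c [])) (\<lambda>g. cls (gen K g))"
    by unfold_locales (simp_all add: scalar_hom scalar_central)
  interpret E: free_eval K G P "\<lambda>c. cls (mono c [])" "\<lambda>g. cls (gen K g)" by (rule E)
  have "E.ev f = cls f"
    using assms
  proof (induction f rule: free_alg_induct)
    case (mono c w)
    have "E.ev (mono c w) = c \<odot>\<^bsub>P\<^esub> lprod P (map (\<lambda>g. cls (gen K g)) w)"
      unfolding E.ev_mono[OF mono] by (rule smult_P_eq_mult[OF mono(1) E.word_closed[OF mono(2)], symmetric])
    also have "\<dots> = cls (mono c w)" by (rule cls_mono[OF mono, symmetric])
    finally show ?case .
  qed (simp_all add: cls_zero E.ev_add cls_add)
  moreover have "E.ev f = (\<Oplus>\<^bsub>P\<^esub>w\<in>supp f. f w \<odot>\<^bsub>P\<^esub> lprod P (map (\<lambda>g. cls (gen K g)) w))"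
    unfolding E.ev_def
  proof (rule P.finsum_cong'[OF HOL.refl])
    fix w assume "w \<in> supp f"
    then have "w \<in> lists G" using supp_word[OF assms] by simp
    then show "cls (mono (f w) []) \<otimes>\<^bsub>P\<^esub> lprod P (map (\<lambda>g. cls (gen K g)) w)
        = f w \<odot>\<^bsub>P\<^esub> lprod P (map (\<lambda>g. cls (gen K g)) w)"
      using smult_P_eq_mult[OF coeff_closed[OF assms] E.word_closed, of w w] by simp
  qed (use assms supp_word[OF assms] E.word_closed in auto)
  ultimately show ?thesis by simp
qed

section \<open>Laurent monomials of \<open>R\<close> as words in signed variables\<close>

lemma label_order_strict: "strict_linear_order_on UNIV label_order"
proof -
  obtain r :: "'a rel" where "well_order_on UNIV r" using well_order_on by blast
  then have "strict_linear_order_on UNIV (r - Id)"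
    by (intro strict_linear_order_on_diff_Id) (simp add: well_order_on_def)
  then show ?thesis unfolding label_order_def by (rule someI)
qed

lemma label_order_iff: "i \<noteq> j \<Longrightarrow> (j, i) \<in> label_order \<longleftrightarrow> (i, j) \<notin> label_order"
  using label_order_strict unfolding strict_linear_order_on_def irrefl_def total_on_def
  by (metis UNIV_I transD)

text \<open>The inverse letter, with \<open>S\<close> letters left fixed by default. The functions
  that follow read \<open>T i j k\<close> as \<open>letter_root\<close> times the exponential of
  \<open>letter_sgn\<close> times \<open>letter_var\<close>: of two mutually inverse letters the one
  that agrees with \<open>label_order\<close> carries the independent parameter.\<close>

definition letter_neg :: "('i \<Rightarrow> 'i \<Rightarrow> enat) \<Rightarrow> 'i letter \<Rightarrow> 'i letter" where
  "letter_neg m l = (case l of T i j k \<Rightarrow> T j i (neg_index m i j k) | _ \<Rightarrow> l)"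

definition letter_var :: "('i \<Rightarrow> 'i \<Rightarrow> enat) \<Rightarrow> 'i letter \<Rightarrow> 'i \<times> 'i \<times> nat" where
  "letter_var m l = (case l of T i j k \<Rightarrow>
     if (i, j) \<in> label_order then (i, j, k) else (j, i, neg_index m i j k))"

definition letter_sgn :: "'i letter \<Rightarrow> int" where
  "letter_sgn l = (case l of T i j k \<Rightarrow> if (i, j) \<in> label_order then 1 else - 1)"

definition letter_root :: "('i \<Rightarrow> 'i \<Rightarrow> enat) \<Rightarrow> 'i letter \<Rightarrow> complex" where
  "letter_root m l = (case l of T i j k \<Rightarrow>
     exp (2 * of_real pi * \<i> * of_nat k / of_nat (the_enat (m i j))))"

text \<open>The exponent vector of a Laurent monomial: the coefficients of the linear form in the
  parameters whose exponential is the image of the monomial, up to the constant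
  \<open>root_prod\<close>.\<close>

definition exponent :: "('i \<Rightarrow> 'i \<Rightarrow> enat) \<Rightarrow> 'i letter list \<Rightarrow> 'i \<times> 'i \<times> nat \<Rightarrow> int" where
  "exponent m u y = (\<Sum>l\<leftarrow>u. if letter_var m l = y then letter_sgn l else 0)"

lemma exponent_simps [simp]:
  "exponent m [] = (\<lambda>_. 0)"
  "exponent m (l # u) y = (if letter_var m l = y then letter_sgn l else 0) + exponent m u y"
  "exponent m (u @ v) y = exponent m u y + exponent m v y"
  by (auto simp: exponent_def)

definition root_prod :: "('i \<Rightarrow> 'i \<Rightarrow> enat) \<Rightarrow> 'i letter list \<Rightarrow> complex" where
  "root_prod m u = (\<Prod>l\<leftarrow>u. letter_root m l)"

lemma t_letters_iff: "T i j k \<in> t_letters I m \<longleftrightarrow> (i, j, k) \<in> t_index I m"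
  by (auto simp: t_letters_def)

lemma t_lettersE:
  assumes "l \<in> t_letters I m"
  obtains i j k where "l = T i j k" "(i, j, k) \<in> t_index I m"
  using assms by (auto simp: t_letters_def)

abbreviation t_hat_letter where
  "t_hat_letter I m l \<equiv> (case l of T i j k \<Rightarrow> t_hat I m i j k)"

context coxeter_words
begin

lemma t_indexD:
  assumes "(i, j, k) \<in> t_index I m"
  obtains n where "m i j = enat n" "m j i = enat n" "i \<in> I" "j \<in> I" "i \<noteq> j" "k < n" "2 \<le> n"
proof -
  obtain n where "m i j = enat n" using assms by (auto simp: t_index_def)
  moreover have "i \<in> I" "j \<in> I" "i \<noteq> j" "enat k < m i j" using assms by (simp_all add: t_index_def)
  ultimately show ?thesis using m_sym[of i j] m_ge_2[of i j n] that[of n] by simp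
qed

lemma t_index_neg: "(i, j, k) \<in> t_index I m \<Longrightarrow> (j, i, neg_index m i j k) \<in> t_index I m"
  by (erule t_indexD) (auto simp: t_index_def neg_index_def)

lemma neg_index_neg: "(i, j, k) \<in> t_index I m \<Longrightarrow> neg_index m j i (neg_index m i j k) = k"
  by (erule t_indexD) (cases "k = 0"; auto simp: neg_index_def)

lemma letter_neg_closed [simp]: "l \<in> t_letters I m \<Longrightarrow> letter_neg m l \<in> t_letters I m"
  by (erule t_lettersE) (auto simp: letter_neg_def t_letters_iff t_index_neg)

lemma letter_var_neg: "l \<in> t_letters I m \<Longrightarrow> letter_var m (letter_neg m l) = letter_var m l"
proof (erule t_lettersE)
  fix i j k assume l: "l = T i j k" "(i, j, k) \<in> t_index I m"
  then show ?thesis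
    using label_order_iff[of i j] neg_index_neg[OF l(2)]
    by (auto simp: letter_neg_def letter_var_def t_index_def)
qed

lemma letter_sgn_neg: "l \<in> t_letters I m \<Longrightarrow> letter_sgn (letter_neg m l) = - letter_sgn l"
proof (erule t_lettersE)
  fix i j k assume l: "l = T i j k" "(i, j, k) \<in> t_index I m"
  then show ?thesis
    using label_order_iff[of i j] by (auto simp: letter_neg_def letter_sgn_def t_index_def)
qed

lemma letter_root_neg: "l \<in> t_letters I m \<Longrightarrow> letter_root m l * letter_root m (letter_neg m l) = 1"
proof (erule t_lettersE, erule t_indexD)
  fix i j k n
  assume l: "l = T i j k" and n: "m i j = enat n" "m j i = enat n" "k < n"
  have "letter_root m l * letter_root m (letter_neg m l) =
      exp (2 * of_real pi * \<i> * of_nat k / of_nat n + 2 * of_real pi * \<i> * of_nat ((n - k) mod n) / of_nat n)"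
    by (simp add: l letter_root_def letter_neg_def neg_index_def n exp_add)
  also have "\<dots> = 1"
  proof (cases "k = 0")
    case False
    then have "2 * of_real pi * \<i> * of_nat k / of_nat n + 2 * of_real pi * \<i> * of_nat ((n - k) mod n) / of_nat n
        = 2 * of_real pi * \<i>"
      using n by (simp add: of_nat_diff field_simps)
    then show ?thesis by simp
  qed simp
  finally show ?thesis .
qed

lemma letter_var_in: "l \<in> t_letters I m \<Longrightarrow> letter_var m l \<in> tau_vars I m"
proof (erule t_lettersE)
  fix i j k assume l: "l = T i j k" "(i, j, k) \<in> t_index I m"
  then have "i \<noteq> j" by (simp add: t_index_def)
  then show ?thesis
    using label_order_iff[of i j] l t_index_neg[OF l(2)] by (auto simp: letter_var_def tau_vars_def)
qed

text \<open>Opposite signs on the same variable mean that one letter agrees with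
  \<open>label_order\<close> and the other runs against it.\<close>

lemma letter_eq_neg:
  assumes "l \<in> t_letters I m" "l' \<in> t_letters I m" "letter_var m l = letter_var m l'" "letter_sgn l \<noteq> letter_sgn l'"
  shows "l' = letter_neg m l"
proof -
  obtain i j k i' j' k' where l: "l = T i j k" "(i, j, k) \<in> t_index I m" "l' = T i' j' k'" "(i', j', k') \<in> t_index I m"
    using assms(1,2) by (auto simp: t_letters_def)
  show ?thesis
    using assms(3,4) l neg_index_neg[OF l(2)] neg_index_neg[OF l(4)]
    by (auto simp: letter_var_def letter_sgn_def letter_neg_def split: if_splits)
qed

lemma letter_sgn_cases: "l \<in> t_letters I m \<Longrightarrow> letter_sgn l = 1 \<or> letter_sgn l = - 1"
  by (erule t_lettersE) (auto simp: letter_sgn_def)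

text \<open>Letters of one sign cannot cancel. Read contrapositively, this finds a letter of the
  opposite sign in a word whose exponent has to compensate a given letter.\<close>

lemma exponent_sgn_nonneg:
  assumes "set u \<subseteq> t_letters I m" "s = 1 \<or> s = - 1"
    "\<And>l. l \<in> set u \<Longrightarrow> letter_var m l = y \<Longrightarrow> letter_sgn l = s"
  shows "0 \<le> s * exponent m u y"
  using assms(1,3)
proof (induction u)
  case (Cons l u)
  then have "0 \<le> s * exponent m u y" by auto
  then show ?case using Cons.prems assms(2) by (auto simp: algebra_simps)
qed simp

lemma exponent_map_neg: "set u \<subseteq> t_letters I m \<Longrightarrow> exponent m (map (letter_neg m) u) y = - exponent m u y"
  by (induction u) (auto simp: letter_var_neg letter_sgn_neg)

lemma exponent_outside: "set u \<subseteq> t_letters I m \<Longrightarrow> y \<notin> tau_vars I m \<Longrightarrow> exponent m u y = 0"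
  by (induction u) (auto dest: letter_var_in)

lemma t_relations_closed:
  assumes "t_letters I m \<subseteq> G"
  shows "t_relations (free_alg complex_ring G) I m \<subseteq> carrier (free_alg complex_ring G)"
proof -
  interpret free_algebra complex_ring G by (intro free_algebra.intro cring_complex)
  interpret F: ring F by (rule ring_F)
  have "gen complex_ring l \<in> carrier F" if "l \<in> t_letters I m" for l
    using that assms by (intro gen_closed) auto
  then show ?thesis
    using t_index_neg by (auto simp: t_relations_def Let_def t_letters_iff)
qed

sublocale R: presented_algebra complex_ring "t_letters I m" "R_relations I m"
  using t_relations_closed[of "t_letters I m"]
  by (intro presented_algebra.intro free_algebra.intro presented_algebra_axioms.intro cring_complex)
    (simp add: R_relations_def)

abbreviation Rt :: "'i letter \<Rightarrow> ('i letter list \<Rightarrow> complex) set" where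
  "Rt l \<equiv> R.cls (gen complex_ring l)"

lemma Rt_closed [simp]: "l \<in> t_letters I m \<Longrightarrow> Rt l \<in> carrier R.P"
  by simp

lemma Rt_neg: assumes l: "l \<in> t_letters I m" shows "Rt l \<otimes>\<^bsub>R.P\<^esub> Rt (letter_neg m l) = \<one>\<^bsub>R.P\<^esub>"
proof -
  let ?g = "gen complex_ring"
  have "?g l \<otimes>\<^bsub>R.F\<^esub> ?g (letter_neg m l) \<ominus>\<^bsub>R.F\<^esub> \<one>\<^bsub>R.F\<^esub> \<in> R_relations I m"
    using l by (elim t_lettersE) (auto simp: R_relations_def t_relations_def Let_def letter_neg_def)
  then have "R.cls (?g l \<otimes>\<^bsub>R.F\<^esub> ?g (letter_neg m l) \<ominus>\<^bsub>R.F\<^esub> \<one>\<^bsub>R.F\<^esub>) = \<zero>\<^bsub>R.P\<^esub>"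
    by (rule R.cls_Rel)
  then show ?thesis
    using l by (simp add: R.cls_minus R.cls_mult R.cls_one R.P.minus_eq_zero_iff)
qed

lemma Rt_comm:
  assumes l: "l \<in> t_letters I m" "l' \<in> t_letters I m"
  shows "Rt l \<otimes>\<^bsub>R.P\<^esub> Rt l' = Rt l' \<otimes>\<^bsub>R.P\<^esub> Rt l"
proof -
  let ?g = "gen complex_ring"
  have "?g l \<otimes>\<^bsub>R.F\<^esub> ?g l' \<ominus>\<^bsub>R.F\<^esub> ?g l' \<otimes>\<^bsub>R.F\<^esub> ?g l \<in> R_relations I m"
    using l by (auto simp: R_relations_def t_relations_def Let_def)
  then have "R.cls (?g l \<otimes>\<^bsub>R.F\<^esub> ?g l' \<ominus>\<^bsub>R.F\<^esub> ?g l' \<otimes>\<^bsub>R.F\<^esub> ?g l) = \<zero>\<^bsub>R.P\<^esub>"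
    by (rule R.cls_Rel)
  then show ?thesis
    using l by (simp add: R.cls_minus R.cls_mult R.P.minus_eq_zero_iff)
qed

lemma Rt_map_closed: "u \<in> lists (t_letters I m) \<Longrightarrow> set (map Rt u) \<subseteq> carrier R.P"
  by (auto simp: in_lists_conv_set)

lemma Rt_word_closed: "u \<in> lists (t_letters I m) \<Longrightarrow> lprod R.P (map Rt u) \<in> carrier R.P"
  by (intro R.P.lprod_closed Rt_map_closed)

lemma R_comm:
  assumes "Z \<in> carrier R.P" "Z' \<in> carrier R.P"
  shows "Z \<otimes>\<^bsub>R.P\<^esub> Z' = Z' \<otimes>\<^bsub>R.P\<^esub> Z"
proof -
  have Rt_central: "Rt l \<otimes>\<^bsub>R.P\<^esub> Z = Z \<otimes>\<^bsub>R.P\<^esub> Rt l" if l: "l \<in> t_letters I m" and Z: "Z \<in> carrier R.P" for l Z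
    using Z
  proof (induction Z rule: R.pres_induct)
    case (word c u)
    have "Rt l \<otimes>\<^bsub>R.P\<^esub> lprod R.P (map Rt u) = lprod R.P (map Rt u) \<otimes>\<^bsub>R.P\<^esub> Rt l"
      using l word Rt_comm by (intro R.P.lprod_commute) auto
    then show ?case using l word Rt_word_closed by (simp add: R.mult_smult R.smult_mult)
  qed (use l in \<open>simp_all add: R.P.l_distr R.P.r_distr\<close>)
  show ?thesis
    using assms(2)
  proof (induction Z' rule: R.pres_induct)
    case (word c u)
    have "Z \<otimes>\<^bsub>R.P\<^esub> lprod R.P (map Rt u) = lprod R.P (map Rt u) \<otimes>\<^bsub>R.P\<^esub> Z"
      using assms word Rt_central by (intro R.P.lprod_commute) auto
    then show ?case using assms word Rt_word_closed by (simp add: R.mult_smult R.smult_mult)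
  qed (use assms in \<open>simp_all add: R.P.l_distr R.P.r_distr\<close>)
qed

lemma R_fields:
  "carrier (R_ring I m) = carrier R.P" "monoid.mult (R_ring I m) = monoid.mult R.P"
  "one (R_ring I m) = one R.P" "zero (R_ring I m) = zero R.P" "add (R_ring I m) = add R.P"
  by (simp_all add: R_ring_def ring.defs)

lemma cring_R: "cring (R_ring I m)"
proof -
  interpret ring "R_ring I m" by (rule ring_cong_fields[OF R.ring_P R_fields])
  show ?thesis by unfold_locales (simp add: R_fields R_comm)
qed

text \<open>By the sign argument the inverse of the initial letter occurs further on. Commutativity
  brings the two together, and the shorter word that is left again has exponent zero.\<close>

lemma Rt_word_trivial:
  assumes "u \<in> lists (t_letters I m)" "exponent m u = (\<lambda>_. 0)"
  shows "lprod R.P (map Rt u) = \<one>\<^bsub>R.P\<^esub>"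
  using assms
proof (induction "length u" arbitrary: u rule: less_induct)
  case less
  show ?case
  proof (cases u)
    case (Cons x v)
    have x: "x \<in> t_letters I m" "set v \<subseteq> t_letters I m" using less.prems Cons by auto
    have "\<exists>l\<in>set v. letter_var m l = letter_var m x \<and> letter_sgn l \<noteq> letter_sgn x"
    proof (rule ccontr)
      assume "\<not> ?thesis"
      then have "0 \<le> letter_sgn x * exponent m v (letter_var m x)"
        using x letter_sgn_cases by (intro exponent_sgn_nonneg) auto
      moreover have "letter_sgn x + exponent m v (letter_var m x) = 0"
        using fun_cong[OF less.prems(2), of "letter_var m x"] Cons by simp
      ultimately show False using letter_sgn_cases[OF x(1)] by auto
    qed
    then obtain l where "l \<in> set v" "letter_var m l = letter_var m x" "letter_sgn l \<noteq> letter_sgn x" by blast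
    then have "letter_neg m x \<in> set v" using letter_eq_neg[of x l] x by auto
    then obtain v1 v2 where v: "v = v1 @ letter_neg m x # v2" by (meson split_list)
    have v12: "set v1 \<subseteq> t_letters I m" "set v2 \<subseteq> t_letters I m" using x v by auto
    have "lprod R.P (map Rt (v1 @ v2)) = \<one>\<^bsub>R.P\<^esub>"
    proof (rule less.hyps)
      show "exponent m (v1 @ v2) = (\<lambda>_. 0)"
      proof
        fix y show "exponent m (v1 @ v2) y = 0"
          using fun_cong[OF less.prems(2), of y] x
          by (simp add: Cons v letter_var_neg letter_sgn_neg split: if_splits)
      qed
    qed (use Cons v v12 in auto)
    moreover have "set (map Rt v1) \<subseteq> carrier R.P" "set (map Rt v2) \<subseteq> carrier R.P"
      using v12 by auto
    moreover have "a \<otimes>\<^bsub>R.P\<^esub> (b \<otimes>\<^bsub>R.P\<^esub> (a' \<otimes>\<^bsub>R.P\<^esub> c)) = b \<otimes>\<^bsub>R.P\<^esub> c"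
      if "a \<otimes>\<^bsub>R.P\<^esub> a' = \<one>\<^bsub>R.P\<^esub>" "a \<in> carrier R.P" "a' \<in> carrier R.P" "b \<in> carrier R.P" "c \<in> carrier R.P" for a a' b c
    proof -
      have "a \<otimes>\<^bsub>R.P\<^esub> (b \<otimes>\<^bsub>R.P\<^esub> (a' \<otimes>\<^bsub>R.P\<^esub> c)) = (a \<otimes>\<^bsub>R.P\<^esub> b) \<otimes>\<^bsub>R.P\<^esub> (a' \<otimes>\<^bsub>R.P\<^esub> c)"
        using that by (simp add: R.P.m_assoc)
      also have "\<dots> = b \<otimes>\<^bsub>R.P\<^esub> ((a \<otimes>\<^bsub>R.P\<^esub> a') \<otimes>\<^bsub>R.P\<^esub> c)"
        using that(2-) R_comm[of a b] by (simp add: R.P.m_assoc)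
      finally show ?thesis using that by simp
    qed
    ultimately show ?thesis
      using Rt_neg[OF x(1)] x v12 R.P.lprod_closed[of "map Rt v1"] R.P.lprod_closed[of "map Rt v2"]
      by (simp add: Cons v R.P.lprod_append)
  qed simp
qed

text \<open>The letterwise inverse of \<open>v\<close> cancels against \<open>v\<close> as well as
  against \<open>u\<close>. Hence a word matters in \<open>R\<close> only through its exponent, and
  \<open>R\<close> is spanned by Laurent monomials.\<close>

lemma Rt_word_cong:
  assumes u: "u \<in> lists (t_letters I m)" and v: "v \<in> lists (t_letters I m)" and "exponent m u = exponent m v"
  shows "lprod R.P (map Rt u) = lprod R.P (map Rt v)"
proof -
  let ?p = "\<lambda>u. lprod R.P (map Rt u)" and ?v = "map (letter_neg m) v"
  have v': "?v \<in> lists (t_letters I m)" using v by auto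
  have "exponent m (u @ ?v) = (\<lambda>_. 0)" "exponent m (?v @ v) = (\<lambda>_. 0)"
    using assms(3) exponent_map_neg[of v] v by (simp_all add: fun_eq_iff subset_iff in_lists_conv_set)
  then have "?p (u @ ?v) = \<one>\<^bsub>R.P\<^esub>" "?p (?v @ v) = \<one>\<^bsub>R.P\<^esub>"
    using u v v' by (metis Rt_word_trivial append_in_lists_conv)+
  moreover have "?p (x @ y) = ?p x \<otimes>\<^bsub>R.P\<^esub> ?p y" if "x \<in> lists (t_letters I m)" "y \<in> lists (t_letters I m)" for x y
    unfolding map_append by (rule R.P.lprod_append[OF Rt_map_closed Rt_map_closed, OF that])
  ultimately have 1: "?p u \<otimes>\<^bsub>R.P\<^esub> ?p ?v = \<one>\<^bsub>R.P\<^esub>" "?p ?v \<otimes>\<^bsub>R.P\<^esub> ?p v = \<one>\<^bsub>R.P\<^esub>"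
    using u v v' by metis+
  note c = Rt_word_closed[OF u] Rt_word_closed[OF v] Rt_word_closed[OF v']
  have "?p u = ?p u \<otimes>\<^bsub>R.P\<^esub> (?p ?v \<otimes>\<^bsub>R.P\<^esub> ?p v)" using 1 c by simp
  also have "\<dots> = (?p u \<otimes>\<^bsub>R.P\<^esub> ?p ?v) \<otimes>\<^bsub>R.P\<^esub> ?p v" using c by (simp only: R.P.m_assoc)
  also have "\<dots> = ?p v" using 1 c by (simp only: R.P.l_one)
  finally show ?thesis .
qed

text \<open>Common part of two constructions, of the maps from \<open>R\<close> to the power series
  ring and to \<open>A(M)\<close>: in both targets the images of letters commute and
  \<open>letter_neg\<close> yields inverses.\<close>

lemma R_relations_vanish:
  assumes "free_eval complex_ring (t_letters I m) B \<eta> \<gamma>"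
    and neg: "\<And>l. l \<in> t_letters I m \<Longrightarrow> \<gamma> l \<otimes>\<^bsub>B\<^esub> \<gamma> (letter_neg m l) = \<one>\<^bsub>B\<^esub>"
    and comm: "\<And>l l'. l \<in> t_letters I m \<Longrightarrow> l' \<in> t_letters I m \<Longrightarrow> \<gamma> l \<otimes>\<^bsub>B\<^esub> \<gamma> l' = \<gamma> l' \<otimes>\<^bsub>B\<^esub> \<gamma> l"
    and r: "r \<in> R_relations I m"
  shows "free_eval.ev complex_ring B \<eta> \<gamma> r = \<zero>\<^bsub>B\<^esub>"
proof -
  interpret E: free_eval complex_ring "t_letters I m" B \<eta> \<gamma> by fact
  let ?g = "gen complex_ring"
  note sub = ring_hom_sub[OF E.ev_hom R.ring_F E.B.ring_axioms]
  have r: "r \<in> t_relations R.F I m" using r by (simp add: R_relations_def)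
  have gen: "?g l \<in> carrier R.F" if "l \<in> t_letters I m" for l using that by simp
  consider i j k where "(i, j, k) \<in> t_index I m"
      "r = ?g (T i j k) \<otimes>\<^bsub>R.F\<^esub> ?g (T j i (neg_index m i j k)) \<ominus>\<^bsub>R.F\<^esub> \<one>\<^bsub>R.F\<^esub>"
    | x y where "x \<in> t_letters I m" "y \<in> t_letters I m" "r = ?g x \<otimes>\<^bsub>R.F\<^esub> ?g y \<ominus>\<^bsub>R.F\<^esub> ?g y \<otimes>\<^bsub>R.F\<^esub> ?g x"
    using r unfolding t_relations_def Let_def by blast
  then show ?thesis
  proof cases
    case 1
    then have l: "T i j k \<in> t_letters I m" "T j i (neg_index m i j k) \<in> t_letters I m"
      by (simp_all add: t_letters_iff t_index_neg)
    then show ?thesis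
      using neg[OF l(1)] 1(2)
      by (simp add: sub gen E.ev_mult ring_hom_one[OF E.ev_hom] letter_neg_def E.B.minus_eq_zero_iff)
  next
    case 2
    then show ?thesis
      using comm[of x y] E.\<gamma> by (simp add: sub gen E.ev_mult E.B.minus_eq_zero_iff)
  qed
qed

section \<open>The embedding into the power series ring\<close>

abbreviation Y where "Y \<equiv> tau_vars I m"

text \<open>Both cases of \<open>tau\<close>, a variable or the negative of one, have the form
  \<open>letter_sgn\<close> times \<open>letter_var\<close>, so the formula for the exponential of a
  scaled variable covers them together.\<close>

lemma t_hat_eq:
  assumes "l \<in> t_letters I m"
  shows "t_hat_letter I m l =
    series_const (letter_root m l) \<otimes>\<^bsub>R_hat I m\<^esub> var_exp (letter_var m l) (of_int (letter_sgn l))"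
proof -
  obtain i j k where l: "l = T i j k" "(i, j, k) \<in> t_index I m" using assms by (elim t_lettersE)
  note Y = letter_var_in[OF assms]
  have neg: "\<ominus>\<^bsub>R_hat I m\<^esub> series_var y = (\<lambda>A. - 1 * series_var y A)" if "y \<in> Y" for y
    using that by (subst series_a_inv) (auto simp: series_simps series_var_def)
  have "tau I m i j k = (\<lambda>A. of_int (letter_sgn l) * series_var (letter_var m l) A)"
  proof (cases "(i, j) \<in> label_order")
    case True
    then show ?thesis by (simp add: tau_def letter_sgn_def letter_var_def l)
  next
    case False
    then show ?thesis using neg Y by (simp add: tau_def letter_sgn_def letter_var_def l)
  qed
  then have "series_exp Y (tau I m i j k) = var_exp (letter_var m l) (of_int (letter_sgn l))"
    using series_exp_scaled_var[OF Y] by simp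
  then show ?thesis by (simp add: series_const_mult l t_hat_def letter_root_def)
qed

lemma t_hat_closed [simp]: "l \<in> t_letters I m \<Longrightarrow> t_hat_letter I m l \<in> carrier (R_hat I m)"
  by (simp add: t_hat_eq series_mult_closed letter_var_in)

lemma t_hat_mult_expo:
  assumes "l \<in> t_letters I m"
  shows "t_hat_letter I m l \<otimes>\<^bsub>R_hat I m\<^esub> (series_const c \<otimes>\<^bsub>R_hat I m\<^esub> expo Y \<alpha>) =
    series_const (letter_root m l * c) \<otimes>\<^bsub>R_hat I m\<^esub>
      expo Y (\<alpha>(letter_var m l := \<alpha> (letter_var m l) + letter_sgn l))"
proof -
  interpret cring "R_hat I m" by (rule cring_series)
  have v: "var_exp (letter_var m l) (of_int (letter_sgn l)) \<in> carrier (R_hat I m)"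
    using letter_var_in[OF assms] by simp
  have "series_const (letter_root m l * c) = series_const (letter_root m l) \<otimes>\<^bsub>R_hat I m\<^esub> series_const c"
    using ring_hom_mult[OF series_const_hom, of "letter_root m l" c Y] by simp
  then show ?thesis
    using v letter_var_in[OF assms]
    by (simp add: t_hat_eq[OF assms] m_ac flip: expo_mult_var_exp)
qed

lemma t_hat_word:
  assumes "u \<in> lists (t_letters I m)"
  shows "lprod (R_hat I m) (map (t_hat_letter I m) u) =
    series_const (root_prod m u) \<otimes>\<^bsub>R_hat I m\<^esub> expo Y (exponent m u)"
  using assms
proof (induction u)
  case Nil
  then show ?case by (simp add: expo_zero root_prod_def series_const_mult)
next
  case (Cons l u)
  have "(exponent m u)(letter_var m l := exponent m u (letter_var m l) + letter_sgn l) = exponent m (l # u)"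
    by (auto simp: fun_eq_iff)
  then show ?case using Cons t_hat_mult_expo[of l "root_prod m u" "exponent m u"]
    by (simp add: root_prod_def del: exponent_simps)
qed

lemma t_hat_neg:
  assumes "l \<in> t_letters I m"
  shows "t_hat_letter I m l \<otimes>\<^bsub>R_hat I m\<^esub> t_hat_letter I m (letter_neg m l) = \<one>\<^bsub>R_hat I m\<^esub>"
proof -
  interpret cring "R_hat I m" by (rule cring_series)
  have "exponent m [l, letter_neg m l] = (\<lambda>_. 0)"
    using assms by (auto simp: letter_var_neg letter_sgn_neg)
  then show ?thesis
    using t_hat_word[of "[l, letter_neg m l]"] assms
    by (simp add: root_prod_def letter_root_neg expo_zero series_const_mult)
qed

lemma free_eval_rho: "free_eval complex_ring (t_letters I m) (R_hat I m) series_const (t_hat_letter I m)"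
proof -
  interpret cring "R_hat I m" by (rule cring_series)
  show ?thesis by unfold_locales (auto simp: series_const_hom intro: series_mult_comm)
qed

text \<open>For injectivity an element of \<open>R\<close> is written as a combination of words.
  Words with equal exponents coincide in \<open>R\<close>, and distinct exponents give independent
  exponentials; so a vanishing image forces the coefficients belonging to each exponent to sum to
  zero, and the element vanishes.\<close>

lemma rho_exists:
  obtains \<rho> where "\<rho> \<in> ring_hom (R_ring I m) (R_hat I m)"
    "\<And>i j k. (i, j, k) \<in> t_index I m \<Longrightarrow> \<rho> (R_t I m i j k) = t_hat I m i j k"
    "\<And>c. c \<in> carrier (R_ring I m) \<Longrightarrow> \<rho> c = \<zero>\<^bsub>R_hat I m\<^esub> \<Longrightarrow> c = \<zero>\<^bsub>R_ring I m\<^esub>"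
proof -
  interpret H: cring "R_hat I m" by (rule cring_series)
  interpret E: free_eval complex_ring "t_letters I m" "R_hat I m" series_const "t_hat_letter I m"
    by (rule free_eval_rho)
  have Frel: "E.ev r = \<zero>\<^bsub>R_hat I m\<^esub>" if "r \<in> R_relations I m" for r
    by (rule R_relations_vanish[OF free_eval_rho t_hat_neg _ that]) (simp_all add: H.m_comm)
  obtain \<rho> where \<rho>: "\<rho> \<in> ring_hom R.P (R_hat I m)" "\<And>x. x \<in> carrier R.F \<Longrightarrow> \<rho> (R.cls x) = E.ev x"
    using E.pres_lift[OF R.presented_algebra_axioms Frel] by metis
  have inj: "c = \<zero>\<^bsub>R.P\<^esub>" if c: "c \<in> carrier R.P" "\<rho> c = \<zero>\<^bsub>R_hat I m\<^esub>" for c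
  proof -
    obtain f where f: "f \<in> carrier R.F" "c = R.cls f" using R.cls_surj c by blast
    let ?A = "{w. f w \<noteq> 0}" and ?p = "\<lambda>u. lprod R.P (map Rt u)"
    have A: "finite ?A" "?A \<subseteq> lists (t_letters I m)" using R.supp_finite[OF f(1)] R.supp_lists[OF f(1)] by simp_all
    \<comment> \<open>The constant of a word is the constant term of its image, and the word as an
      element of \<open>R\<close> depends on the exponent alone.\<close>
    have root: "root_prod m u = root_prod m v"
      if "u \<in> lists (t_letters I m)" "v \<in> lists (t_letters I m)" "exponent m u = exponent m v" for u v
    proof -
      have "root_prod m u = \<rho> (?p u) {#}" if "u \<in> lists (t_letters I m)" for u
      proof -
        have "?p u = R.cls (lprod R.F (map (gen complex_ring) u))"
          using that by (subst R.cls_lprod) (auto simp: comp_def)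
        then have "?p u = R.cls (R.mono 1 u)" using R.mono_eq_lprod[OF that] by simp
        then have "\<rho> (?p u) = E.ev (R.mono 1 u)" using \<rho>(2)[OF R.mono_closed, of 1 u] that by simp
        also have "\<dots> = lprod (R_hat I m) (map (t_hat_letter I m) u)"
          using E.ev_mono[of 1 u] that by (simp add: series_const_mult)
        finally have "\<rho> (?p u) = lprod (R_hat I m) (map (t_hat_letter I m) u)" .
        then show ?thesis using t_hat_word[OF that] by (simp add: series_const_mult expo_def)
      qed
      then show ?thesis using Rt_word_cong that by metis
    qed
    have nz: "root_prod m u \<noteq> 0" if "u \<in> lists (t_letters I m)" for u
      using that
    proof (induction u)
      case (Cons l u)
      then show ?case by (auto simp: root_prod_def letter_root_def t_letters_def)
    qed (simp add: root_prod_def)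
    have "E.ev f = (\<lambda>M. \<Sum>w\<in>?A. f w * root_prod m w * expo Y (exponent m w) M)"
    proof -
      have "E.ev f = (\<Oplus>\<^bsub>R_hat I m\<^esub>w\<in>?A. series_const (f w * root_prod m w) \<otimes>\<^bsub>R_hat I m\<^esub> expo Y (exponent m w))"
        unfolding E.ev_def complex_ring_simps
      proof (rule H.finsum_cong'[OF HOL.refl])
        fix w assume "w \<in> ?A"
        then show "series_const (f w) \<otimes>\<^bsub>R_hat I m\<^esub> lprod (R_hat I m) (map (t_hat_letter I m) w) =
            series_const (f w * root_prod m w) \<otimes>\<^bsub>R_hat I m\<^esub> expo Y (exponent m w)"
          using t_hat_word[OF subsetD[OF A(2)]] by (simp add: series_const_mult mult.assoc)
      qed (intro Pi_I series_mult_closed series_const_closed expo_closed)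
      also have "\<dots> = (\<lambda>M. \<Sum>w\<in>?A. f w * root_prod m w * expo Y (exponent m w) M)"
        by (subst finsum_series, intro Pi_I series_mult_closed series_const_closed expo_closed)
          (simp add: series_const_mult)
      finally show ?thesis .
    qed
    then have zero: "(\<Sum>w\<in>?A. f w * root_prod m w * expo Y (exponent m w) M) = 0" for M
      using c f \<rho>(2) by (simp add: series_simps fun_eq_iff)
    have coeff: "(\<Sum>w\<in>{w \<in> ?A. exponent m w = a}. f w) = 0" if a: "a \<in> exponent m ` ?A" for a
    proof -
      let ?c = "\<lambda>a. \<Sum>w\<in>{w \<in> ?A. exponent m w = a}. f w * root_prod m w"
      have "?c a = 0"
      proof (rule expo_independent[where F = "exponent m ` ?A" and Y = Y and c = ?c])
        fix M
        have "(\<Sum>a\<in>exponent m ` ?A. ?c a * expo Y a M) =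
            (\<Sum>a\<in>exponent m ` ?A. \<Sum>w\<in>{w \<in> ?A. exponent m w = a}. f w * root_prod m w * expo Y (exponent m w) M)"
          by (intro sum.cong) (auto simp: sum_distrib_right)
        also have "\<dots> = (\<Sum>w\<in>?A. f w * root_prod m w * expo Y (exponent m w) M)"
          by (rule sum.image_gen[OF A(1), symmetric])
        also have "\<dots> = 0" by (rule zero)
        finally show "(\<Sum>a\<in>exponent m ` ?A. ?c a * expo Y a M) = 0" .
      qed (use A a exponent_outside in \<open>auto simp: subset_iff\<close>)
      moreover obtain v where v: "v \<in> ?A" "a = exponent m v" using a by blast
      moreover have "?c a = (\<Sum>w\<in>{w \<in> ?A. exponent m w = a}. f w) * root_prod m v"
        unfolding sum_distrib_right using A v root by (intro sum.cong) (auto simp: subset_iff)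
      ultimately show ?thesis using nz[OF subsetD[OF A(2)]] by simp
    qed
    \<comment> \<open>A chosen word of exponent \<open>a\<close> stands for the Laurent monomial
      with that exponent.\<close>
    define e where "e a = ?p (SOME v. v \<in> lists (t_letters I m) \<and> exponent m v = a)" for a
    have e: "?p w = e (exponent m w)" "?p w \<in> carrier R.P" if "w \<in> lists (t_letters I m)" for w
    proof -
      let ?v = "SOME v. v \<in> lists (t_letters I m) \<and> exponent m v = exponent m w"
      have "?v \<in> lists (t_letters I m) \<and> exponent m ?v = exponent m w"
        by (rule someI[of _ w]) (use that in simp)
      then show "?p w = e (exponent m w)" unfolding e_def using that by (intro Rt_word_cong) auto
    qed (rule Rt_word_closed[OF that])
    have "c = (\<Oplus>\<^bsub>R.P\<^esub>w\<in>?A. f w \<odot>\<^bsub>R.P\<^esub> ?p w)"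
      using R.cls_expand[OF f(1)] f(2) by simp
    also have "\<dots> = (\<Oplus>\<^bsub>R.P\<^esub>w\<in>?A. f w \<odot>\<^bsub>R.P\<^esub> e (exponent m w))"
      using A e by (intro R.P.finsum_cong') (auto simp: subset_iff)
    also have "\<dots> = \<zero>\<^bsub>R.P\<^esub>"
      using A e coeff by (intro module_finsum_regroup[OF R.module_P, where e = e and g = "exponent m"]) (auto simp: finsum_complex subset_iff)
    finally show ?thesis .
  qed
  show ?thesis
  proof (rule that)
    show "\<rho> \<in> ring_hom (R_ring I m) (R_hat I m)" using \<rho>(1) by (simp add: ring_hom_def R_fields)
  next
    fix i j k assume "(i, j, k) \<in> t_index I m"
    then show "\<rho> (R_t I m i j k) = t_hat I m i j k"
      using \<rho>(2)[of "gen complex_ring (T i j k)"] by (simp add: R_t_def t_letters_iff)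
  qed (use inj in \<open>simp add: R_fields\<close>)
qed

end

section \<open>Linear independence from topological freeness\<close>

lemma quot_alg_simps:
  "carrier (quot_alg F J) = a_rcosets\<^bsub>F\<^esub> J" "add (quot_alg F J) = set_add F" "zero (quot_alg F J) = J"
  "c \<odot>\<^bsub>quot_alg F J\<^esub> U = (\<Union>x\<in>U. J +>\<^bsub>F\<^esub> (c \<odot>\<^bsub>F\<^esub> x))"
  by (simp_all add: quot_alg_def ring.defs module.defs FactRing_def)

lemma series_module_simps:
  "v \<in> carrier (series_module Y V) \<longleftrightarrow>
    (\<forall>A. v A \<in> carrier V) \<and> (\<forall>A. \<not> set_mset A \<subseteq> Y \<longrightarrow> v A = \<zero>\<^bsub>V\<^esub>)"
  "v \<oplus>\<^bsub>series_module Y V\<^esub> v' = (\<lambda>A. v A \<oplus>\<^bsub>V\<^esub> v' A)"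
  "f \<odot>\<^bsub>series_module Y V\<^esub> v = (\<lambda>A. \<Oplus>\<^bsub>V\<^esub>B\<in>{B. B \<subseteq># A}. f B \<odot>\<^bsub>V\<^esub> v (A - B))"
  by (simp_all add: series_module_def)

text \<open>A single term of the convolution survives. The lemma serves for a variable, for a
  constant, and for a series all of whose coefficients of smaller degree vanish.\<close>

lemma series_smult_single:
  assumes V: "module complex_ring V" and v: "\<And>A. v A \<in> carrier V"
    and f: "\<And>B. B \<subseteq># A \<Longrightarrow> B \<noteq> B0 \<Longrightarrow> f B = 0" and B0: "B0 \<subseteq># A"
  shows "(f \<odot>\<^bsub>series_module Y V\<^esub> v) A = f B0 \<odot>\<^bsub>V\<^esub> v (A - B0)"
proof -
  interpret V: module complex_ring V by fact
  have "(f \<odot>\<^bsub>series_module Y V\<^esub> v) A =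
      (\<Oplus>\<^bsub>V\<^esub>B\<in>{B. B \<subseteq># A}. if B = B0 then f B \<odot>\<^bsub>V\<^esub> v (A - B) else \<zero>\<^bsub>V\<^esub>)"
    unfolding series_module_simps
  proof (rule V.M.finsum_cong'[OF HOL.refl])
    fix B assume "B \<in> {B. B \<subseteq># A}"
    then show "f B \<odot>\<^bsub>V\<^esub> v (A - B) = (if B = B0 then f B \<odot>\<^bsub>V\<^esub> v (A - B) else \<zero>\<^bsub>V\<^esub>)"
      using f[of B] v V.smult_l_null by simp
  qed (use v in auto)
  also have "\<dots> = f B0 \<odot>\<^bsub>V\<^esub> v (A - B0)"
    using B0 v by (intro V.M.add.finprod_singleton_swap) auto
  finally show ?thesis .
qed

locale series_algebra = presented_algebra "series_ring Y" G Rel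
  for Y :: "'x set" and G :: "'g set" and Rel +
  assumes finite_Y: "finite Y"
begin

abbreviation K where "K \<equiv> series_ring Y"
abbreviation In where "In n \<equiv> adic_ideal Y P n"
abbreviation C where "C \<equiv> adic_completion Y P"

lemma filtration_closed: "(\<lambda>f. f \<odot>\<^bsub>P\<^esub> \<one>\<^bsub>P\<^esub>) ` series_filtration Y n \<subseteq> carrier P"
  by (auto simp: series_filtration_def)

lemma In_ideal: "ideal (In n) P"
  unfolding adic_ideal_def by (rule P.genideal_ideal[OF filtration_closed])

lemma In_decreasing: "In (Suc n) \<subseteq> In n"
proof -
  have "(\<lambda>f. f \<odot>\<^bsub>P\<^esub> \<one>\<^bsub>P\<^esub>) ` series_filtration Y (Suc n) \<subseteq> (\<lambda>f. f \<odot>\<^bsub>P\<^esub> \<one>\<^bsub>P\<^esub>) ` series_filtration Y n"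
    by (auto simp: series_filtration_def)
  also have "\<dots> \<subseteq> In n" unfolding adic_ideal_def by (rule P.genideal_self[OF filtration_closed])
  finally show ?thesis
    using P.genideal_minimal[OF In_ideal] unfolding adic_ideal_def[of Y P "Suc n"] by blast
qed

lemma smult_as_mult:
  assumes "c \<in> carrier K" "x \<in> carrier P"
  shows "c \<odot>\<^bsub>P\<^esub> x = (c \<odot>\<^bsub>P\<^esub> \<one>\<^bsub>P\<^esub>) \<otimes>\<^bsub>P\<^esub> x"
  using smult_mult[of c "\<one>\<^bsub>P\<^esub>" x] assms by simp

lemma In_smult: "c \<in> carrier K \<Longrightarrow> x \<in> In n \<Longrightarrow> c \<odot>\<^bsub>P\<^esub> x \<in> In n"
proof -
  interpret ideal "In n" P by (rule In_ideal)
  assume "c \<in> carrier K" "x \<in> In n"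
  then show ?thesis using smult_as_mult[of c x] a_Hcarr[of x] I_l_closed[of x "c \<odot>\<^bsub>P\<^esub> \<one>\<^bsub>P\<^esub>"] by simp
qed

lemma coset_zero: "In n +>\<^bsub>P\<^esub> \<zero>\<^bsub>P\<^esub> = In n"
  using ideal.rcos_ring_hom[OF In_ideal] ring_hom_zero[OF _ P.ring_axioms ideal.quotient_is_ring[OF In_ideal]]
  by (fastforce simp: FactRing_def)

lemma coset_add:
  "a \<in> carrier P \<Longrightarrow> b \<in> carrier P \<Longrightarrow> (In n +>\<^bsub>P\<^esub> a) <+>\<^bsub>P\<^esub> (In n +>\<^bsub>P\<^esub> b) = In n +>\<^bsub>P\<^esub> (a \<oplus>\<^bsub>P\<^esub> b)"
  using ring_hom_add[OF ideal.rcos_ring_hom[OF In_ideal], of a b n] by (simp add: FactRing_def)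

lemma coset_smult:
  assumes c: "c \<in> carrier K" and x: "x \<in> carrier P"
  shows "(\<Union>y\<in>In n +>\<^bsub>P\<^esub> x. In n +>\<^bsub>P\<^esub> (c \<odot>\<^bsub>P\<^esub> y)) = In n +>\<^bsub>P\<^esub> (c \<odot>\<^bsub>P\<^esub> x)"
proof -
  interpret ideal "In n" P by (rule In_ideal)
  have "In n +>\<^bsub>P\<^esub> (c \<odot>\<^bsub>P\<^esub> y) = In n +>\<^bsub>P\<^esub> (c \<odot>\<^bsub>P\<^esub> x)" if y: "y \<in> In n +>\<^bsub>P\<^esub> x" for y
  proof -
    obtain j where j: "j \<in> In n" "y = j \<oplus>\<^bsub>P\<^esub> x" using y by (auto simp: a_r_coset_def')
    then have "c \<odot>\<^bsub>P\<^esub> y = c \<odot>\<^bsub>P\<^esub> j \<oplus>\<^bsub>P\<^esub> c \<odot>\<^bsub>P\<^esub> x"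
      using c x a_Hcarr[of j] by (simp add: smult_r_distr)
    moreover have "In n +>\<^bsub>P\<^esub> (c \<odot>\<^bsub>P\<^esub> j) = In n +>\<^bsub>P\<^esub> \<zero>\<^bsub>P\<^esub>"
      using a_rcos_const In_smult[OF c j(1)] by simp
    moreover have "c \<odot>\<^bsub>P\<^esub> j \<in> carrier P" "c \<odot>\<^bsub>P\<^esub> x \<in> carrier P" using c x j(1) a_Hcarr by auto
    ultimately show ?thesis
      using coset_add[of "c \<odot>\<^bsub>P\<^esub> j" "c \<odot>\<^bsub>P\<^esub> x" n] coset_add[of "\<zero>\<^bsub>P\<^esub>" "c \<odot>\<^bsub>P\<^esub> x" n] by simp
  qed
  then show ?thesis using a_rcos_self[OF x] by blast
qed

text \<open>The canonical map into the completion. Nothing is claimed about its kernel; relations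
  are pushed forward along it.\<close>

definition emb :: "('g list \<Rightarrow> 'x series) set \<Rightarrow> nat \<Rightarrow> ('g list \<Rightarrow> 'x series) set set" where
  "emb a = (\<lambda>n. In n +>\<^bsub>P\<^esub> a)"

lemma C_simps:
  "z \<in> carrier C \<longleftrightarrow> (\<forall>n. z n \<in> a_rcosets\<^bsub>P\<^esub> (In n)) \<and> (\<forall>n. z (Suc n) \<subseteq> z n)"
  "z \<oplus>\<^bsub>C\<^esub> z' = (\<lambda>n. z n <+>\<^bsub>P\<^esub> z' n)"
  "c \<odot>\<^bsub>C\<^esub> z = (\<lambda>n. \<Union>x\<in>z n. In n +>\<^bsub>P\<^esub> (c \<odot>\<^bsub>P\<^esub> x))"
  by (simp_all add: adic_completion_def quot_alg_simps)

lemma coset_obtain: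
  assumes "z \<in> carrier C"
  obtains a where "a \<in> carrier P" "z n = In n +>\<^bsub>P\<^esub> a"
proof -
  have "\<exists>a\<in>carrier P. z n = In n +>\<^bsub>P\<^esub> a"
    using assms by (simp add: C_simps A_RCOSETS_defs a_r_coset_def[symmetric])
  then show ?thesis using that by blast
qed

lemma coset_closed: "a \<in> carrier P \<Longrightarrow> In n +>\<^bsub>P\<^esub> a \<in> a_rcosets\<^bsub>P\<^esub> (In n)"
  using ideal.Icarr[OF In_ideal] by (intro P.a_rcosetsI) blast

lemma emb_closed: "a \<in> carrier P \<Longrightarrow> emb a \<in> carrier C"
  using In_decreasing coset_closed by (auto simp: C_simps emb_def a_r_coset_def')

lemma emb_add: "a \<in> carrier P \<Longrightarrow> b \<in> carrier P \<Longrightarrow> emb (a \<oplus>\<^bsub>P\<^esub> b) = emb a \<oplus>\<^bsub>C\<^esub> emb b"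
  by (simp add: C_simps emb_def coset_add)

lemma emb_smult: "c \<in> carrier K \<Longrightarrow> a \<in> carrier P \<Longrightarrow> emb (c \<odot>\<^bsub>P\<^esub> a) = c \<odot>\<^bsub>C\<^esub> emb a"
  by (simp add: C_simps emb_def coset_smult)

lemma C_add_closed:
  assumes "z \<in> carrier C" "z' \<in> carrier C"
  shows "z \<oplus>\<^bsub>C\<^esub> z' \<in> carrier C"
proof -
  have "z n <+>\<^bsub>P\<^esub> z' n \<in> a_rcosets\<^bsub>P\<^esub> (In n)" for n
    using coset_obtain[OF assms(1), of n] coset_obtain[OF assms(2), of n]
    by (metis P.a_closed coset_add coset_closed)
  moreover have "z (Suc n) <+>\<^bsub>P\<^esub> z' (Suc n) \<subseteq> z n <+>\<^bsub>P\<^esub> z' n" for n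
    using assms by (fastforce simp: C_simps set_add_def set_mult_def)
  ultimately show ?thesis by (simp add: C_simps)
qed

lemma C_smult_closed:
  assumes c: "c \<in> carrier K" and z: "z \<in> carrier C"
  shows "c \<odot>\<^bsub>C\<^esub> z \<in> carrier C"
proof -
  have "(\<Union>x\<in>z n. In n +>\<^bsub>P\<^esub> (c \<odot>\<^bsub>P\<^esub> x)) \<in> a_rcosets\<^bsub>P\<^esub> (In n)" for n
    using coset_obtain[OF z, of n] c by (metis coset_smult coset_closed smult_closed)
  moreover have "(\<Union>x\<in>z (Suc n). In (Suc n) +>\<^bsub>P\<^esub> (c \<odot>\<^bsub>P\<^esub> x)) \<subseteq> (\<Union>x\<in>z n. In n +>\<^bsub>P\<^esub> (c \<odot>\<^bsub>P\<^esub> x))" for n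
    using z In_decreasing[of n] unfolding C_simps a_r_coset_def' by fast
  ultimately show ?thesis by (simp add: C_simps)
qed

text \<open>A variable belongs to the maximal ideal, so multiplication by it lands in the first adic
  ideal, which is the zero coset at level 1.\<close>

lemma var_smult_level_1:
  assumes y: "y \<in> Y" and z: "z \<in> carrier C"
  shows "(series_var y \<odot>\<^bsub>C\<^esub> z) 1 = In 1"
proof -
  interpret ideal "In 1" P by (rule In_ideal)
  obtain a where a: "a \<in> carrier P" "z 1 = In 1 +>\<^bsub>P\<^esub> a" using coset_obtain[OF z] by metis
  have var: "series_var y \<in> carrier K" using y by (auto simp: series_simps series_var_def)
  then have "series_var y \<in> series_filtration Y 1"
    by (simp add: series_filtration_def series_var_def)
  then have "series_var y \<odot>\<^bsub>P\<^esub> \<one>\<^bsub>P\<^esub> \<in> In 1"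
    unfolding adic_ideal_def using P.genideal_self[OF filtration_closed] by blast
  then have "series_var y \<odot>\<^bsub>P\<^esub> a \<in> In 1"
    using smult_as_mult[OF var a(1)] I_r_closed a(1) by simp
  then show ?thesis using coset_smult[OF var a(1), of 1] a(2) a_rcos_const by (simp add: C_simps)
qed

context
  fixes V :: "(complex, nat \<Rightarrow> ('g list \<Rightarrow> 'x series) set set) module"
    and h :: "(nat \<Rightarrow> ('g list \<Rightarrow> 'x series) set set) \<Rightarrow> 'x multiset \<Rightarrow> nat \<Rightarrow> ('g list \<Rightarrow> 'x series) set set"
  assumes V: "module complex_ring V" and h: "h \<in> module_iso K C (series_module Y V)"
begin

interpretation V: module complex_ring V by (rule V)

lemma h_closed: "z \<in> carrier C \<Longrightarrow> h z \<in> carrier (series_module Y V)"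
  using h by (auto simp: module_iso_def bij_betw_def)

lemma h_coeff_closed: "z \<in> carrier C \<Longrightarrow> h z A \<in> carrier V"
  using h_closed by (simp add: series_module_simps)

lemma h_add: "z \<in> carrier C \<Longrightarrow> z' \<in> carrier C \<Longrightarrow> h (z \<oplus>\<^bsub>C\<^esub> z') = h z \<oplus>\<^bsub>series_module Y V\<^esub> h z'"
  using h by (simp add: module_iso_def)

lemma h_smult: "c \<in> carrier K \<Longrightarrow> z \<in> carrier C \<Longrightarrow> h (c \<odot>\<^bsub>C\<^esub> z) = c \<odot>\<^bsub>series_module Y V\<^esub> h z"
  using h by (simp add: module_iso_def)

lemma h_inj: "z \<in> carrier C \<Longrightarrow> z' \<in> carrier C \<Longrightarrow> h z = h z' \<Longrightarrow> z = z'"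
  using h by (auto simp: module_iso_def bij_betw_def dest: inj_onD)

lemma h_surj: "v \<in> carrier (series_module Y V) \<Longrightarrow> \<exists>z\<in>carrier C. h z = v"
proof -
  assume v: "v \<in> carrier (series_module Y V)"
  have "h ` carrier C = carrier (series_module Y V)" using h by (simp add: module_iso_def bij_betw_def)
  then have "v \<in> h ` carrier C" using v by simp
  then show ?thesis by blast
qed

text \<open>
  The preimage of a series without constant term lies in \<open>\<mm>\<close> times the completion: split off the
  variables one at a time.
\<close>

lemma no_constant_term_level_1:
  assumes "z \<in> carrier C" "h z {#} = \<zero>\<^bsub>V\<^esub>"
  shows "z 1 = In 1"
proof -
  interpret I: ideal "In 1" P by (rule In_ideal)
  \<comment> \<open>The induction is over subsets \<open>Y'\<close> of the variables: every monomial
    occurring in \<open>h z\<close> is supposed to involve some variable of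
    \<open>Y'\<close>.\<close>
  have "\<forall>z\<in>carrier C. (\<forall>A. set_mset A \<inter> Y' = {} \<longrightarrow> h z A = \<zero>\<^bsub>V\<^esub>) \<longrightarrow> z 1 = In 1"
    if "finite Y'" "Y' \<subseteq> Y" for Y'
    using that
  proof (induction Y')
    case empty
    show ?case
    proof (intro ballI impI)
      fix z assume z: "z \<in> carrier C" "\<forall>A. set_mset A \<inter> {} = {} \<longrightarrow> h z A = \<zero>\<^bsub>V\<^esub>"
      have zero: "emb \<zero>\<^bsub>P\<^esub> \<in> carrier C" by (rule emb_closed) simp
      have "emb \<zero>\<^bsub>P\<^esub> = \<zero>\<^bsub>K\<^esub> \<odot>\<^bsub>C\<^esub> emb \<zero>\<^bsub>P\<^esub>"
        by (subst emb_smult[symmetric]) simp_all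
      then have "h (emb \<zero>\<^bsub>P\<^esub>) = \<zero>\<^bsub>K\<^esub> \<odot>\<^bsub>series_module Y V\<^esub> h (emb \<zero>\<^bsub>P\<^esub>)"
        using h_smult[OF K.zero_closed zero] by simp
      also have "\<dots> = (\<lambda>A. \<zero>\<^bsub>V\<^esub>)"
        using h_coeff_closed[OF zero] V.smult_l_null
        unfolding series_module_simps by (intro ext V.M.add.finprod_one_eqI) (simp add: series_simps)
      finally have "h z = h (emb \<zero>\<^bsub>P\<^esub>)" using z by (simp add: fun_eq_iff)
      then have "z = emb \<zero>\<^bsub>P\<^esub>" using h_inj z zero by blast
      then show "z 1 = In 1" by (simp add: emb_def coset_zero)
    qed
  next
    case (insert y Y')
    show ?case
    proof (intro ballI impI)
      fix z assume z: "z \<in> carrier C" "\<forall>A. set_mset A \<inter> insert y Y' = {} \<longrightarrow> h z A = \<zero>\<^bsub>V\<^esub>"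
      have y: "y \<in> Y" using insert by simp
      have var: "series_var y \<in> carrier K" using y by (auto simp: series_simps series_var_def)
      \<comment> \<open>The series is split: \<open>u\<close> comes from the part divisible by
        \<open>y\<close>, divided by \<open>y\<close>, and \<open>v\<close> from the part free of
        \<open>y\<close>, all of whose monomials meet \<open>Y'\<close>.\<close>
      have "(\<lambda>A. h z (add_mset y A)) \<in> carrier (series_module Y V)"
        "(\<lambda>A. if y \<in># A then \<zero>\<^bsub>V\<^esub> else h z A) \<in> carrier (series_module Y V)"
        using h_closed[OF z(1)] y by (auto simp: series_module_simps)
      then obtain u v where u: "u \<in> carrier C" "h u = (\<lambda>A. h z (add_mset y A))"
        and v: "v \<in> carrier C" "h v = (\<lambda>A. if y \<in># A then \<zero>\<^bsub>V\<^esub> else h z A)"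
        using h_surj by meson
      have yu: "series_var y \<odot>\<^bsub>C\<^esub> u \<in> carrier C" by (rule C_smult_closed[OF var u(1)])
      have hyu: "(series_var y \<odot>\<^bsub>series_module Y V\<^esub> h u) A = (if y \<in># A then h z A else \<zero>\<^bsub>V\<^esub>)" for A
      proof (cases "y \<in># A")
        case True
        then have "(series_var y \<odot>\<^bsub>series_module Y V\<^esub> h u) A = series_var y {#y#} \<odot>\<^bsub>V\<^esub> h u (A - {#y#})"
          using h_coeff_closed[OF u(1)] by (intro series_smult_single V) (auto simp: series_var_def)
        then show ?thesis
          using True h_coeff_closed[OF z(1)] V.smult_one by (simp add: series_var_def u(2))
      next
        case False
        have "(series_var y \<odot>\<^bsub>series_module Y V\<^esub> h u) A = series_var y {#} \<odot>\<^bsub>V\<^esub> h u (A - {#})"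
          using h_coeff_closed[OF u(1)] False
          by (intro series_smult_single V) (auto simp: series_var_def split: if_splits)
        then show ?thesis
          using False h_coeff_closed[OF u(1)] V.smult_l_null by (simp add: series_var_def)
      qed
      have "h (series_var y \<odot>\<^bsub>C\<^esub> u \<oplus>\<^bsub>C\<^esub> v) = h z"
        using h_add[OF yu v(1)] h_smult[OF var u(1)] h_coeff_closed[OF z(1)] hyu
        by (simp add: series_module_simps(2) v(2) fun_eq_iff)
      then have "z = series_var y \<odot>\<^bsub>C\<^esub> u \<oplus>\<^bsub>C\<^esub> v"
        using h_inj C_add_closed[OF yu v(1)] z(1) by metis
      moreover have "v 1 = In 1" using insert v z(2) by auto
      moreover have "In 1 <+>\<^bsub>P\<^esub> In 1 = In 1"
        using coset_add[of "\<zero>\<^bsub>P\<^esub>" "\<zero>\<^bsub>P\<^esub>" 1] by (simp add: coset_zero)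
      ultimately show "z 1 = In 1"
        using var_smult_level_1[OF y u(1)] by (simp add: C_simps(2))
    qed
  qed
  \<comment> \<open>For \<open>Y' = Y\<close> the condition concerns the empty monomial alone,
    because a nonempty monomial disjoint from \<open>Y\<close> has coefficient zero in
    \<open>V[[Y]]\<close>.\<close>
  moreover have "h z A = \<zero>\<^bsub>V\<^esub>" if "set_mset A \<inter> Y = {}" for A
  proof (cases "A = {#}")
    case False
    then have "\<not> set_mset A \<subseteq> Y" using that by auto
    then show ?thesis using h_closed[OF assms(1)] by (simp add: series_module_simps)
  qed (use assms in simp)
  ultimately show ?thesis using finite_Y assms(1) by blast
qed

text \<open>The formula is stated for the coefficient at a single monomial, so that the sum on the
  right is taken in the module \<open>V\<close>.\<close>

lemma h_emb_finsum:
  assumes "finite A" "c \<in> A \<rightarrow> carrier K" "e \<in> A \<rightarrow> carrier P"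
  shows "h (emb (\<Oplus>\<^bsub>P\<^esub>x\<in>A. c x \<odot>\<^bsub>P\<^esub> e x)) M =
    (\<Oplus>\<^bsub>V\<^esub>x\<in>A. (c x \<odot>\<^bsub>series_module Y V\<^esub> h (emb (e x))) M)"
  using assms
proof (induction A)
  case empty
  have zero: "emb \<zero>\<^bsub>P\<^esub> \<in> carrier C" by (rule emb_closed) simp
  \<comment> \<open>The image of zero is idempotent under addition, hence zero.\<close>
  have "emb \<zero>\<^bsub>P\<^esub> \<oplus>\<^bsub>C\<^esub> emb \<zero>\<^bsub>P\<^esub> = emb \<zero>\<^bsub>P\<^esub>" using emb_add[of "\<zero>\<^bsub>P\<^esub>" "\<zero>\<^bsub>P\<^esub>"] by simp
  then have "h (emb \<zero>\<^bsub>P\<^esub>) M = h (emb \<zero>\<^bsub>P\<^esub>) M \<oplus>\<^bsub>V\<^esub> h (emb \<zero>\<^bsub>P\<^esub>) M"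
    using fun_cong[OF h_add[OF zero zero], of M] by (simp add: series_module_simps(2))
  then show ?case using h_coeff_closed[OF zero] V.M.add.r_cancel_one' by simp
next
  case (insert x A)
  have closed: "c z \<odot>\<^bsub>P\<^esub> e z \<in> carrier P" if "z \<in> insert x A" for z using insert.prems that by auto
  have sum: "(\<Oplus>\<^bsub>P\<^esub>x\<in>A. c x \<odot>\<^bsub>P\<^esub> e x) \<in> carrier P" using closed by (intro P.finsum_closed) auto
  have smult: "(c z \<odot>\<^bsub>series_module Y V\<^esub> h (emb (e z))) M = h (emb (c z \<odot>\<^bsub>P\<^esub> e z)) M"
    if "z \<in> insert x A" for z
  proof -
    have "c z \<in> carrier K" "e z \<in> carrier P" using insert.prems that by auto
    then show ?thesis by (simp add: emb_closed h_smult emb_smult)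
  qed
  have "h (emb (\<Oplus>\<^bsub>P\<^esub>x\<in>insert x A. c x \<odot>\<^bsub>P\<^esub> e x)) M =
      h (emb (c x \<odot>\<^bsub>P\<^esub> e x)) M \<oplus>\<^bsub>V\<^esub> h (emb (\<Oplus>\<^bsub>P\<^esub>x\<in>A. c x \<odot>\<^bsub>P\<^esub> e x)) M"
    using insert closed sum emb_closed
    by (subst P.finsum_insert) (auto simp: emb_add h_add series_module_simps(2))
  also have "\<dots> = (\<Oplus>\<^bsub>V\<^esub>x\<in>insert x A. (c x \<odot>\<^bsub>series_module Y V\<^esub> h (emb (e x))) M)"
    using insert closed emb_closed h_coeff_closed smult
    by (subst V.M.finsum_insert) (auto simp: Pi_iff)
  finally show ?case .
qed

text \<open>Suppose that all coefficients of degree below \<open>size M\<close> vanish. At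
  \<open>M\<close> the image of the relation under \<open>h\<close> then reduces to the sum of
  \<open>c x M\<close> times the constant terms of \<open>h (emb (e x))\<close>. The same sum is the
  constant term of the image of the combination with constant coefficients \<open>c x M\<close>.
  That combination therefore lies in the first adic ideal, and independence modulo this ideal gives
  \<open>c x M = 0\<close>.\<close>

lemma independent_of_iso:
  assumes A: "finite A" and c: "c \<in> A \<rightarrow> carrier K" and e: "e \<in> A \<rightarrow> carrier P"
    and indep: "\<And>d x. (\<Oplus>\<^bsub>P\<^esub>x\<in>A. series_const (d x) \<odot>\<^bsub>P\<^esub> e x) \<in> In 1 \<Longrightarrow> x \<in> A \<Longrightarrow> d x = 0"
    and zero: "(\<Oplus>\<^bsub>P\<^esub>x\<in>A. c x \<odot>\<^bsub>P\<^esub> e x) = \<zero>\<^bsub>P\<^esub>"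
  shows "x \<in> A \<Longrightarrow> c x M = 0"
proof (induction "size M" arbitrary: M x rule: less_induct)
  case less
  interpret I: ideal "In 1" P by (rule In_ideal)
  have he: "h (emb (e x)) B \<in> carrier V" if "x \<in> A" for x B
    using that e by (intro h_coeff_closed emb_closed) auto
  have h0: "h (emb \<zero>\<^bsub>P\<^esub>) M = \<zero>\<^bsub>V\<^esub>"
    using h_emb_finsum[of "{}"] by simp
  have "\<zero>\<^bsub>V\<^esub> = (\<Oplus>\<^bsub>V\<^esub>x\<in>A. (c x \<odot>\<^bsub>series_module Y V\<^esub> h (emb (e x))) M)"
    using h_emb_finsum[OF A c e, of M] zero h0 by simp
  also have "\<dots> = (\<Oplus>\<^bsub>V\<^esub>x\<in>A. c x M \<odot>\<^bsub>V\<^esub> h (emb (e x)) {#})"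
  proof (rule V.M.finsum_cong'[OF HOL.refl])
    fix x assume x: "x \<in> A"
    have "(c x \<odot>\<^bsub>series_module Y V\<^esub> h (emb (e x))) M = c x M \<odot>\<^bsub>V\<^esub> h (emb (e x)) (M - M)"
    proof (rule series_smult_single[OF V])
      fix B assume "B \<subseteq># M" "B \<noteq> M"
      then have "size B < size M" by (simp add: mset_subset_size subset_mset.less_le)
      then show "c x B = 0" using less.hyps x by blast
    qed (use he x in auto)
    then show "(c x \<odot>\<^bsub>series_module Y V\<^esub> h (emb (e x))) M = c x M \<odot>\<^bsub>V\<^esub> h (emb (e x)) {#}" by simp
  qed (use he in auto)
  finally have rel: "(\<Oplus>\<^bsub>V\<^esub>x\<in>A. c x M \<odot>\<^bsub>V\<^esub> h (emb (e x)) {#}) = \<zero>\<^bsub>V\<^esub>" by simp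
  let ?b = "\<Oplus>\<^bsub>P\<^esub>x\<in>A. series_const (c x M) \<odot>\<^bsub>P\<^esub> e x"
  have b: "?b \<in> carrier P" using e by (intro P.finsum_closed) auto
  have "h (emb ?b) {#} = (\<Oplus>\<^bsub>V\<^esub>x\<in>A. (series_const (c x M) \<odot>\<^bsub>series_module Y V\<^esub> h (emb (e x))) {#})"
    using A e by (intro h_emb_finsum) auto
  also have "\<dots> = (\<Oplus>\<^bsub>V\<^esub>x\<in>A. c x M \<odot>\<^bsub>V\<^esub> h (emb (e x)) {#})"
  proof (rule V.M.finsum_cong'[OF HOL.refl])
    fix x assume x: "x \<in> A"
    have "(series_const (c x M) \<odot>\<^bsub>series_module Y V\<^esub> h (emb (e x))) {#} =
        (series_const (c x M) :: 'x series) {#} \<odot>\<^bsub>V\<^esub> h (emb (e x)) ({#} - {#})"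
      using he x by (intro series_smult_single[where A = "{#}" and f = "series_const (c x M)"] V) auto
    then show "(series_const (c x M) \<odot>\<^bsub>series_module Y V\<^esub> h (emb (e x))) {#} =
        c x M \<odot>\<^bsub>V\<^esub> h (emb (e x)) {#}" by (simp add: series_const_def)
  qed (use he in auto)
  finally have "emb ?b 1 = In 1"
    using no_constant_term_level_1[OF emb_closed[OF b]] rel by simp
  then have "?b \<in> In 1" using I.a_rcos_self[OF b] by (simp add: emb_def)
  then show ?case using indep[of "\<lambda>x. c x M" x] less.prems by simp
qed

end

lemma independent_of_topologically_free:
  assumes "topologically_free Y C"
    and "finite A" "c \<in> A \<rightarrow> carrier K" "e \<in> A \<rightarrow> carrier P"
    and "\<And>d x. (\<Oplus>\<^bsub>P\<^esub>x\<in>A. series_const (d x) \<odot>\<^bsub>P\<^esub> e x) \<in> In 1 \<Longrightarrow> x \<in> A \<Longrightarrow> d x = 0"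
    and "(\<Oplus>\<^bsub>P\<^esub>x\<in>A. c x \<odot>\<^bsub>P\<^esub> e x) = \<zero>\<^bsub>P\<^esub>" "x \<in> A"
  shows "c x = \<zero>\<^bsub>K\<^esub>"
proof -
  obtain V :: "(complex, nat \<Rightarrow> ('g list \<Rightarrow> 'x series) set set) module"
    where V: "module complex_ring V" "module_iso K C (series_module Y V) \<noteq> {}"
    using assms(1) unfolding topologically_free_def by blast
  then obtain h where "h \<in> module_iso K C (series_module Y V)" by blast
  from independent_of_iso[OF V(1) this assms(2-4) _ assms(6,7)] assms(5) show ?thesis by (simp add: series_simps fun_eq_iff)
qed

end

section \<open>Operators on functions\<close>

lemma series_const_coeff: "series_const c {#} = c"
  by (simp add: series_const_def)

text \<open>Additive operators on the complex functions on a set, with composition as product: in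
  this ring a group acting on the set is represented without forming its group algebra.\<close>

definition op_ring :: "(('a \<Rightarrow> complex) \<Rightarrow> 'a \<Rightarrow> complex) ring" where
  "op_ring = \<lparr>carrier = {\<phi>. \<forall>f g. \<phi> (\<lambda>x. f x + g x) = (\<lambda>x. \<phi> f x + \<phi> g x)},
     monoid.mult = (\<lambda>\<phi> \<psi>. \<phi> \<circ> \<psi>), one = id, zero = (\<lambda>f x. 0), add = (\<lambda>\<phi> \<psi> f x. \<phi> f x + \<psi> f x)\<rparr>"

lemma op_ring_simps:
  "\<phi> \<in> carrier op_ring \<longleftrightarrow> (\<forall>f g. \<phi> (\<lambda>x. f x + g x) = (\<lambda>x. \<phi> f x + \<phi> g x))"
  "\<phi> \<otimes>\<^bsub>op_ring\<^esub> \<psi> = \<phi> \<circ> \<psi>" "\<one>\<^bsub>op_ring\<^esub> = id" "\<zero>\<^bsub>op_ring\<^esub> = (\<lambda>f x. 0)"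
  "\<phi> \<oplus>\<^bsub>op_ring\<^esub> \<psi> = (\<lambda>f x. \<phi> f x + \<psi> f x)"
  by (simp_all add: op_ring_def)

lemma ring_op: "ring (op_ring :: (('a \<Rightarrow> complex) \<Rightarrow> 'a \<Rightarrow> complex) ring)"
proof (rule ringI)
  show "abelian_group (op_ring :: (('a \<Rightarrow> complex) \<Rightarrow> 'a \<Rightarrow> complex) ring)"
  proof (rule abelian_groupI)
    fix \<phi> :: "('a \<Rightarrow> complex) \<Rightarrow> 'a \<Rightarrow> complex" assume "\<phi> \<in> carrier op_ring"
    then show "\<exists>\<psi>\<in>carrier op_ring. \<psi> \<oplus>\<^bsub>op_ring\<^esub> \<phi> = \<zero>\<^bsub>op_ring\<^esub>"
      by (intro bexI[of _ "\<lambda>f x. - \<phi> f x"]) (auto simp: op_ring_simps)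
  qed (auto simp: op_ring_simps algebra_simps)
  show "monoid (op_ring :: (('a \<Rightarrow> complex) \<Rightarrow> 'a \<Rightarrow> complex) ring)"
    by (rule monoidI) (auto simp: op_ring_simps)
qed (auto simp: op_ring_simps)

lemma op_ring_minus:
  assumes "\<phi> \<in> carrier op_ring" "\<psi> \<in> carrier op_ring"
  shows "\<phi> \<ominus>\<^bsub>op_ring\<^esub> \<psi> = (\<lambda>f x. \<phi> f x - \<psi> f x)"
proof -
  interpret ring op_ring by (rule ring_op)
  have "\<ominus>\<^bsub>op_ring\<^esub> \<psi> = (\<lambda>f x. - \<psi> f x)"
    using assms by (intro minus_equality) (auto simp: op_ring_simps)
  then show ?thesis by (simp add: a_minus_def op_ring_simps)
qed

lemma finsum_op:
  assumes "\<phi> \<in> A \<rightarrow> carrier op_ring"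
  shows "finsum op_ring \<phi> A = (\<lambda>f x. \<Sum>a\<in>A. \<phi> a f x)"
proof -
  interpret ring op_ring by (rule ring_op)
  show ?thesis
  proof (cases "finite A")
    case True
    then show ?thesis using assms
    proof (induction A)
      case (insert a A)
      then have "finsum op_ring \<phi> (insert a A) = \<phi> a \<oplus>\<^bsub>op_ring\<^esub> finsum op_ring \<phi> A"
        by (intro finsum_insert) auto
      then show ?case using insert by (simp add: op_ring_simps)
    qed (simp add: op_ring_simps)
  qed (simp add: op_ring_simps)
qed

definition scalar_op :: "complex \<Rightarrow> ('a \<Rightarrow> complex) \<Rightarrow> 'a \<Rightarrow> complex" where
  "scalar_op c = (\<lambda>f x. c * f x)"

text \<open>Pulling back reverses composition, which matches \<open>fold\<close>: the leftmost
  letter of a word acts on the point before the others.\<close>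

definition pull_op :: "('a \<Rightarrow> 'a) \<Rightarrow> ('a \<Rightarrow> complex) \<Rightarrow> 'a \<Rightarrow> complex" where
  "pull_op \<beta> = (\<lambda>f x. f (\<beta> x))"

lemma scalar_op_closed [simp]: "scalar_op c \<in> carrier op_ring"
  by (simp add: op_ring_simps scalar_op_def distrib_left)

lemma pull_op_closed [simp]: "pull_op \<beta> \<in> carrier op_ring"
  by (simp add: op_ring_simps pull_op_def)

lemma pull_op_mult: "pull_op \<beta> \<otimes>\<^bsub>op_ring\<^esub> pull_op \<gamma> = pull_op (\<gamma> \<circ> \<beta>)"
  by (simp add: op_ring_simps pull_op_def comp_def)

lemma pull_op_id: "pull_op id = \<one>\<^bsub>op_ring\<^esub>"
  by (simp add: op_ring_simps pull_op_def fun_eq_iff)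

text \<open>The value at 0 of the sequence \<open>p(E) s\<close>, where \<open>E\<close> is the
  shift; a linear factor \<open>X - c\<close> acts as \<open>E - c\<close>.\<close>

definition poly_comb :: "complex poly \<Rightarrow> (nat \<Rightarrow> complex) \<Rightarrow> complex" where
  "poly_comb p s = (\<Sum>l\<le>degree p. coeff p l * s l)"

lemma poly_comb_eq: "degree p \<le> N \<Longrightarrow> poly_comb p s = (\<Sum>l\<le>N. coeff p l * s l)"
  unfolding poly_comb_def by (intro sum.mono_neutral_left) (auto simp: coeff_eq_0)

lemma poly_comb_linear_factor:
  "poly_comb ([:- c, 1:] * p) s = poly_comb p (\<lambda>l. s (Suc l)) - c * poly_comb p s"
proof -
  define N where "N = Suc (degree p)"
  have deg: "degree ([:- c, 1:] * p) \<le> N"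
    using degree_mult_le[of "[:- c, 1:]" p] by (simp add: N_def)
  have eq: "[:- c, 1:] * p = pCons 0 p - smult c p" by simp
  have "poly_comb ([:- c, 1:] * p) s = (\<Sum>l\<le>N. coeff (pCons 0 p) l * s l) - c * (\<Sum>l\<le>N. coeff p l * s l)"
    unfolding poly_comb_eq[OF deg] unfolding eq
    by (simp add: algebra_simps sum_subtractf sum_distrib_left)
  also have "(\<Sum>l\<le>N. coeff (pCons 0 p) l * s l) = poly_comb p (\<lambda>l. s (Suc l))"
    unfolding N_def sum.atMost_Suc_shift poly_comb_def by simp
  also have "(\<Sum>l\<le>N. coeff p l * s l) = poly_comb p s" by (intro poly_comb_eq[symmetric]) (simp add: N_def)
  finally show ?thesis .
qed

text \<open>All factors are polynomials in one operator, the pullback along \<open>\<beta>\<close>,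
  so their product is the product polynomial in that operator.\<close>

lemma lprod_linear_ops:
  "lprod op_ring (map (\<lambda>c f x. f (\<beta> x) - c * f x) cs) f x =
    poly_comb (\<Prod>c\<leftarrow>cs. [:- c, 1:]) (\<lambda>l. f ((\<beta> ^^ l) x))"
proof (induction cs arbitrary: x)
  case Nil
  show ?case by (simp add: op_ring_simps poly_comb_def)
next
  case (Cons c cs)
  then show ?case
    by (simp only: list.map lprod_Cons op_ring_simps(2) comp_apply prod_list.Cons poly_comb_linear_factor)
      (simp add: funpow_swap1)
qed

text \<open>Both sides are monic of degree \<open>n\<close> and vanish at the \<open>n\<close> roots
  of unity, so a nonzero difference would have degree below \<open>n\<close> and too many
  roots.\<close>

lemma prod_roots_of_unity:
  assumes "0 < n"
  shows "(\<Prod>k<n. [:- cis (2 * pi * real k / real n), 1:]) = monom 1 n - 1"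
proof -
  let ?\<omega> = "\<lambda>k. cis (2 * pi * real k / real n)"
  let ?p = "\<Prod>k<n. [:- ?\<omega> k, 1:]" and ?q = "monom 1 n - 1 :: complex poly"
  have bij: "bij_betw ?\<omega> {..<n} {z. z ^ n = 1}" by (rule bij_betw_roots_unity[OF assms])
  have deg_p: "degree ?p = n" by (subst degree_prod_eq_sum_degree) auto
  have lead_p: "coeff ?p n = 1" using lead_coeff_prod[of "\<lambda>k. [:- ?\<omega> k, 1:]" "{..<n}"] by (simp add: deg_p)
  have deg: "degree (?p - ?q) \<le> n"
    using deg_p by (intro degree_diff_le) (auto intro: degree_monom_le)
  show ?thesis
  proof (rule ccontr)
    assume ne: "?p \<noteq> ?q"
    have "coeff (?p - ?q) n = 0" using lead_p assms by simp
    then have "degree (?p - ?q) \<noteq> n" using ne leading_coeff_0_iff[of "?p - ?q"] by auto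
    then have lt: "degree (?p - ?q) < n" using deg by simp
    have "{z. z ^ n = 1} \<subseteq> {z. poly (?p - ?q) z = 0}"
    proof
      fix z :: complex assume z: "z \<in> {z. z ^ n = 1}"
      then obtain k where "k < n" "z = ?\<omega> k" using bij by (auto simp: bij_betw_def)
      then have "poly ?p z = 0" unfolding poly_prod by (intro prod_zero) auto
      then show "z \<in> {z. poly (?p - ?q) z = 0}" using z by (simp add: poly_monom)
    qed
    then have "card {z :: complex. z ^ n = 1} \<le> card {z. poly (?p - ?q) z = 0}"
      using ne by (intro card_mono poly_roots_finite) auto
    also have "\<dots> \<le> degree (?p - ?q)" using ne by (intro card_poly_roots_bound) auto
    also have "\<dots> < n" by (rule lt)
    finally show False using bij_betw_same_card[OF bij] by simp
  qed
qed

text \<open>The product is \<open>X^n - 1\<close> evaluated at the pullback along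
  \<open>\<beta>\<close>, and \<open>\<beta>\<close> has period \<open>n\<close>. For
  \<open>\<tau> = 0\<close> the polynomial relation of \<open>A_+(M)\<close> becomes
  \<open>(s_i s_j)^n = 1\<close> in the same way.\<close>

lemma lprod_roots_of_unity_op:
  assumes n: "0 < n" and \<beta>: "\<And>x. (\<beta> ^^ n) x = x"
  shows "lprod op_ring (map (\<lambda>k f x. f (\<beta> x) - cis (2 * pi * real (k mod n) / real n) * f x) [1..<Suc n])
    = \<zero>\<^bsub>op_ring\<^esub>"
proof (rule ext, rule ext)
  fix f x
  let ?c = "\<lambda>k. cis (2 * pi * real (k mod n) / real n)"
  \<comment> \<open>The factor with \<open>k = n\<close> belongs to the residue 0.\<close>
  have set1: "{1..<Suc n} = insert n {1..<n}" and set2: "{..<n} = insert 0 {1..<n}" using n by auto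
  have "(\<Prod>c\<leftarrow>map ?c [1..<Suc n]. [:- c, 1:]) = (\<Prod>k\<in>{1..<Suc n}. [:- ?c k, 1:])"
    by (simp add: prod.distinct_set_conv_list[symmetric] comp_def del: upt_Suc)
  also have "\<dots> = (\<Prod>k<n. [:- ?c k, 1:])" unfolding set1 set2 by simp
  also have "\<dots> = (\<Prod>k<n. [:- cis (2 * pi * real k / real n), 1:])" by (intro prod.cong) auto
  also have "\<dots> = monom 1 n - 1" by (rule prod_roots_of_unity[OF n])
  finally have prod: "(\<Prod>c\<leftarrow>map ?c [1..<Suc n]. [:- c, 1:]) = monom 1 n - 1" .
  have deg: "degree (monom 1 n - 1 :: complex poly) \<le> n"
    by (intro degree_diff_le) (auto intro: degree_monom_le)
  have "lprod op_ring (map (\<lambda>k f x. f (\<beta> x) - ?c k * f x) [1..<Suc n]) f x =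
      poly_comb (monom 1 n - 1) (\<lambda>l. f ((\<beta> ^^ l) x))"
    using lprod_linear_ops[of \<beta> "map ?c [1..<Suc n]" f x] unfolding prod by (simp add: comp_def del: upt_Suc)
  also have "\<dots> = (\<Sum>l\<le>n. (if l = n then f ((\<beta> ^^ l) x) else 0) - (if l = 0 then f ((\<beta> ^^ l) x) else 0))"
    unfolding poly_comb_eq[OF deg] using n
    by (intro sum.cong) (auto simp: coeff_1)
  also have "\<dots> = f ((\<beta> ^^ n) x) - f x"
    by (simp add: sum_subtractf)
  finally show "lprod op_ring (map (\<lambda>k f x. f (\<beta> x) - ?c k * f x) [1..<Suc n]) f x = \<zero>\<^bsub>op_ring\<^esub> f x"
    by (simp add: \<beta> op_ring_simps)
qed


section \<open>The algebra of pairs\<close>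

text \<open>One treatment of the presentation for both coefficient rings, \<open>R\<close> and the
  power series ring.\<close>

locale ap_algebra = coxeter_words I m
  for I :: "'i set" and m :: "'i \<Rightarrow> 'i \<Rightarrow> enat" +
  fixes K :: "'k ring" and t :: "'i \<Rightarrow> 'i \<Rightarrow> nat \<Rightarrow> 'k"
  assumes cring_K: "cring K"
    and t_closed: "\<And>i j k. (i, j, k) \<in> t_index I m \<Longrightarrow> t i j k \<in> carrier K"
begin

lemma t_mod_closed:
  "i \<in> I \<Longrightarrow> j \<in> I \<Longrightarrow> i \<noteq> j \<Longrightarrow> m i j = enat n \<Longrightarrow> t i j (k mod n) \<in> carrier K"
  using m_ge_2[of i j n] by (intro t_closed) (simp add: t_index_def)

lemma Ap_relations_closed: "Ap_relations K t I m \<subseteq> carrier (free_alg K (Ap_letters I))"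
proof -
  interpret free_algebra K "Ap_letters I" by (intro free_algebra.intro cring_K)
  interpret F: ring F by (rule ring_F)
  have gen: "gen K (i, j) \<in> carrier F" if "i \<in> I" "j \<in> I" "i \<noteq> j" for i j
    using that by (intro gen_closed) (simp add: Ap_letters_def)
  have "c \<odot>\<^bsub>F\<^esub> \<one>\<^bsub>F\<^esub> \<in> carrier F" if "c \<in> carrier K" for c using that by (simp add: smult_eq_mult)
  then have "lprod F (map (\<lambda>k. gen K (i, j) \<ominus>\<^bsub>F\<^esub> t i j (k mod n) \<odot>\<^bsub>F\<^esub> \<one>\<^bsub>F\<^esub>) [1..<Suc n]) \<in> carrier F"
    if "i \<in> I" "j \<in> I" "i \<noteq> j" "m i j = enat n" for i j n
    using that gen t_mod_closed by (intro F.lprod_closed) (auto simp del: upt_Suc)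
  then show ?thesis
    using gen unfolding Ap_relations_def Let_def by (auto simp del: upt_Suc)
qed

sublocale Ap: presented_algebra K "Ap_letters I" "Ap_relations K t I m"
  by (intro presented_algebra.intro free_algebra.intro presented_algebra_axioms.intro cring_K Ap_relations_closed)

text \<open>With \<open>pair i i = 1\<close> included, the inverse and the triangle relations merge
  into the single rule \<open>a_ij a_jp = a_ip\<close> for all indices.\<close>

definition pair :: "'i \<Rightarrow> 'i \<Rightarrow> (('i \<times> 'i) list \<Rightarrow> 'k) set" where
  "pair i j = (if i = j then \<one>\<^bsub>Ap.P\<^esub> else Ap.cls (gen K (i, j)))"

lemma letters_iff: "(i, j) \<in> Ap_letters I \<longleftrightarrow> i \<in> I \<and> j \<in> I \<and> i \<noteq> j"
  by (auto simp: Ap_letters_def)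

lemma gen_pair_closed: "i \<in> I \<Longrightarrow> j \<in> I \<Longrightarrow> i \<noteq> j \<Longrightarrow> gen K (i, j) \<in> carrier Ap.F"
  by (intro Ap.gen_closed) (simp add: letters_iff)

lemma pair_closed [simp]: "i \<in> I \<Longrightarrow> j \<in> I \<Longrightarrow> pair i j \<in> carrier Ap.P"
  using gen_pair_closed by (simp add: pair_def)

lemma pair_inv: "i \<in> I \<Longrightarrow> j \<in> I \<Longrightarrow> pair i j \<otimes>\<^bsub>Ap.P\<^esub> pair j i = \<one>\<^bsub>Ap.P\<^esub>"
proof (cases "i = j")
  case False
  assume ij: "i \<in> I" "j \<in> I"
  then have "gen K (i, j) \<otimes>\<^bsub>Ap.F\<^esub> gen K (j, i) \<ominus>\<^bsub>Ap.F\<^esub> \<one>\<^bsub>Ap.F\<^esub> \<in> Ap_relations K t I m"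
    using False by (auto simp: Ap_relations_def Let_def)
  from Ap.cls_Rel[OF this] show ?thesis
    using ij False gen_pair_closed
    by (simp add: pair_def Ap.cls_minus Ap.cls_mult Ap.cls_one Ap.P.minus_eq_zero_iff)
qed (simp add: pair_def)

lemma pair_mult:
  assumes "i \<in> I" "j \<in> I" "p \<in> I"
  shows "pair i j \<otimes>\<^bsub>Ap.P\<^esub> pair j p = pair i p"
proof -
  consider "i = j" | "j = p" | "i = p" | "i \<noteq> j" "j \<noteq> p" "i \<noteq> p" by blast
  then show ?thesis
  proof cases
    case 1 then show ?thesis using assms pair_closed[of j p] by (simp add: pair_def del: pair_closed)
  next
    case 2 then show ?thesis using assms pair_closed[of i j] by (simp add: pair_def del: pair_closed)
  next
    case 3 then show ?thesis using assms pair_inv[of i j] by (simp add: pair_def[of p p])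
  next
    case 4
    then have "gen K (i, j) \<otimes>\<^bsub>Ap.F\<^esub> gen K (j, p) \<otimes>\<^bsub>Ap.F\<^esub> gen K (p, i) \<ominus>\<^bsub>Ap.F\<^esub> \<one>\<^bsub>Ap.F\<^esub> \<in> Ap_relations K t I m"
      using assms unfolding Ap_relations_def Let_def by blast
    from Ap.cls_Rel[OF this] have "pair i j \<otimes>\<^bsub>Ap.P\<^esub> pair j p \<otimes>\<^bsub>Ap.P\<^esub> pair p i = \<one>\<^bsub>Ap.P\<^esub>"
      using assms 4 gen_pair_closed
      by (simp add: pair_def Ap.cls_minus Ap.cls_mult Ap.cls_one Ap.P.minus_eq_zero_iff)
    then have "pair i j \<otimes>\<^bsub>Ap.P\<^esub> pair j p \<otimes>\<^bsub>Ap.P\<^esub> (pair p i \<otimes>\<^bsub>Ap.P\<^esub> pair i p) = pair i p"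
      using assms by (simp add: Ap.P.m_assoc[symmetric])
    then show ?thesis using assms pair_inv[of p i] by simp
  qed
qed

lemma pair_rel:
  assumes "i \<in> I" "j \<in> I" "i \<noteq> j" "m i j = enat n"
  shows "lprod Ap.P (map (\<lambda>k. pair i j \<ominus>\<^bsub>Ap.P\<^esub> t i j (k mod n) \<odot>\<^bsub>Ap.P\<^esub> \<one>\<^bsub>Ap.P\<^esub>) [1..<Suc n]) = \<zero>\<^bsub>Ap.P\<^esub>"
proof -
  let ?f = "\<lambda>k. gen K (i, j) \<ominus>\<^bsub>Ap.F\<^esub> t i j (k mod n) \<odot>\<^bsub>Ap.F\<^esub> \<one>\<^bsub>Ap.F\<^esub>"
  have sm: "c \<odot>\<^bsub>Ap.F\<^esub> \<one>\<^bsub>Ap.F\<^esub> \<in> carrier Ap.F" if "c \<in> carrier K" for c using that by (simp add: Ap.smult_eq_mult)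
  have f: "?f k \<in> carrier Ap.F" "Ap.cls (?f k) = pair i j \<ominus>\<^bsub>Ap.P\<^esub> t i j (k mod n) \<odot>\<^bsub>Ap.P\<^esub> \<one>\<^bsub>Ap.P\<^esub>" for k
    using assms gen_pair_closed[of i j] sm[OF t_mod_closed[of i j n k]] t_mod_closed[of i j n k]
      Ap.smult_cls[of "t i j (k mod n)" "\<one>\<^bsub>Ap.F\<^esub>"]
    by (simp_all add: pair_def Ap.cls_minus Ap.cls_one)
  have "lprod Ap.F (map ?f [1..<Suc n]) \<in> Ap_relations K t I m"
    using assms unfolding Ap_relations_def Let_def by blast
  from Ap.cls_Rel[OF this] show ?thesis
    using f(1) by (subst (asm) Ap.cls_lprod) (auto simp: comp_def f(2) simp del: upt_Suc)
qed

fun pair_word :: "'i list \<Rightarrow> (('i \<times> 'i) list \<Rightarrow> 'k) set" where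
  "pair_word [] = \<one>\<^bsub>Ap.P\<^esub>"
| "pair_word [i] = undefined"
| "pair_word (i # j # w) = pair i j \<otimes>\<^bsub>Ap.P\<^esub> pair_word w"

lemma pair_word_closed: "w \<in> lists I \<Longrightarrow> even (length w) \<Longrightarrow> pair_word w \<in> carrier Ap.P"
  by (induction w rule: pair_word.induct) auto

text \<open>The universal property, phrased for a family \<open>\<alpha>\<close> on all pairs of
  indices: \<open>refl\<close> and \<open>mult\<close> together cover the inverse and the triangle
  relations.\<close>

lemma pair_lift:
  assumes B: "ring B" and \<eta>: "\<eta> \<in> ring_hom K B"
    and \<alpha>: "\<And>i j. i \<in> I \<Longrightarrow> j \<in> I \<Longrightarrow> \<alpha> i j \<in> carrier B"
    and comm: "\<And>c i j. c \<in> carrier K \<Longrightarrow> i \<in> I \<Longrightarrow> j \<in> I \<Longrightarrow> \<eta> c \<otimes>\<^bsub>B\<^esub> \<alpha> i j = \<alpha> i j \<otimes>\<^bsub>B\<^esub> \<eta> c"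
    and refl: "\<And>i. i \<in> I \<Longrightarrow> \<alpha> i i = \<one>\<^bsub>B\<^esub>"
    and mult: "\<And>i j p. i \<in> I \<Longrightarrow> j \<in> I \<Longrightarrow> p \<in> I \<Longrightarrow> \<alpha> i j \<otimes>\<^bsub>B\<^esub> \<alpha> j p = \<alpha> i p"
    and rel: "\<And>i j n. i \<in> I \<Longrightarrow> j \<in> I \<Longrightarrow> i \<noteq> j \<Longrightarrow> m i j = enat n \<Longrightarrow>
      lprod B (map (\<lambda>k. \<alpha> i j \<ominus>\<^bsub>B\<^esub> \<eta> (t i j (k mod n))) [1..<Suc n]) = \<zero>\<^bsub>B\<^esub>"
  obtains h where "h \<in> ring_hom Ap.P B" "\<And>i j. i \<in> I \<Longrightarrow> j \<in> I \<Longrightarrow> h (pair i j) = \<alpha> i j"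
    "\<And>c Z. c \<in> carrier K \<Longrightarrow> Z \<in> carrier Ap.P \<Longrightarrow> h (c \<odot>\<^bsub>Ap.P\<^esub> Z) = \<eta> c \<otimes>\<^bsub>B\<^esub> h Z"
proof -
  interpret B: ring B by (rule B)
  let ?\<gamma> = "\<lambda>(i, j). \<alpha> i j"
  have E: "free_eval K (Ap_letters I) B \<eta> ?\<gamma>"
    using \<alpha> comm by (intro free_eval.intro free_eval_axioms.intro Ap.free_algebra_axioms B \<eta>)
      (auto simp: letters_iff)
  interpret E: free_eval K "Ap_letters I" B \<eta> ?\<gamma> by (rule E)
  note sub = ring_hom_sub[OF E.ev_hom Ap.ring_F B]
  have one: "E.ev \<one>\<^bsub>Ap.F\<^esub> = \<one>\<^bsub>B\<^esub>" by (rule ring_hom_one[OF E.ev_hom])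
  have gen: "E.ev (gen K (i, j)) = \<alpha> i j" if "i \<in> I" "j \<in> I" "i \<noteq> j" for i j
    using E.ev_gen[of "(i, j)"] that by (simp add: letters_iff)
  have ker: "E.ev r = \<zero>\<^bsub>B\<^esub>" if r: "r \<in> Ap_relations K t I m" for r
  proof -
    consider i j where "i \<in> I" "j \<in> I" "i \<noteq> j" "r = gen K (i, j) \<otimes>\<^bsub>Ap.F\<^esub> gen K (j, i) \<ominus>\<^bsub>Ap.F\<^esub> \<one>\<^bsub>Ap.F\<^esub>"
      | i j n where "i \<in> I" "j \<in> I" "i \<noteq> j" "m i j = enat n"
        "r = lprod Ap.F (map (\<lambda>k. gen K (i, j) \<ominus>\<^bsub>Ap.F\<^esub> t i j (k mod n) \<odot>\<^bsub>Ap.F\<^esub> \<one>\<^bsub>Ap.F\<^esub>) [1..<Suc n])"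
      | i j p where "i \<in> I" "j \<in> I" "p \<in> I" "i \<noteq> j" "j \<noteq> p" "i \<noteq> p"
        "r = gen K (i, j) \<otimes>\<^bsub>Ap.F\<^esub> gen K (j, p) \<otimes>\<^bsub>Ap.F\<^esub> gen K (p, i) \<ominus>\<^bsub>Ap.F\<^esub> \<one>\<^bsub>Ap.F\<^esub>"
      using r unfolding Ap_relations_def Let_def by blast
    then show ?thesis
    proof cases
      case 1
      then show ?thesis
        using gen_pair_closed \<alpha> by (simp add: sub E.ev_mult gen one mult refl B.minus_eq_zero_iff)
    next
      case 2
      let ?f = "\<lambda>k. gen K (i, j) \<ominus>\<^bsub>Ap.F\<^esub> t i j (k mod n) \<odot>\<^bsub>Ap.F\<^esub> \<one>\<^bsub>Ap.F\<^esub>"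
      have f: "?f k \<in> carrier Ap.F" "E.ev (?f k) = \<alpha> i j \<ominus>\<^bsub>B\<^esub> \<eta> (t i j (k mod n))" for k
        using 2 gen_pair_closed[of i j] t_mod_closed[of i j n k]
        by (simp_all add: Ap.smult_eq_mult sub gen)
      then have "E.ev r = lprod B (map (E.ev \<circ> ?f) [1..<Suc n])"
        unfolding 2(5) by (subst ring_hom_lprod[OF E.ev_hom Ap.ring_F]) (auto simp del: upt_Suc)
      also have "\<dots> = \<zero>\<^bsub>B\<^esub>" unfolding comp_def f(2) using 2 by (intro rel) auto
      finally show ?thesis .
    next
      case 3
      then show ?thesis
        using gen_pair_closed \<alpha> by (simp add: sub E.ev_mult gen one mult refl B.minus_eq_zero_iff)
    qed
  qed
  obtain h where h: "h \<in> ring_hom Ap.P B" "\<And>g. g \<in> Ap_letters I \<Longrightarrow> h (Ap.cls (gen K g)) = ?\<gamma> g"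
    "\<And>c Z. c \<in> carrier K \<Longrightarrow> Z \<in> carrier Ap.P \<Longrightarrow> h (c \<odot>\<^bsub>Ap.P\<^esub> Z) = \<eta> c \<otimes>\<^bsub>B\<^esub> h Z"
    by (rule E.pres_lift[OF Ap.presented_algebra_axioms ker], assumption) (rule that)
  have "h (pair i j) = \<alpha> i j" if "i \<in> I" "j \<in> I" for i j
    using that h(2)[of "(i, j)"] ring_hom_one[OF h(1)] by (simp add: pair_def letters_iff refl)
  then show ?thesis using that h by blast
qed

end

lemma (in coxeter_words) ap_algebra_R: "ap_algebra I m (R_ring I m) (R_t I m)"
proof -
  have "R_t I m i j k \<in> carrier (R_ring I m)" if "(i, j, k) \<in> t_index I m" for i j k
    using Rt_closed[of "T i j k"] that by (simp add: R_t_def R_fields t_letters_iff)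
  then show ?thesis
    by (intro ap_algebra.intro ap_algebra_axioms.intro coxeter_words_axioms cring_R)
qed

lemma (in coxeter_words) ap_algebra_hat: "ap_algebra I m (R_hat I m) (t_hat I m)"
proof -
  have "t_hat I m i j k \<in> carrier (R_hat I m)" if "(i, j, k) \<in> t_index I m" for i j k
    using t_hat_closed[of "T i j k"] that by (simp add: t_letters_iff)
  then show ?thesis
    by (intro ap_algebra.intro ap_algebra_axioms.intro coxeter_words_axioms cring_series)
qed

section \<open>The regular representation of the Coxeter group\<close>

context coxeter_words
begin

abbreviation wcls :: "'i list \<Rightarrow> 'i list set" where
  "wcls u \<equiv> coxeter_cong I m `` {u}"

lemma wcls_eq_iff: "u \<in> lists I \<Longrightarrow> v \<in> lists I \<Longrightarrow> wcls u = wcls v \<longleftrightarrow> u \<approx> v"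
  unfolding eqv_def by (rule eq_equiv_class_iff[OF equiv_cong])

text \<open>Right multiplication by \<open>s_i\<close> on the group. Sets of words that are not
  group elements are fixed, so that the Coxeter relations hold for these maps on the whole
  type.\<close>

definition step :: "'i \<Rightarrow> 'i list set \<Rightarrow> 'i list set" where
  "step i Z = (if Z \<in> lists I // coxeter_cong I m then \<Union>u\<in>Z. wcls (u @ [i]) else Z)"

lemma step_wcls:
  assumes "i \<in> I" "v \<in> lists I"
  shows "step i (wcls v) = wcls (v @ [i])"
proof -
  have "(\<lambda>u. wcls (u @ [i])) respects coxeter_cong I m"
  proof (rule congruentI)
    fix u u' assume "(u, u') \<in> coxeter_cong I m"
    then have "u \<approx> u'" by (simp add: eqv_def)
    then have "u @ [i] \<approx> u' @ [i]" using assms by (intro eqv_append eqv_refl) auto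
    then show "wcls (u @ [i]) = wcls (u' @ [i])" using wcls_eq_iff eqv_lists by blast
  qed
  then have "(\<Union>u\<in>wcls v. wcls (u @ [i])) = wcls (v @ [i])"
    using UN_equiv_class[OF equiv_cong] assms(2) by blast
  then show ?thesis using assms by (simp add: step_def quotientI)
qed

lemma steps_wcls: "u \<in> lists I \<Longrightarrow> v \<in> lists I \<Longrightarrow> fold step u (wcls v) = wcls (v @ u)"
  by (induction u arbitrary: v) (auto simp: step_wcls)

lemma steps_trivial:
  assumes "u \<approx> []"
  shows "fold step u Z = Z"
proof (cases "Z \<in> lists I // coxeter_cong I m")
  case True
  then obtain v where v: "v \<in> lists I" "Z = wcls v" unfolding quotient_def by blast
  have u: "u \<in> lists I" using eqv_lists[OF assms] by simp
  have "v @ u \<approx> v @ []" using assms v by (intro eqv_append eqv_refl)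
  then show ?thesis using v u wcls_eq_iff[of "v @ u" v] by (simp add: steps_wcls)
next
  case False
  have "fold step w Z = Z" for w by (induction w) (auto simp: step_def False)
  then show ?thesis by blast
qed

interpretation H: ap_algebra I m "R_hat I m" "t_hat I m" by (rule ap_algebra_hat)

text \<open>The reduction modulo the maximal ideal, realised by operators. A power series acts
  through its constant term, which for \<open>t_hat\<close> is a root of unity, and
  \<open>a_ij\<close> acts as the pullback along right multiplication by \<open>s_i s_j\<close>. The
  polynomial relation holds because the \<open>n\<close>-th power of \<open>s_i s_j\<close> is
  trivial.\<close>

lemma regular_representation:
  obtains \<epsilon> where "\<epsilon> \<in> ring_hom H.Ap.P op_ring"
    "\<And>w. w \<in> lists I \<Longrightarrow> even (length w) \<Longrightarrow> \<epsilon> (H.pair_word w) = pull_op (fold step w)"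
    "\<And>c Z. c \<in> carrier (R_hat I m) \<Longrightarrow> Z \<in> carrier H.Ap.P \<Longrightarrow>
      \<epsilon> (c \<odot>\<^bsub>H.Ap.P\<^esub> Z) = scalar_op (c {#}) \<otimes>\<^bsub>op_ring\<^esub> \<epsilon> Z"
proof -
  let ?\<eta> = "\<lambda>c :: ('i \<times> 'i \<times> nat) series. scalar_op (c {#}) :: ('i list set \<Rightarrow> complex) \<Rightarrow> _"
  have \<eta>: "?\<eta> \<in> ring_hom (R_hat I m) op_ring"
    by (intro ring_hom_memI scalar_op_closed)
      (auto simp: series_simps(2-) op_ring_simps(2-) scalar_op_def fun_eq_iff distrib_right)
  show ?thesis
  proof (rule H.pair_lift[OF ring_op \<eta>, of "\<lambda>i j. pull_op (fold step [i, j])"])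
    fix i j n assume ij: "i \<in> I" "j \<in> I" "i \<noteq> j" "m i j = enat n"
    have n: "2 \<le> n" using m_ge_2 ij by blast
    let ?\<beta> = "fold step [i, j]"
    have root: "t_hat I m i j (k mod n) {#} = cis (2 * pi * real (k mod n) / real n)" for k
    proof -
      have l: "T i j (k mod n) \<in> t_letters I m" using ij n by (simp add: t_letters_iff t_index_def)
      show ?thesis
        using t_hat_eq[OF l] ij n
        by (simp add: series_const_mult var_exp_def letter_root_def cis_conv_exp mult_ac)
    qed
    have "fold step (concat (replicate l [i, j])) x = (?\<beta> ^^ l) x" for l x
      by (induction l arbitrary: x) (auto simp: funpow_swap1)
    moreover have "concat (replicate n [i, j]) \<approx> []"
      using eqv_powerI[of "[]" "[]" i j n] ij by simp
    ultimately have per: "(?\<beta> ^^ n) x = x" for x using steps_trivial by metis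
    have "(\<lambda>k. pull_op ?\<beta> \<ominus>\<^bsub>op_ring\<^esub> ?\<eta> (t_hat I m i j (k mod n))) =
        (\<lambda>k f x. f (?\<beta> x) - cis (2 * pi * real (k mod n) / real n) * f x)"
      unfolding root op_ring_minus[OF pull_op_closed scalar_op_closed]
      by (simp add: pull_op_def scalar_op_def)
    then show "lprod op_ring (map (\<lambda>k. pull_op ?\<beta> \<ominus>\<^bsub>op_ring\<^esub> ?\<eta> (t_hat I m i j (k mod n))) [1..<Suc n])
        = \<zero>\<^bsub>op_ring\<^esub>"
      using lprod_roots_of_unity_op[of n ?\<beta>] n per by simp
  next
    fix i assume "i \<in> I"
    then have "fold step [i, i] = id" using steps_trivial[OF eqv_square] by auto
    then show "pull_op (fold step [i, i]) = \<one>\<^bsub>op_ring\<^esub>" by (simp only: pull_op_id)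
  next
    fix i j p assume ijp: "i \<in> I" "j \<in> I" "p \<in> I"
    have "fold step [j, p] \<circ> fold step [i, j] = fold step [i, p]"
      using steps_trivial[OF eqv_square[OF ijp(2)]] by (auto simp: fun_eq_iff)
    then show "pull_op (fold step [i, j]) \<otimes>\<^bsub>op_ring\<^esub> pull_op (fold step [j, p]) =
        pull_op (fold step [i, p])"
      unfolding pull_op_mult by (rule arg_cong)
  next
    fix h assume h: "h \<in> ring_hom H.Ap.P op_ring"
      "\<And>i j. i \<in> I \<Longrightarrow> j \<in> I \<Longrightarrow> h (H.pair i j) = pull_op (fold step [i, j])"
      "\<And>c Z. c \<in> carrier (R_hat I m) \<Longrightarrow> Z \<in> carrier H.Ap.P \<Longrightarrow>
        h (c \<odot>\<^bsub>H.Ap.P\<^esub> Z) = scalar_op (c {#}) \<otimes>\<^bsub>op_ring\<^esub> h Z"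
    have "h (H.pair_word w) = pull_op (fold step w)" if "w \<in> lists I" "even (length w)" for w
      using that
    proof (induction w rule: H.pair_word.induct)
      case 1
      show ?case using ring_hom_one[OF h(1)] by (simp add: pull_op_id[symmetric] id_def)
    next
      case (3 i j w)
      then have "h (H.pair_word (i # j # w)) = pull_op (fold step [i, j]) \<otimes>\<^bsub>op_ring\<^esub> pull_op (fold step w)"
        using ring_hom_mult[OF h(1), of "H.pair i j" "H.pair_word w"] h(2) H.pair_word_closed[of w] by simp
      then show ?case by (simp add: pull_op_mult comp_def)
    qed simp
    then show ?thesis using that h by blast
  qed (auto simp: op_ring_simps scalar_op_def pull_op_def)
qed

lemma finite_tau_vars: "finite (tau_vars I m)"
proof -
  have "finite I" using cox by (simp add: coxeter_matrix_def)
  then have fin: "finite (SIGMA i:I. SIGMA j:I. {..<the_enat (m i j)})" by (intro finite_SigmaI) auto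
  have "tau_vars I m \<subseteq> (SIGMA i:I. SIGMA j:I. {..<the_enat (m i j)})"
    by (auto simp: tau_vars_def t_index_def)
  then show ?thesis using fin by (rule finite_subset)
qed

text \<open>What has to be supplied is the independence modulo the first adic ideal. The regular
  representation kills that ideal, and in it the words act as translations by distinct group
  elements.\<close>

theorem pair_words_independent_hat:
  assumes flat: "topologically_free (tau_vars I m) (Ap_hat I m)"
    and A: "finite A" and c: "c \<in> A \<rightarrow> carrier (R_hat I m)"
    and w: "\<And>x. x \<in> A \<Longrightarrow> w x \<in> lists I \<and> even (length (w x))"
    and distinct: "\<And>x y. x \<in> A \<Longrightarrow> y \<in> A \<Longrightarrow> w x \<approx> w y \<Longrightarrow> x = y"
    and zero: "(\<Oplus>\<^bsub>H.Ap.P\<^esub>x\<in>A. c x \<odot>\<^bsub>H.Ap.P\<^esub> H.pair_word (w x)) = \<zero>\<^bsub>H.Ap.P\<^esub>" and x: "x \<in> A"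
  shows "c x = \<zero>\<^bsub>R_hat I m\<^esub>"
proof -
  interpret SA: series_algebra "tau_vars I m" "Ap_letters I" "Ap_relations (R_hat I m) (t_hat I m) I m"
    by (intro series_algebra.intro series_algebra_axioms.intro H.Ap.presented_algebra_axioms finite_tau_vars)
  interpret Op: ring op_ring by (rule ring_op)
  obtain \<epsilon> where \<epsilon>: "\<epsilon> \<in> ring_hom H.Ap.P op_ring"
    "\<And>w. w \<in> lists I \<Longrightarrow> even (length w) \<Longrightarrow> \<epsilon> (H.pair_word w) = pull_op (fold step w)"
    "\<And>c Z. c \<in> carrier (R_hat I m) \<Longrightarrow> Z \<in> carrier H.Ap.P \<Longrightarrow>
      \<epsilon> (c \<odot>\<^bsub>H.Ap.P\<^esub> Z) = scalar_op (c {#}) \<otimes>\<^bsub>op_ring\<^esub> \<epsilon> Z"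
    by (rule regular_representation) (rule that)
  have wc: "H.pair_word (w x) \<in> carrier H.Ap.P" if "x \<in> A" for x
    using w[OF that] H.pair_word_closed by blast
  have "ideal (a_kernel H.Ap.P op_ring \<epsilon>) H.Ap.P"
    by (rule ring_hom_ring.kernel_is_ideal[OF ring_hom_ringI2[OF H.Ap.ring_P ring_op \<epsilon>(1)]])
  moreover have "(\<lambda>f. f \<odot>\<^bsub>H.Ap.P\<^esub> \<one>\<^bsub>H.Ap.P\<^esub>) ` series_filtration (tau_vars I m) 1 \<subseteq> a_kernel H.Ap.P op_ring \<epsilon>"
  proof
    fix a assume "a \<in> (\<lambda>f. f \<odot>\<^bsub>H.Ap.P\<^esub> \<one>\<^bsub>H.Ap.P\<^esub>) ` series_filtration (tau_vars I m) 1"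
    then obtain f where f: "f \<in> carrier (R_hat I m)" "f {#} = 0" "a = f \<odot>\<^bsub>H.Ap.P\<^esub> \<one>\<^bsub>H.Ap.P\<^esub>"
      by (auto simp: series_filtration_def)
    then have "\<epsilon> a = \<zero>\<^bsub>op_ring\<^esub>" by (simp add: \<epsilon>(3) scalar_op_def op_ring_simps comp_def)
    then show "a \<in> a_kernel H.Ap.P op_ring \<epsilon>" using f by (simp add: a_kernel_def')
  qed
  ultimately have ker: "SA.In 1 \<subseteq> a_kernel H.Ap.P op_ring \<epsilon>"
    unfolding adic_ideal_def by (rule H.Ap.P.genideal_minimal)
  have indep: "d x = 0"
    if b: "(\<Oplus>\<^bsub>H.Ap.P\<^esub>x\<in>A. series_const (d x) \<odot>\<^bsub>H.Ap.P\<^esub> H.pair_word (w x)) \<in> SA.In 1" and x: "x \<in> A"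
    for d x
  proof -
    have "\<zero>\<^bsub>op_ring\<^esub> = \<epsilon> (\<Oplus>\<^bsub>H.Ap.P\<^esub>x\<in>A. series_const (d x) \<odot>\<^bsub>H.Ap.P\<^esub> H.pair_word (w x))"
      using b ker by (auto simp: a_kernel_def')
    also have "\<dots> = (\<Oplus>\<^bsub>op_ring\<^esub>x\<in>A. \<epsilon> (series_const (d x) \<odot>\<^bsub>H.Ap.P\<^esub> H.pair_word (w x)))"
      using wc by (subst ring_hom_finsum[OF \<epsilon>(1) H.Ap.ring_P ring_op]) (auto simp: comp_def)
    also have "\<dots> = (\<Oplus>\<^bsub>op_ring\<^esub>x\<in>A. scalar_op (d x) \<otimes>\<^bsub>op_ring\<^esub> pull_op (fold step (w x)))"
    proof (rule Op.finsum_cong'[OF HOL.refl])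
      fix x assume "x \<in> A"
      then show "\<epsilon> (series_const (d x) \<odot>\<^bsub>H.Ap.P\<^esub> H.pair_word (w x)) =
          scalar_op (d x) \<otimes>\<^bsub>op_ring\<^esub> pull_op (fold step (w x))"
        using \<epsilon>(3)[OF series_const_closed wc, of x "d x"] \<epsilon>(2)[of "w x"] w[of x]
        by (simp add: series_const_coeff)
    qed simp
    also have "\<dots> = (\<lambda>f Z. \<Sum>x\<in>A. d x * f (fold step (w x) Z))"
      by (subst finsum_op, intro Pi_I Op.m_closed scalar_op_closed pull_op_closed)
        (simp add: op_ring_simps(2) scalar_op_def pull_op_def)
    finally have "0 = (\<Sum>y\<in>A. d y * f (fold step (w y) Z))" for f Z
      by (simp add: op_ring_simps fun_eq_iff)
    \<comment> \<open>The indicator function of the class of \<open>w x\<close>, taken at the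
      identity, isolates \<open>d x\<close>: every other word of the family moves the identity to a
      different class.\<close>
    from this[of "\<lambda>Z. if Z = wcls (w x) then 1 else 0" "wcls []"]
    have "0 = (\<Sum>y\<in>A. d y * (if wcls (w y) = wcls (w x) then 1 else 0))"
      using w by (simp add: steps_wcls)
    also have "\<dots> = (\<Sum>y\<in>A. if y = x then d y else 0)"
      using w distinct x wcls_eq_iff eqv_refl by (intro sum.cong) auto
    also have "\<dots> = d x" using A x by simp
    finally show ?thesis by simp
  qed
  show ?thesis
  proof (rule SA.independent_of_topologically_free[where e = "\<lambda>x. H.pair_word (w x)" and c = c, OF _ A])
    show "topologically_free (tau_vars I m) SA.C"
      using flat by (simp add: Ap_hat_def Ap_over_def)
  qed (use c wc indep zero x in auto)
qed

interpretation Q: ap_algebra I m "R_ring I m" "R_t I m" by (rule ap_algebra_R)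

text \<open>Base change along the embedding \<open>\<rho>\<close> induces a map of the presented
  algebras that sends each word to the corresponding word. A relation over \<open>R\<close> thus
  becomes one over the power series ring, and injectivity of \<open>\<rho>\<close> brings the
  vanishing of the coefficients back.\<close>

theorem pair_words_independent:
  assumes flat: "topologically_free (tau_vars I m) (Ap_hat I m)"
    and A: "finite A" and c: "c \<in> A \<rightarrow> carrier (R_ring I m)"
    and w: "\<And>x. x \<in> A \<Longrightarrow> w x \<in> lists I \<and> even (length (w x))"
    and distinct: "\<And>x y. x \<in> A \<Longrightarrow> y \<in> A \<Longrightarrow> w x \<approx> w y \<Longrightarrow> x = y"
    and zero: "(\<Oplus>\<^bsub>Q.Ap.P\<^esub>x\<in>A. c x \<odot>\<^bsub>Q.Ap.P\<^esub> Q.pair_word (w x)) = \<zero>\<^bsub>Q.Ap.P\<^esub>" and x: "x \<in> A"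
  shows "c x = \<zero>\<^bsub>R_ring I m\<^esub>"
proof -
  obtain \<rho> where \<rho>: "\<rho> \<in> ring_hom (R_ring I m) (R_hat I m)"
    "\<And>i j k. (i, j, k) \<in> t_index I m \<Longrightarrow> \<rho> (R_t I m i j k) = t_hat I m i j k"
    "\<And>c. c \<in> carrier (R_ring I m) \<Longrightarrow> \<rho> c = \<zero>\<^bsub>R_hat I m\<^esub> \<Longrightarrow> c = \<zero>\<^bsub>R_ring I m\<^esub>"
    by (rule rho_exists) (rule that)
  have \<rho>c: "\<rho> c \<in> carrier (R_hat I m)" if "c \<in> carrier (R_ring I m)" for c
    by (rule ring_hom_closed[OF \<rho>(1) that])
  let ?\<eta> = "\<lambda>c. H.Ap.cls (H.Ap.mono (\<rho> c) [])"
  have \<eta>: "?\<eta> \<in> ring_hom (R_ring I m) H.Ap.P"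
    using ring_hom_trans[OF \<rho>(1) H.Ap.scalar_hom] by (simp add: comp_def)
  have \<eta>_scalar: "?\<eta> c = \<rho> c \<odot>\<^bsub>H.Ap.P\<^esub> \<one>\<^bsub>H.Ap.P\<^esub>" if "c \<in> carrier (R_ring I m)" for c
    by (rule H.Ap.cls_scalar[OF \<rho>c[OF that]])
  obtain \<chi> where \<chi>: "\<chi> \<in> ring_hom Q.Ap.P H.Ap.P"
    "\<And>i j. i \<in> I \<Longrightarrow> j \<in> I \<Longrightarrow> \<chi> (Q.pair i j) = H.pair i j"
    "\<And>c Z. c \<in> carrier (R_ring I m) \<Longrightarrow> Z \<in> carrier Q.Ap.P \<Longrightarrow>
      \<chi> (c \<odot>\<^bsub>Q.Ap.P\<^esub> Z) = ?\<eta> c \<otimes>\<^bsub>H.Ap.P\<^esub> \<chi> Z"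
  proof (rule Q.pair_lift[OF H.Ap.ring_P \<eta>, of H.pair])
    fix i j n assume ij: "i \<in> I" "j \<in> I" "i \<noteq> j" "m i j = enat n"
    have "?\<eta> (R_t I m i j (k mod n)) = t_hat I m i j (k mod n) \<odot>\<^bsub>H.Ap.P\<^esub> \<one>\<^bsub>H.Ap.P\<^esub>" for k
    proof -
      have "(i, j, k mod n) \<in> t_index I m" using ij m_ge_2[OF ij] by (simp add: t_index_def)
      then show ?thesis using \<eta>_scalar[OF Q.t_mod_closed[OF ij], of k] by (simp only: \<rho>(2))
    qed
    then show "lprod H.Ap.P (map (\<lambda>k. H.pair i j \<ominus>\<^bsub>H.Ap.P\<^esub> ?\<eta> (R_t I m i j (k mod n))) [1..<Suc n])
        = \<zero>\<^bsub>H.Ap.P\<^esub>"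
      using H.pair_rel[OF ij] by simp
  next
    fix c i j assume "c \<in> carrier (R_ring I m)" "i \<in> I" "j \<in> I"
    then show "?\<eta> c \<otimes>\<^bsub>H.Ap.P\<^esub> H.pair i j = H.pair i j \<otimes>\<^bsub>H.Ap.P\<^esub> ?\<eta> c"
      by (intro H.Ap.scalar_central \<rho>c H.pair_closed)
  next
    fix i show "H.pair i i = \<one>\<^bsub>H.Ap.P\<^esub>" by (simp add: H.pair_def)
  qed (use H.pair_mult H.pair_closed in auto)
  have \<chi>_word: "\<chi> (Q.pair_word u) = H.pair_word u" if "u \<in> lists I" "even (length u)" for u
    using that
  proof (induction u rule: Q.pair_word.induct)
    case 1
    show ?case using ring_hom_one[OF \<chi>(1)] by simp
  next
    case (3 i j u)
    then show ?case
      using ring_hom_mult[OF \<chi>(1), of "Q.pair i j" "Q.pair_word u"] \<chi>(2) Q.pair_word_closed[of u] by simp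
  qed simp
  have Qc: "Q.pair_word (w x) \<in> carrier Q.Ap.P" "H.pair_word (w x) \<in> carrier H.Ap.P" if "x \<in> A" for x
    using w[OF that] Q.pair_word_closed H.pair_word_closed by blast+
  have smult: "\<chi> (c x \<odot>\<^bsub>Q.Ap.P\<^esub> Q.pair_word (w x)) = \<rho> (c x) \<odot>\<^bsub>H.Ap.P\<^esub> H.pair_word (w x)" if "x \<in> A" for x
  proof -
    have cx: "c x \<in> carrier (R_ring I m)" using c that by auto
    have "\<chi> (c x \<odot>\<^bsub>Q.Ap.P\<^esub> Q.pair_word (w x)) = ?\<eta> (c x) \<otimes>\<^bsub>H.Ap.P\<^esub> H.pair_word (w x)"
      using \<chi>(3)[OF cx Qc(1)[OF that]] \<chi>_word w[OF that] by simp
    also have "\<dots> = \<rho> (c x) \<odot>\<^bsub>H.Ap.P\<^esub> H.pair_word (w x)"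
      by (rule H.Ap.smult_P_eq_mult[OF \<rho>c[OF cx] Qc(2)[OF that], symmetric])
    finally show ?thesis .
  qed
  have closed: "(\<lambda>x. c x \<odot>\<^bsub>Q.Ap.P\<^esub> Q.pair_word (w x)) \<in> A \<rightarrow> carrier Q.Ap.P"
    using c Qc(1) Q.Ap.smult_closed by blast
  have "\<zero>\<^bsub>H.Ap.P\<^esub> = \<chi> (\<Oplus>\<^bsub>Q.Ap.P\<^esub>x\<in>A. c x \<odot>\<^bsub>Q.Ap.P\<^esub> Q.pair_word (w x))"
    unfolding zero by (rule ring_hom_zero[OF \<chi>(1) Q.Ap.ring_P H.Ap.ring_P, symmetric])
  also have "\<dots> = (\<Oplus>\<^bsub>H.Ap.P\<^esub>x\<in>A. \<chi> (c x \<odot>\<^bsub>Q.Ap.P\<^esub> Q.pair_word (w x)))"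
    using ring_hom_finsum[OF \<chi>(1) Q.Ap.ring_P H.Ap.ring_P closed] by (simp only: comp_def)
  also have "\<dots> = (\<Oplus>\<^bsub>H.Ap.P\<^esub>x\<in>A. \<rho> (c x) \<odot>\<^bsub>H.Ap.P\<^esub> H.pair_word (w x))"
  proof (rule H.Ap.P.finsum_cong'[OF HOL.refl])
    show "(\<lambda>x. \<rho> (c x) \<odot>\<^bsub>H.Ap.P\<^esub> H.pair_word (w x)) \<in> A \<rightarrow> carrier H.Ap.P"
      using c Qc(2) \<rho>c H.Ap.smult_closed by blast
  qed (rule smult)
  finally have "\<rho> (c x) = \<zero>\<^bsub>R_hat I m\<^esub>"
    using c \<rho>c by (intro pair_words_independent_hat[OF flat A _ w distinct _ x]) auto
  then show ?thesis using \<rho>(3) c x by blast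
qed

end

section \<open>Spans and bases\<close>

text \<open>Linear combinations are built up one term at a time, so that closure properties follow
  by rule induction; \<open>rspan_finsum\<close> returns to finite sums.\<close>

inductive_set rspan :: "'k ring \<Rightarrow> ('k, 'a) module \<Rightarrow> 'a set \<Rightarrow> 'a set"
  for K :: "'k ring" and M :: "('k, 'a) module" and E :: "'a set" where
  rspan_zero: "\<zero>\<^bsub>M\<^esub> \<in> rspan K M E"
| rspan_step: "x \<in> rspan K M E \<Longrightarrow> c \<in> carrier K \<Longrightarrow> e \<in> E \<Longrightarrow> x \<oplus>\<^bsub>M\<^esub> c \<odot>\<^bsub>M\<^esub> e \<in> rspan K M E"

lemma rspan_mono: "E \<subseteq> E' \<Longrightarrow> rspan K M E \<subseteq> rspan K M E'"
proof
  fix x assume "E \<subseteq> E'" "x \<in> rspan K M E"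
  from this(2,1) show "x \<in> rspan K M E'" by induction (auto intro: rspan_zero rspan_step)
qed

context
  fixes K :: "'k ring" and M :: "('k, 'a) module"
  assumes module: "module K M"
begin

interpretation module K M by (rule module)

lemma rspan_closed: "x \<in> rspan K M E \<Longrightarrow> E \<subseteq> carrier M \<Longrightarrow> x \<in> carrier M"
  by (induction rule: rspan.induct) auto

lemma rspan_base: "e \<in> E \<Longrightarrow> E \<subseteq> carrier M \<Longrightarrow> e \<in> rspan K M E"
  using rspan_step[OF rspan_zero, of "\<one>\<^bsub>K\<^esub>" K e E M] by (simp add: subset_iff)

lemma rspan_add:
  assumes "y \<in> rspan K M E" "x \<in> rspan K M E" "E \<subseteq> carrier M"
  shows "x \<oplus>\<^bsub>M\<^esub> y \<in> rspan K M E"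
  using assms(1)
proof induction
  case rspan_zero
  then show ?case using assms(2,3) rspan_closed by simp
next
  case (rspan_step y c e)
  have "x \<in> carrier M" "y \<in> carrier M" "c \<odot>\<^bsub>M\<^esub> e \<in> carrier M"
    using assms(2,3) rspan_step rspan_closed by auto
  then have "x \<oplus>\<^bsub>M\<^esub> (y \<oplus>\<^bsub>M\<^esub> c \<odot>\<^bsub>M\<^esub> e) = (x \<oplus>\<^bsub>M\<^esub> y) \<oplus>\<^bsub>M\<^esub> c \<odot>\<^bsub>M\<^esub> e"
    by (simp add: M.a_assoc)
  then show ?case using rspan.rspan_step[OF rspan_step.IH rspan_step.hyps(2,3)] by simp
qed

lemma rspan_smult:
  assumes "x \<in> rspan K M E" "c \<in> carrier K" "E \<subseteq> carrier M"
  shows "c \<odot>\<^bsub>M\<^esub> x \<in> rspan K M E"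
  using assms(1)
proof induction
  case rspan_zero
  then show ?case using assms(2) rspan.rspan_zero by simp
next
  case (rspan_step x d e)
  have "x \<in> carrier M" "e \<in> carrier M" using assms(3) rspan_step rspan_closed by auto
  then have "c \<odot>\<^bsub>M\<^esub> (x \<oplus>\<^bsub>M\<^esub> d \<odot>\<^bsub>M\<^esub> e) = c \<odot>\<^bsub>M\<^esub> x \<oplus>\<^bsub>M\<^esub> (c \<otimes>\<^bsub>K\<^esub> d) \<odot>\<^bsub>M\<^esub> e"
    using assms(2) rspan_step by (simp add: smult_r_distr smult_assoc1)
  then show ?case using rspan.rspan_step[OF rspan_step.IH, of "c \<otimes>\<^bsub>K\<^esub> d" e] assms(2) rspan_step by simp
qed

lemma rspan_trans:
  assumes "E \<subseteq> rspan K M E'" "E' \<subseteq> carrier M"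
  shows "rspan K M E \<subseteq> rspan K M E'"
proof
  fix x assume "x \<in> rspan K M E"
  then show "x \<in> rspan K M E'"
  proof induction
    case (rspan_step x c e)
    show ?case
      by (rule rspan_add[OF rspan_smult[OF subsetD[OF assms(1) rspan_step.hyps(3)] rspan_step.hyps(2) assms(2)]
            rspan_step.IH assms(2)])
  qed (rule rspan_zero)
qed

lemma rspan_finsum:
  assumes "x \<in> rspan K M (e ` Y)" "e \<in> Y \<rightarrow> carrier M"
  shows "\<exists>F c. finite F \<and> F \<subseteq> Y \<and> c \<in> F \<rightarrow> carrier K \<and> x = (\<Oplus>\<^bsub>M\<^esub>y\<in>F. c y \<odot>\<^bsub>M\<^esub> e y)"
  using assms(1)
proof induction
  case rspan_zero
  show ?case by (intro exI[of _ "{}"]) simp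
next
  case (rspan_step x d e')
  then obtain F c y where F: "finite F" "F \<subseteq> Y" "c \<in> F \<rightarrow> carrier K" "x = (\<Oplus>\<^bsub>M\<^esub>y\<in>F. c y \<odot>\<^bsub>M\<^esub> e y)"
    and y: "y \<in> Y" "e' = e y" by blast
  \<comment> \<open>Both coefficient families are extended by zero to \<open>insert y F\<close>,
    which treats a new index and a repeated one alike.\<close>
  define c1 where "c1 z = (if z \<in> F then c z else \<zero>\<^bsub>K\<^esub>)" for z
  define c2 where "c2 z = (if z = y then d else \<zero>\<^bsub>K\<^esub>)" for z
  let ?F = "insert y F"
  have cl: "c1 z \<in> carrier K" "c2 z \<in> carrier K" for z using F rspan_step by (auto simp: c1_def c2_def)
  have e: "e z \<in> carrier M" if "z \<in> ?F" for z using that F y assms(2) by auto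
  have "x = (\<Oplus>\<^bsub>M\<^esub>z\<in>?F. c1 z \<odot>\<^bsub>M\<^esub> e z)"
    unfolding F(4)
  proof (rule M.add.finprod_mono_neutral_cong_left)
    fix z assume "z \<in> ?F - F"
    then have "z \<notin> F" "e z \<in> carrier M" using e by auto
    then show "c1 z \<odot>\<^bsub>M\<^esub> e z = \<zero>\<^bsub>M\<^esub>" using smult_l_null by (simp add: c1_def)
  next
    fix z assume "z \<in> F"
    then show "c z \<odot>\<^bsub>M\<^esub> e z = c1 z \<odot>\<^bsub>M\<^esub> e z" by (simp add: c1_def)
  qed (use F(1) e cl in auto)
  moreover have "d \<odot>\<^bsub>M\<^esub> e y = (\<Oplus>\<^bsub>M\<^esub>z\<in>?F. c2 z \<odot>\<^bsub>M\<^esub> e z)"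
  proof -
    have "(\<Oplus>\<^bsub>M\<^esub>z\<in>?F. c2 z \<odot>\<^bsub>M\<^esub> e z) = (\<Oplus>\<^bsub>M\<^esub>z\<in>?F. if z = y then d \<odot>\<^bsub>M\<^esub> e z else \<zero>\<^bsub>M\<^esub>)"
      using e rspan_step by (intro M.finsum_cong') (auto simp: c2_def)
    also have "\<dots> = d \<odot>\<^bsub>M\<^esub> e y"
      using F e rspan_step by (intro M.add.finprod_singleton_swap) auto
    finally show ?thesis by simp
  qed
  ultimately have "x \<oplus>\<^bsub>M\<^esub> d \<odot>\<^bsub>M\<^esub> e' = (\<Oplus>\<^bsub>M\<^esub>z\<in>?F. c1 z \<odot>\<^bsub>M\<^esub> e z \<oplus>\<^bsub>M\<^esub> c2 z \<odot>\<^bsub>M\<^esub> e z)"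
    using e cl y by (subst M.finsum_addf) auto
  also have "\<dots> = (\<Oplus>\<^bsub>M\<^esub>z\<in>?F. (c1 z \<oplus>\<^bsub>K\<^esub> c2 z) \<odot>\<^bsub>M\<^esub> e z)"
    using e cl by (intro M.finsum_cong') (auto simp: smult_l_distr)
  finally have "x \<oplus>\<^bsub>M\<^esub> d \<odot>\<^bsub>M\<^esub> e' = (\<Oplus>\<^bsub>M\<^esub>z\<in>?F. (c1 z \<oplus>\<^bsub>K\<^esub> c2 z) \<odot>\<^bsub>M\<^esub> e z)" .
  then show ?case using F y cl by (intro exI[of _ ?F] exI[of _ "\<lambda>z. c1 z \<oplus>\<^bsub>K\<^esub> c2 z"]) auto
qed

lemma module_basisI:
  assumes "e \<in> Y \<rightarrow> carrier M" "carrier M \<subseteq> rspan K M (e ` Y)"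
    and "\<And>F c x. finite F \<Longrightarrow> F \<subseteq> Y \<Longrightarrow> c \<in> F \<rightarrow> carrier K \<Longrightarrow>
      (\<Oplus>\<^bsub>M\<^esub>x\<in>F. c x \<odot>\<^bsub>M\<^esub> e x) = \<zero>\<^bsub>M\<^esub> \<Longrightarrow> x \<in> F \<Longrightarrow> c x = \<zero>\<^bsub>K\<^esub>"
  shows "module_basis K M Y e"
  unfolding module_basis_def
proof (intro conjI ballI allI impI module assms(1))
  fix a assume "a \<in> carrier M"
  then show "\<exists>F c. finite F \<and> F \<subseteq> Y \<and> c \<in> F \<rightarrow> carrier K \<and> a = (\<Oplus>\<^bsub>M\<^esub>x\<in>F. c x \<odot>\<^bsub>M\<^esub> e x)"
    using assms(1,2) by (intro rspan_finsum) auto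
qed (use assms(3) in blast)

end


text \<open>Of \<open>h\<close> only additivity and its effect on multiples of the generators are
  prescribed, which admits left multiplication by \<open>s_i\<close>, where scalars are
  twisted.\<close>

lemma rspan_hom:
  assumes M: "module K M" and N: "module K N"
    and x: "x \<in> rspan K M E" and E: "E \<subseteq> carrier M" and E': "E' \<subseteq> carrier N"
    and h0: "h \<zero>\<^bsub>M\<^esub> = \<zero>\<^bsub>N\<^esub>"
    and hadd: "\<And>x y. x \<in> carrier M \<Longrightarrow> y \<in> carrier M \<Longrightarrow> h (x \<oplus>\<^bsub>M\<^esub> y) = h x \<oplus>\<^bsub>N\<^esub> h y"
    and hsm: "\<And>c e. c \<in> carrier K \<Longrightarrow> e \<in> E \<Longrightarrow> h (c \<odot>\<^bsub>M\<^esub> e) \<in> rspan K N E'"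
  shows "h x \<in> rspan K N E'"
  using x
proof induction
  case rspan_zero
  then show ?case by (simp add: h0 rspan.rspan_zero)
next
  case (rspan_step x c e)
  interpret M: module K M by (rule M)
  have "x \<in> carrier M" by (rule rspan_closed[OF M rspan_step.hyps(1) E])
  moreover have "c \<odot>\<^bsub>M\<^esub> e \<in> carrier M" using E rspan_step by auto
  ultimately show ?case using rspan_step hadd hsm by (simp add: rspan_add[OF N _ _ E'])
qed

lemma finsum_additive:
  assumes M: "abelian_monoid M" and N: "abelian_monoid N"
    and h: "h \<in> carrier M \<rightarrow> carrier N" and h0: "h \<zero>\<^bsub>M\<^esub> = \<zero>\<^bsub>N\<^esub>"
    and hadd: "\<And>x y. x \<in> carrier M \<Longrightarrow> y \<in> carrier M \<Longrightarrow> h (x \<oplus>\<^bsub>M\<^esub> y) = h x \<oplus>\<^bsub>N\<^esub> h y"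
    and F: "finite F" "e \<in> F \<rightarrow> carrier M"
  shows "h (\<Oplus>\<^bsub>M\<^esub>x\<in>F. e x) = (\<Oplus>\<^bsub>N\<^esub>x\<in>F. h (e x))"
  using F
proof (induction F rule: finite_induct)
  case empty
  show ?case using M N by (simp add: abelian_monoid.finsum_empty h0)
next
  case (insert x F)
  have e: "e x \<in> carrier M" "e \<in> F \<rightarrow> carrier M" using insert by auto
  moreover have "h (e x) \<in> carrier N" "(\<lambda>x. h (e x)) \<in> F \<rightarrow> carrier N" using e h by auto
  ultimately show ?case
    using insert abelian_monoid.finsum_closed[OF M, of e F]
    by (simp add: abelian_monoid.finsum_insert[OF M] abelian_monoid.finsum_insert[OF N] hadd)
qed


section \<open>Two by two matrices\<close>

text \<open>The entries \<open>(a, b, c, d)\<close> are read row by row.\<close>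

definition mat_ring :: "('b, 'x) ring_scheme \<Rightarrow> ('b \<times> 'b \<times> 'b \<times> 'b) ring" where
  "mat_ring B =
     \<lparr>carrier = carrier B \<times> carrier B \<times> carrier B \<times> carrier B,
      monoid.mult = (\<lambda>(a, b, c, d) (a', b', c', d').
        (a \<otimes>\<^bsub>B\<^esub> a' \<oplus>\<^bsub>B\<^esub> b \<otimes>\<^bsub>B\<^esub> c', a \<otimes>\<^bsub>B\<^esub> b' \<oplus>\<^bsub>B\<^esub> b \<otimes>\<^bsub>B\<^esub> d',
         c \<otimes>\<^bsub>B\<^esub> a' \<oplus>\<^bsub>B\<^esub> d \<otimes>\<^bsub>B\<^esub> c', c \<otimes>\<^bsub>B\<^esub> b' \<oplus>\<^bsub>B\<^esub> d \<otimes>\<^bsub>B\<^esub> d')),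
      one = (\<one>\<^bsub>B\<^esub>, \<zero>\<^bsub>B\<^esub>, \<zero>\<^bsub>B\<^esub>, \<one>\<^bsub>B\<^esub>),
      zero = (\<zero>\<^bsub>B\<^esub>, \<zero>\<^bsub>B\<^esub>, \<zero>\<^bsub>B\<^esub>, \<zero>\<^bsub>B\<^esub>),
      add = (\<lambda>(a, b, c, d) (a', b', c', d').
        (a \<oplus>\<^bsub>B\<^esub> a', b \<oplus>\<^bsub>B\<^esub> b', c \<oplus>\<^bsub>B\<^esub> c', d \<oplus>\<^bsub>B\<^esub> d'))\<rparr>"

lemma mat_simps [simp]:
  "(a, b, c, d) \<in> carrier (mat_ring B) \<longleftrightarrow>
    a \<in> carrier B \<and> b \<in> carrier B \<and> c \<in> carrier B \<and> d \<in> carrier B"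
  "(a, b, c, d) \<otimes>\<^bsub>mat_ring B\<^esub> (a', b', c', d') =
    (a \<otimes>\<^bsub>B\<^esub> a' \<oplus>\<^bsub>B\<^esub> b \<otimes>\<^bsub>B\<^esub> c', a \<otimes>\<^bsub>B\<^esub> b' \<oplus>\<^bsub>B\<^esub> b \<otimes>\<^bsub>B\<^esub> d',
     c \<otimes>\<^bsub>B\<^esub> a' \<oplus>\<^bsub>B\<^esub> d \<otimes>\<^bsub>B\<^esub> c', c \<otimes>\<^bsub>B\<^esub> b' \<oplus>\<^bsub>B\<^esub> d \<otimes>\<^bsub>B\<^esub> d')"
  "\<one>\<^bsub>mat_ring B\<^esub> = (\<one>\<^bsub>B\<^esub>, \<zero>\<^bsub>B\<^esub>, \<zero>\<^bsub>B\<^esub>, \<one>\<^bsub>B\<^esub>)"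
  "\<zero>\<^bsub>mat_ring B\<^esub> = (\<zero>\<^bsub>B\<^esub>, \<zero>\<^bsub>B\<^esub>, \<zero>\<^bsub>B\<^esub>, \<zero>\<^bsub>B\<^esub>)"
  "(a, b, c, d) \<oplus>\<^bsub>mat_ring B\<^esub> (a', b', c', d') =
    (a \<oplus>\<^bsub>B\<^esub> a', b \<oplus>\<^bsub>B\<^esub> b', c \<oplus>\<^bsub>B\<^esub> c', d \<oplus>\<^bsub>B\<^esub> d')"
  by (simp_all add: mat_ring_def)

lemma mat_carrierE:
  assumes "Z \<in> carrier (mat_ring B)"
  obtains a b c d where "Z = (a, b, c, d)" "a \<in> carrier B" "b \<in> carrier B" "c \<in> carrier B" "d \<in> carrier B"
  using assms by (cases Z) auto

context ring
begin

lemma ring_mat: "ring (mat_ring R)"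
proof (rule ringI)
  show "abelian_group (mat_ring R)"
  proof (rule abelian_groupI)
    fix Z assume "Z \<in> carrier (mat_ring R)"
    then obtain a b c d where Z: "Z = (a, b, c, d)" "a \<in> carrier R" "b \<in> carrier R" "c \<in> carrier R" "d \<in> carrier R"
      by (rule mat_carrierE)
    then show "\<exists>W\<in>carrier (mat_ring R). W \<oplus>\<^bsub>mat_ring R\<^esub> Z = \<zero>\<^bsub>mat_ring R\<^esub>"
      by (intro bexI[of _ "(\<ominus> a, \<ominus> b, \<ominus> c, \<ominus> d)"]) (simp_all add: l_neg)
  qed (auto elim!: mat_carrierE simp: a_ac)
  show "monoid (mat_ring R)"
    by (rule monoidI) (auto elim!: mat_carrierE simp: l_distr r_distr m_assoc a_ac)
qed (auto elim!: mat_carrierE simp: l_distr r_distr a_ac)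

lemma mat_minus:
  assumes "a \<in> carrier R" "b \<in> carrier R" "c \<in> carrier R" "d \<in> carrier R"
    "a' \<in> carrier R" "b' \<in> carrier R" "c' \<in> carrier R" "d' \<in> carrier R"
  shows "(a, b, c, d) \<ominus>\<^bsub>mat_ring R\<^esub> (a', b', c', d') = (a \<ominus> a', b \<ominus> b', c \<ominus> c', d \<ominus> d')"
proof -
  interpret M: ring "mat_ring R" by (rule ring_mat)
  have "\<ominus>\<^bsub>mat_ring R\<^esub> (a', b', c', d') = (\<ominus> a', \<ominus> b', \<ominus> c', \<ominus> d')"
    using assms by (intro M.minus_equality) (simp_all add: l_neg)
  then show ?thesis by (simp add: M.minus_eq minus_eq)
qed

lemma lprod_diag:
  assumes "\<And>x. x \<in> set xs \<Longrightarrow> f x \<in> carrier R" "\<And>x. x \<in> set xs \<Longrightarrow> g x \<in> carrier R"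
  shows "lprod (mat_ring R) (map (\<lambda>x. (f x, \<zero>, \<zero>, g x)) xs) =
    (lprod R (map f xs), \<zero>, \<zero>, lprod R (map g xs))"
  using assms
proof (induction xs)
  case (Cons x xs)
  then have "lprod R (map f xs) \<in> carrier R" "lprod R (map g xs) \<in> carrier R"
    by (auto intro!: lprod_closed)
  then show ?case using Cons by simp
qed simp

text \<open>Between consecutive factors \<open>v\<close> and \<open>u\<close> cancel.\<close>

lemma lprod_conj:
  assumes "u \<in> carrier R" "v \<in> carrier R" "u \<otimes> v = \<one>" "v \<otimes> u = \<one>" "\<And>x. x \<in> set xs \<Longrightarrow> f x \<in> carrier R"
  shows "lprod R (map (\<lambda>x. u \<otimes> f x \<otimes> v) xs) = u \<otimes> lprod R (map f xs) \<otimes> v"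
  using assms(5)
proof (induction xs)
  case (Cons x xs)
  have L: "lprod R (map f xs) \<in> carrier R" "f x \<in> carrier R" using Cons.prems by (auto intro!: lprod_closed)
  have "(u \<otimes> f x \<otimes> v) \<otimes> (u \<otimes> lprod R (map f xs) \<otimes> v) =
      u \<otimes> f x \<otimes> (v \<otimes> u) \<otimes> lprod R (map f xs) \<otimes> v"
    using assms(1,2) L by (simp add: m_assoc)
  also have "\<dots> = u \<otimes> (f x \<otimes> lprod R (map f xs)) \<otimes> v"
    using assms L by (simp add: m_assoc)
  finally show ?case using Cons by simp
qed (use assms in simp)

end


section \<open>The algebra of the full Coxeter group\<close>

context coxeter_words
begin

lemma t_letters_subset: "t_letters I m \<subseteq> A_letters I m"
  by (simp add: A_letters_def)

lemma A_relations_closed: "A_relations I m \<subseteq> carrier (free_alg complex_ring (A_letters I m))"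
proof -
  interpret free_algebra complex_ring "A_letters I m" by (intro free_algebra.intro cring_complex)
  interpret F: ring F by (rule ring_F)
  have S: "gen complex_ring (S i) \<in> carrier F" if "i \<in> I" for i
    using that by (intro gen_closed) (simp add: A_letters_def)
  have T: "gen complex_ring (T i j k) \<in> carrier F" if "(i, j, k) \<in> t_index I m" for i j k
    using that by (intro gen_closed) (simp add: A_letters_def t_letters_iff)
  have T': "gen complex_ring (T j i k) \<in> carrier F" if "(i, j, k) \<in> t_index I m" for i j k
    using that m_sym by (intro T) (auto simp: t_index_def)
  have "lprod F (map (\<lambda>k. gen complex_ring (S i) \<otimes>\<^bsub>F\<^esub> gen complex_ring (S j) \<ominus>\<^bsub>F\<^esub>
      gen complex_ring (T i j (k mod n))) [1..<Suc n]) \<in> carrier F"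
    if "i \<in> I" "j \<in> I" "i \<noteq> j" "m i j = enat n" for i j n
  proof -
    have "gen complex_ring (T i j (k mod n)) \<in> carrier F" for k
      using m_ge_2[OF that] that by (intro T) (simp add: t_index_def)
    then show ?thesis using that S by (intro F.lprod_closed) (auto simp del: upt_Suc)
  qed
  then show ?thesis
    using S T T' t_relations_closed[OF t_letters_subset] unfolding A_relations_def Let_def
    by (auto simp del: upt_Suc)
qed

sublocale A: presented_algebra complex_ring "A_letters I m" "A_relations I m"
  by (intro presented_algebra.intro free_algebra.intro presented_algebra_axioms.intro
      cring_complex A_relations_closed)

abbreviation At :: "'i letter \<Rightarrow> ('i letter list \<Rightarrow> complex) set" where
  "At l \<equiv> A.cls (gen complex_ring l)"

lemma At_S [simp]: "i \<in> I \<Longrightarrow> At (S i) \<in> carrier A.P"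
  by (intro A.cls_closed A.gen_closed) (simp add: A_letters_def)

lemma At_t [simp]: "l \<in> t_letters I m \<Longrightarrow> At l \<in> carrier A.P"
  using t_letters_subset by (intro A.cls_closed A.gen_closed) auto

lemma gen_A [simp]:
  "i \<in> I \<Longrightarrow> gen complex_ring (S i) \<in> carrier A.F" "l \<in> t_letters I m \<Longrightarrow> gen complex_ring l \<in> carrier A.F"
  using t_letters_subset by (intro A.gen_closed; auto simp: A_letters_def)+

lemma A_square: "i \<in> I \<Longrightarrow> At (S i) \<otimes>\<^bsub>A.P\<^esub> At (S i) = \<one>\<^bsub>A.P\<^esub>"
proof -
  assume i: "i \<in> I"
  then have "gen complex_ring (S i) \<otimes>\<^bsub>A.F\<^esub> gen complex_ring (S i) \<ominus>\<^bsub>A.F\<^esub> \<one>\<^bsub>A.F\<^esub> \<in> A_relations I m"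
    unfolding A_relations_def Let_def by blast
  from A.cls_Rel[OF this] show ?thesis
    using i by (simp add: A.cls_minus A.cls_mult A.cls_one A.P.minus_eq_zero_iff)
qed

lemma A_twist:
  assumes "p \<in> I" "(i, j, k) \<in> t_index I m"
  shows "At (S p) \<otimes>\<^bsub>A.P\<^esub> At (T i j k) = At (T j i k) \<otimes>\<^bsub>A.P\<^esub> At (S p)"
proof -
  have l: "T i j k \<in> t_letters I m" "T j i k \<in> t_letters I m"
    using assms m_sym by (auto simp: t_letters_iff t_index_def)
  have "gen complex_ring (S p) \<otimes>\<^bsub>A.F\<^esub> gen complex_ring (T i j k) \<ominus>\<^bsub>A.F\<^esub>
      gen complex_ring (T j i k) \<otimes>\<^bsub>A.F\<^esub> gen complex_ring (S p) \<in> A_relations I m"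
    using assms unfolding A_relations_def Let_def by blast
  from A.cls_Rel[OF this] show ?thesis
    using assms l by (simp add: A.cls_minus A.cls_mult A.P.minus_eq_zero_iff)
qed

lemma A_product:
  assumes "i \<in> I" "j \<in> I" "i \<noteq> j" "m i j = enat n"
  shows "lprod A.P (map (\<lambda>k. At (S i) \<otimes>\<^bsub>A.P\<^esub> At (S j) \<ominus>\<^bsub>A.P\<^esub> At (T i j (k mod n))) [1..<Suc n]) = \<zero>\<^bsub>A.P\<^esub>"
proof -
  let ?f = "\<lambda>k. gen complex_ring (S i) \<otimes>\<^bsub>A.F\<^esub> gen complex_ring (S j) \<ominus>\<^bsub>A.F\<^esub> gen complex_ring (T i j (k mod n))"
  have "T i j (k mod n) \<in> t_letters I m" for k
    using m_ge_2[OF assms] assms by (simp add: t_letters_iff t_index_def)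
  then have f: "?f k \<in> carrier A.F"
    "A.cls (?f k) = At (S i) \<otimes>\<^bsub>A.P\<^esub> At (S j) \<ominus>\<^bsub>A.P\<^esub> At (T i j (k mod n))" for k
    using assms by (simp_all add: A.cls_minus A.cls_mult)
  have "lprod A.F (map ?f [1..<Suc n]) \<in> A_relations I m"
    using assms unfolding A_relations_def Let_def by blast
  from A.cls_Rel[OF this] show ?thesis
    using f(1) by (subst (asm) A.cls_lprod) (auto simp: comp_def f(2) simp del: upt_Suc)
qed

lemma At_neg: "l \<in> t_letters I m \<Longrightarrow> At l \<otimes>\<^bsub>A.P\<^esub> At (letter_neg m l) = \<one>\<^bsub>A.P\<^esub>"
proof -
  assume l: "l \<in> t_letters I m"
  then have "gen complex_ring l \<otimes>\<^bsub>A.F\<^esub> gen complex_ring (letter_neg m l) \<ominus>\<^bsub>A.F\<^esub> \<one>\<^bsub>A.F\<^esub> \<in> A_relations I m"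
    by (elim t_lettersE) (auto simp: A_relations_def t_relations_def Let_def letter_neg_def)
  from A.cls_Rel[OF this] show ?thesis
    using l by (simp add: A.cls_minus A.cls_mult A.cls_one A.P.minus_eq_zero_iff)
qed

lemma At_comm:
  "l \<in> t_letters I m \<Longrightarrow> l' \<in> t_letters I m \<Longrightarrow> At l \<otimes>\<^bsub>A.P\<^esub> At l' = At l' \<otimes>\<^bsub>A.P\<^esub> At l"
proof -
  assume l: "l \<in> t_letters I m" "l' \<in> t_letters I m"
  then have "gen complex_ring l \<otimes>\<^bsub>A.F\<^esub> gen complex_ring l' \<ominus>\<^bsub>A.F\<^esub> gen complex_ring l' \<otimes>\<^bsub>A.F\<^esub> gen complex_ring l
      \<in> A_relations I m"
    by (auto simp: A_relations_def t_relations_def Let_def)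
  from A.cls_Rel[OF this] show ?thesis
    using l by (simp add: A.cls_minus A.cls_mult A.P.minus_eq_zero_iff)
qed

lemma R_to_A:
  obtains \<theta> where "\<theta> \<in> ring_hom R.P A.P" "\<And>p. p \<in> carrier R.F \<Longrightarrow> \<theta> (R.cls p) = A.cls p"
proof -
  let ?\<eta> = "\<lambda>c. A.cls (A.mono c [])"
  have E: "free_eval complex_ring (t_letters I m) A.P ?\<eta> At"
    by (intro free_eval.intro free_eval_axioms.intro R.free_algebra_axioms A.ring_P A.scalar_hom)
      (rule At_t, assumption, rule A.scalar_central, assumption, rule At_t, assumption)
  interpret E: free_eval complex_ring "t_letters I m" A.P ?\<eta> At by (rule E)
  have ker: "E.ev r = \<zero>\<^bsub>A.P\<^esub>" if "r \<in> R_relations I m" for r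
    by (rule R_relations_vanish[OF E At_neg At_comm that])
  obtain \<theta> where \<theta>: "\<theta> \<in> ring_hom R.P A.P" "\<And>p. p \<in> carrier R.F \<Longrightarrow> \<theta> (R.cls p) = E.ev p"
    by (rule E.pres_lift[OF R.presented_algebra_axioms ker], assumption) (rule that)
  have "E.ev p = A.cls p" if "p \<in> carrier R.F" for p
    using that
  proof (induction p rule: R.free_alg_induct)
    case zero
    have "\<zero>\<^bsub>R.F\<^esub> = \<zero>\<^bsub>A.F\<^esub>" by (simp add: R.F_simps A.F_simps)
    then show ?case using A.cls_zero E.ev_zero by simp
  next
    case (mono c w)
    have w: "w \<in> lists (A_letters I m)" using mono t_letters_subset lists_mono[of "t_letters I m"] by blast
    have "E.ev (R.mono c w) = A.cls (A.mono c []) \<otimes>\<^bsub>A.P\<^esub> lprod A.P (map At w)" by (rule E.ev_mono[OF mono])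
    also have "\<dots> = c \<odot>\<^bsub>A.P\<^esub> lprod A.P (map At w)"
      by (rule A.smult_P_eq_mult[OF mono(1) E.word_closed[OF mono(2)], symmetric])
    also have "\<dots> = A.cls (A.mono c w)" by (rule A.cls_mono[OF mono(1) w, symmetric])
    finally show ?case .
  next
    case (add f g)
    have sub: "x \<in> carrier A.F" if "x \<in> carrier R.F" for x
      using that t_letters_subset lists_mono[of "t_letters I m"] unfolding R.carrier_iff A.carrier_iff by blast
    have "f \<oplus>\<^bsub>R.F\<^esub> g = f \<oplus>\<^bsub>A.F\<^esub> g" by (simp add: R.F_simps A.F_simps)
    then show ?case using add sub E.ev_add A.cls_add by metis
  qed
  then show ?thesis using that \<theta> by simp
qed

text \<open>The structure map of \<open>A(M)\<close> over \<open>R\<close>, fixed by choice; its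
  values on \<open>R\<close> are determined by the second property.\<close>

definition theta :: "('i letter list \<Rightarrow> complex) set \<Rightarrow> ('i letter list \<Rightarrow> complex) set" where
  "theta = (SOME \<theta>. \<theta> \<in> ring_hom R.P A.P \<and> (\<forall>p\<in>carrier R.F. \<theta> (R.cls p) = A.cls p))"

lemma theta: "theta \<in> ring_hom R.P A.P" "p \<in> carrier R.F \<Longrightarrow> theta (R.cls p) = A.cls p"
proof -
  have "\<exists>\<theta>. \<theta> \<in> ring_hom R.P A.P \<and> (\<forall>p\<in>carrier R.F. \<theta> (R.cls p) = A.cls p)"
    using R_to_A by metis
  from someI_ex[OF this] show "theta \<in> ring_hom R.P A.P" "p \<in> carrier R.F \<Longrightarrow> theta (R.cls p) = A.cls p"
    unfolding theta_def by blast+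
qed

lemma theta_scalar: "theta (R.cls (R.mono c [])) = A.cls (A.mono c [])"
  using theta(2)[OF R.mono_closed[of c "[]"]] by simp

lemma theta_closed [simp]: "c \<in> carrier R.P \<Longrightarrow> theta c \<in> carrier A.P"
  by (rule ring_hom_closed[OF theta(1)])

lemma theta_minus:
  assumes c: "c \<in> carrier R.P"
  shows "theta (\<ominus>\<^bsub>R.P\<^esub> c) = \<ominus>\<^bsub>A.P\<^esub> theta c"
proof (rule A.P.minus_equality[symmetric])
  have "theta (\<ominus>\<^bsub>R.P\<^esub> c) \<oplus>\<^bsub>A.P\<^esub> theta c = theta (\<ominus>\<^bsub>R.P\<^esub> c \<oplus>\<^bsub>R.P\<^esub> c)"
    using c by (simp only: ring_hom_add[OF theta(1)] R.P.a_inv_closed)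
  also have "\<dots> = \<zero>\<^bsub>A.P\<^esub>"
    using c by (simp only: R.P.l_neg ring_hom_zero[OF theta(1) R.ring_P A.ring_P])
  finally show "theta (\<ominus>\<^bsub>R.P\<^esub> c) \<oplus>\<^bsub>A.P\<^esub> theta c = \<zero>\<^bsub>A.P\<^esub>" .
qed (use c in simp_all)

lemma R_F_subset: "p \<in> carrier R.F \<Longrightarrow> p \<in> carrier A.F"
  using t_letters_subset lists_mono[of "t_letters I m"] unfolding R.carrier_iff A.carrier_iff by blast

lemma A_fields:
  "carrier (A_alg I m) = carrier A.P" "monoid.mult (A_alg I m) = monoid.mult A.P"
  "one (A_alg I m) = one A.P" "zero (A_alg I m) = zero A.P" "add (A_alg I m) = add A.P"
  unfolding A.P_fields by (simp_all add: A_alg_def Let_def ring.defs module.defs A_ideal_def)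

text \<open>Any representatives of \<open>c\<close> and \<open>Z\<close> give the same product,
  because the class map is multiplicative. Scalars act as left multiplications and are not assumed
  to commute with the \<open>s_p\<close>.\<close>

lemma A_smult:
  assumes c: "c \<in> carrier R.P" and Z: "Z \<in> carrier A.P"
  shows "c \<odot>\<^bsub>A_alg I m\<^esub> Z = theta c \<otimes>\<^bsub>A.P\<^esub> Z"
proof -
  obtain p x where p: "p \<in> carrier R.F" "c = R.cls p" and x: "x \<in> carrier A.F" "Z = A.cls x"
    using R.cls_surj[OF c] A.cls_surj[OF Z] by blast
  have "c \<odot>\<^bsub>A_alg I m\<^esub> Z = (\<Union>p\<in>c. \<Union>x\<in>Z. A.cls (p \<otimes>\<^bsub>A.F\<^esub> x))"
    by (simp add: A_alg_def Let_def ring.defs module.defs A_ideal_def pres_class_def)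
  also have "\<dots> = (\<Union>p\<in>c. \<Union>x\<in>Z. theta c \<otimes>\<^bsub>A.P\<^esub> Z)"
  proof (intro SUP_cong HOL.refl)
    fix p' x' assume p': "p' \<in> c" and x': "x' \<in> Z"
    have pc: "p' \<in> carrier R.F" "R.cls p' = c"
      using R.J.a_elemrcos_carrier[OF p(1)] R.J.a_repr_independence'[OF _ p(1), of p'] p' p(2)
      by (simp_all add: pres_class_def)
    have xc: "x' \<in> carrier A.F" "A.cls x' = Z"
      using A.J.a_elemrcos_carrier[OF x(1)] A.J.a_repr_independence'[OF _ x(1), of x'] x' x(2)
      by (simp_all add: pres_class_def)
    have "A.cls (p' \<otimes>\<^bsub>A.F\<^esub> x') = A.cls p' \<otimes>\<^bsub>A.P\<^esub> A.cls x'"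
      using R_F_subset pc xc by (intro A.cls_mult) auto
    then show "A.cls (p' \<otimes>\<^bsub>A.F\<^esub> x') = theta c \<otimes>\<^bsub>A.P\<^esub> Z" using theta(2)[OF pc(1)] pc xc by simp
  qed
  also have "\<dots> = theta c \<otimes>\<^bsub>A.P\<^esub> Z"
    using p x R.J.a_rcos_self[OF p(1)] A.J.a_rcos_self[OF x(1)] by (auto simp: pres_class_def)
  finally show ?thesis .
qed

lemma module_A: "module (R_ring I m) (A_alg I m)"
proof (rule moduleI[OF cring_R])
  show "abelian_group (A_alg I m)"
    by (rule ring.is_abelian_group[OF ring_cong_fields[OF A.ring_P A_fields]])
qed (simp_all add: A_fields R_fields A_smult ring_hom_add[OF theta(1)] ring_hom_mult[OF theta(1)]
    ring_hom_one[OF theta(1)] A.P.l_distr A.P.r_distr A.P.m_assoc)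

section \<open>Reduced words span \<open>A(M)\<close>\<close>

abbreviation TA :: "'i list \<Rightarrow> ('i letter list \<Rightarrow> complex) set" where
  "TA w \<equiv> lprod A.P (map (\<lambda>i. At (S i)) w)"

lemma T_word_eq: "T_word I m w = TA w"
proof -
  have "A_s I m = (\<lambda>i. At (S i))" by (simp add: fun_eq_iff A_s_def)
  then show ?thesis by (simp add: T_word_def lprod_def A_fields)
qed

lemma TA_closed [simp]: "w \<in> lists I \<Longrightarrow> TA w \<in> carrier A.P"
  by (intro A.P.lprod_closed) auto

lemma TA_append:
  assumes "u \<in> lists I" "v \<in> lists I"
  shows "TA (u @ v) = TA u \<otimes>\<^bsub>A.P\<^esub> TA v"
proof -
  have "set (map (\<lambda>i. At (S i)) w) \<subseteq> carrier A.P" if "w \<in> lists I" for w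
    using that by auto
  then show ?thesis unfolding map_append using assms by (intro A.P.lprod_append)
qed

lemma TA_cancel:
  assumes "p \<in> lists I" "v \<in> lists I"
  shows "TA (rev p @ p @ v) = TA v"
  using assms
proof (induction p arbitrary: v)
  case (Cons i p)
  have pv: "TA (p @ v) \<in> carrier A.P" using Cons by (intro TA_closed) auto
  have "TA (i # i # p @ v) = (At (S i) \<otimes>\<^bsub>A.P\<^esub> At (S i)) \<otimes>\<^bsub>A.P\<^esub> TA (p @ v)"
    using Cons pv by (simp add: A.P.m_assoc)
  also have "\<dots> = TA (p @ v)" using Cons pv by (simp add: A_square)
  finally have e: "TA (i # i # p @ v) = TA (p @ v)" .
  have "TA (rev (i # p) @ (i # p) @ v) = TA (rev p) \<otimes>\<^bsub>A.P\<^esub> TA (i # i # p @ v)"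
    using Cons TA_append[of "rev p" "i # i # p @ v"] by simp
  also have "\<dots> = TA (rev p @ p @ v)"
    unfolding e using Cons by (intro TA_append[symmetric]) auto
  finally show ?case using Cons by simp
qed simp

text \<open>Moving \<open>s_i\<close> to the right past a scalar exchanges \<open>t_abk\<close> and
  \<open>t_bak\<close> in it. Spans only ask for some twisted scalar, so the automorphism of
  \<open>R\<close> behind it is left implicit.\<close>

lemma theta_twist:
  assumes i: "i \<in> I" and c: "c \<in> carrier R.P"
  shows "\<exists>c'\<in>carrier R.P. At (S i) \<otimes>\<^bsub>A.P\<^esub> theta c = theta c' \<otimes>\<^bsub>A.P\<^esub> At (S i)"
  using c
proof (induction c rule: R.pres_induct)
  case zero
  have "theta \<zero>\<^bsub>R.P\<^esub> = \<zero>\<^bsub>A.P\<^esub>" by (rule ring_hom_zero[OF theta(1) R.ring_P A.ring_P])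
  then show ?case using i by (intro bexI[of _ "\<zero>\<^bsub>R.P\<^esub>"]) simp_all
next
  case (word c w)
  let ?z = "R.cls (R.mono c [])"
  have z: "?z \<in> carrier R.P" using word by simp
  note tz = theta_scalar[of c]
  have "\<exists>c'\<in>carrier R.P. At (S i) \<otimes>\<^bsub>A.P\<^esub> theta (lprod R.P (map Rt w)) = theta c' \<otimes>\<^bsub>A.P\<^esub> At (S i)"
    using word(2)
  proof (induction w)
    case Nil
    show ?case using i by (intro bexI[of _ "\<one>\<^bsub>R.P\<^esub>"]) (simp_all add: ring_hom_one[OF theta(1)])
  next
    case (Cons l w)
    then obtain c' where c': "c' \<in> carrier R.P"
      "At (S i) \<otimes>\<^bsub>A.P\<^esub> theta (lprod R.P (map Rt w)) = theta c' \<otimes>\<^bsub>A.P\<^esub> At (S i)" by auto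
    obtain a b k where l: "l = T a b k" "(a, b, k) \<in> t_index I m" using Cons by (elim t_lettersE) auto
    then have l': "T b a k \<in> t_letters I m" using m_sym by (auto simp: t_letters_iff t_index_def)
    have lt: "l \<in> t_letters I m" "w \<in> lists (t_letters I m)" using Cons by auto
    let ?w = "lprod R.P (map Rt w)"
    have wc: "?w \<in> carrier R.P" using lt Rt_word_closed by blast
    have t: "theta (Rt l) = At l" "theta (Rt (T b a k)) = At (T b a k)"
      using theta(2) lt l' by simp_all
    have "At (S i) \<otimes>\<^bsub>A.P\<^esub> theta (Rt l \<otimes>\<^bsub>R.P\<^esub> ?w) = (At (S i) \<otimes>\<^bsub>A.P\<^esub> At l) \<otimes>\<^bsub>A.P\<^esub> theta ?w"
      using i lt wc by (simp add: ring_hom_mult[OF theta(1)] t A.P.m_assoc)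
    also have "\<dots> = At (T b a k) \<otimes>\<^bsub>A.P\<^esub> (At (S i) \<otimes>\<^bsub>A.P\<^esub> theta ?w)"
      using i wc l' A_twist[OF i l(2)] by (simp add: l(1) A.P.m_assoc)
    also have "\<dots> = theta (Rt (T b a k) \<otimes>\<^bsub>R.P\<^esub> c') \<otimes>\<^bsub>A.P\<^esub> At (S i)"
      using i l' c' by (simp add: ring_hom_mult[OF theta(1)] t A.P.m_assoc)
    finally show ?case
      using c' l' by (intro bexI[of _ "Rt (T b a k) \<otimes>\<^bsub>R.P\<^esub> c'"]) simp_all
  qed
  then obtain c' where c': "c' \<in> carrier R.P"
    "At (S i) \<otimes>\<^bsub>A.P\<^esub> theta (lprod R.P (map Rt w)) = theta c' \<otimes>\<^bsub>A.P\<^esub> At (S i)" by blast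
  have w: "lprod R.P (map Rt w) \<in> carrier R.P" by (rule Rt_word_closed[OF word(2)])
  have "At (S i) \<otimes>\<^bsub>A.P\<^esub> theta (?z \<otimes>\<^bsub>R.P\<^esub> lprod R.P (map Rt w)) =
      (At (S i) \<otimes>\<^bsub>A.P\<^esub> theta ?z) \<otimes>\<^bsub>A.P\<^esub> theta (lprod R.P (map Rt w))"
    using i z w by (simp add: ring_hom_mult[OF theta(1)] A.P.m_assoc del: R.cls_closed)
  also have "At (S i) \<otimes>\<^bsub>A.P\<^esub> theta ?z = theta ?z \<otimes>\<^bsub>A.P\<^esub> At (S i)"
    unfolding tz using i by (intro A.scalar_central[symmetric]) simp_all
  also have "(theta ?z \<otimes>\<^bsub>A.P\<^esub> At (S i)) \<otimes>\<^bsub>A.P\<^esub> theta (lprod R.P (map Rt w)) =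
      theta (?z \<otimes>\<^bsub>R.P\<^esub> c') \<otimes>\<^bsub>A.P\<^esub> At (S i)"
    using i z w c' by (simp add: ring_hom_mult[OF theta(1)] A.P.m_assoc del: R.cls_closed)
  finally show ?case
    unfolding R.smult_P_eq_mult[OF word(1) w] using z c' by (intro bexI[of _ "?z \<otimes>\<^bsub>R.P\<^esub> c'"]) auto
next
  case (add Z Y)
  then obtain a b where "a \<in> carrier R.P" "b \<in> carrier R.P"
    "At (S i) \<otimes>\<^bsub>A.P\<^esub> theta Z = theta a \<otimes>\<^bsub>A.P\<^esub> At (S i)" "At (S i) \<otimes>\<^bsub>A.P\<^esub> theta Y = theta b \<otimes>\<^bsub>A.P\<^esub> At (S i)"
    by blast
  then show ?case
    using i add by (intro bexI[of _ "a \<oplus>\<^bsub>R.P\<^esub> b"])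
      (simp_all add: ring_hom_add[OF theta(1)] A.P.l_distr A.P.r_distr)
qed

abbreviation spanA :: "('i letter list \<Rightarrow> complex) set set \<Rightarrow> ('i letter list \<Rightarrow> complex) set set" where
  "spanA E \<equiv> rspan (R_ring I m) (A_alg I m) E"

text \<open>The closure operator to which \<open>span_reduced_words\<close> is applied.\<close>

definition clA :: "'i list set \<Rightarrow> 'i list set" where
  "clA U = {u \<in> lists I. TA u \<in> spanA (TA ` U)}"

lemma TA_image: "U \<subseteq> lists I \<Longrightarrow> TA ` U \<subseteq> carrier (A_alg I m)"
  unfolding A_fields using TA_closed by blast

lemma image_Cons_lists: "i \<in> I \<Longrightarrow> U \<subseteq> lists I \<Longrightarrow> (#) i ` U \<subseteq> lists I"
  by (rule image_subsetI) (rule lists.Cons, assumption, erule (1) subsetD)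

lemma image_append_lists:
  assumes "v \<in> lists I" "U \<subseteq> lists I"
  shows "(\<lambda>u. v @ u) ` U \<subseteq> lists I" "(\<lambda>u. u @ v) ` U \<subseteq> lists I"
  using assms by (intro image_subsetI; metis append_in_lists_conv subsetD)+

text \<open>Left multiplication by \<open>s_i\<close> is additive and semilinear; the span absorbs
  the twisted scalars.\<close>

lemma span_left:
  assumes i: "i \<in> I" and U: "U \<subseteq> lists I" and x: "x \<in> spanA (TA ` U)"
  shows "At (S i) \<otimes>\<^bsub>A.P\<^esub> x \<in> spanA (TA ` (#) i ` U)"
proof (rule rspan_hom[OF module_A module_A x TA_image[OF U]])
  have iU: "(#) i ` U \<subseteq> lists I" by (rule image_Cons_lists[OF i U])
  then show sub: "TA ` (#) i ` U \<subseteq> carrier (A_alg I m)" by (rule TA_image)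
  fix c e assume c: "c \<in> carrier (R_ring I m)" and "e \<in> TA ` U"
  then obtain u where u: "u \<in> U" "e = TA u" by blast
  have cR: "c \<in> carrier R.P" using c by (simp add: R_fields)
  have uI: "u \<in> lists I" using u(1) U by blast
  then have uc: "TA u \<in> carrier A.P" by (rule TA_closed)
  obtain c' where c': "c' \<in> carrier R.P" "At (S i) \<otimes>\<^bsub>A.P\<^esub> theta c = theta c' \<otimes>\<^bsub>A.P\<^esub> At (S i)"
    using theta_twist[OF i cR] by blast
  have "At (S i) \<otimes>\<^bsub>A.P\<^esub> (c \<odot>\<^bsub>A_alg I m\<^esub> e) = (At (S i) \<otimes>\<^bsub>A.P\<^esub> theta c) \<otimes>\<^bsub>A.P\<^esub> TA u"
    using i cR uc by (simp add: u A_smult A.P.m_assoc)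
  also have "\<dots> = theta c' \<otimes>\<^bsub>A.P\<^esub> TA (i # u)"
    using i c' uc by (simp add: A.P.m_assoc)
  also have "\<dots> = c' \<odot>\<^bsub>A_alg I m\<^esub> TA (i # u)"
    using c' i uI by (intro A_smult[symmetric] TA_closed) simp_all
  also have "\<dots> \<in> spanA (TA ` (#) i ` U)"
    using c'(1) u(1) by (intro rspan_smult[OF module_A] rspan_base[OF module_A] sub imageI) (simp_all add: R_fields)
  finally show "At (S i) \<otimes>\<^bsub>A.P\<^esub> (c \<odot>\<^bsub>A_alg I m\<^esub> e) \<in> spanA (TA ` (#) i ` U)" .
qed (use i in \<open>simp_all add: A_fields A.P.r_distr\<close>)

lemma span_right:
  assumes v: "v \<in> lists I" and U: "U \<subseteq> lists I" and x: "x \<in> spanA (TA ` U)"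
  shows "x \<otimes>\<^bsub>A.P\<^esub> TA v \<in> spanA (TA ` (\<lambda>u. u @ v) ` U)"
proof (rule rspan_hom[OF module_A module_A x TA_image[OF U]])
  have vU: "(\<lambda>u. u @ v) ` U \<subseteq> lists I" by (rule image_append_lists(2)[OF v U])
  then show sub: "TA ` (\<lambda>u. u @ v) ` U \<subseteq> carrier (A_alg I m)" by (rule TA_image)
  fix c e assume c: "c \<in> carrier (R_ring I m)" and "e \<in> TA ` U"
  then obtain u where u: "u \<in> U" "e = TA u" by blast
  have cR: "c \<in> carrier R.P" using c by (simp add: R_fields)
  have uI: "u \<in> lists I" using u(1) U by blast
  have "(c \<odot>\<^bsub>A_alg I m\<^esub> e) \<otimes>\<^bsub>A.P\<^esub> TA v = theta c \<otimes>\<^bsub>A.P\<^esub> TA (u @ v)"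
    using v cR uI by (simp add: u A_smult A.P.m_assoc TA_append del: map_append)
  also have "\<dots> = c \<odot>\<^bsub>A_alg I m\<^esub> TA (u @ v)"
    using cR uI v by (intro A_smult[symmetric] TA_closed) auto
  also have "\<dots> \<in> spanA (TA ` (\<lambda>u. u @ v) ` U)"
    using c u(1) by (intro rspan_smult[OF module_A] rspan_base[OF module_A] sub imageI)
  finally show "(c \<odot>\<^bsub>A_alg I m\<^esub> e) \<otimes>\<^bsub>A.P\<^esub> TA v \<in> spanA (TA ` (\<lambda>u. u @ v) ` U)" .
qed (use v in \<open>simp_all add: A_fields A.P.l_distr\<close>)

lemma clA_lists: "clA U \<subseteq> lists I"
  by (auto simp: clA_def)

lemma clA_base:
  assumes U: "U \<subseteq> lists I"
  shows "U \<subseteq> clA U"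
proof
  fix u assume u: "u \<in> U"
  show "u \<in> clA U"
    using subsetD[OF U u] rspan_base[OF module_A imageI[OF u] TA_image[OF U]] by (simp add: clA_def)
qed

lemma clA_trans:
  assumes U': "U' \<subseteq> lists I" and U: "U \<subseteq> clA U'"
  shows "clA U \<subseteq> clA U'"
proof
  have sub: "TA ` U \<subseteq> spanA (TA ` U')"
  proof (rule image_subsetI)
    fix u assume "u \<in> U"
    from subsetD[OF U this] show "TA u \<in> spanA (TA ` U')" by (simp add: clA_def)
  qed
  fix u assume "u \<in> clA U"
  then show "u \<in> clA U'"
    using subsetD[OF rspan_trans[OF module_A sub TA_image[OF U']]] by (simp add: clA_def)
qed

lemma clA_Cons: "i \<in> I \<Longrightarrow> U \<subseteq> lists I \<Longrightarrow> u \<in> clA U \<Longrightarrow> i # u \<in> clA ((#) i ` U)"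
  unfolding clA_def using span_left[of i U "TA u"] by simp

lemma clA_append_left:
  "d \<in> lists I \<Longrightarrow> U \<subseteq> lists I \<Longrightarrow> u \<in> clA U \<Longrightarrow> d @ u \<in> clA ((\<lambda>u. d @ u) ` U)"
proof (induction d)
  case (Cons i d)
  then have "i # d @ u \<in> clA ((#) i ` (\<lambda>u. d @ u) ` U)"
    by (intro clA_Cons image_append_lists) auto
  then show ?case by (simp add: image_image)
qed simp

lemma clA_append_right:
  assumes "v \<in> lists I" "U \<subseteq> lists I" "u \<in> clA U"
  shows "u @ v \<in> clA ((\<lambda>u. u @ v) ` U)"
  using assms span_right[of v U "TA u"] TA_append[of u v] by (simp add: clA_def)

lemma clA_equal: "u \<in> lists I \<Longrightarrow> u' \<in> U \<Longrightarrow> U \<subseteq> lists I \<Longrightarrow> TA u = TA u' \<Longrightarrow> u \<in> clA U"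
  using clA_base[of U] by (auto simp: clA_def)

text \<open>Expanding the product of the factors \<open>s_i s_j - t_ijk\<close>, with scalars
  collected on the left, gives the monic top term \<open>(s_i s_j)^n\<close> plus a combination of
  lower powers. How scalars change on their way past \<open>s_i\<close> and \<open>s_j\<close> is
  not tracked, since only the span matters.\<close>

lemma clA_power:
  assumes ij: "i \<in> I" "j \<in> I" "i \<noteq> j" "m i j = enat n"
  shows "alt (2 * n) i j \<in> clA ((\<lambda>l. alt (2 * l) i j) ` {..<n})"
proof -
  let ?X = "At (S i) \<otimes>\<^bsub>A.P\<^esub> At (S j)" and ?W = "\<lambda>n. (\<lambda>l. alt (2 * l) i j) ` {..<n}"
  interpret MA: module "R_ring I m" "A_alg I m" by (rule module_A)
  have alt: "alt (2 * l) i j \<in> lists I" for l using ij by (intro alt_in_lists)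
  have W: "?W n \<subseteq> lists I" for n using alt by blast
  have Xc: "?X \<in> carrier A.P" using ij by simp
  have X_step: "?X \<otimes>\<^bsub>A.P\<^esub> x \<in> spanA (TA ` ?W (Suc n))" if "x \<in> spanA (TA ` ?W n)" for x n
  proof -
    have x: "x \<in> carrier A.P" using rspan_closed[OF module_A that TA_image[OF W]] by (simp add: A_fields)
    have "At (S i) \<otimes>\<^bsub>A.P\<^esub> (At (S j) \<otimes>\<^bsub>A.P\<^esub> x) \<in> spanA (TA ` (#) i ` (#) j ` ?W n)"
      using ij W[of n] that by (intro span_left image_Cons_lists)
    moreover have "(#) i ` (#) j ` ?W n \<subseteq> ?W (Suc n)"
    proof
      fix u assume "u \<in> (#) i ` (#) j ` ?W n"
      then obtain l where "l < n" "u = i # j # alt (2 * l) i j" by blast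
      then show "u \<in> ?W (Suc n)" by (intro image_eqI[of _ _ "Suc l"]) auto
    qed
    ultimately have "At (S i) \<otimes>\<^bsub>A.P\<^esub> (At (S j) \<otimes>\<^bsub>A.P\<^esub> x) \<in> spanA (TA ` ?W (Suc n))"
      by (rule subsetD[OF rspan_mono[OF image_mono], rotated])
    then show ?thesis using x ij by (simp add: A.P.m_assoc)
  qed
  \<comment> \<open>For the induction the scalars form an arbitrary list; one more factor
    \<open>X - c\<close> in front raises the bound on the powers in the remainder by one.\<close>
  have expand: "\<exists>r\<in>spanA (TA ` ?W (length cs)).
      lprod A.P (map (\<lambda>c. ?X \<ominus>\<^bsub>A.P\<^esub> theta c) cs) = TA (alt (2 * length cs) i j) \<oplus>\<^bsub>A.P\<^esub> r"
    if "set cs \<subseteq> carrier R.P" for cs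
    using that
  proof (induction cs)
    case Nil
    show ?case by (intro bexI[of _ "\<zero>\<^bsub>A.P\<^esub>"]) (use rspan_zero[of "A_alg I m"] in \<open>simp_all add: A_fields\<close>)
  next
    case (Cons c cs)
    let ?n = "length cs"
    obtain r where r: "r \<in> spanA (TA ` ?W ?n)"
      "lprod A.P (map (\<lambda>c. ?X \<ominus>\<^bsub>A.P\<^esub> theta c) cs) = TA (alt (2 * ?n) i j) \<oplus>\<^bsub>A.P\<^esub> r"
      using Cons by auto
    have c: "c \<in> carrier R.P" using Cons by simp
    have rc: "r \<in> carrier A.P" using rspan_closed[OF module_A r(1) TA_image[OF W]] by (simp add: A_fields)
    let ?T = "TA (alt (2 * ?n) i j)"
    have Tc: "?T \<in> carrier A.P" using alt by (intro TA_closed)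
    have XT: "?X \<otimes>\<^bsub>A.P\<^esub> ?T = TA (alt (2 * Suc ?n) i j)" using ij Tc by (simp add: A.P.m_assoc)
    have mc: "\<ominus>\<^bsub>R.P\<^esub> c \<in> carrier R.P" using c by simp
    note tm = theta_minus[OF c]
    let ?r = "?X \<otimes>\<^bsub>A.P\<^esub> r \<oplus>\<^bsub>A.P\<^esub> (\<ominus>\<^bsub>R.P\<^esub> c) \<odot>\<^bsub>A_alg I m\<^esub> (?T \<oplus>\<^bsub>A.P\<^esub> r)"
    have "(?X \<ominus>\<^bsub>A.P\<^esub> theta c) \<otimes>\<^bsub>A.P\<^esub> (?T \<oplus>\<^bsub>A.P\<^esub> r) = ?X \<otimes>\<^bsub>A.P\<^esub> ?T \<oplus>\<^bsub>A.P\<^esub> ?r"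
      using Xc Tc rc c mc by (simp add: A_smult tm A.P.minus_eq A.P.l_distr A.P.r_distr A.P.a_ac)
    moreover have "?r \<in> spanA (TA ` ?W (Suc ?n))"
    proof -
      have "?T \<in> spanA (TA ` ?W (Suc ?n))"
        by (intro rspan_base[OF module_A] TA_image[OF W] imageI) simp
      moreover have "?W ?n \<subseteq> ?W (Suc ?n)" by (intro image_mono) auto
      from subsetD[OF rspan_mono[OF image_mono[OF this]] r(1)] have "r \<in> spanA (TA ` ?W (Suc ?n))" .
      ultimately have "?T \<oplus>\<^bsub>A.P\<^esub> r \<in> spanA (TA ` ?W (Suc ?n))"
        using rspan_add[OF module_A _ _ TA_image[OF W], of r "Suc ?n" ?T] by (simp add: A_fields)
      then have "(\<ominus>\<^bsub>R.P\<^esub> c) \<odot>\<^bsub>A_alg I m\<^esub> (?T \<oplus>\<^bsub>A.P\<^esub> r) \<in> spanA (TA ` ?W (Suc ?n))"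
        using mc by (intro rspan_smult[OF module_A] TA_image[OF W]) (simp_all add: R_fields)
      then show ?thesis
        using rspan_add[OF module_A _ X_step[OF r(1)] TA_image[OF W]] by (simp add: A_fields)
    qed
    ultimately show ?case using r(2) XT by (intro bexI[of _ ?r]) simp_all
  qed
  let ?cs = "map (\<lambda>k. Rt (T i j (k mod n))) [1..<Suc n]"
  have tl: "T i j (k mod n) \<in> t_letters I m" for k
    using m_ge_2[OF ij] ij by (simp add: t_letters_iff t_index_def)
  have cs: "set ?cs \<subseteq> carrier R.P" unfolding set_map by (rule image_subsetI) (rule Rt_closed[OF tl])
  have len: "length ?cs = n" by simp
  obtain r where r: "r \<in> spanA (TA ` ?W n)"
    "lprod A.P (map (\<lambda>c. ?X \<ominus>\<^bsub>A.P\<^esub> theta c) ?cs) = TA (alt (2 * n) i j) \<oplus>\<^bsub>A.P\<^esub> r"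
    using expand[OF cs] unfolding len by (rule bexE)
  have rc: "r \<in> carrier A.P" using rspan_closed[OF module_A r(1) TA_image[OF W]] by (simp add: A_fields)
  have "map (\<lambda>c. ?X \<ominus>\<^bsub>A.P\<^esub> theta c) ?cs = map (\<lambda>k. ?X \<ominus>\<^bsub>A.P\<^esub> At (T i j (k mod n))) [1..<Suc n]"
    using theta(2) tl by (simp add: comp_def del: upt_Suc)
  from r(2)[unfolded this A_product[OF ij]] have "TA (alt (2 * n) i j) \<oplus>\<^bsub>A.P\<^esub> r = \<zero>\<^bsub>A.P\<^esub>" by (rule HOL.sym)
  then have "TA (alt (2 * n) i j) = \<ominus>\<^bsub>A.P\<^esub> r"
    using rc alt by (intro A.P.minus_equality[symmetric] TA_closed) 
  also have "\<dots> = (\<ominus>\<^bsub>R.P\<^esub> \<one>\<^bsub>R.P\<^esub>) \<odot>\<^bsub>A_alg I m\<^esub> r"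
    using rc theta_minus[OF R.P.one_closed]
    by (simp add: A_smult ring_hom_one[OF theta(1)] A.P.l_minus)
  also have "\<dots> \<in> spanA (TA ` ?W n)"
    using r(1) by (intro rspan_smult[OF module_A] TA_image[OF W]) (simp_all add: R_fields)
  finally show ?thesis using alt by (simp add: clA_def)
qed

text \<open>The relation for \<open>(s_i s_j)^n\<close> is multiplied on the left by the inverse of
  \<open>alt n i j\<close>. Its top term becomes the second half of \<open>alt (2 * n) i j\<close>,
  an alternating word of length \<open>n\<close>; the power \<open>l = 0\<close> becomes
  \<open>rev (alt n i j)\<close>, and a power with \<open>0 < l < n\<close> shrinks to an
  alternating word of length \<open>|n - 2 l| < n\<close>. The parity of \<open>n\<close> decides
  with which letters the two words of length \<open>n\<close> begin.\<close>

lemma clA_braid_aux: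
  assumes ij: "i \<in> I" "j \<in> I" "i \<noteq> j" "m i j = enat n" and v: "v \<in> lists I"
  shows "(if even n then alt n i j else alt n j i) @ v \<in>
    clA (insert (rev (alt n i j) @ v) {y \<in> lists I. length y < n + length v})"
proof -
  let ?p = "alt n i j" and ?short = "{y \<in> lists I. length y < n + length v}"
  let ?W = "(\<lambda>l. alt (2 * l) i j) ` {..<n}"
  have alt: "alt k a b \<in> lists I" if "a \<in> {i, j}" "b \<in> {i, j}" for k a b
    using ij that by (intro alt_in_lists) auto
  have pI: "?p \<in> lists I" "rev ?p \<in> lists I" using alt by auto
  have target: "insert (rev ?p @ v) ?short \<subseteq> lists I" using pI v by auto
  have W: "?W \<subseteq> lists I" using alt by blast
  have "alt (2 * n) i j @ v \<in> clA ((\<lambda>u. u @ v) ` ?W)"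
    by (intro clA_append_right v W clA_power ij)
  then have 1: "rev ?p @ alt (2 * n) i j @ v \<in> clA ((\<lambda>u. rev ?p @ u) ` (\<lambda>u. u @ v) ` ?W)"
    by (intro clA_append_left pI image_append_lists v W)
  have "(\<lambda>u. rev ?p @ u) ` (\<lambda>u. u @ v) ` ?W \<subseteq> clA (insert (rev ?p @ v) ?short)"
  proof
    fix u assume "u \<in> (\<lambda>u. rev ?p @ u) ` (\<lambda>u. u @ v) ` ?W"
    then obtain l where l: "l < n" "u = rev ?p @ alt (2 * l) i j @ v" by blast
    have uI: "u \<in> lists I" using l pI alt v by auto
    consider "l = 0" | "0 < l" "2 * l \<le> n" | "n < 2 * l" by linarith
    then show "u \<in> clA (insert (rev ?p @ v) ?short)"
    proof cases
      case 1
      then show ?thesis using clA_base[OF target] l by auto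
    next
      case 2
      \<comment> \<open>Here \<open>q\<close> is the part of \<open>alt n i j\<close> that the power
        does not cancel.\<close>
      define q where "q = alt (n - 2 * l) i j"
      have p: "?p = alt (2 * l) i j @ q" using alt_add[of "2 * l" "n - 2 * l" i j] 2 by (simp add: q_def)
      have q: "q \<in> lists I" using alt by (simp add: q_def)
      have "TA u = TA (rev q) \<otimes>\<^bsub>A.P\<^esub> TA (rev (alt (2 * l) i j) @ alt (2 * l) i j @ v)"
        unfolding l p rev_append append_assoc using q alt v by (intro TA_append) auto
      also have "\<dots> = TA (rev q @ v)"
        using q alt v by (subst TA_cancel) (auto simp: TA_append simp del: map_append)
      finally have eq: "TA u = TA (rev q @ v)" .
      have "rev q @ v \<in> ?short" using q v 2 by (simp add: q_def)
      then show ?thesis by (rule clA_equal[OF uI insertI2 target eq])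
    next
      case 3
      \<comment> \<open>Here \<open>q\<close> is the part of the power left over when all of
        \<open>alt n i j\<close> is cancelled; its initial letter depends on the parity of
        \<open>n\<close>.\<close>
      define q where "q = (if even n then alt (2 * l - n) i j else alt (2 * l - n) j i)"
      have p: "alt (2 * l) i j = ?p @ q" using alt_add[of n "2 * l - n" i j] 3 by (simp add: q_def)
      have q: "q \<in> lists I" using alt by (simp add: q_def)
      have eq: "TA u = TA (q @ v)" unfolding l p append_assoc using pI q v by (intro TA_cancel) auto
      have "q @ v \<in> ?short" using q v 3 l(1) by (simp add: q_def)
      then show ?thesis by (rule clA_equal[OF uI insertI2 target eq])
    qed
  qed
  then have 2: "rev ?p @ alt (2 * n) i j @ v \<in> clA (insert (rev ?p @ v) ?short)"
    using 1 clA_trans[OF target] by blast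
  define q where "q = (if even n then alt n i j else alt n j i)"
  have q: "q \<in> lists I" using alt by (simp add: q_def)
  have "alt (2 * n) i j = ?p @ q" using alt_add[of n n i j] by (simp add: q_def mult_2)
  then have "TA (rev ?p @ alt (2 * n) i j @ v) = TA (q @ v)"
    using TA_cancel[of ?p "q @ v"] pI q v by simp
  then show ?thesis using 2 q v by (simp add: clA_def q_def)
qed

text \<open>For odd \<open>n\<close> the auxiliary statement comes out with \<open>i\<close> and
  \<open>j\<close> exchanged, so it is applied to \<open>j\<close> and \<open>i\<close>.\<close>

lemma clA_braid:
  assumes ij: "i \<in> I" "j \<in> I" "i \<noteq> j" "m i j = enat n" and v: "v \<in> lists I"
  shows "alt n i j @ v \<in> clA (insert (alt n j i @ v) {y \<in> lists I. length y < n + length v})"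
proof (cases "even n")
  case True
  then show ?thesis using clA_braid_aux[OF ij v] by (simp add: rev_alt)
next
  case False
  have "m j i = enat n" using ij m_sym by metis
  then show ?thesis using False clA_braid_aux[of j i n v] ij v by (simp add: rev_alt)
qed

lemma words_span:
  assumes "W \<subseteq> lists I" "\<And>u. u \<in> lists I \<Longrightarrow> \<exists>y\<in>W. u \<approx> y \<and> reduced y"
  shows "lists I \<subseteq> clA W"
proof (rule span_reduced_words[OF _ _ _ _ _ _ assms])
  fix i v assume "i \<in> I" "v \<in> lists I"
  then show "i # i # v \<in> clA {v}" using TA_cancel[of "[i]" v] by (intro clA_equal[of _ v]) auto
qed (auto intro!: clA_Cons clA_braid dest: subsetD[OF clA_lists] subsetD[OF clA_base] subsetD[OF clA_trans])

text \<open>A letter \<open>t\<close> in front of a product acts as a scalar, and a letter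
  \<open>S i\<close> in front prolongs the words while twisting the scalars.\<close>

lemma carrier_A_span: "carrier (A_alg I m) \<subseteq> spanA (TA ` lists I)"
proof
  interpret MA: module "R_ring I m" "A_alg I m" by (rule module_A)
  have sub: "TA ` lists I \<subseteq> carrier (A_alg I m)" by (rule TA_image) simp
  fix Z assume "Z \<in> carrier (A_alg I m)"
  then have "Z \<in> carrier A.P" by (simp add: A_fields)
  then show "Z \<in> spanA (TA ` lists I)"
  proof (induction Z rule: A.pres_induct)
    case zero
    then show ?case using rspan_zero[of "A_alg I m"] by (simp add: A_fields)
  next
    case (add Z Y)
    then show ?case using rspan_add[OF module_A _ _ sub] by (simp add: A_fields)
  next
    case (word c w)
    have scalar: "A.cls (A.mono c []) \<otimes>\<^bsub>A.P\<^esub> x \<in> spanA (TA ` lists I)" if "x \<in> spanA (TA ` lists I)" for x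
    proof -
      have x: "x \<in> carrier A.P" using rspan_closed[OF module_A that sub] by (simp add: A_fields)
      have "A.cls (A.mono c []) \<otimes>\<^bsub>A.P\<^esub> x = R.cls (R.mono c []) \<odot>\<^bsub>A_alg I m\<^esub> x"
        using x by (simp add: A_smult theta_scalar)
      then show ?thesis using rspan_smult[OF module_A that _ sub] by (simp add: R_fields)
    qed
    have "lprod A.P (map At w) \<in> spanA (TA ` lists I)"
      using word(2)
    proof (induction w)
      case Nil
      have "TA [] \<in> spanA (TA ` lists I)" by (intro rspan_base[OF module_A] sub) blast
      then show ?case by simp
    next
      case (Cons l w)
      then have IH: "lprod A.P (map At w) \<in> spanA (TA ` lists I)" by simp
      have x: "lprod A.P (map At w) \<in> carrier A.P" using rspan_closed[OF module_A IH sub] by (simp add: A_fields)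
      show ?case
      proof (cases "l \<in> t_letters I m")
        case True
        then have "At l \<otimes>\<^bsub>A.P\<^esub> lprod A.P (map At w) = Rt l \<odot>\<^bsub>A_alg I m\<^esub> lprod A.P (map At w)"
          using x theta(2)[of "gen complex_ring l"] by (simp add: A_smult)
        then show ?thesis using rspan_smult[OF module_A IH _ sub, of "Rt l"] True by (simp add: R_fields)
      next
        case False
        then obtain i where i: "i \<in> I" "l = S i" using Cons.hyps by (auto simp: A_letters_def)
        have "At (S i) \<otimes>\<^bsub>A.P\<^esub> lprod A.P (map At w) \<in> spanA (TA ` (#) i ` lists I)"
          using i by (intro span_left IH) auto
        moreover have "(#) i ` lists I \<subseteq> lists I" using i by auto
        ultimately show ?thesis using subsetD[OF rspan_mono[OF image_mono]] i by (simp add: i(2))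
      qed
    qed
    moreover from this have "lprod A.P (map At w) \<in> carrier A.P"
      using rspan_closed[OF module_A _ sub] by (simp add: A_fields)
    ultimately show ?case
      using scalar by (subst A.smult_P_eq_mult[OF word(1)])
  qed
qed


section \<open>Matrices over \<open>A_+(M)\<close> for the elements of \<open>A(M)\<close>\<close>

interpretation Q: ap_algebra I m "R_ring I m" "R_t I m" by (rule ap_algebra_R)

text \<open>The index \<open>o\<close> of the generator in the basis \<open>1, s_o\<close>. It lies
  in \<open>I\<close> as soon as \<open>I\<close> is nonempty.\<close>

definition base_point :: 'i where "base_point = (SOME i. i \<in> I)"

lemma base_point: "i \<in> I \<Longrightarrow> base_point \<in> I"
  unfolding base_point_def by (rule someI)

abbreviation "AP \<equiv> Q.Ap.P"

text \<open>
  \<open>A(M)\<close> is a free right module over \<open>A\<^sub>+(M)\<close> on \<open>1\<close> and \<open>s\<^sub>o\<close>; the matrices describe left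
  multiplication. The first row is linear over \<open>R\<close>, the second one twisted.
\<close>

lemma matrix_representation:
  obtains \<psi> where "\<psi> \<in> ring_hom A.P (mat_ring AP)"
    "\<And>i. i \<in> I \<Longrightarrow> \<psi> (At (S i)) = (\<zero>\<^bsub>AP\<^esub>, Q.pair i base_point, Q.pair base_point i, \<zero>\<^bsub>AP\<^esub>)"
    "\<And>i j k. (i, j, k) \<in> t_index I m \<Longrightarrow> \<psi> (At (T i j k)) =
      (R_t I m i j k \<odot>\<^bsub>AP\<^esub> \<one>\<^bsub>AP\<^esub>, \<zero>\<^bsub>AP\<^esub>, \<zero>\<^bsub>AP\<^esub>, R_t I m j i k \<odot>\<^bsub>AP\<^esub> \<one>\<^bsub>AP\<^esub>)"
    "\<And>c. \<psi> (A.cls (A.mono c [])) =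
      (R.cls (R.mono c []) \<odot>\<^bsub>AP\<^esub> \<one>\<^bsub>AP\<^esub>, \<zero>\<^bsub>AP\<^esub>, \<zero>\<^bsub>AP\<^esub>, R.cls (R.mono c []) \<odot>\<^bsub>AP\<^esub> \<one>\<^bsub>AP\<^esub>)"
proof -
  let ?o = base_point and ?sc = "\<lambda>c. c \<odot>\<^bsub>AP\<^esub> \<one>\<^bsub>AP\<^esub>"
  interpret MR: ring "mat_ring AP" by (rule Q.Ap.P.ring_mat)
  have sc_closed: "?sc c \<in> carrier AP" if "c \<in> carrier R.P" for c using that by (simp add: R_fields)
  have sc_central: "?sc c \<otimes>\<^bsub>AP\<^esub> Z = Z \<otimes>\<^bsub>AP\<^esub> ?sc c" if "c \<in> carrier R.P" "Z \<in> carrier AP" for c Z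
    using that by (simp add: R_fields Q.Ap.smult_mult Q.Ap.mult_smult)
  have sc_mult: "?sc c \<otimes>\<^bsub>AP\<^esub> ?sc d = ?sc (c \<otimes>\<^bsub>R.P\<^esub> d)" if "c \<in> carrier R.P" "d \<in> carrier R.P" for c d
    using that Q.Ap.smult_assoc1[of c d "\<one>\<^bsub>AP\<^esub>"] by (simp add: R_fields Q.Ap.smult_mult)
  have sc_add: "?sc (c \<oplus>\<^bsub>R.P\<^esub> d) = ?sc c \<oplus>\<^bsub>AP\<^esub> ?sc d" if "c \<in> carrier R.P" "d \<in> carrier R.P" for c d
    using that Q.Ap.smult_l_distr[of c d "\<one>\<^bsub>AP\<^esub>"] by (simp add: R_fields)
  have sc_one: "?sc \<one>\<^bsub>R.P\<^esub> = \<one>\<^bsub>AP\<^esub>" using Q.Ap.smult_one[of "\<one>\<^bsub>AP\<^esub>"] by (simp add: R_fields)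
  let ?\<eta> = "\<lambda>c. (?sc (R.cls (R.mono c [])), \<zero>\<^bsub>AP\<^esub>, \<zero>\<^bsub>AP\<^esub>, ?sc (R.cls (R.mono c [])))"
  \<comment> \<open>The columns are read off from \<open>s_i = s_o (s_o s_i)\<close> and
    \<open>s_i s_o\<close> for a generator, and from \<open>t_ijk\<close> and
    \<open>t_ijk s_o = s_o t_jik\<close> for a letter \<open>t\<close>.\<close>
  let ?\<gamma> = "\<lambda>l. case l of S i \<Rightarrow> (\<zero>\<^bsub>AP\<^esub>, Q.pair i ?o, Q.pair ?o i, \<zero>\<^bsub>AP\<^esub>)
    | T i j k \<Rightarrow> (?sc (Rt (T i j k)), \<zero>\<^bsub>AP\<^esub>, \<zero>\<^bsub>AP\<^esub>, ?sc (Rt (T j i k)))"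
  have scc: "R.cls (R.mono c []) \<in> carrier R.P" for c by simp
  have \<eta>: "?\<eta> \<in> ring_hom complex_ring (mat_ring AP)"
    using scc sc_closed[OF scc] sc_closed[OF R.P.m_closed[OF scc scc]] ring_hom_add[OF R.scalar_hom] ring_hom_mult[OF R.scalar_hom] ring_hom_one[OF R.scalar_hom]
    by (intro ring_hom_memI) (simp_all add: sc_mult sc_add sc_one del: R.cls_closed complex_ring_simps(2,5))
  have tsym: "T j i k \<in> t_letters I m" if "T i j k \<in> t_letters I m" for i j k
    using that m_sym by (auto simp: t_letters_iff t_index_def)
  have po: "Q.pair i ?o \<in> carrier AP" "Q.pair ?o i \<in> carrier AP" if "i \<in> I" for i
    using that base_point by (auto intro: Q.pair_closed)
  have \<gamma>: "?\<gamma> l \<in> carrier (mat_ring AP)" if "l \<in> A_letters I m" for l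
    using that po tsym sc_closed by (auto simp: A_letters_def elim!: t_lettersE simp: t_letters_iff[symmetric])
  have comm: "?\<eta> c \<otimes>\<^bsub>mat_ring AP\<^esub> ?\<gamma> l = ?\<gamma> l \<otimes>\<^bsub>mat_ring AP\<^esub> ?\<eta> c" if l: "l \<in> A_letters I m" for c l
    using \<gamma>[OF l] sc_closed[OF scc, of c] sc_central[OF scc, of _ c] by (cases l) auto
  have E: "free_eval complex_ring (A_letters I m) (mat_ring AP) ?\<eta> ?\<gamma>"
    by (intro free_eval.intro free_eval_axioms.intro A.free_algebra_axioms MR.ring_axioms \<eta> \<gamma> comm)
  interpret E: free_eval complex_ring "A_letters I m" "mat_ring AP" ?\<eta> ?\<gamma> by (rule E)
  note sub = ring_hom_sub[OF E.ev_hom A.ring_F MR.ring_axioms]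
  have evS: "E.ev (gen complex_ring (S i)) = (\<zero>\<^bsub>AP\<^esub>, Q.pair i ?o, Q.pair ?o i, \<zero>\<^bsub>AP\<^esub>)" if "i \<in> I" for i
    using E.ev_gen[of "S i"] that by (simp add: A_letters_def)
  have evT: "E.ev (gen complex_ring (T i j k)) = (?sc (Rt (T i j k)), \<zero>\<^bsub>AP\<^esub>, \<zero>\<^bsub>AP\<^esub>, ?sc (Rt (T j i k)))"
    if "T i j k \<in> t_letters I m" for i j k
    using E.ev_gen[of "T i j k"] that by (simp add: A_letters_def)
  have genA: "gen complex_ring l \<in> carrier A.F" if "l \<in> t_letters I m" for l using that by simp
  have one: "E.ev \<one>\<^bsub>A.F\<^esub> = \<one>\<^bsub>mat_ring AP\<^esub>" by (rule ring_hom_one[OF E.ev_hom])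
  have ker: "E.ev r = \<zero>\<^bsub>mat_ring AP\<^esub>" if r: "r \<in> A_relations I m" for r
  proof -
    let ?g = "gen complex_ring"
    consider (neg) i j k where "(i, j, k) \<in> t_index I m"
        "r = ?g (T i j k) \<otimes>\<^bsub>A.F\<^esub> ?g (T j i (neg_index m i j k)) \<ominus>\<^bsub>A.F\<^esub> \<one>\<^bsub>A.F\<^esub>"
      | (comm) x y where "x \<in> t_letters I m" "y \<in> t_letters I m" "r = ?g x \<otimes>\<^bsub>A.F\<^esub> ?g y \<ominus>\<^bsub>A.F\<^esub> ?g y \<otimes>\<^bsub>A.F\<^esub> ?g x"
      | (square) i where "i \<in> I" "r = ?g (S i) \<otimes>\<^bsub>A.F\<^esub> ?g (S i) \<ominus>\<^bsub>A.F\<^esub> \<one>\<^bsub>A.F\<^esub>"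
      | (braid) i j n where "i \<in> I" "j \<in> I" "i \<noteq> j" "m i j = enat n"
        "r = lprod A.F (map (\<lambda>k. ?g (S i) \<otimes>\<^bsub>A.F\<^esub> ?g (S j) \<ominus>\<^bsub>A.F\<^esub> ?g (T i j (k mod n))) [1..<Suc n])"
      | (twist) p i j k where "p \<in> I" "(i, j, k) \<in> t_index I m"
        "r = ?g (S p) \<otimes>\<^bsub>A.F\<^esub> ?g (T i j k) \<ominus>\<^bsub>A.F\<^esub> ?g (T j i k) \<otimes>\<^bsub>A.F\<^esub> ?g (S p)"
      using r unfolding A_relations_def t_relations_def Let_def by blast
    then show ?thesis
    proof cases
      case neg
      let ?k = "neg_index m i j k"
      have ij: "m i j = m j i" using neg(1) m_sym by (auto simp: t_index_def)
      have l: "T i j k \<in> t_letters I m" "T j i ?k \<in> t_letters I m" "T j i k \<in> t_letters I m" "T i j ?k \<in> t_letters I m"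
        using neg(1) t_index_neg[OF neg(1)] tsym by (simp_all add: t_letters_iff)
      have "Rt (T i j k) \<otimes>\<^bsub>R.P\<^esub> Rt (T j i ?k) = \<one>\<^bsub>R.P\<^esub>" "Rt (T j i k) \<otimes>\<^bsub>R.P\<^esub> Rt (T i j ?k) = \<one>\<^bsub>R.P\<^esub>"
        using Rt_neg[OF l(1)] Rt_neg[OF l(3)] ij by (simp_all add: letter_neg_def neg_index_def)
      then have "E.ev (?g (T i j k) \<otimes>\<^bsub>A.F\<^esub> ?g (T j i ?k)) = \<one>\<^bsub>mat_ring AP\<^esub>"
        using l sc_closed Rt_closed by (simp add: E.ev_mult evT sc_mult sc_one)
      then show ?thesis
        unfolding neg(2) using l genA by (subst sub) (simp_all only: one MR.minus_eq_zero_iff A.F.m_closed A.F.one_closed MR.one_closed genA)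
    next
      case comm
      obtain i j k i' j' k' where l: "x = T i j k" "y = T i' j' k'" using comm(1,2) by (auto simp: t_letters_def)
      have lt: "T i j k \<in> t_letters I m" "T j i k \<in> t_letters I m" "T i' j' k' \<in> t_letters I m" "T j' i' k' \<in> t_letters I m"
        using comm(1,2) tsym l by auto
      have "E.ev (?g x \<otimes>\<^bsub>A.F\<^esub> ?g y) = E.ev (?g y \<otimes>\<^bsub>A.F\<^esub> ?g x)"
        using lt sc_closed Rt_closed genA
        by (simp add: l E.ev_mult evT sc_mult R_comm)
      then show ?thesis
        unfolding comm(3) using comm(1,2) genA E.ev_closed
        by (subst sub) (simp_all only: MR.minus_eq_zero_iff A.F.m_closed genA E.ev_closed)
    next
      case square
      have "E.ev (?g (S i) \<otimes>\<^bsub>A.F\<^esub> ?g (S i)) = \<one>\<^bsub>mat_ring AP\<^esub>"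
        using square(1) po[OF square(1)] base_point[OF square(1)] by (simp add: E.ev_mult evS Q.pair_inv)
      then show ?thesis
        unfolding square(2) using square(1)
        by (subst sub) (simp_all only: one MR.minus_eq_zero_iff A.F.m_closed A.F.one_closed MR.one_closed gen_A)
    next
      case braid
      let ?f = "\<lambda>k. ?g (S i) \<otimes>\<^bsub>A.F\<^esub> ?g (S j) \<ominus>\<^bsub>A.F\<^esub> ?g (T i j (k mod n))"
      let ?a = "\<lambda>k. Q.pair i j \<ominus>\<^bsub>AP\<^esub> R_t I m i j (k mod n) \<odot>\<^bsub>AP\<^esub> \<one>\<^bsub>AP\<^esub>"
      let ?b = "\<lambda>k. Q.pair j i \<ominus>\<^bsub>AP\<^esub> R_t I m j i (k mod n) \<odot>\<^bsub>AP\<^esub> \<one>\<^bsub>AP\<^esub>"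
      have o: "?o \<in> I" using base_point braid by blast
      have ji: "m j i = enat n" using braid m_sym by metis
      have lt: "T i j (k mod n) \<in> t_letters I m" "T j i (k mod n) \<in> t_letters I m" for k
        using m_ge_2[OF braid(1-4)] braid tsym by (simp_all add: t_letters_iff t_index_def m_sym)
      have f: "?f k \<in> carrier A.F" for k using lt braid by simp
      have rt: "R_t I m x y (k mod n) = Rt (T x y (k mod n))" for x y k by (rule R_t_def)
      have ab: "?a k \<in> carrier AP" "?b k \<in> carrier AP" for k
        using lt sc_closed braid by (simp_all add: rt)
      \<comment> \<open>The lower right entry of a factor is \<open>s_o s_i s_j s_o - t_jik\<close>.
        Since \<open>s_o s_i s_j s_o = (s_o s_i)(s_j s_i)(s_i s_o)\<close>, it is a conjugate of
        \<open>a_ji - t_jik\<close>, so the product of these entries vanishes by the relation for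
        the pair \<open>(j, i)\<close>.\<close>
      have conj: "Q.pair ?o i \<otimes>\<^bsub>AP\<^esub> ?b k \<otimes>\<^bsub>AP\<^esub> Q.pair i ?o =
          Q.pair ?o i \<otimes>\<^bsub>AP\<^esub> Q.pair j ?o \<ominus>\<^bsub>AP\<^esub> ?sc (Rt (T j i (k mod n)))" for k
      proof -
        let ?s = "?sc (Rt (T j i (k mod n)))"
        have s: "?s \<in> carrier AP" using lt sc_closed by simp
        have "Q.pair ?o i \<otimes>\<^bsub>AP\<^esub> (Q.pair j i \<ominus>\<^bsub>AP\<^esub> ?s) \<otimes>\<^bsub>AP\<^esub> Q.pair i ?o =
            Q.pair ?o i \<otimes>\<^bsub>AP\<^esub> (Q.pair j i \<otimes>\<^bsub>AP\<^esub> Q.pair i ?o) \<ominus>\<^bsub>AP\<^esub> Q.pair ?o i \<otimes>\<^bsub>AP\<^esub> ?s \<otimes>\<^bsub>AP\<^esub> Q.pair i ?o"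
          using o braid s by (simp add: Q.Ap.P.minus_eq Q.Ap.P.l_distr Q.Ap.P.r_distr Q.Ap.P.l_minus Q.Ap.P.r_minus Q.Ap.P.m_assoc)
        also have "Q.pair ?o i \<otimes>\<^bsub>AP\<^esub> ?s \<otimes>\<^bsub>AP\<^esub> Q.pair i ?o = ?s \<otimes>\<^bsub>AP\<^esub> (Q.pair ?o i \<otimes>\<^bsub>AP\<^esub> Q.pair i ?o)"
          using o braid s sc_central[of "Rt (T j i (k mod n))" "Q.pair ?o i"] lt by (simp add: Q.Ap.P.m_assoc[symmetric])
        also have "\<dots> = ?s" using o braid s by (simp add: Q.pair_inv)
        finally show ?thesis using o braid by (simp add: rt Q.pair_mult)
      qed
      have ev: "E.ev (?f k) = (?a k, \<zero>\<^bsub>AP\<^esub>, \<zero>\<^bsub>AP\<^esub>, Q.pair ?o i \<otimes>\<^bsub>AP\<^esub> ?b k \<otimes>\<^bsub>AP\<^esub> Q.pair i ?o)" for k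
      proof -
        have c: "?sc (Rt (T i j (k mod n))) \<in> carrier AP" "?sc (Rt (T j i (k mod n))) \<in> carrier AP"
          using lt sc_closed by simp_all
        have "E.ev (?f k) = E.ev (?g (S i)) \<otimes>\<^bsub>mat_ring AP\<^esub> E.ev (?g (S j)) \<ominus>\<^bsub>mat_ring AP\<^esub> E.ev (?g (T i j (k mod n)))"
          using lt braid by (simp only: sub E.ev_mult gen_A A.F.m_closed)
        also have "\<dots> = (Q.pair i ?o \<otimes>\<^bsub>AP\<^esub> Q.pair ?o j, \<zero>\<^bsub>AP\<^esub>, \<zero>\<^bsub>AP\<^esub>, Q.pair ?o i \<otimes>\<^bsub>AP\<^esub> Q.pair j ?o)
            \<ominus>\<^bsub>mat_ring AP\<^esub> (?sc (Rt (T i j (k mod n))), \<zero>\<^bsub>AP\<^esub>, \<zero>\<^bsub>AP\<^esub>, ?sc (Rt (T j i (k mod n))))"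
          using lt braid po o by (simp add: evS evT)
        also have "\<dots> = (?a k, \<zero>\<^bsub>AP\<^esub>, \<zero>\<^bsub>AP\<^esub>, Q.pair ?o i \<otimes>\<^bsub>AP\<^esub> Q.pair j ?o \<ominus>\<^bsub>AP\<^esub> ?sc (Rt (T j i (k mod n))))"
          using braid o c by (subst Q.Ap.P.mat_minus) (simp_all add: Q.pair_mult rt Q.Ap.P.minus_eq)
        finally show ?thesis unfolding conj .
      qed
      have "E.ev r = lprod (mat_ring AP) (map (\<lambda>k. (?a k, \<zero>\<^bsub>AP\<^esub>, \<zero>\<^bsub>AP\<^esub>, Q.pair ?o i \<otimes>\<^bsub>AP\<^esub> ?b k \<otimes>\<^bsub>AP\<^esub> Q.pair i ?o)) [1..<Suc n])"
        unfolding braid(5) using f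
        by (subst ring_hom_lprod[OF E.ev_hom A.ring_F]) (auto simp: comp_def ev simp del: upt_Suc)
      also have "\<dots> = (lprod AP (map ?a [1..<Suc n]), \<zero>\<^bsub>AP\<^esub>, \<zero>\<^bsub>AP\<^esub>,
          lprod AP (map (\<lambda>k. Q.pair ?o i \<otimes>\<^bsub>AP\<^esub> ?b k \<otimes>\<^bsub>AP\<^esub> Q.pair i ?o) [1..<Suc n]))"
        using ab o braid by (intro Q.Ap.P.lprod_diag) auto
      also have "lprod AP (map (\<lambda>k. Q.pair ?o i \<otimes>\<^bsub>AP\<^esub> ?b k \<otimes>\<^bsub>AP\<^esub> Q.pair i ?o) [1..<Suc n]) =
          Q.pair ?o i \<otimes>\<^bsub>AP\<^esub> lprod AP (map ?b [1..<Suc n]) \<otimes>\<^bsub>AP\<^esub> Q.pair i ?o"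
        using ab o braid by (intro Q.Ap.P.lprod_conj) (auto simp: Q.pair_inv)
      also have "lprod AP (map ?b [1..<Suc n]) = \<zero>\<^bsub>AP\<^esub>" using braid ji by (intro Q.pair_rel) auto
      also have "lprod AP (map ?a [1..<Suc n]) = \<zero>\<^bsub>AP\<^esub>" using braid by (intro Q.pair_rel) auto
      finally show ?thesis using o braid by simp
    next
      case twist
      have lt: "T i j k \<in> t_letters I m" "T j i k \<in> t_letters I m" using twist tsym by (auto simp: t_letters_iff)
      have "E.ev (?g (S p) \<otimes>\<^bsub>A.F\<^esub> ?g (T i j k)) = E.ev (?g (T j i k) \<otimes>\<^bsub>A.F\<^esub> ?g (S p))"
        using twist(1) lt sc_closed Rt_closed po[OF twist(1)]
          sc_central[of "Rt (T i j k)" "Q.pair ?o p"] sc_central[of "Rt (T j i k)" "Q.pair p ?o"]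
        by (simp add: E.ev_mult evT evS)
      then show ?thesis
        unfolding twist(3) using twist(1) lt
        by (subst sub) (simp_all only: MR.minus_eq_zero_iff A.F.m_closed gen_A E.ev_closed)
    qed
  qed
  obtain \<psi> where \<psi>: "\<psi> \<in> ring_hom A.P (mat_ring AP)" "\<And>x. x \<in> carrier A.F \<Longrightarrow> \<psi> (A.cls x) = E.ev x"
    by (rule E.pres_lift[OF A.presented_algebra_axioms ker], assumption) (rule that)
  show ?thesis
  proof (rule that[OF \<psi>(1)])
    fix i j k assume "(i, j, k) \<in> t_index I m"
    then show "\<psi> (At (T i j k)) = (?sc (R_t I m i j k), \<zero>\<^bsub>AP\<^esub>, \<zero>\<^bsub>AP\<^esub>, ?sc (R_t I m j i k))"
      using \<psi>(2)[of "gen complex_ring (T i j k)"] evT[of i j k] genA[of "T i j k"] by (simp add: t_letters_iff R_t_def[of I m i j k] R_t_def[of I m j i k])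
  next
    fix c show "\<psi> (A.cls (A.mono c [])) = ?\<eta> c"
      using \<psi>(2)[of "A.mono c []"] E.ev_scalar[of c] by simp
  qed (use \<psi>(2) evS gen_A in simp)
qed


text \<open>A pair \<open>s_i s_j\<close> acts by a diagonal matrix, so putting it in front of a
  word preserves the shape of the matrix: diagonal for even words, antidiagonal for odd ones. The
  first row of either shape has a single possibly nonzero entry, which is how the two maps separate
  the parities.\<close>

lemma row_maps:
  obtains f g where
    "\<And>h Z. h \<in> {f, g} \<Longrightarrow> Z \<in> carrier A.P \<Longrightarrow> h Z \<in> carrier Q.Ap.P"
    "\<And>h Z Y. h \<in> {f, g} \<Longrightarrow> Z \<in> carrier A.P \<Longrightarrow> Y \<in> carrier A.P \<Longrightarrow> h (Z \<oplus>\<^bsub>A.P\<^esub> Y) = h Z \<oplus>\<^bsub>Q.Ap.P\<^esub> h Y"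
    "\<And>h. h \<in> {f, g} \<Longrightarrow> h \<zero>\<^bsub>A.P\<^esub> = \<zero>\<^bsub>Q.Ap.P\<^esub>"
    "\<And>h c Z. h \<in> {f, g} \<Longrightarrow> c \<in> carrier (R_ring I m) \<Longrightarrow> Z \<in> carrier A.P \<Longrightarrow>
      h (c \<odot>\<^bsub>A_alg I m\<^esub> Z) = c \<odot>\<^bsub>Q.Ap.P\<^esub> h Z"
    "\<And>u. u \<in> lists I \<Longrightarrow> f (TA u) = (if even (length u) then Q.pair_word u else \<zero>\<^bsub>Q.Ap.P\<^esub>)"
    "\<And>u. u \<in> lists I \<Longrightarrow> g (TA u) = (if even (length u) then \<zero>\<^bsub>Q.Ap.P\<^esub> else Q.pair_word (u @ [base_point]))"
proof -
  let ?o = base_point and ?sc = "\<lambda>c. c \<odot>\<^bsub>AP\<^esub> \<one>\<^bsub>AP\<^esub>"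
  interpret MR: ring "mat_ring AP" by (rule Q.Ap.P.ring_mat)
  obtain \<psi> where \<psi>: "\<psi> \<in> ring_hom A.P (mat_ring AP)"
    and \<psi>S: "\<And>i. i \<in> I \<Longrightarrow> \<psi> (At (S i)) = (\<zero>\<^bsub>AP\<^esub>, Q.pair i ?o, Q.pair ?o i, \<zero>\<^bsub>AP\<^esub>)"
    and \<psi>T: "\<And>i j k. (i, j, k) \<in> t_index I m \<Longrightarrow> \<psi> (At (T i j k)) =
      (?sc (R_t I m i j k), \<zero>\<^bsub>AP\<^esub>, \<zero>\<^bsub>AP\<^esub>, ?sc (R_t I m j i k))"
    and \<psi>c: "\<And>c. \<psi> (A.cls (A.mono c [])) =
      (?sc (R.cls (R.mono c [])), \<zero>\<^bsub>AP\<^esub>, \<zero>\<^bsub>AP\<^esub>, ?sc (R.cls (R.mono c [])))"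
    by (rule matrix_representation) (rule that)
  note \<psi>_mult = ring_hom_mult[OF \<psi>] and \<psi>_add = ring_hom_add[OF \<psi>]
  have \<psi>_zero: "\<psi> \<zero>\<^bsub>A.P\<^esub> = \<zero>\<^bsub>mat_ring AP\<^esub>" by (rule ring_hom_zero[OF \<psi> A.ring_P MR.ring_axioms])
  have \<psi>_closed: "\<psi> Z \<in> carrier (mat_ring AP)" if "Z \<in> carrier A.P" for Z by (rule ring_hom_closed[OF \<psi> that])
  have sc_closed: "?sc c \<in> carrier AP" if "c \<in> carrier R.P" for c using that by (simp add: R_fields)
  have sc_mult: "?sc c \<otimes>\<^bsub>AP\<^esub> ?sc d = ?sc (c \<otimes>\<^bsub>R.P\<^esub> d)" if "c \<in> carrier R.P" "d \<in> carrier R.P" for c d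
    using that Q.Ap.smult_assoc1[of c d "\<one>\<^bsub>AP\<^esub>"] by (simp add: R_fields Q.Ap.smult_mult)
  have sc_add: "?sc (c \<oplus>\<^bsub>R.P\<^esub> d) = ?sc c \<oplus>\<^bsub>AP\<^esub> ?sc d" if "c \<in> carrier R.P" "d \<in> carrier R.P" for c d
    using that Q.Ap.smult_l_distr[of c d "\<one>\<^bsub>AP\<^esub>"] by (simp add: R_fields)
  have sc_one: "?sc \<one>\<^bsub>R.P\<^esub> = \<one>\<^bsub>AP\<^esub>" using Q.Ap.smult_one[of "\<one>\<^bsub>AP\<^esub>"] by (simp add: R_fields)
  have sc_zero: "?sc \<zero>\<^bsub>R.P\<^esub> = \<zero>\<^bsub>AP\<^esub>" using Q.Ap.smult_l_null[of "\<one>\<^bsub>AP\<^esub>"] by (simp add: R_fields)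
  \<comment> \<open>The lower right entry \<open>d\<close> is the twisted scalar; it does not meet
    the first row, so its value is left open.\<close>
  let ?good = "\<lambda>c. \<exists>d\<in>carrier AP. \<psi> (theta c) = (?sc c, \<zero>\<^bsub>AP\<^esub>, \<zero>\<^bsub>AP\<^esub>, d)"
  have good_mult: "?good (a \<otimes>\<^bsub>R.P\<^esub> b)" if a: "a \<in> carrier R.P" "?good a" and b: "b \<in> carrier R.P" "?good b" for a b
  proof -
    obtain d e where d: "d \<in> carrier AP" "\<psi> (theta a) = (?sc a, \<zero>\<^bsub>AP\<^esub>, \<zero>\<^bsub>AP\<^esub>, d)"
      and e: "e \<in> carrier AP" "\<psi> (theta b) = (?sc b, \<zero>\<^bsub>AP\<^esub>, \<zero>\<^bsub>AP\<^esub>, e)" using a b by blast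
    have "\<psi> (theta (a \<otimes>\<^bsub>R.P\<^esub> b)) = (?sc (a \<otimes>\<^bsub>R.P\<^esub> b), \<zero>\<^bsub>AP\<^esub>, \<zero>\<^bsub>AP\<^esub>, d \<otimes>\<^bsub>AP\<^esub> e)"
      using a(1) b(1) d e sc_closed
      by (simp add: ring_hom_mult[OF theta(1)] \<psi>_mult sc_mult del: R.cls_closed)
    then show ?thesis using d(1) e(1) by blast
  qed
  have good: "?good c" if "c \<in> carrier R.P" for c
    using that
  proof (induction c rule: R.pres_induct)
    case zero
    have "theta \<zero>\<^bsub>R.P\<^esub> = \<zero>\<^bsub>A.P\<^esub>" by (rule ring_hom_zero[OF theta(1) R.ring_P A.ring_P])
    then show ?case by (intro bexI[of _ "\<zero>\<^bsub>AP\<^esub>"]) (simp_all add: \<psi>_zero sc_zero)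
  next
    case (add Z Y)
    then obtain d e where d: "d \<in> carrier AP" "\<psi> (theta Z) = (?sc Z, \<zero>\<^bsub>AP\<^esub>, \<zero>\<^bsub>AP\<^esub>, d)"
      and e: "e \<in> carrier AP" "\<psi> (theta Y) = (?sc Y, \<zero>\<^bsub>AP\<^esub>, \<zero>\<^bsub>AP\<^esub>, e)" by blast
    have "\<psi> (theta (Z \<oplus>\<^bsub>R.P\<^esub> Y)) = (?sc (Z \<oplus>\<^bsub>R.P\<^esub> Y), \<zero>\<^bsub>AP\<^esub>, \<zero>\<^bsub>AP\<^esub>, d \<oplus>\<^bsub>AP\<^esub> e)"
      using add(1,2) d e by (simp add: ring_hom_add[OF theta(1)] \<psi>_add sc_add)
    then show ?case using d(1) e(1) by blast
  next
    case (word c w)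
    have s: "?good (R.cls (R.mono c []))"
      using sc_closed[of "R.cls (R.mono c [])"] by (simp add: theta_scalar \<psi>c)
    have "?good (lprod R.P (map Rt w))"
      using word(2)
    proof (induction w)
      case Nil
      show ?case
        using ring_hom_one[OF \<psi>] by (intro bexI[of _ "\<one>\<^bsub>AP\<^esub>"]) (simp_all add: ring_hom_one[OF theta(1)] sc_one)
    next
      case (Cons l w)
      obtain a b k where l: "l = T a b k" "(a, b, k) \<in> t_index I m" using Cons by (elim t_lettersE) auto
      then have l': "T b a k \<in> t_letters I m" using m_sym by (auto simp: t_letters_iff t_index_def)
      have "?good (Rt l)"
        using \<psi>T[OF l(2)] theta(2)[of "gen complex_ring l"] Cons.hyps(1) sc_closed[OF Rt_closed[OF l']]
        by (intro bexI[of _ "?sc (Rt (T b a k))"])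
          (simp_all add: l(1) R_t_def[of I m a b k] R_t_def[of I m b a k])
      from good_mult[OF Rt_closed[OF Cons.hyps(1)] this Rt_word_closed[OF Cons.hyps(2)] Cons.IH]
      show ?case by simp
    qed
    from good_mult[OF _ s Rt_word_closed[OF word(2)] this] show ?case
      unfolding R.smult_P_eq_mult[OF word(1) Rt_word_closed[OF word(2)]] by simp
  qed
  have words: "if even (length u) then \<exists>d\<in>carrier AP. \<psi> (TA u) = (Q.pair_word u, \<zero>\<^bsub>AP\<^esub>, \<zero>\<^bsub>AP\<^esub>, d)
      else \<exists>d\<in>carrier AP. \<psi> (TA u) = (\<zero>\<^bsub>AP\<^esub>, Q.pair_word (u @ [?o]), d, \<zero>\<^bsub>AP\<^esub>)" if "u \<in> lists I" for u
    using that
  proof (induction u rule: induct_list012)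
    case 1
    show ?case using ring_hom_one[OF \<psi>] by auto
  next
    case (2 i)
    then have i: "i \<in> I" by simp
    show ?case using \<psi>S[OF i] i base_point[OF i] by simp
  next
    case (3 i j u)
    then have ij: "i \<in> I" "j \<in> I" and u: "u \<in> lists I" by auto
    have o: "?o \<in> I" by (rule base_point[OF ij(1)])
    have uc: "TA u \<in> carrier A.P" by (rule TA_closed[OF u])
    let ?d = "Q.pair ?o i \<otimes>\<^bsub>AP\<^esub> Q.pair j ?o"
    have d: "?d \<in> carrier AP" using ij o by simp
    have "\<psi> (At (S i) \<otimes>\<^bsub>A.P\<^esub> At (S j)) = (Q.pair i j, \<zero>\<^bsub>AP\<^esub>, \<zero>\<^bsub>AP\<^esub>, ?d)"
      using ij o by (simp add: \<psi>_mult \<psi>S Q.pair_mult)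
    moreover have "TA (i # j # u) = (At (S i) \<otimes>\<^bsub>A.P\<^esub> At (S j)) \<otimes>\<^bsub>A.P\<^esub> TA u"
      using ij uc by (simp add: A.P.m_assoc)
    ultimately have e: "\<psi> (TA (i # j # u)) = (Q.pair i j, \<zero>\<^bsub>AP\<^esub>, \<zero>\<^bsub>AP\<^esub>, ?d) \<otimes>\<^bsub>mat_ring AP\<^esub> \<psi> (TA u)"
      using ij uc by (simp only: \<psi>_mult A.P.m_closed At_S)
    show ?case
    proof (cases "even (length u)")
      case True
      then obtain d' where d': "d' \<in> carrier AP" "\<psi> (TA u) = (Q.pair_word u, \<zero>\<^bsub>AP\<^esub>, \<zero>\<^bsub>AP\<^esub>, d')"
        using 3(1)[OF u] by auto
      have "\<psi> (TA (i # j # u)) = (Q.pair_word (i # j # u), \<zero>\<^bsub>AP\<^esub>, \<zero>\<^bsub>AP\<^esub>, ?d \<otimes>\<^bsub>AP\<^esub> d')"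
        unfolding e d'(2) using ij d d'(1) Q.pair_word_closed[OF u True] by simp
      then show ?thesis using True Q.Ap.P.m_closed[OF d d'(1)] by auto
    next
      case False
      then obtain d' where d': "d' \<in> carrier AP" "\<psi> (TA u) = (\<zero>\<^bsub>AP\<^esub>, Q.pair_word (u @ [?o]), d', \<zero>\<^bsub>AP\<^esub>)"
        using 3(1)[OF u] by auto
      have "Q.pair_word (u @ [?o]) \<in> carrier AP" using u o False by (intro Q.pair_word_closed) auto
      then have "\<psi> (TA (i # j # u)) = (\<zero>\<^bsub>AP\<^esub>, Q.pair_word ((i # j # u) @ [?o]), ?d \<otimes>\<^bsub>AP\<^esub> d', \<zero>\<^bsub>AP\<^esub>)"
        unfolding e d'(2) using ij d d'(1) by simp
      then show ?thesis using False Q.Ap.P.m_closed[OF d d'(1)] by auto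
    qed
  qed
  let ?f = "\<lambda>Z. fst (\<psi> Z)" and ?g = "\<lambda>Z. fst (snd (\<psi> Z))"
  have smult: "?f (c \<odot>\<^bsub>A_alg I m\<^esub> Z) = c \<odot>\<^bsub>AP\<^esub> ?f Z" "?g (c \<odot>\<^bsub>A_alg I m\<^esub> Z) = c \<odot>\<^bsub>AP\<^esub> ?g Z"
    if c: "c \<in> carrier (R_ring I m)" and Z: "Z \<in> carrier A.P" for c Z
  proof -
    have cR: "c \<in> carrier R.P" using c by (simp add: R_fields)
    obtain d where d: "d \<in> carrier AP" "\<psi> (theta c) = (?sc c, \<zero>\<^bsub>AP\<^esub>, \<zero>\<^bsub>AP\<^esub>, d)" using good[OF cR] by blast
    obtain p q r s where Z': "\<psi> Z = (p, q, r, s)" "p \<in> carrier AP" "q \<in> carrier AP" "r \<in> carrier AP" "s \<in> carrier AP"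
      by (rule mat_carrierE[OF \<psi>_closed[OF Z]])
    have "\<psi> (c \<odot>\<^bsub>A_alg I m\<^esub> Z) = \<psi> (theta c) \<otimes>\<^bsub>mat_ring AP\<^esub> \<psi> Z"
      unfolding A_smult[OF cR Z] by (rule \<psi>_mult[OF theta_closed[OF cR] Z])
    then show "?f (c \<odot>\<^bsub>A_alg I m\<^esub> Z) = c \<odot>\<^bsub>AP\<^esub> ?f Z" "?g (c \<odot>\<^bsub>A_alg I m\<^esub> Z) = c \<odot>\<^bsub>AP\<^esub> ?g Z"
      using c d Z' by (simp_all add: Q.Ap.smult_mult)
  qed
  have closed: "?f Z \<in> carrier AP" "?g Z \<in> carrier AP" if Z: "Z \<in> carrier A.P" for Z
    by (rule mat_carrierE[OF \<psi>_closed[OF Z]], simp)+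
  have add: "?f (Z \<oplus>\<^bsub>A.P\<^esub> Y) = ?f Z \<oplus>\<^bsub>AP\<^esub> ?f Y" "?g (Z \<oplus>\<^bsub>A.P\<^esub> Y) = ?g Z \<oplus>\<^bsub>AP\<^esub> ?g Y"
    if "Z \<in> carrier A.P" "Y \<in> carrier A.P" for Z Y
    unfolding \<psi>_add[OF that] by (cases "\<psi> Z"; cases "\<psi> Y"; simp)+
  show ?thesis
  proof (rule that[of ?f ?g])
    fix u assume u: "u \<in> lists I"
    show "?f (TA u) = (if even (length u) then Q.pair_word u else \<zero>\<^bsub>AP\<^esub>)"
      using words[OF u] by (cases "even (length u)") auto
    show "?g (TA u) = (if even (length u) then \<zero>\<^bsub>AP\<^esub> else Q.pair_word (u @ [?o]))"
      using words[OF u] by (cases "even (length u)") auto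
  next
    fix h Z assume "h \<in> {?f, ?g}" "Z \<in> carrier A.P"
    then show "h Z \<in> carrier AP" using closed[of Z] by (elim insertE emptyE) simp_all
  next
    fix h Z Y assume "h \<in> {?f, ?g}" "Z \<in> carrier A.P" "Y \<in> carrier A.P"
    then show "h (Z \<oplus>\<^bsub>A.P\<^esub> Y) = h Z \<oplus>\<^bsub>AP\<^esub> h Y" using add[of Z Y] by (elim insertE emptyE) simp_all
  next
    fix h assume "h \<in> {?f, ?g}"
    then show "h \<zero>\<^bsub>A.P\<^esub> = \<zero>\<^bsub>AP\<^esub>" by (elim insertE emptyE) (simp_all add: \<psi>_zero)
  next
    fix h c Z assume "h \<in> {?f, ?g}" "c \<in> carrier (R_ring I m)" "Z \<in> carrier A.P"
    then show "h (c \<odot>\<^bsub>A_alg I m\<^esub> Z) = c \<odot>\<^bsub>AP\<^esub> h Z" using smult[of c Z] by (elim insertE emptyE) simp_all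
  qed
qed

lemma Ap_alg_eq: "Ap_alg I m = Q.Ap.P"
  by (simp add: Ap_alg_def Ap_over_def)

lemma Tp_word_eq: "even (length u) \<Longrightarrow> Tp_word I m u = Q.pair_word u"
proof (induction u rule: induct_list012)
  case (3 i j u)
  have "Ap_a I m i j = Q.pair i j" unfolding Ap_a_def Ap_alg_eq Q.pair_def ..
  then show ?case using 3 by (simp add: Ap_alg_eq)
qed (simp_all add: Ap_alg_eq)

section \<open>The bases\<close>

text \<open>A generator \<open>a_ij\<close> puts the two letters \<open>i\<close> and
  \<open>j\<close> in front, so every product of generators is a word of even length.\<close>

lemma carrier_Ap_span: "carrier Q.Ap.P \<subseteq> rspan (R_ring I m) Q.Ap.P (Q.pair_word ` {u \<in> lists I. even (length u)})"
proof
  have sub: "Q.pair_word ` {u \<in> lists I. even (length u)} \<subseteq> carrier AP"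
    by (rule image_subsetI) (simp add: Q.pair_word_closed)
  fix Z assume "Z \<in> carrier AP"
  then show "Z \<in> rspan (R_ring I m) AP (Q.pair_word ` {u \<in> lists I. even (length u)})"
  proof (induction Z rule: Q.Ap.pres_induct)
    case zero
    show ?case by (rule rspan_zero)
  next
    case (add Z Y)
    show ?case by (rule rspan_add[OF Q.Ap.module_P add(4,3) sub])
  next
    case (word c v)
    have "\<exists>u. u \<in> lists I \<and> even (length u) \<and> lprod AP (map (\<lambda>g. Q.Ap.cls (gen (R_ring I m) g)) v) = Q.pair_word u"
      using word(2)
    proof (induction v)
      case Nil
      show ?case by (intro exI[of _ "[]"]) simp
    next
      case (Cons g v)
      then obtain u where u: "u \<in> lists I" "even (length u)"
        "lprod AP (map (\<lambda>g. Q.Ap.cls (gen (R_ring I m) g)) v) = Q.pair_word u" by blast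
      obtain i j where g: "g = (i, j)" by (cases g)
      then have "i \<in> I" "j \<in> I" "i \<noteq> j" using Cons.hyps by (simp_all add: Q.letters_iff)
      then show ?case using u by (intro exI[of _ "i # j # u"]) (simp add: g Q.pair_def)
    qed
    then obtain u where u: "u \<in> {u \<in> lists I. even (length u)}"
      "lprod AP (map (\<lambda>g. Q.Ap.cls (gen (R_ring I m) g)) v) = Q.pair_word u" by blast
    show ?case
      unfolding u(2) by (rule rspan_smult[OF Q.Ap.module_P rspan_base[OF Q.Ap.module_P imageI[OF u(1)] sub] word(1) sub])
  qed
qed

context
  fixes w :: "'i list set \<Rightarrow> 'i list"
  assumes flat: "topologically_free (tau_vars I m) (Ap_hat I m)"
    and w: "\<And>x. x \<in> carrier (coxeter_group I m) \<Longrightarrow> reduced_word_for x (w x)"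
begin

lemma w_lists: "x \<in> carrier (coxeter_group I m) \<Longrightarrow> w x \<in> lists I"
  and w_class: "x \<in> carrier (coxeter_group I m) \<Longrightarrow> wcls (w x) = x"
proof -
  assume x: "x \<in> carrier (coxeter_group I m)"
  then obtain u where u: "u \<in> lists I" "x = wcls u"
    unfolding coxeter_group_def quotient_def by auto
  have "w x \<in> x" using w[OF x] by (simp add: reduced_word_for_def)
  then have e: "u \<approx> w x" by (simp add: u(2) eqv_def)
  then show "w x \<in> lists I" using eqv_lists by blast
  then show "wcls (w x) = x" using wcls_eq_iff[OF u(1)] e u(2) by metis
qed

lemma w_inj:
  assumes "x \<in> carrier (coxeter_group I m)" "y \<in> carrier (coxeter_group I m)" "w x \<approx> w y"
  shows "x = y"
  using assms wcls_eq_iff[of "w x" "w y"] w_lists w_class by metis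

lemma w_reduced: "x \<in> carrier (coxeter_group I m) \<Longrightarrow> reduced (w x)"
  unfolding reduced_def
proof (intro conjI allI impI w_lists)
  fix v assume x: "x \<in> carrier (coxeter_group I m)" and "w x \<approx> v"
  then have "v \<in> wcls (w x)" by (simp add: eqv_def)
  then have "v \<in> x" by (simp only: w_class[OF x])
  then show "length (w x) \<le> length v" using w[OF x] by (simp add: reduced_word_for_def)
qed

lemma plus_iff: "x \<in> coxeter_plus I m \<longleftrightarrow> x \<in> carrier (coxeter_group I m) \<and> even (length (w x))"
proof (cases "x \<in> carrier (coxeter_group I m)")
  case x: True
  have "w x \<in> x" using w[OF x] by (simp add: reduced_word_for_def)
  then have "(SOME u. u \<in> x) \<in> x" by (rule someI)
  then have "(SOME u. u \<in> x) \<in> wcls (w x)" by (simp only: w_class[OF x])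
  then have "w x \<approx> (SOME u. u \<in> x)" by (simp add: eqv_def)
  from eqv_parity[OF this] show ?thesis
    using x by (simp add: coxeter_plus_def coxeter_sign_def minus_one_power_iff)
qed (simp add: coxeter_plus_def)

lemma all_words_span: "lists I \<subseteq> clA (w ` carrier (coxeter_group I m))"
proof (rule words_span)
  show "w ` carrier (coxeter_group I m) \<subseteq> lists I" by (rule image_subsetI) (rule w_lists)
  fix u assume u: "u \<in> lists I"
  then have x: "wcls u \<in> carrier (coxeter_group I m)" by (simp add: coxeter_group_def quotientI)
  then have "u \<approx> w (wcls u)" using wcls_eq_iff[OF u w_lists[OF x]] w_class[OF x] by simp
  then show "\<exists>y\<in>w ` carrier (coxeter_group I m). u \<approx> y \<and> reduced y" using x w_reduced by blast
qed

text \<open>The upper left entry keeps the even words of a relation, the upper right entry the odd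
  ones, completed to even length by \<open>base_point\<close>. Either part is a relation in
  \<open>A_+(M)\<close> between words of distinct group elements, because a letter appended on the
  right can be cancelled.\<close>

lemma basis_A: "module_basis (R_ring I m) (A_alg I m) (carrier (coxeter_group I m)) (\<lambda>x. T_word I m (w x))"
  unfolding T_word_eq
proof (rule module_basisI[OF module_A])
  let ?C = "carrier (coxeter_group I m)"
  have wI: "w ` ?C \<subseteq> lists I" by (rule image_subsetI) (rule w_lists)
  show "(\<lambda>x. TA (w x)) \<in> ?C \<rightarrow> carrier (A_alg I m)"
    unfolding A_fields by (rule funcsetI) (rule TA_closed[OF w_lists])
  have "TA ` lists I \<subseteq> spanA (TA ` w ` ?C)"
  proof (rule image_subsetI)
    fix u assume "u \<in> lists I"
    from subsetD[OF all_words_span this] show "TA u \<in> spanA (TA ` w ` ?C)" by (simp add: clA_def)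
  qed
  from subset_trans[OF carrier_A_span rspan_trans[OF module_A this TA_image[OF wI]]]
  show "carrier (A_alg I m) \<subseteq> spanA ((\<lambda>x. TA (w x)) ` ?C)" by (simp only: image_image)
  fix F c x
  assume F: "finite F" "F \<subseteq> ?C" and c: "c \<in> F \<rightarrow> carrier (R_ring I m)" and x: "x \<in> F"
    and zero: "(\<Oplus>\<^bsub>A_alg I m\<^esub>x\<in>F. c x \<odot>\<^bsub>A_alg I m\<^esub> TA (w x)) = \<zero>\<^bsub>A_alg I m\<^esub>"
  interpret MA: module "R_ring I m" "A_alg I m" by (rule module_A)
  obtain f g where closed: "\<And>h Z. h \<in> {f, g} \<Longrightarrow> Z \<in> carrier A.P \<Longrightarrow> h Z \<in> carrier AP"
    and add: "\<And>h Z Y. h \<in> {f, g} \<Longrightarrow> Z \<in> carrier A.P \<Longrightarrow> Y \<in> carrier A.P \<Longrightarrow> h (Z \<oplus>\<^bsub>A.P\<^esub> Y) = h Z \<oplus>\<^bsub>AP\<^esub> h Y"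
    and null: "\<And>h. h \<in> {f, g} \<Longrightarrow> h \<zero>\<^bsub>A.P\<^esub> = \<zero>\<^bsub>AP\<^esub>"
    and smult: "\<And>h c Z. h \<in> {f, g} \<Longrightarrow> c \<in> carrier (R_ring I m) \<Longrightarrow> Z \<in> carrier A.P \<Longrightarrow>
      h (c \<odot>\<^bsub>A_alg I m\<^esub> Z) = c \<odot>\<^bsub>AP\<^esub> h Z"
    and f: "\<And>u. u \<in> lists I \<Longrightarrow> f (TA u) = (if even (length u) then Q.pair_word u else \<zero>\<^bsub>AP\<^esub>)"
    and g: "\<And>u. u \<in> lists I \<Longrightarrow> g (TA u) = (if even (length u) then \<zero>\<^bsub>AP\<^esub> else Q.pair_word (u @ [base_point]))"
    by (rule row_maps) (rule that)
  have wl: "w y \<in> lists I" if "y \<in> F" for y using w_lists[of y] that F(2) by blast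
  have cy: "c y \<in> carrier (R_ring I m)" if "y \<in> F" for y using c that by blast
  have rows: "(\<Oplus>\<^bsub>AP\<^esub>y\<in>F. c y \<odot>\<^bsub>AP\<^esub> h (TA (w y))) = \<zero>\<^bsub>AP\<^esub>" if h: "h \<in> {f, g}" for h
  proof -
    have t: "c y \<odot>\<^bsub>A_alg I m\<^esub> TA (w y) \<in> carrier (A_alg I m)" if "y \<in> F" for y
      by (rule MA.smult_closed[OF cy[OF that]]) (simp only: A_fields TA_closed[OF wl[OF that]])
    have "(\<Oplus>\<^bsub>AP\<^esub>y\<in>F. c y \<odot>\<^bsub>AP\<^esub> h (TA (w y))) = (\<Oplus>\<^bsub>AP\<^esub>y\<in>F. h (c y \<odot>\<^bsub>A_alg I m\<^esub> TA (w y)))"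
    proof (rule Q.Ap.P.finsum_cong')
      show "(\<lambda>y. h (c y \<odot>\<^bsub>A_alg I m\<^esub> TA (w y))) \<in> F \<rightarrow> carrier AP"
        by (rule funcsetI) (rule closed[OF h t[unfolded A_fields]])
    qed (simp_all only: smult[OF h cy TA_closed[OF wl]])
    also have "\<dots> = h (\<Oplus>\<^bsub>A_alg I m\<^esub>y\<in>F. c y \<odot>\<^bsub>A_alg I m\<^esub> TA (w y))"
    proof (rule finsum_additive[symmetric])
      show "h \<in> carrier (A_alg I m) \<rightarrow> carrier AP" unfolding A_fields by (rule funcsetI) (rule closed[OF h])
      show "(\<lambda>y. c y \<odot>\<^bsub>A_alg I m\<^esub> TA (w y)) \<in> F \<rightarrow> carrier (A_alg I m)" by (rule funcsetI) (rule t)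
    qed (use h null add F in \<open>simp_all only: A_fields MA.M.abelian_monoid_axioms Q.Ap.P.abelian_monoid_axioms\<close>)
    also have "\<dots> = \<zero>\<^bsub>AP\<^esub>" unfolding zero A_fields by (rule null[OF h])
    finally show ?thesis .
  qed
  have part: "(\<Oplus>\<^bsub>AP\<^esub>y\<in>{y \<in> F. p y}. c y \<odot>\<^bsub>AP\<^esub> Q.pair_word (v y)) = \<zero>\<^bsub>AP\<^esub>"
    if h: "h \<in> {f, g}" and hw: "\<And>y. y \<in> F \<Longrightarrow> h (TA (w y)) = (if p y then Q.pair_word (v y) else \<zero>\<^bsub>AP\<^esub>)" for h p v
  proof -
    have "c y \<odot>\<^bsub>AP\<^esub> Q.pair_word (v y) \<in> carrier AP" if "y \<in> F" "p y" for y
      using closed[OF h TA_closed[OF wl[OF that(1)]]] hw[OF that(1)] cy[OF that(1)] that(2) by simp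
    then have "(\<Oplus>\<^bsub>AP\<^esub>y\<in>{y \<in> F. p y}. c y \<odot>\<^bsub>AP\<^esub> Q.pair_word (v y)) = (\<Oplus>\<^bsub>AP\<^esub>y\<in>F. c y \<odot>\<^bsub>AP\<^esub> h (TA (w y)))"
      using F(1) hw cy by (intro Q.Ap.P.add.finprod_mono_neutral_cong_left) auto
    then show ?thesis using rows[OF h] by simp
  qed
  show "c x = \<zero>\<^bsub>R_ring I m\<^esub>"
  proof (cases "even (length (w x))")
    case True
    show ?thesis
    proof (rule pair_words_independent[OF flat, of "{y \<in> F. even (length (w y))}" c w])
      show "(\<Oplus>\<^bsub>AP\<^esub>y\<in>{y \<in> F. even (length (w y))}. c y \<odot>\<^bsub>AP\<^esub> Q.pair_word (w y)) = \<zero>\<^bsub>AP\<^esub>"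
        by (rule part[of f]) (simp_all add: f wl del: in_lists_conv_set)
      show "y = z" if "y \<in> {y \<in> F. even (length (w y))}" "z \<in> {y \<in> F. even (length (w y))}"
        "w y \<approx> w z" for y z
        using w_inj[OF _ _ that(3)] that(1,2) F(2) by blast
    qed (use F c x wl True in auto)
  next
    case False
    then have "w x \<noteq> []" by auto
    \<comment> \<open>A word of odd length has a letter, so \<open>I\<close> is nonempty and
      contains \<open>base_point\<close>.\<close>
    then have o: "base_point \<in> I" using base_point[of "hd (w x)"] wl[OF x] by (cases "w x") auto
    show ?thesis
    proof (rule pair_words_independent[OF flat, of "{y \<in> F. odd (length (w y))}" c "\<lambda>y. w y @ [base_point]"])
      show "(\<Oplus>\<^bsub>AP\<^esub>y\<in>{y \<in> F. odd (length (w y))}. c y \<odot>\<^bsub>AP\<^esub> Q.pair_word (w y @ [base_point])) = \<zero>\<^bsub>AP\<^esub>"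
        by (rule part[of g]) (simp_all add: g wl del: in_lists_conv_set)
      show "y = z" if "y \<in> {y \<in> F. odd (length (w y))}" "z \<in> {y \<in> F. odd (length (w y))}"
        "w y @ [base_point] \<approx> w z @ [base_point]" for y z
        using w_inj eqv_cancel_right[OF that(3)] that(1,2) F(2) by blast
    qed (use F c x wl o False in auto)
  qed
qed

text \<open>Spanning is inherited from \<open>A(M)\<close>: there an even word is a combination of
  the chosen reduced words, and the upper left entry maps this combination to \<open>A_+(M)\<close>,
  killing the odd words. Independence is the statement on words of even length itself.\<close>

lemma basis_Ap: "module_basis (R_ring I m) (Ap_alg I m) (coxeter_plus I m) (\<lambda>x. Tp_word I m (w x))"
  unfolding Ap_alg_eq
proof (rule module_basisI[OF Q.Ap.module_P])
  let ?C = "carrier (coxeter_group I m)" and ?P = "coxeter_plus I m"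
  have Tp: "Tp_word I m (w x) = Q.pair_word (w x)" if "x \<in> ?P" for x using that plus_iff Tp_word_eq by blast
  have wP: "w x \<in> lists I" "even (length (w x))" if "x \<in> ?P" for x using that plus_iff w_lists by blast+
  show e: "(\<lambda>x. Tp_word I m (w x)) \<in> ?P \<rightarrow> carrier AP"
    by (rule funcsetI) (simp only: Tp Q.pair_word_closed[OF wP])
  let ?E = "(\<lambda>x. Tp_word I m (w x)) ` ?P"
  have E: "?E \<subseteq> carrier AP" by (rule image_subsetI) (rule funcset_mem[OF e])
  obtain f g where closed: "\<And>h Z. h \<in> {f, g} \<Longrightarrow> Z \<in> carrier A.P \<Longrightarrow> h Z \<in> carrier AP"
    and add: "\<And>h Z Y. h \<in> {f, g} \<Longrightarrow> Z \<in> carrier A.P \<Longrightarrow> Y \<in> carrier A.P \<Longrightarrow> h (Z \<oplus>\<^bsub>A.P\<^esub> Y) = h Z \<oplus>\<^bsub>AP\<^esub> h Y"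
    and null: "\<And>h. h \<in> {f, g} \<Longrightarrow> h \<zero>\<^bsub>A.P\<^esub> = \<zero>\<^bsub>AP\<^esub>"
    and smult: "\<And>h c Z. h \<in> {f, g} \<Longrightarrow> c \<in> carrier (R_ring I m) \<Longrightarrow> Z \<in> carrier A.P \<Longrightarrow>
      h (c \<odot>\<^bsub>A_alg I m\<^esub> Z) = c \<odot>\<^bsub>AP\<^esub> h Z"
    and f: "\<And>u. u \<in> lists I \<Longrightarrow> f (TA u) = (if even (length u) then Q.pair_word u else \<zero>\<^bsub>AP\<^esub>)"
    and g: "\<And>u. u \<in> lists I \<Longrightarrow> g (TA u) = (if even (length u) then \<zero>\<^bsub>AP\<^esub> else Q.pair_word (u @ [base_point]))"
    by (rule row_maps) (rule that)
  have wI: "w ` ?C \<subseteq> lists I" by (rule image_subsetI) (rule w_lists)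
  have "Q.pair_word ` {u \<in> lists I. even (length u)} \<subseteq> rspan (R_ring I m) AP ?E"
  proof (rule image_subsetI)
    fix u assume "u \<in> {u \<in> lists I. even (length u)}"
    then have u: "u \<in> lists I" "even (length u)" by simp_all
    have "TA u \<in> spanA (TA ` w ` ?C)" using subsetD[OF all_words_span u(1)] by (simp add: clA_def)
    then have "f (TA u) \<in> rspan (R_ring I m) AP ?E"
    proof (rule rspan_hom[OF module_A Q.Ap.module_P _ TA_image[OF wI] E])
      fix c e assume c: "c \<in> carrier (R_ring I m)" and "e \<in> TA ` w ` ?C"
      then obtain x where x: "x \<in> ?C" "e = TA (w x)" by blast
      have "f (c \<odot>\<^bsub>A_alg I m\<^esub> e) = c \<odot>\<^bsub>AP\<^esub> f e"
        unfolding x(2) by (rule smult[OF _ c TA_closed[OF w_lists[OF x(1)]]]) simp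
      also have "\<dots> \<in> rspan (R_ring I m) AP ?E"
      proof (cases "even (length (w x))")
        case True
        then have xP: "x \<in> ?P" using x(1) plus_iff by blast
        have "f e = Tp_word I m (w x)" using True f[OF w_lists[OF x(1)]] Tp[OF xP] x(2) by simp
        moreover have "Tp_word I m (w x) \<in> ?E" using xP by (rule imageI)
        ultimately have "f e \<in> rspan (R_ring I m) AP ?E" using rspan_base[OF Q.Ap.module_P _ E] by metis
        then show ?thesis by (rule rspan_smult[OF Q.Ap.module_P _ c E])
      next
        case False
        then have "f e = \<zero>\<^bsub>AP\<^esub>" using f[OF w_lists[OF x(1)]] x(2) by simp
        then show ?thesis using c rspan_zero[of AP] by simp
      qed
      finally show "f (c \<odot>\<^bsub>A_alg I m\<^esub> e) \<in> rspan (R_ring I m) AP ?E" .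
    qed (simp_all only: A_fields add null insertI1)
    then show "Q.pair_word u \<in> rspan (R_ring I m) AP ?E" using f[OF u(1)] u(2) by simp
  qed
  from subset_trans[OF carrier_Ap_span rspan_trans[OF Q.Ap.module_P this E]]
  show "carrier AP \<subseteq> rspan (R_ring I m) AP ?E" .
  fix F c x
  assume F: "finite F" "F \<subseteq> ?P" and c: "c \<in> F \<rightarrow> carrier (R_ring I m)" and x: "x \<in> F"
    and zero: "(\<Oplus>\<^bsub>AP\<^esub>x\<in>F. c x \<odot>\<^bsub>AP\<^esub> Tp_word I m (w x)) = \<zero>\<^bsub>AP\<^esub>"
  show "c x = \<zero>\<^bsub>R_ring I m\<^esub>"
  proof (rule pair_words_independent[OF flat F(1) c _ _ _ x])
    show "w y \<in> lists I \<and> even (length (w y))" if "y \<in> F" for y using that F(2) wP by blast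
    show "y = z" if "y \<in> F" "z \<in> F" "w y \<approx> w z" for y z
      using that F(2) w_inj plus_iff by blast
    have "c y \<odot>\<^bsub>AP\<^esub> Tp_word I m (w y) \<in> carrier AP" if "y \<in> F" for y
      using that c e F(2) by blast
    then have "(\<Oplus>\<^bsub>AP\<^esub>y\<in>F. c y \<odot>\<^bsub>AP\<^esub> Q.pair_word (w y)) = (\<Oplus>\<^bsub>AP\<^esub>y\<in>F. c y \<odot>\<^bsub>AP\<^esub> Tp_word I m (w y))"
      using F(2) Tp by (intro Q.Ap.P.finsum_cong') auto
    then show "(\<Oplus>\<^bsub>AP\<^esub>y\<in>F. c y \<odot>\<^bsub>AP\<^esub> Q.pair_word (w y)) = \<zero>\<^bsub>AP\<^esub>" using zero by simp
  qed
qed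

end

end

theorem proposition3p2:
  fixes I :: "'i set" and m :: "'i \<Rightarrow> 'i \<Rightarrow> enat" and w :: "'i list set \<Rightarrow> 'i list"
  assumes "flat_coxeter_matrix I m"
    and "\<And>x. x \<in> carrier (coxeter_group I m) \<Longrightarrow> reduced_word_for x (w x)"
  shows "module_basis (R_ring I m) (A_alg I m) (carrier (coxeter_group I m)) (\<lambda>x. T_word I m (w x)) \<and>
    module_basis (R_ring I m) (Ap_alg I m) (coxeter_plus I m) (\<lambda>x. Tp_word I m (w x))"
proof -
  interpret coxeter_words I m using assms(1) by unfold_locales (simp add: flat_coxeter_matrix_def)
  have "topologically_free (tau_vars I m) (Ap_hat I m)" using assms(1) by (simp add: flat_coxeter_matrix_def)
  then show ?thesis using basis_A basis_Ap assms(2) by blast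
qed

end
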